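(* Let $\Theta=\Theta(w,z,x,y)$ be a solution of the second heavenly equation $$\Theta_{xw}+\Theta_{yz}+\Theta_{xx}\Theta_{yy}-\Theta_{xy}^2=0,$$ which gives the Ricci-flat anti-self-dual metric of signature $(2,2)$ $$g=dw\,dx+dz\,dy-\Theta_{xx}\,dz^2-\Theta_{yy}\,dw^2+2\Theta_{xy}\,dw\,dz .$$ Then the system of second order ODEs with vanishing Wilczynski invariants corresponding to the conformal structure $[g]$ is $$Y''=2\frac{\partial\Lambda}{\partial Z'},\qquad Z''=-2\frac{\partial\Lambda}{\partial Y'},$$ where $\Lambda=\Lambda(X,Y,Z,Y',Z')$ satisfies the initial condition $$\Lambda|_{X=X_0}=-\Theta\bigl(Y(X_0),Z(X_0),Z'(X_0),-Y'(X_0)\bigr)$$ (the arguments of $\Theta$ being in the order $(w,z,x,y)$), and the $X$-dependence of $\Lambda$ is determined by the equation $$\frac{d\phi_{AB}}{dX}+\frac{1}{2}\left(\varepsilon_{AC}\frac{\partial F^C}{\partial Y^B}+\varepsilon_{BC}\frac{\partial F^C}{\partial Y^A}\right)=\Omega^2\phi_{AB},\qquad A,B\in\{0,1\},$$ where $F^0=2\,\partial\Lambda/\partial Z'$, $F^1=-2\,\partial\Lambda/\partial Y'$, $\Omega^2=\frac12\,\partial F^C/\partial P^C$ (which is $0$ for this $F^A$) and $$\phi_{AB}=-\frac12\,\varepsilon_{AC}\frac{\partial F^C}{\partial P^B}+\frac14\,\varepsilon_{AB}\frac{\partial F^C}{\partial P^C}.$$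
   Context: All considerations are local. Subscripts on $\Theta$ denote partial derivatives. Capital indices $A,B,C,\dots$ take values $0,1$, and repeated indices are summed. $Y^A=(Y,Z)$, $P^A=(Y',Z')$ with $'=d/dX$; $\varepsilon_{AB}$ and $\varepsilon^{AB}$ are antisymmetric with $\varepsilon_{01}=\varepsilon^{01}=1$. A system of two second order ODEs is $(Y^A)''=F^A(X,Y,Z,Y',Z')$, i.e. $Y''=F^0$, $Z''=F^1$, where $(F^0,F^1)$ are functions of class $C^5$ on an open set of $\mathbb{R}^5$. In the equation for $\phi_{AB}$, $d/dX$ is the total derivative $$\frac{d}{dX}=\frac{\partial}{\partial X}+P^A\frac{\partial}{\partial Y^A}+F^A\frac{\partial}{\partial P^A},$$ with $(X,Y^A,P^A)$ regarded as independent coordinates. The Wilczynski invariants vanish if $T-\frac12\mathrm{Trace}(T)\,\mathbb{I}=0$, where $$T^A_B=-\frac{\partial F^A}{\partial Y^B}-\frac14\frac{\partial F^A}{\partial P^C}\frac{\partial F^C}{\partial P^B}+\frac12\frac{d}{dX}\frac{\partial F^A}{\partial P^B}.$$ Correspondence between conformal structures and systems of ODEs: let $(M,[g])$ be a four-manifold with a conformal structure of signature $(2,2)$ which is anti-self-dual (the self-dual part of the Weyl tensor vanishes). An $\alpha$-surface is a two-dimensional surface in $M$ which is totally null and self-dual (its tangent planes are self-dual totally null planes). The twistor space $\mathcal{T}$ is the three-dimensional space of $\alpha$-surfaces in $M$. Each point $p\in M$ determines a curve $L_p\subset\mathcal{T}$, a twistor line, consisting of all $\alpha$-surfaces through $p$.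 In local coordinates $(X,Y,Z)$ on $\mathcal{T}$, the four-parameter family of twistor lines is the family of integral curves (graphs $X\mapsto(X,Y(X),Z(X))$ of solutions) of a system of two second order ODEs with vanishing Wilczynski invariants. This is the system corresponding to $[g]$; it is defined up to point transformations (local changes of the coordinates $(X,Y,Z)$). Conversely, the solution space $M$ of a system with vanishing Wilczynski invariants carries a conformal structure, uniquely determined by the condition that the surfaces in $M$ corresponding to points of $\mathcal{T}$ (all solutions whose graph passes through a given point) are totally null; it is represented by the quadratic form $\varepsilon_{AB}\,dY^A\,dP^B+\phi_{AB}\,dY^A\,dY^B$ (evaluated modulo $dX$), with $\phi_{AB}$ given by the formula in the claim. *)

theory Defs
  imports "HOL-Analysis.Analysis"
begin

section \<open>Differentiability classes\<close>

text \<open>Meant for open \<open>S\<close>; class \<open>C\<^sup>k\<close> by iterated partial derivatives.\<close>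

primrec Ck_on :: "nat \<Rightarrow> ('a::euclidean_space \<Rightarrow> 'b::real_normed_vector) \<Rightarrow> 'a set \<Rightarrow> bool" where
  "Ck_on 0 f S \<longleftrightarrow> continuous_on S f"
| "Ck_on (Suc k) f S \<longleftrightarrow> f differentiable_on S \<and>
     (\<forall>b\<in>Basis. Ck_on k (\<lambda>q. frechet_derivative f (at q) b) S)"

definition smooth_on :: "('a::euclidean_space \<Rightarrow> 'b::real_normed_vector) \<Rightarrow> 'a set \<Rightarrow> bool" where
  "smooth_on f S \<longleftrightarrow> (\<forall>k. Ck_on k f S)"

definition C1_diffeo :: "('a::euclidean_space \<Rightarrow> 'b::euclidean_space) \<Rightarrow> 'a set \<Rightarrow> 'b set \<Rightarrow> bool" where
  "C1_diffeo h S T \<longleftrightarrow> open S \<and> open T \<and> bij_betw h S T \<and>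
     Ck_on 1 h S \<and> Ck_on 1 (inv_into S h) T"

definition pd :: "('a::real_normed_vector \<Rightarrow> real) \<Rightarrow> 'a \<Rightarrow> 'a \<Rightarrow> real" where
  "pd f v q = deriv (\<lambda>t. f (q + t *\<^sub>R v)) 0"


section \<open>Neutral metrics on open subsets of four-space and their alpha-surfaces\<close>

text \<open>A metric is a field \<open>G\<close> of symmetric matrices on \<open>real^4\<close>. The notions below depend only
  on the conformal class of \<open>G\<close>. The orientation of \<open>real^4\<close> is the standard one; for the
  coordinates \<open>(w,z,x,y)\<close> it is the orientation for which the planes \<open>w = z = const\<close>, totally
  null for the heavenly metric, are self-dual.\<close>

definition levi_civita :: "4 \<Rightarrow> 4 \<Rightarrow> 4 \<Rightarrow> 4 \<Rightarrow> real" where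
  "levi_civita a b c d = det (vector [axis a 1, axis b 1, axis c 1, axis d 1] :: real^4^4)"

definition wedge :: "real^4 \<Rightarrow> real^4 \<Rightarrow> real^4^4" where
  "wedge u v = (\<chi> a b. u$a * v$b - u$b * v$a)"

definition lower :: "real^4^4 \<Rightarrow> real^4^4 \<Rightarrow> real^4^4" where
  "lower g B = (\<chi> a b. \<Sum>c\<in>UNIV. \<Sum>d\<in>UNIV. g$a$c * g$b$d * B$c$d)"

text \<open>Hodge dual of a bivector, with its two indices lowered; \<open>sqrt \<bar>det g\<bar> * levi_civita\<close> is the
  volume form.\<close>

definition hodge_lower :: "real^4^4 \<Rightarrow> real^4^4 \<Rightarrow> real^4^4" where
  "hodge_lower g B = (\<chi> a b. (1/2) * sqrt \<bar>det g\<bar> *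
     (\<Sum>c\<in>UNIV. \<Sum>d\<in>UNIV. levi_civita a b c d * B$c$d))"

definition self_dual_bivector :: "real^4^4 \<Rightarrow> real^4^4 \<Rightarrow> bool" where
  "self_dual_bivector g B \<longleftrightarrow> hodge_lower g B = lower g B"

definition alpha_plane :: "real^4^4 \<Rightarrow> (real^4) set \<Rightarrow> bool" where
  "alpha_plane g P \<longleftrightarrow> subspace P \<and> dim P = 2 \<and>
     (\<forall>u\<in>P. \<forall>v\<in>P. u \<bullet> (g *v v) = 0) \<and>
     (\<forall>u\<in>P. \<forall>v\<in>P. self_dual_bivector g (wedge u v))"

text \<open>Surfaces are given locally as level sets of submersions \<open>f\<close> to the plane; the tangent plane
  is then the kernel of the derivative of \<open>f\<close>. Connectedness ensures that an alpha-surface is a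
  single leaf, so that it represents one point of twistor space.\<close>

definition alpha_surface :: "(real^4 \<Rightarrow> real^4^4) \<Rightarrow> (real^4) set \<Rightarrow> (real^4) set \<Rightarrow> bool" where
  "alpha_surface G M S \<longleftrightarrow> S \<noteq> {} \<and> S \<subseteq> M \<and> connected S \<and>
     (\<forall>p\<in>S. \<exists>N (f :: real^4 \<Rightarrow> real^2). open N \<and> p \<in> N \<and> N \<subseteq> M \<and> Ck_on 1 f N \<and>
        (\<forall>q\<in>N. surj (frechet_derivative f (at q))) \<and>
        S \<inter> N = {q\<in>N. f q = f p} \<and>
        (\<forall>q\<in>S\<inter>N. alpha_plane (G q) {v. frechet_derivative f (at q) v = 0}))"


section \<open>Systems of two second order ODEs\<close>

text \<open>Points of jet space are \<open>(X, Y, P)\<close> with \<open>Y = (Y,Z)\<close> and \<open>P = (Y',Z')\<close>. The values \<open>0, 1\<close> of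
  the indices \<open>A, B, C\<close> correspond to the elements \<open>1, 2\<close> of the type \<open>2\<close>.\<close>

type_synonym jet = "real \<times> (real^2) \<times> (real^2)"

definition dX :: jet where "dX = (1, 0, 0)"
definition dY :: "2 \<Rightarrow> jet" where "dY A = (0, axis A 1, 0)"
definition dP :: "2 \<Rightarrow> jet" where "dP A = (0, 0, axis A 1)"

definition eps :: "2 \<Rightarrow> 2 \<Rightarrow> real" where
  "eps A B = (if A = 1 \<and> B = 2 then 1 else if A = 2 \<and> B = 1 then -1 else 0)"

definition total_deriv :: "(jet \<Rightarrow> real^2) \<Rightarrow> (jet \<Rightarrow> real) \<Rightarrow> jet \<Rightarrow> real" where
  "total_deriv F f q = pd f dX q + (\<Sum>A\<in>UNIV. snd (snd q) $ A * pd f (dY A) q)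
     + (\<Sum>A\<in>UNIV. F q $ A * pd f (dP A) q)"

definition wilczynski_T :: "(jet \<Rightarrow> real^2) \<Rightarrow> jet \<Rightarrow> real^2^2" where
  "wilczynski_T F q = (\<chi> A B. - pd (\<lambda>r. F r $ A) (dY B) q
     - (1/4) * (\<Sum>C\<in>UNIV. pd (\<lambda>r. F r $ A) (dP C) q * pd (\<lambda>r. F r $ C) (dP B) q)
     + (1/2) * total_deriv F (\<lambda>r. pd (\<lambda>s. F s $ A) (dP B) r) q)"

definition wilczynski_vanish :: "(jet \<Rightarrow> real^2) \<Rightarrow> jet set \<Rightarrow> bool" where
  "wilczynski_vanish F D \<longleftrightarrow>
     (\<forall>q\<in>D. wilczynski_T F q - ((1/2) * trace (wilczynski_T F q)) *\<^sub>R mat 1 = 0)"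

definition Omega_sq :: "(jet \<Rightarrow> real^2) \<Rightarrow> jet \<Rightarrow> real" where
  "Omega_sq F q = (1/2) * (\<Sum>C\<in>UNIV. pd (\<lambda>r. F r $ C) (dP C) q)"

definition phi :: "(jet \<Rightarrow> real^2) \<Rightarrow> 2 \<Rightarrow> 2 \<Rightarrow> jet \<Rightarrow> real" where
  "phi F A B q = - (1/2) * (\<Sum>C\<in>UNIV. eps A C * pd (\<lambda>r. F r $ C) (dP B) q)
     + (1/4) * eps A B * (\<Sum>C\<in>UNIV. pd (\<lambda>r. F r $ C) (dP C) q)"

definition phi_equation :: "(jet \<Rightarrow> real^2) \<Rightarrow> jet \<Rightarrow> bool" where
  "phi_equation F q \<longleftrightarrow> (\<forall>A B.
     total_deriv F (phi F A B) q
     + (1/2) * (\<Sum>C\<in>UNIV. eps A C * pd (\<lambda>r. F r $ C) (dY B) q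
                        + eps B C * pd (\<lambda>r. F r $ C) (dY A) q)
     = Omega_sq F q * phi F A B q)"


section \<open>The twistor correspondence\<close>

text \<open>A coordinate patch \<open>W\<close>, with coordinates \<open>(X, (Y,Z))\<close>, of the twistor space of \<open>(M,G)\<close>: the
  point of twistor space with coordinates \<open>\<tau>\<close> is the alpha-surface \<open>S \<tau>\<close>.\<close>

definition twistor_patch ::
    "(real^4 \<Rightarrow> real^4^4) \<Rightarrow> (real^4) set \<Rightarrow> (real \<times> (real^2)) set \<Rightarrow> (real \<times> (real^2) \<Rightarrow> (real^4) set) \<Rightarrow> bool" where
  "twistor_patch G M W S \<longleftrightarrow> open W \<and> inj_on S W \<and> (\<forall>\<tau>\<in>W. alpha_surface G M (S \<tau>))"

definition twistor_line ::
    "(real \<times> (real^2)) set \<Rightarrow> (real \<times> (real^2) \<Rightarrow> (real^4) set) \<Rightarrow> real^4 \<Rightarrow> (real \<times> (real^2)) set" where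
  "twistor_line W S p = {\<tau>\<in>W. p \<in> S \<tau>}"

text \<open>The system \<open>Y'' = F\<close> on \<open>D\<close> corresponds, near \<open>q\<^sub>0 \<in> D\<close>, to the conformal structure of \<open>G\<close> on
  \<open>U\<close> near \<open>p\<^sub>0 \<in> U\<close>: in suitable coordinates \<open>(X, (Y,Z))\<close> on the twistor space of a neighbourhood
  \<open>M\<close> of \<open>p\<^sub>0\<close>, the twistor line of each \<open>p \<in> M\<close> is the graph of a solution \<open>\<gamma> _ p\<close> of the system
  (with derivative \<open>\<gamma>' _ p\<close>), the line of \<open>p\<^sub>0\<close> being the integral curve through \<open>q\<^sub>0\<close>.
  The diffeomorphism condition says that these are locally all solutions, i.e. that \<open>M\<close> is the
  (four-dimensional) local solution space; in particular the image of \<open>I \<times> M\<close> in twistor space,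
  \<open>W\<close>, is three-dimensional and \<open>(X,\<gamma>)\<close> is a submersion onto it.\<close>

definition corresponds_near ::
    "(real^4 \<Rightarrow> real^4^4) \<Rightarrow> (real^4) set \<Rightarrow> (jet \<Rightarrow> real^2) \<Rightarrow> jet set \<Rightarrow> real^4 \<Rightarrow> jet \<Rightarrow> bool" where
  "corresponds_near G U F D p\<^sub>0 q\<^sub>0 \<longleftrightarrow>
     (\<exists>M I J W S \<gamma> \<gamma>'.
        open M \<and> p\<^sub>0 \<in> M \<and> M \<subseteq> U \<and> open I \<and> is_interval I \<and> open J \<and> J \<subseteq> D \<and>
        (\<forall>p\<in>M. \<forall>X\<in>I.
           ((\<lambda>t. \<gamma> t p) has_vector_derivative \<gamma>' X p) (at X) \<and>
           ((\<lambda>t. \<gamma>' t p) has_vector_derivative F (X, \<gamma> X p, \<gamma>' X p)) (at X)) \<and>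
        C1_diffeo (\<lambda>(X, p). (X, \<gamma> X p, \<gamma>' X p)) (I \<times> M) J \<and>
        fst q\<^sub>0 \<in> I \<and> q\<^sub>0 = (fst q\<^sub>0, \<gamma> (fst q\<^sub>0) p\<^sub>0, \<gamma>' (fst q\<^sub>0) p\<^sub>0) \<and>
        W = (\<lambda>(X, p). (X, \<gamma> X p)) ` (I \<times> M) \<and>
        twistor_patch G M W S \<and>
        (\<forall>p\<in>M. twistor_line W S p = (\<lambda>X. (X, \<gamma> X p)) ` I))"


section \<open>The second heavenly equation\<close>

text \<open>Coordinates on \<open>real^4\<close> are \<open>(w,z,x,y)\<close>, in this order.\<close>

definition pd2 :: "(real^4 \<Rightarrow> real) \<Rightarrow> 4 \<Rightarrow> 4 \<Rightarrow> real^4 \<Rightarrow> real" where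
  "pd2 \<Theta> a b = pd (pd \<Theta> (axis a 1)) (axis b 1)"

definition second_heavenly :: "(real^4 \<Rightarrow> real) \<Rightarrow> real^4 \<Rightarrow> bool" where
  "second_heavenly \<Theta> p \<longleftrightarrow>
     pd2 \<Theta> 3 1 p + pd2 \<Theta> 4 2 p + pd2 \<Theta> 3 3 p * pd2 \<Theta> 4 4 p - (pd2 \<Theta> 3 4 p)\<^sup>2 = 0"

definition heavenly_form :: "(real^4 \<Rightarrow> real) \<Rightarrow> real^4 \<Rightarrow> real^4 \<Rightarrow> real" where
  "heavenly_form \<Theta> p v = v$1 * v$3 + v$2 * v$4
     - pd2 \<Theta> 3 3 p * (v$2)\<^sup>2 - pd2 \<Theta> 4 4 p * (v$1)\<^sup>2 + 2 * pd2 \<Theta> 3 4 p * v$1 * v$2"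

text \<open>The Gram matrix of the quadratic form, by polarization.\<close>

definition heavenly_metric :: "(real^4 \<Rightarrow> real) \<Rightarrow> real^4 \<Rightarrow> real^4^4" where
  "heavenly_metric \<Theta> p = (\<chi> a b. (1/2) * (heavenly_form \<Theta> p (axis a 1 + axis b 1)
     - heavenly_form \<Theta> p (axis a 1) - heavenly_form \<Theta> p (axis b 1)))"

definition Lambda_system :: "(jet \<Rightarrow> real) \<Rightarrow> jet \<Rightarrow> real^2" where
  "Lambda_system \<Lambda> q = vector [2 * pd \<Lambda> (dP 2) q, - 2 * pd \<Lambda> (dP 1) q]"

text \<open>The initial condition identifies the jet \<open>(X\<^sub>0,Y,Z,Y',Z')\<close> with the point
  \<open>(w,z,x,y) = (Y,Z,Z',-Y')\<close>; \<open>point_of_data\<close> and \<open>data_of_point\<close> are mutually inverse.\<close>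

definition point_of_data :: "real^2 \<Rightarrow> real^2 \<Rightarrow> real^4" where
  "point_of_data Y P = vector [Y$1, Y$2, P$2, - P$1]"

definition data_of_point :: "real \<Rightarrow> real^4 \<Rightarrow> jet" where
  "data_of_point X\<^sub>0 p = (X\<^sub>0, vector [p$1, p$2], vector [- p$4, p$3])"

text \<open>\<open>\<Lambda>\<close> is a solution on \<open>D\<close> of the initial value problem with data \<open>\<Theta>\<close>, such that the
  right-hand sides of the resulting system are of class \<open>C\<^sup>5\<close>.\<close>

definition Lambda_solution ::
    "(real^4 \<Rightarrow> real) \<Rightarrow> (real^4) set \<Rightarrow> real \<Rightarrow> jet set \<Rightarrow> (jet \<Rightarrow> real) \<Rightarrow> bool" where
  "Lambda_solution \<Theta> U X\<^sub>0 D \<Lambda> \<longleftrightarrow> open D \<and> \<Lambda> differentiable_on D \<and> Ck_on 5 (Lambda_system \<Lambda>) D \<and>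
     (\<forall>Y P. (X\<^sub>0, Y, P) \<in> D \<longrightarrow>
        point_of_data Y P \<in> U \<and> \<Lambda> (X\<^sub>0, Y, P) = - \<Theta> (point_of_data Y P)) \<and>
     (\<forall>q\<in>D. phi_equation (Lambda_system \<Lambda>) q)"

end

theory Submission imports Defs begin

text \<open>The alpha-surfaces with parameter \<open>s = X - X\<^sub>0\<close> are the integral surfaces of two commuting
  vector fields \<open>L0, L1\<close> depending on \<open>s\<close>. Functions \<open>Y = (Y,Z)\<close> of \<open>(X,p)\<close> that they annihilate
  are, together with \<open>X\<close>, coordinates of twistor space, and \<open>X \<mapsto> Y(X,p)\<close> is the twistor line of \<open>p\<close>.
  If \<open>Y\<close> is normalised by \<open>dY \<and> dZ\<close> being the parallel self-dual two-form with parameter \<open>s\<close>, the metric is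
  \<open>\<epsilon>\<^sub>A\<^sub>B dY\<^sup>A dP\<^sup>B + \<psi>\<^sub>A\<^sub>B dY\<^sup>A dY\<^sup>B\<close> with \<open>P = Y'\<close>. Since it does not depend on \<open>X\<close>, comparing coefficients in its
  \<open>X\<close>-derivative shows that \<open>P' = F\<close> has trace-free \<open>F\<^sub>P\<close>, hence a potential \<open>\<Lambda>\<close>, that \<open>\<psi> = \<phi>\<close>, and that \<open>\<phi>\<close>
  satisfies its evolution equation.

  Conversely, for every solution \<open>\<Lambda>\<close> the evolution equation says that the form
  \<open>\<epsilon>\<^sub>A\<^sub>B dY\<^sup>A dP\<^sup>B + \<phi>\<^sub>A\<^sub>B dY\<^sup>A dY\<^sup>B\<close> on the solution space is constant in \<open>X\<close>. At \<open>X\<^sub>0\<close> it is the heavenly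
  metric, so the surfaces \<open>Y(X,p) = const\<close> are totally null; being graphs over the plane
  \<open>w = z = const\<close>, they are self-dual.\<close>

section \<open>Calculus of functions of class \<open>C\<^sup>k\<close>\<close>

text \<open>With \<open>\<Theta>\<close> merely smooth, the evolution equation cannot be integrated
  in \<open>X\<close> by power series, so existence of \<open>\<Lambda>\<close> is not treated as a
  Cauchy problem but read off from twistor coordinates. These are free up to point transformations,
  and the initial condition removes that freedom: at \<open>X\<^sub>0\<close> it says
  \<open>F = (- 2 * \<Theta>_x, - 2 * \<Theta>_y)\<close>, so \<open>Y\<close>, \<open>Y'\<close>
  and \<open>Y''\<close> are prescribed there as \<open>(w, z)\<close>, \<open>(- y, x)\<close> and
  this vector. The delicate point is to meet this together with the unimodular normalisation of
  \<open>dY\<close> and \<open>dZ\<close>. The normalisation forces a correction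
  \<open>s\<^sup>2 * R\<close> of \<open>Z\<close> with \<open>s = X - X\<^sub>0\<close>; the
  heavenly equation makes \<open>R\<close> vanish at \<open>s = 0\<close>, so the prescribed 2-jet
  survives. Two derivatives in \<open>X\<close> lead from \<open>Y\<close> to \<open>F\<close>,
  hence \<open>F\<close> of class 5 asks for \<open>Y\<close> of class 7, and flows, inverse
  functions and parameter integrals have to be controlled at finite orders. In the converse
  direction most of the work lies in choosing one neighbourhood so small that the surfaces in it are
  connected and different points of the twistor patch give different surfaces.\<close>

definition dd :: "('a::real_normed_vector \<Rightarrow> 'b::real_normed_vector) \<Rightarrow> 'a \<Rightarrow> 'a \<Rightarrow> 'b" where
  "dd f v q = frechet_derivative f (at q) v"

lemma dd_eqI: "(f has_derivative f') (at q) \<Longrightarrow> dd f v q = f' v"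
  unfolding dd_def using frechet_derivative_at by metis

lemma has_derivative_dd: "f differentiable at q \<Longrightarrow> (f has_derivative (\<lambda>v. dd f v q)) (at q)"
  unfolding dd_def using frechet_derivative_works by blast

lemma frechet_derivative_cong_open:
  assumes "open S" "q \<in> S" "\<And>x. x \<in> S \<Longrightarrow> f x = g x"
  shows "frechet_derivative f (at q) = frechet_derivative g (at q)"
proof -
  have "(f has_derivative D) (at q) \<longleftrightarrow> (g has_derivative D) (at q)" for D
    using has_derivative_transform_within_open[of f D q UNIV S g]
          has_derivative_transform_within_open[of g D q UNIV S f] assms by auto
  then show ?thesis unfolding frechet_derivative_def by simp
qed

lemma dd_cong_open:
  "open S \<Longrightarrow> q \<in> S \<Longrightarrow> (\<And>x. x \<in> S \<Longrightarrow> f x = g x) \<Longrightarrow> dd f v q = dd g v q"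
  unfolding dd_def using frechet_derivative_cong_open[of S q f g] by simp

text \<open>On an open set \<open>frechet_derivative\<close> sees only nearby values, so equality on
  \<open>S\<close> passes to all iterated derivatives. This lets a function be replaced by a formula
  that is valid on \<open>S\<close> only.\<close>

lemma Ck_on_cong:
  assumes "open S" "\<And>x. x \<in> S \<Longrightarrow> f x = g x" "Ck_on k f S"
  shows "Ck_on k g S"
  using assms(2,3)
proof (induction k arbitrary: f g)
  case 0
  then show ?case using continuous_on_cong[of S S f g] by simp
next
  case (Suc k)
  have d: "g differentiable_on S"
    unfolding differentiable_on_eq_differentiable_at[OF assms(1)] differentiable_def
  proof
    fix x assume x: "x \<in> S"
    then have "(f has_derivative frechet_derivative f (at x)) (at x)"
      using Suc.prems(2) assms(1) frechet_derivative_works by (auto simp: differentiable_on_eq_differentiable_at)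
    then show "\<exists>D. (g has_derivative D) (at x)"
      using has_derivative_transform_within_open[of f "frechet_derivative f (at x)" x UNIV S g] assms(1) x Suc.prems(1) by auto
  qed
  have "Ck_on k (\<lambda>q. frechet_derivative g (at q) b) S" if "b \<in> Basis" for b
  proof (rule Suc.IH)
    show "Ck_on k (\<lambda>q. frechet_derivative f (at q) b) S" using Suc.prems that by simp
    show "frechet_derivative f (at x) b = frechet_derivative g (at x) b" if "x \<in> S" for x
      using frechet_derivative_cong_open[OF assms(1) that, of f g] Suc.prems(1) by simp
  qed
  then show ?case using d by simp
qed

lemma Ck_on_SucI:
  assumes "open S" "\<And>q. q \<in> S \<Longrightarrow> (f has_derivative f' q) (at q)"
    and "\<And>b. b \<in> Basis \<Longrightarrow> Ck_on k (\<lambda>q. f' q b) S"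
  shows "Ck_on (Suc k) f S"
proof -
  have "f differentiable_on S"
    unfolding differentiable_on_eq_differentiable_at[OF assms(1)] differentiable_def using assms(2) by blast
  moreover have "Ck_on k (\<lambda>q. frechet_derivative f (at q) b) S" if "b \<in> Basis" for b
  proof (rule Ck_on_cong[OF assms(1) _ assms(3)[OF that]])
    show "f' q b = frechet_derivative f (at q) b" if "q \<in> S" for q
      using frechet_derivative_at[OF assms(2)[OF that]] by simp
  qed
  ultimately show ?thesis by simp
qed

lemma Ck_on_Suc_differentiable:
  assumes "Ck_on (Suc k) f S" "open S" "q \<in> S" shows "f differentiable at q"
  using assms by (simp add: differentiable_on_eq_differentiable_at)

lemma Ck_on_has_derivative:
  assumes "Ck_on (Suc k) f S" "open S" "q \<in> S"
  shows "(f has_derivative (\<lambda>v. dd f v q)) (at q)"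
  using has_derivative_dd Ck_on_Suc_differentiable[OF assms] by blast

lemma Ck_on_dd_Basis:
  "Ck_on (Suc k) f S \<Longrightarrow> b \<in> Basis \<Longrightarrow> Ck_on k (dd f b) S"
  unfolding dd_def by simp

lemma Ck_on_continuous:
  assumes "Ck_on k f S" "open S" shows "continuous_on S f"
  using assms by (cases k) (auto intro: differentiable_imp_continuous_on)

lemma Ck_on_Suc_imp: "Ck_on (Suc k) f S \<Longrightarrow> open S \<Longrightarrow> Ck_on k f S"
proof (induction k arbitrary: f)
  case 0
  then show ?case by (simp add: differentiable_imp_continuous_on)
next
  case (Suc k)
  have "Ck_on k (\<lambda>q. frechet_derivative f (at q) b) S" if "b \<in> Basis" for b
    using Suc.IH[of "\<lambda>q. frechet_derivative f (at q) b"] Suc.prems that by (simp del: Ck_on.simps(2) add: Ck_on.simps(2)[of "Suc k" f])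
  then show ?case using Suc.prems(1) by (simp del: Ck_on.simps(2) add: Ck_on.simps(2)[of _ f])
qed

lemma Ck_on_mono: "Ck_on k f S \<Longrightarrow> j \<le> k \<Longrightarrow> open S \<Longrightarrow> Ck_on j f S"
  by (induction k) (auto simp: le_Suc_eq simp del: Ck_on.simps(2) dest: Ck_on_Suc_imp)

lemma Ck_on_subset: "Ck_on k f S \<Longrightarrow> T \<subseteq> S \<Longrightarrow> Ck_on k f T"
  by (induction k arbitrary: f) (auto intro: continuous_on_subset differentiable_on_subset)

lemma Ck_on_const [simp]: "open S \<Longrightarrow> Ck_on k (\<lambda>q. c) S"
proof (induction k arbitrary: c)
  case (Suc k)
  show ?case by (rule Ck_on_SucI[where f'="\<lambda>q v. 0"]) (use Suc in auto)
qed simp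

lemma Ck_on_add:
  assumes "open S" "Ck_on k f S" "Ck_on k g S"
  shows "Ck_on k (\<lambda>q. f q + g q) S"
  using assms(2,3)
proof (induction k arbitrary: f g)
  case 0 then show ?case by (simp add: continuous_on_add)
next
  case (Suc k)
  show ?case
  proof (rule Ck_on_SucI[OF assms(1), where f'="\<lambda>q v. dd f v q + dd g v q"])
    show "((\<lambda>q. f q + g q) has_derivative (\<lambda>v. dd f v q + dd g v q)) (at q)" if "q \<in> S" for q
      by (rule has_derivative_add[OF Ck_on_has_derivative[OF Suc.prems(1) assms(1) that] Ck_on_has_derivative[OF Suc.prems(2) assms(1) that]])
    show "Ck_on k (\<lambda>q. dd f b q + dd g b q) S" if "b \<in> Basis" for b
      using Suc.IH Ck_on_dd_Basis Suc.prems that by blast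
  qed
qed

lemma Ck_on_bounded_linear_comp:
  assumes "bounded_linear L" "open S" "Ck_on k f S"
  shows "Ck_on k (\<lambda>q. L (f q)) S"
  using assms(3)
proof (induction k arbitrary: f)
  case 0 then show ?case
    using bounded_linear.continuous_on[OF assms(1), of S f] by simp
next
  case (Suc k)
  show ?case
  proof (rule Ck_on_SucI[OF assms(2), where f'="\<lambda>q v. L (dd f v q)"])
    show "((\<lambda>q. L (f q)) has_derivative (\<lambda>v. L (dd f v q))) (at q)" if "q \<in> S" for q
      by (rule bounded_linear.has_derivative[OF assms(1) Ck_on_has_derivative[OF Suc.prems assms(2) that]])
    show "Ck_on k (\<lambda>q. L (dd f b q)) S" if "b \<in> Basis" for b
      using Suc.IH Ck_on_dd_Basis Suc.prems that by blast
  qed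
qed

lemma Ck_on_bounded_linear:
  assumes "bounded_linear L" "open S" shows "Ck_on k L S"
proof (cases k)
  case 0 then show ?thesis
    using bounded_linear.continuous_on[OF assms(1), of S "\<lambda>x. x"] by (simp add: continuous_on_id)
next
  case (Suc k)
  show ?thesis unfolding Suc
    by (rule Ck_on_SucI[OF assms(2), where f'="\<lambda>q. L"])
       (use assms bounded_linear_imp_has_derivative in auto)
qed

lemma Ck_on_id [simp]: "open S \<Longrightarrow> Ck_on k (\<lambda>q. q) S"
  using Ck_on_bounded_linear bounded_linear_ident by blast

text \<open>The product rule yields terms of the same shape, so one induction covers scalar
  multiples, products and the application of operators to vectors.\<close>

lemma Ck_on_bilinear:
  assumes bl: "bounded_bilinear mul" and S: "open S" and "Ck_on k f S" "Ck_on k g S"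
  shows "Ck_on k (\<lambda>q. mul (f q) (g q)) S"
  using assms(3,4)
proof (induction k arbitrary: f g)
  case 0 then show ?case using bounded_bilinear.continuous_on[OF bl] by auto
next
  case (Suc k)
  have k: "Ck_on k f S" "Ck_on k g S" using Suc.prems Ck_on_Suc_imp S by blast+
  show ?case
  proof (rule Ck_on_SucI[OF S, where f'="\<lambda>q v. mul (f q) (dd g v q) + mul (dd f v q) (g q)"])
    show "((\<lambda>q. mul (f q) (g q)) has_derivative (\<lambda>v. mul (f q) (dd g v q) + mul (dd f v q) (g q))) (at q)" if "q \<in> S" for q
      by (rule bounded_bilinear.FDERIV[OF bl Ck_on_has_derivative[OF Suc.prems(1) S that] Ck_on_has_derivative[OF Suc.prems(2) S that]])
    show "Ck_on k (\<lambda>q. mul (f q) (dd g b q) + mul (dd f b q) (g q)) S" if "b \<in> Basis" for b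
      by (rule Ck_on_add[OF S Suc.IH[OF k(1) Ck_on_dd_Basis[OF Suc.prems(2) that]]
            Suc.IH[OF Ck_on_dd_Basis[OF Suc.prems(1) that] k(2)]])
  qed
qed

lemmas Ck_on_scaleR = Ck_on_bilinear[OF bounded_bilinear_scaleR]
lemmas Ck_on_mult = Ck_on_bilinear[OF bounded_bilinear_mult]

lemma Ck_on_minus: "open S \<Longrightarrow> Ck_on k f S \<Longrightarrow> Ck_on k (\<lambda>q. - f q) S"
  using Ck_on_bounded_linear_comp[OF bounded_linear_minus[OF bounded_linear_ident]] by blast

lemma Ck_on_diff: "open S \<Longrightarrow> Ck_on k f S \<Longrightarrow> Ck_on k g S \<Longrightarrow> Ck_on k (\<lambda>q. f q - g q) S"
  using Ck_on_add[of S k f "\<lambda>q. - g q"] Ck_on_minus by auto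

lemma Ck_on_cmult: fixes f :: "_ \<Rightarrow> real" shows "open S \<Longrightarrow> Ck_on k f S \<Longrightarrow> Ck_on k (\<lambda>q. c * f q) S"
  by (intro Ck_on_mult Ck_on_const)

lemma Ck_on_inner: "open S \<Longrightarrow> Ck_on k f S \<Longrightarrow> Ck_on k (\<lambda>q. f q \<bullet> y) S"
  using Ck_on_bounded_linear_comp[OF bounded_linear_inner_left] by blast

lemma Ck_on_power: fixes f :: "_ \<Rightarrow> real"
  shows "open S \<Longrightarrow> Ck_on k f S \<Longrightarrow> Ck_on k (\<lambda>q. f q ^ n) S"
  by (induction n) (auto intro: Ck_on_mult)

lemma Ck_on_sum:
  assumes "open S" "\<And>i. i \<in> I \<Longrightarrow> Ck_on k (f i) S"
  shows "Ck_on k (\<lambda>q. \<Sum>i\<in>I. f i q) S"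
  using assms(2) by (induction I rule: infinite_finite_induct) (auto intro: Ck_on_add assms(1) Ck_on_const)

lemma Ck_on_Pair:
  assumes "open S" "Ck_on k f S" "Ck_on k g S"
  shows "Ck_on k (\<lambda>q. (f q, g q)) S"
proof -
  have "Ck_on k (\<lambda>q. (f q, 0) + (0, g q)) S"
    by (intro Ck_on_add assms(1) Ck_on_bounded_linear_comp[where L="\<lambda>x. (x, 0)", OF _ assms(1,2)]
         Ck_on_bounded_linear_comp[where L="\<lambda>x. (0, x)", OF _ assms(1,3)])
       (auto intro: bounded_linear_Pair bounded_linear_zero bounded_linear_ident)
  then show ?thesis by simp
qed

lemma Ck_on_fst: "open S \<Longrightarrow> Ck_on k f S \<Longrightarrow> Ck_on k (\<lambda>q. fst (f q)) S"
  using Ck_on_bounded_linear_comp[OF bounded_linear_fst] by blast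
lemma Ck_on_snd: "open S \<Longrightarrow> Ck_on k f S \<Longrightarrow> Ck_on k (\<lambda>q. snd (f q)) S"
  using Ck_on_bounded_linear_comp[OF bounded_linear_snd] by blast
lemma Ck_on_vec_nth: fixes f :: "_ \<Rightarrow> real^'n"
  shows "open S \<Longrightarrow> Ck_on k f S \<Longrightarrow> Ck_on k (\<lambda>q. f q $ i) S"
  using Ck_on_bounded_linear_comp[OF bounded_linear_vec_nth] by blast

lemma Ck_on_vec: fixes f :: "_ \<Rightarrow> real^'n"
  assumes "open S" "\<And>i. Ck_on k (\<lambda>q. f q $ i) S" shows "Ck_on k f S"
proof -
  have "Ck_on k (\<lambda>q. \<Sum>i\<in>UNIV. (f q $ i) *\<^sub>R axis i 1) S"
    using assms by (intro Ck_on_sum Ck_on_scaleR Ck_on_const)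
  moreover have "(\<lambda>q. \<Sum>i\<in>UNIV. (f q $ i) *\<^sub>R axis i 1) = f"
    using basis_expansion[of "f _"] by (auto simp: scalar_mult_eq_scaleR)
  ultimately show ?thesis by (rule back_subst[where P="\<lambda>h. Ck_on k h S"])
qed

lemma dd_linear: "f differentiable at q \<Longrightarrow> linear (\<lambda>v. dd f v q)"
  using has_derivative_dd has_derivative_linear by blast

lemma dd_Basis_expansion:
  fixes f :: "'a::euclidean_space \<Rightarrow> _"
  assumes "f differentiable at q"
  shows "dd f v q = (\<Sum>b\<in>Basis. (v \<bullet> b) *\<^sub>R dd f b q)"
proof -
  have "dd f (\<Sum>b\<in>Basis. (v \<bullet> b) *\<^sub>R b) q = (\<Sum>b\<in>Basis. (v \<bullet> b) *\<^sub>R dd f b q)"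
    using linear_sum[OF dd_linear[OF assms], of "\<lambda>b. (v \<bullet> b) *\<^sub>R b" Basis] linear_scale[OF dd_linear[OF assms]] by simp
  then show ?thesis by (simp add: euclidean_representation)
qed

text \<open>Expansion in \<open>Basis\<close> reduces a direction that varies with the point to
  fixed ones. It is needed for derivatives along vector fields such as \<open>e1v\<close>.\<close>

lemma Ck_on_dd_var:
  assumes S: "open S" and f: "Ck_on (Suc k) f S" and v: "Ck_on k v S"
  shows "Ck_on k (\<lambda>q. dd f (v q) q) S"
proof (rule Ck_on_cong[OF S])
  show "Ck_on k (\<lambda>q. \<Sum>b\<in>Basis. (v q \<bullet> b) *\<^sub>R dd f b q) S"
    by (rule Ck_on_sum[OF S], rule Ck_on_scaleR[OF S Ck_on_inner[OF S v] Ck_on_dd_Basis[OF f]])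
  show "(\<Sum>b\<in>Basis. (v q \<bullet> b) *\<^sub>R dd f b q) = dd f (v q) q" if "q \<in> S" for q
    by (rule dd_Basis_expansion[OF Ck_on_Suc_differentiable[OF f S that], symmetric])
qed

lemma Ck_on_dd: "open S \<Longrightarrow> Ck_on (Suc k) f S \<Longrightarrow> Ck_on k (dd f v) S"
  by (rule Ck_on_dd_var) auto

lemma dd_compose:
  assumes "f differentiable at (g q)" "g differentiable at q"
  shows "dd (\<lambda>q. f (g q)) v q = dd f (dd g v q) (g q)"
  by (rule dd_eqI[OF has_derivative_compose[OF has_derivative_dd[OF assms(2)] has_derivative_dd[OF assms(1)]]])

lemma Ck_on_compose:
  assumes "open S" "open T" "Ck_on k f T" "Ck_on k g S" "g ` S \<subseteq> T"
  shows "Ck_on k (\<lambda>q. f (g q)) S"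
  using assms(3,4)
proof (induction k arbitrary: f)
  case 0 then show ?case using assms(5) continuous_on_compose2 by auto
next
  case (Suc k)
  have g: "Ck_on k g S" using Suc.prems Ck_on_Suc_imp assms(1) by blast
  have df: "f differentiable at (g q)" if "q \<in> S" for q
    using Ck_on_Suc_differentiable[OF Suc.prems(1) assms(2)] assms(5) that by blast
  show ?case
  proof (rule Ck_on_SucI[OF assms(1), where f'="\<lambda>q v. dd f (dd g v q) (g q)"])
    show "((\<lambda>q. f (g q)) has_derivative (\<lambda>v. dd f (dd g v q) (g q))) (at q)" if "q \<in> S" for q
      using has_derivative_compose[OF Ck_on_has_derivative[OF Suc.prems(2) assms(1) that] has_derivative_dd[OF df[OF that]]]
      by simp
    show "Ck_on k (\<lambda>q. dd f (dd g b q) (g q)) S" if b: "b \<in> Basis" for b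
    proof (rule Ck_on_cong[OF assms(1)])
      show "Ck_on k (\<lambda>q. \<Sum>c\<in>Basis. (dd g b q \<bullet> c) *\<^sub>R dd f c (g q)) S"
        by (rule Ck_on_sum[OF assms(1)], rule Ck_on_scaleR[OF assms(1) Ck_on_inner[OF assms(1) Ck_on_dd_Basis[OF Suc.prems(2) b]]
              Suc.IH[OF Ck_on_dd_Basis[OF Suc.prems(1)] g]])
    qed (rule dd_Basis_expansion[OF df, symmetric])
  qed
qed

section \<open>Rules for directional derivatives, comparison with \<open>pd\<close>, and symmetry of
  second derivatives\<close>

lemma dd_add: "f differentiable at q \<Longrightarrow> g differentiable at q \<Longrightarrow>
    dd (\<lambda>q. f q + g q) v q = dd f v q + dd g v q"
  by (rule dd_eqI[OF has_derivative_add[OF has_derivative_dd has_derivative_dd]])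

lemma dd_diff: "f differentiable at q \<Longrightarrow> g differentiable at q \<Longrightarrow>
    dd (\<lambda>q. f q - g q) v q = dd f v q - dd g v q"
  by (rule dd_eqI[OF has_derivative_diff[OF has_derivative_dd has_derivative_dd]])

lemma dd_minus: "f differentiable at q \<Longrightarrow> dd (\<lambda>q. - f q) v q = - dd f v q"
  by (rule dd_eqI[OF has_derivative_minus[OF has_derivative_dd]])

lemma dd_bounded_linear: "bounded_linear L \<Longrightarrow> f differentiable at q \<Longrightarrow> dd (\<lambda>q. L (f q)) v q = L (dd f v q)"
  by (rule dd_eqI[OF bounded_linear.has_derivative[OF _ has_derivative_dd]])

lemma dd_vec_nth: fixes f :: "_ \<Rightarrow> real^'n"
  shows "f differentiable at q \<Longrightarrow> dd (\<lambda>q. f q $ i) v q = dd f v q $ i"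
  by (rule dd_bounded_linear[OF bounded_linear_vec_nth])

lemma dd_const [simp]: "dd (\<lambda>q. c) v q = 0"
  by (rule dd_eqI[OF has_derivative_const])

lemma has_vector_derivative_line:
  assumes "f differentiable at (q + s *\<^sub>R v)"
  shows "((\<lambda>t. f (q + t *\<^sub>R v)) has_vector_derivative dd f v (q + s *\<^sub>R v)) (at s)"
proof -
  have "((\<lambda>t. q + t *\<^sub>R v) has_derivative (\<lambda>t. t *\<^sub>R v)) (at s)"
    by (auto intro!: derivative_eq_intros)
  from has_derivative_compose[OF this has_derivative_dd[OF assms]]
  show ?thesis unfolding has_vector_derivative_def
    using linear_scale[OF dd_linear[OF assms]] by simp
qed

text \<open>\<open>pd\<close> is a derivative along a single line and says nothing about
  differentiability; this is the bridge from the definitions, stated with \<open>pd\<close>, to the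
  calculus of \<open>dd\<close>.\<close>

lemma pd_eq_dd:
  fixes f :: "'a::real_normed_vector \<Rightarrow> real"
  assumes "f differentiable at q" shows "pd f v q = dd f v q"
  using has_vector_derivative_line[of f q 0 v] assms
  by (auto simp: pd_def has_real_derivative_iff_has_vector_derivative[symmetric] intro: DERIV_imp_deriv)

lemma pd_cong_open:
  assumes "open S" "q \<in> S" "\<And>x. x \<in> S \<Longrightarrow> f x = g x"
  shows "pd f v q = pd g v q"
proof -
  have "\<forall>\<^sub>F t in nhds 0. q + t *\<^sub>R v \<in> S"
  proof -
    have "((\<lambda>t::real. q + t *\<^sub>R v) \<longlongrightarrow> q + 0 *\<^sub>R v) (nhds 0)"
      by (intro tendsto_intros filterlim_ident)
    then show ?thesis using assms(1,2) topological_tendstoD by fastforce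
  qed
  then have "\<forall>\<^sub>F t in nhds 0. f (q + t *\<^sub>R v) = g (q + t *\<^sub>R v)"
    using assms(3) by (auto elim: eventually_mono)
  then show ?thesis unfolding pd_def by (rule deriv_cong_ev) simp
qed

text \<open>Clairaut: both mixed derivatives are limits of the second difference quotient.\<close>

lemma second_difference:
  fixes f :: "'a::euclidean_space \<Rightarrow> real"
  assumes S: "open S" "convex S" and f: "Ck_on 2 f S" and h: "h > 0"
    and sub: "\<And>s t. 0 \<le> s \<Longrightarrow> s \<le> h \<Longrightarrow> 0 \<le> t \<Longrightarrow> t \<le> h \<Longrightarrow> q + s *\<^sub>R u + t *\<^sub>R v \<in> S"
  obtains s t where "0 \<le> s" "s \<le> h" "0 \<le> t" "t \<le> h"
    "f (q + h *\<^sub>R u + h *\<^sub>R v) - f (q + h *\<^sub>R u) - f (q + h *\<^sub>R v) + f q = h * h * dd (dd f u) v (q + s *\<^sub>R u + t *\<^sub>R v)"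
proof -
  have f2: "Ck_on (Suc (Suc 0)) f S" using f by (simp add: numeral_2_eq_2)
  have f1: "Ck_on (Suc 0) (dd f u) S" using Ck_on_dd[OF S(1) f2] .
  \<comment> \<open>The mean value theorem is used in direction \<open>u\<close> for the increment
    in direction \<open>v\<close>, and then in direction \<open>v\<close> for
    \<open>dd f u\<close>.\<close>
  define G where "G s = f (q + s *\<^sub>R u + h *\<^sub>R v) - f (q + s *\<^sub>R u)" for s
  have fd: "((\<lambda>s. f (q + s *\<^sub>R u + t *\<^sub>R v)) has_real_derivative dd f u (q + s *\<^sub>R u + t *\<^sub>R v)) (at s)"
    if "0 \<le> s" "s \<le> h" "0 \<le> t" "t \<le> h" for s t
    using has_vector_derivative_line[of f "q + t *\<^sub>R v" s u] Ck_on_Suc_differentiable[OF f2 S(1) sub[OF that]]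
    by (simp add: has_real_derivative_iff_has_vector_derivative ac_simps)
  have "\<exists>s. 0 < s \<and> s < h \<and> G h - G 0 = (h - 0) * (dd f u (q + s *\<^sub>R u + h *\<^sub>R v) - dd f u (q + s *\<^sub>R u))"
    using h fd[of _ h] fd[of _ 0] unfolding G_def by (intro MVT2) (auto intro!: DERIV_diff)
  then obtain s where s: "0 < s" "s < h" and
    e1: "G h - G 0 = h * (dd f u (q + s *\<^sub>R u + h *\<^sub>R v) - dd f u (q + s *\<^sub>R u))" by auto
  have gd: "((\<lambda>t. dd f u (q + s *\<^sub>R u + t *\<^sub>R v)) has_real_derivative dd (dd f u) v (q + s *\<^sub>R u + t *\<^sub>R v)) (at t)"
    if "0 \<le> t" "t \<le> h" for t
    using has_vector_derivative_line[of "dd f u" "q + s *\<^sub>R u" t v] Ck_on_Suc_differentiable[OF f1 S(1) sub] s that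
    by (simp add: has_real_derivative_iff_has_vector_derivative)
  have "\<exists>t. 0 < t \<and> t < h \<and> dd f u (q + s *\<^sub>R u + h *\<^sub>R v) - dd f u (q + s *\<^sub>R u + 0 *\<^sub>R v) = (h - 0) * dd (dd f u) v (q + s *\<^sub>R u + t *\<^sub>R v)"
    using h gd by (intro MVT2) auto
  then obtain t where t: "0 < t" "t < h" and
    e2: "dd f u (q + s *\<^sub>R u + h *\<^sub>R v) - dd f u (q + s *\<^sub>R u) = h * dd (dd f u) v (q + s *\<^sub>R u + t *\<^sub>R v)" by auto
  show ?thesis
    using that[of s t] s t e1 e2 unfolding G_def by simp
qed

lemma dd_commute_real:
  fixes f :: "'a::euclidean_space \<Rightarrow> real"
  assumes S: "open S" "q \<in> S" and f: "Ck_on 2 f S"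
  shows "dd (dd f u) v q = dd (dd f v) u q"
proof -
  obtain e where e: "e > 0" "ball q e \<subseteq> S" using S open_contains_ball by blast
  define B where "B = ball q e"
  have B: "open B" "convex B" "Ck_on 2 f B" unfolding B_def using Ck_on_subset[OF f e(2)] by auto
  have f2: "Ck_on (Suc (Suc 0)) f B" using B by (simp add: numeral_2_eq_2)
  have cont: "continuous (at q) (dd (dd f u) v)" "continuous (at q) (dd (dd f v) u)"
    using Ck_on_dd[OF B(1) Ck_on_dd[OF B(1) f2]] e(1) B(1)
    by (auto simp: continuous_on_eq_continuous_at B_def)
  have "\<bar>dd (dd f u) v q - dd (dd f v) u q\<bar> \<le> r" if r: "r > 0" for r
  proof -
    obtain d1 where d1: "d1 > 0" "\<And>x. norm (x - q) < d1 \<Longrightarrow> norm (dd (dd f u) v x - dd (dd f u) v q) < r/2"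
      using cont(1) r unfolding continuous_at_eps_delta dist_norm by (meson half_gt_zero)
    obtain d2 where d2: "d2 > 0" "\<And>x. norm (x - q) < d2 \<Longrightarrow> norm (dd (dd f v) u x - dd (dd f v) u q) < r/2"
      using cont(2) r unfolding continuous_at_eps_delta dist_norm by (meson half_gt_zero)
    define d where "d = min e (min d1 d2)"
    \<comment> \<open>So small that the parallelogram with sides \<open>h *\<^sub>R u\<close> and
      \<open>h *\<^sub>R v\<close> stays within distance \<open>d\<close> of \<open>q\<close>; the
      summand 1 covers the case \<open>u = v = 0\<close>.\<close>
    define h where "h = d / (2 * (norm u + norm v + 1))"
    define n where "n = norm u + norm v + 1"
    have n: "n > 0" unfolding n_def by (simp add: add_nonneg_pos)
    have d: "d > 0" using e d1 d2 unfolding d_def by auto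
    have h: "h > 0" unfolding h_def using d by (intro divide_pos_pos) (auto intro: add_nonneg_pos)
    have hd: "h * (norm u + norm v) < d"
    proof -
      have "h * (norm u + norm v) \<le> h * (norm u + norm v + 1)" using h by auto
      also have "\<dots> = d / 2" unfolding h_def n_def[symmetric] using n by simp
      finally show ?thesis using d by simp
    qed
    have nrm: "norm (q + s *\<^sub>R u + t *\<^sub>R v - q) < d" if "0 \<le> s" "s \<le> h" "0 \<le> t" "t \<le> h" for s t
    proof -
      have "norm (q + s *\<^sub>R u + t *\<^sub>R v - q) \<le> s * norm u + t * norm v"
        using norm_triangle_ineq[of "s *\<^sub>R u" "t *\<^sub>R v"] that by simp
      also have "\<dots> \<le> h * norm u + h * norm v" using that by (intro add_mono mult_right_mono) auto
      finally show ?thesis using hd by (simp add: algebra_simps)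
    qed
    have inB: "q + s *\<^sub>R u + t *\<^sub>R v \<in> B" "q + t *\<^sub>R v + s *\<^sub>R u \<in> B" if "0 \<le> s" "s \<le> h" "0 \<le> t" "t \<le> h" for s t
      using nrm[OF that] unfolding B_def d_def by (auto simp: dist_norm norm_minus_commute algebra_simps)
    obtain s t where st: "0 \<le> s" "s \<le> h" "0 \<le> t" "t \<le> h"
      "f (q + h *\<^sub>R u + h *\<^sub>R v) - f (q + h *\<^sub>R u) - f (q + h *\<^sub>R v) + f q = h * h * dd (dd f u) v (q + s *\<^sub>R u + t *\<^sub>R v)"
      using second_difference[OF B h, of q u v] inB by metis
    obtain s' t' where st': "0 \<le> s'" "s' \<le> h" "0 \<le> t'" "t' \<le> h"
      "f (q + h *\<^sub>R v + h *\<^sub>R u) - f (q + h *\<^sub>R v) - f (q + h *\<^sub>R u) + f q = h * h * dd (dd f v) u (q + s' *\<^sub>R v + t' *\<^sub>R u)"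
      using second_difference[OF B h, of q v u] inB by metis
    have sw: "q + h *\<^sub>R v + h *\<^sub>R u = q + h *\<^sub>R u + h *\<^sub>R v" by simp
    have "h * h * dd (dd f u) v (q + s *\<^sub>R u + t *\<^sub>R v) = h * h * dd (dd f v) u (q + s' *\<^sub>R v + t' *\<^sub>R u)"
      using st(5) st'(5) unfolding sw by linarith
    then have eq: "dd (dd f u) v (q + s *\<^sub>R u + t *\<^sub>R v) = dd (dd f v) u (q + s' *\<^sub>R v + t' *\<^sub>R u)"
      using h by simp
    have "\<bar>dd (dd f u) v (q + s *\<^sub>R u + t *\<^sub>R v) - dd (dd f u) v q\<bar> < r/2"
      using d1(2) nrm[OF st(1-4)] unfolding d_def by auto
    moreover have "\<bar>dd (dd f v) u (q + s' *\<^sub>R v + t' *\<^sub>R u) - dd (dd f v) u q\<bar> < r/2"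
      using d2(2) nrm[OF st'(3,4,1,2)] unfolding d_def by (auto simp: algebra_simps)
    ultimately show ?thesis using eq by linarith
  qed
  then show ?thesis using field_le_epsilon[of "\<bar>dd (dd f u) v q - dd (dd f v) u q\<bar>" 0] by force
qed

lemma dd_commute:
  fixes f :: "'a::euclidean_space \<Rightarrow> 'b::euclidean_space"
  assumes S: "open S" "q \<in> S" and f: "Ck_on 2 f S"
  shows "dd (dd f u) v q = dd (dd f v) u q"
proof (rule euclidean_eqI)
  fix b :: 'b assume "b \<in> Basis"
  define g where "g x = f x \<bullet> b" for x
  have f2: "Ck_on (Suc (Suc 0)) f S" using f by (simp add: numeral_2_eq_2)
  have g2: "Ck_on 2 g S" unfolding g_def using Ck_on_bounded_linear_comp[OF bounded_linear_inner_left S(1) f] .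
  have e: "dd g w x = dd f w x \<bullet> b" if "x \<in> S" for x w
    unfolding g_def using dd_bounded_linear[OF bounded_linear_inner_left Ck_on_Suc_differentiable[OF f2 S(1) that]] .
  have "dd (dd g w) z q = dd (dd f w) z q \<bullet> b" for w z
    using dd_cong_open[OF S, of "dd g w" "\<lambda>x. dd f w x \<bullet> b" z] e
      dd_bounded_linear[OF bounded_linear_inner_left[of b] Ck_on_Suc_differentiable[OF Ck_on_dd[OF S(1) f2, of w] S], of z]
    by simp
  then show "dd (dd f u) v q \<bullet> b = dd (dd f v) u q \<bullet> b"
    using dd_commute_real[OF S g2, of u v] by simp
qed

section \<open>Flows of vector fields of class \<open>C\<^sup>k\<close>\<close>

text \<open>Gronwall in exponential form: \<open>exp (c * s) * (d s \<bullet> d s)\<close> is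
  nonincreasing for \<open>c = - 2 * L\<close> and nondecreasing for \<open>c = 2 * L\<close>, so it
  stays zero after \<open>t0\<close> and before \<open>t0\<close> respectively. With
  \<open>L = 0\<close> it also serves to show that functions with zero derivative are
  constant.\<close>

lemma linear_growth_zero:
  fixes d :: "real \<Rightarrow> 'a::real_inner"
  assumes d: "\<And>s. s \<in> {a..b} \<Longrightarrow> (d has_vector_derivative d' s) (at s)"
    and L: "\<And>s. s \<in> {a..b} \<Longrightarrow> norm (d' s) \<le> L * norm (d s)"
    and t0: "t0 \<in> {a..b}" "d t0 = 0" and t: "t \<in> {a..b}"
  shows "d t = 0"
proof -
  define E where "E c s = exp (c * s) * (d s \<bullet> d s)" for c s
  have E: "(E c has_real_derivative exp (c * s) * (c * (d s \<bullet> d s) + 2 * (d s \<bullet> d' s))) (at s)" if "s \<in> {a..b}" for c s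
  proof -
    have "((\<lambda>s. d s \<bullet> d s) has_derivative (\<lambda>h. d s \<bullet> (h *\<^sub>R d' s) + (h *\<^sub>R d' s) \<bullet> d s)) (at s)"
      using d[OF that] unfolding has_vector_derivative_def by (intro has_derivative_inner)
    then have 1: "((\<lambda>s. d s \<bullet> d s) has_real_derivative 2 * (d s \<bullet> d' s)) (at s)"
      unfolding has_field_derivative_def by (rule has_derivative_eq_rhs) (auto simp: inner_commute)
    have 2: "((\<lambda>s. exp (c * s)) has_real_derivative exp (c * s) * c) (at s)"
      by (auto intro!: derivative_eq_intros)
    show ?thesis unfolding E_def using DERIV_mult[OF 2 1] by (simp add: algebra_simps)
  qed
  have ip: "\<bar>d s \<bullet> d' s\<bar> \<le> L * (d s \<bullet> d s)" if "s \<in> {a..b}" for s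
  proof -
    have "\<bar>d s \<bullet> d' s\<bar> \<le> norm (d s) * norm (d' s)" by (rule Cauchy_Schwarz_ineq2)
    also have "\<dots> \<le> norm (d s) * (L * norm (d s))" using L[OF that] by (intro mult_left_mono) auto
    finally show ?thesis by (simp add: power2_norm_eq_inner[symmetric] power2_eq_square algebra_simps)
  qed
  have "d t \<bullet> d t \<le> 0"
  proof (cases "t0 \<le> t")
    case True
    have "E (- 2 * L) t \<le> E (- 2 * L) t0"
    proof (rule DERIV_nonpos_imp_nonincreasing[OF True], intro exI conjI)
      fix s assume "t0 \<le> s" "s \<le> t" then have s: "s \<in> {a..b}" using t t0 by auto
      show "(E (- 2 * L) has_real_derivative exp (- 2 * L * s) * (- 2 * L * (d s \<bullet> d s) + 2 * (d s \<bullet> d' s))) (at s)"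
        by (rule E[OF s])
      show "exp (- 2 * L * s) * (- 2 * L * (d s \<bullet> d s) + 2 * (d s \<bullet> d' s)) \<le> 0"
        using ip[OF s] by (simp add: mult_le_0_iff abs_le_iff)
    qed
    then show ?thesis unfolding E_def by (simp add: t0 mult_le_0_iff)
  next
    case False
    then have le: "t \<le> t0" by simp
    have "E (2 * L) t \<le> E (2 * L) t0"
    proof (rule DERIV_nonneg_imp_nondecreasing[OF le], intro exI conjI)
      fix s assume "t \<le> s" "s \<le> t0" then have s: "s \<in> {a..b}" using t t0 by auto
      show "(E (2 * L) has_real_derivative exp (2 * L * s) * (2 * L * (d s \<bullet> d s) + 2 * (d s \<bullet> d' s))) (at s)"
        by (rule E[OF s])
      show "0 \<le> exp (2 * L * s) * (2 * L * (d s \<bullet> d s) + 2 * (d s \<bullet> d' s))"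
        using ip[OF s] by (simp add: zero_le_mult_iff abs_le_iff)
    qed
    then show ?thesis unfolding E_def by (simp add: t0 mult_le_0_iff)
  qed
  then show ?thesis using inner_ge_zero[of "d t"] by simp
qed

text \<open>The derivative as a point of a normed space of operators, so that its continuity and its
  own derivative can be used uniformly over all directions.\<close>

definition Dblin :: "('a::euclidean_space \<Rightarrow> 'b::real_normed_vector) \<Rightarrow> 'a \<Rightarrow> 'a \<Rightarrow>\<^sub>L 'b" where
  "Dblin f x = Blinfun (\<lambda>v. dd f v x)"

lemma blinfun_apply_Dblin:
  assumes "f differentiable at x" shows "blinfun_apply (Dblin f x) = (\<lambda>v. dd f v x)"
  unfolding Dblin_def using has_derivative_bounded_linear[OF has_derivative_dd[OF assms]]
  by (rule bounded_linear_Blinfun_apply)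

lemma Ck_on_1_Dblin:
  assumes "open U" "Ck_on (Suc k) f U"
  shows "x \<in> U \<Longrightarrow> (f has_derivative blinfun_apply (Dblin f x)) (at x)"
    and "continuous_on U (Dblin f)"
proof -
  have df: "f differentiable at x" if "x \<in> U" for x
    using Ck_on_Suc_differentiable[OF assms(2,1) that] .
  show "x \<in> U \<Longrightarrow> (f has_derivative blinfun_apply (Dblin f x)) (at x)"
    using has_derivative_dd[OF df] blinfun_apply_Dblin[OF df] by simp
  show "continuous_on U (Dblin f)"
  proof (rule continuous_on_blinfun_componentwise)
    fix i :: 'a assume "i \<in> Basis"
    have "continuous_on U (dd f i)" using Ck_on_continuous[OF Ck_on_dd[OF assms] assms(1)] .
    moreover have "dd f i x = blinfun_apply (Dblin f x) i" if "x \<in> U" for x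
      using blinfun_apply_Dblin[OF df[OF that]] by simp
    ultimately show "continuous_on U (\<lambda>x. blinfun_apply (Dblin f x) i)"
      using continuous_on_cong[of U U "dd f i" "\<lambda>x. blinfun_apply (Dblin f x) i"] by simp
  qed
qed

text \<open>Over the compact interval between \<open>t0\<close> and \<open>t\<close> both curves
  sweep out one compact set, on which the locally Lipschitz \<open>f\<close> has a single Lipschitz
  constant; \<open>linear_growth_zero\<close> then applies to the difference.\<close>

lemma ode_unique:
  fixes f :: "'a::euclidean_space \<Rightarrow> 'a"
  assumes U: "open U" and f: "Ck_on (Suc k) f U"
    and u: "\<And>t. t \<in> {a<..<b} \<Longrightarrow> u t \<in> U \<and> (u has_vector_derivative f (u t)) (at t)"
    and v: "\<And>t. t \<in> {a<..<b} \<Longrightarrow> v t \<in> U \<and> (v has_vector_derivative f (v t)) (at t)"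
    and t0: "t0 \<in> {a<..<b}" "u t0 = v t0" and t: "t \<in> {a<..<b}"
  shows "u t = v t"
proof -
  define c d where "c = min t0 t" and "d = max t0 t"
  have cd: "{c..d} \<subseteq> {a<..<b}" "t0 \<in> {c..d}" "t \<in> {c..d}" using t0 t unfolding c_def d_def by auto
  have cont: "continuous_on {c..d} u" "continuous_on {c..d} v"
    using u v cd by (meson continuous_at_imp_continuous_on has_vector_derivative_continuous subsetD)+
  define K where "K = u ` {c..d} \<union> v ` {c..d}"
  have K: "compact K" "K \<subseteq> U"
    unfolding K_def using cont u v cd by (auto intro!: compact_Un compact_continuous_image)
  have "local_lipschitz UNIV U (\<lambda>_::real. f)"
  proof (rule c1_implies_local_lipschitz)
    show "(f has_derivative blinfun_apply (Dblin f (snd (t, x)))) (at x)" if "x \<in> U" for t :: real and x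
      using Ck_on_1_Dblin(1)[OF U f that] by simp
    show "continuous_on (UNIV \<times> U) (\<lambda>p::real \<times> 'a. Dblin f (snd p))"
      by (intro continuous_on_compose2[OF Ck_on_1_Dblin(2)[OF U f]] continuous_intros) auto
  qed (use U in auto)
  then have "local_lipschitz {0} K (\<lambda>_::real. f)" by (rule local_lipschitz_subset) (use K in auto)
  then obtain L where "\<And>s::real. s \<in> {0} \<Longrightarrow> L-lipschitz_on K f"
    using local_lipschitz_compact_implies_lipschitz[where X=K and T="{0::real}" and f="\<lambda>_. f"] K(1) by auto
  then have lip: "L-lipschitz_on K f" by simp
  have "u t - v t = 0"
  proof (rule linear_growth_zero[where d="\<lambda>s. u s - v s" and d'="\<lambda>s. f (u s) - f (v s)" and a=c and b=d and L=L and ?t0.0=t0])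
    fix s assume s: "s \<in> {c..d}"
    show "((\<lambda>s. u s - v s) has_vector_derivative f (u s) - f (v s)) (at s)"
      using u v s cd by (intro has_vector_derivative_diff) auto
    have "u s \<in> K" "v s \<in> K" using s unfolding K_def by auto
    then show "norm (f (u s) - f (v s)) \<le> L * norm (u s - v s)"
      using lipschitz_onD[OF lip] unfolding dist_norm by blast
  qed (use cd t0 in auto)
  then show ?thesis by simp
qed

text \<open>Signed integrals are written as \<open>t *\<^sub>R integral {0..1} (\<lambda>s. G (t * s))\<close>, which makes sense
  for both signs of \<open>t\<close> and is continuous in parameters.\<close>

lemma scaled_integral_deriv:
  fixes G :: "real \<Rightarrow> 'b::banach"
  assumes G: "continuous_on {-T..T} G" and t: "t \<in> {-T<..<T}"
  shows "((\<lambda>t. t *\<^sub>R integral {0..1} (\<lambda>s. G (t * s))) has_vector_derivative G t) (at t)"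
proof -
  obtain H where H: "\<And>x. x \<in> {-T..T} \<Longrightarrow> (H has_vector_derivative G x) (at x within {-T..T})"
    using antiderivative_continuous[OF G] by blast
  have eq: "r *\<^sub>R integral {0..1} (\<lambda>s. G (r * s)) = H r - H 0" if r: "r \<in> {-T<..<T}" for r
  proof -
    have m: "r * s \<in> {-T..T}" if "s \<in> {0..1}" for s
    proof -
      have "\<bar>r * s\<bar> \<le> \<bar>r\<bar> * 1" unfolding abs_mult using that by (intro mult_left_mono) auto
      then show ?thesis using r by auto
    qed
    have "((\<lambda>s. r *\<^sub>R G (r * s)) has_integral H (r * 1) - H (r * 0)) {0..1}"
    proof (rule fundamental_theorem_of_calculus)
      fix s :: real assume s: "s \<in> {0..1}"
      have "((\<lambda>s. r * s) has_vector_derivative r) (at s within {0..1})"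
        by (auto intro!: derivative_eq_intros)
      moreover have "(H has_vector_derivative G (r * s)) (at (r * s) within (\<lambda>s. r * s) ` {0..1})"
        by (rule has_vector_derivative_within_subset[OF H[OF m[OF s]]]) (use m in auto)
      ultimately show "((\<lambda>s. H (r * s)) has_vector_derivative r *\<^sub>R G (r * s)) (at s within {0..1})"
        using vector_diff_chain_within[of "\<lambda>s. r * s" r s "{0..1}" H "G (r * s)"] by (simp add: o_def)
    qed simp
    from integral_unique[OF this] show ?thesis by simp
  qed
  have "(H has_vector_derivative G t) (at t within {-T<..<T})"
    by (rule has_vector_derivative_within_subset[OF H]) (use t in auto)
  then have "(H has_vector_derivative G t) (at t)" using t at_within_open[of t "{-T<..<T}"] by simp
  then have "((\<lambda>r. H r - H 0) has_vector_derivative G t) (at t)"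
    by (auto intro!: derivative_eq_intros)
  then show ?thesis
    by (rule has_vector_derivative_transform_within_open[where S="{-T<..<T}"]) (use t eq in auto)
qed

text \<open>The fixed point is sought among bounded continuous functions of time and parameter
  together, so continuity in the parameter comes with the solution. The Lipschitz bound is global
  and the initial value is 0; callers truncate their fields and add their initial values.\<close>

lemma picard:
  fixes g :: "real \<Rightarrow> 'q::metric_space \<Rightarrow> 'v::banach \<Rightarrow> 'v"
  assumes cont: "continuous_on UNIV (\<lambda>(t, q, v). g t q v)"
    and lip: "\<And>t q v w. norm (g t q v - g t q w) \<le> L * norm (v - w)"
    and bnd: "\<And>t q. norm (g t q 0) \<le> B"
    and T: "0 < T" "T * L \<le> 1/2" "0 \<le> L"
  obtains \<psi> where "continuous_on UNIV (\<lambda>(t, q). \<psi> t q)" "\<And>q. \<psi> 0 q = 0"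
    "\<And>t q. t \<in> {-T<..<T} \<Longrightarrow> ((\<lambda>t. \<psi> t q) has_vector_derivative g t q (\<psi> t q)) (at t)"
    "\<And>t q K. (\<And>t v. norm (g t q v) \<le> K) \<Longrightarrow> norm (\<psi> t q) \<le> T * K"
proof -
  \<comment> \<open>Clamping time to \<open>{-T..T}\<close> keeps the integral operator bounded on
    functions defined for all times; the differential equation is claimed only inside the
    interval.\<close>
  define c where "c t = max (-T) (min T t)" for t :: real
  have c: "continuous_on UNIV c" unfolding c_def by (intro continuous_intros)
  have cT: "\<bar>c t\<bar> \<le> T" for t using T unfolding c_def by auto
  define \<Phi> where "\<Phi> v p = c (fst p) *\<^sub>R integral (cbox 0 1) (\<lambda>s. g (c (fst p) * s) (snd p) (apply_bcontfun v (c (fst p) * s, snd p)))"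
    for v :: "(real \<times> 'q) \<Rightarrow>\<^sub>C 'v" and p
  have cv: "continuous_on S (apply_bcontfun v)" for v :: "(real \<times> 'q) \<Rightarrow>\<^sub>C 'v" and S
    by (rule continuous_on_subset[OF continuous_on_apply_bcontfun]) auto
  have ci: "continuous_on UNIV (\<lambda>(p, s). g (c (fst p) * s) (snd p) (apply_bcontfun v (c (fst p) * s, snd p)))"
    for v :: "(real \<times> 'q) \<Rightarrow>\<^sub>C 'v"
    unfolding split_beta
    by (rule continuous_on_compose2[OF cont, unfolded split_beta, of _ "\<lambda>x. (c (fst (fst x)) * snd x, snd (fst x), apply_bcontfun v (c (fst (fst x)) * snd x, snd (fst x)))", simplified])
       (intro continuous_intros continuous_on_compose2[OF c] continuous_on_compose2[OF cv], auto)
  have cont\<Phi>: "continuous_on UNIV (\<Phi> v)" for v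
  proof -
    have "continuous_on UNIV (\<lambda>p. integral (cbox 0 1) (\<lambda>s. g (c (fst p) * s) (snd p) (apply_bcontfun v (c (fst p) * s, snd p))))"
      by (rule integral_continuous_on_param) (rule continuous_on_subset[OF ci], auto)
    then show ?thesis unfolding \<Phi>_def by (intro continuous_intros continuous_on_compose2[OF c]) auto
  qed
  have inb: "(\<lambda>s. g (c (fst p) * s) (snd p) (apply_bcontfun v (c (fst p) * s, snd p))) integrable_on cbox 0 1"
    for v :: "(real \<times> 'q) \<Rightarrow>\<^sub>C 'v" and p
  proof (rule integrable_continuous)
    have "continuous_on (cbox 0 1) (\<lambda>s. (\<lambda>(p, s). g (c (fst p) * s) (snd p) (apply_bcontfun v (c (fst p) * s, snd p))) (p, s))"
      by (rule continuous_on_compose2[OF ci]) (auto intro!: continuous_intros)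
    then show "continuous_on (cbox 0 1) (\<lambda>s. g (c (fst p) * s) (snd p) (apply_bcontfun v (c (fst p) * s, snd p)))" by simp
  qed
  have int_le: "norm (c t *\<^sub>R integral (cbox 0 1) F) \<le> T * K"
    if "\<And>s. s \<in> cbox 0 1 \<Longrightarrow> norm (F s) \<le> K" "F integrable_on cbox 0 1" for F :: "real \<Rightarrow> 'v" and K t
  proof -
    have K0: "0 \<le> K" using order_trans[OF norm_ge_zero that(1)[of 0]] by simp
    have "norm (integral (cbox 0 1) F) \<le> K * measure lborel (cbox 0 (1::real))"
      using that K0 by (intro integrable_bound) auto
    then have "norm (integral (cbox 0 1) F) \<le> K" by simp
    then have "\<bar>c t\<bar> * norm (integral (cbox 0 1) F) \<le> T * K" using cT[of t] T K0 by (intro mult_mono) auto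
    then show ?thesis by simp
  qed
  have gb: "norm (g t q v) \<le> B + L * norm v" for t q v
    using lip[of t q v 0] bnd[of t q] norm_triangle_ineq[of "g t q v - g t q 0" "g t q 0"] by simp
  have bc: "\<Phi> v \<in> bcontfun" for v
  proof -
    have "norm (\<Phi> v p) \<le> T * (B + L * norm v)" for p
      unfolding \<Phi>_def
    proof (rule int_le[OF _ inb])
      fix s :: real
      show "norm (g (c (fst p) * s) (snd p) (apply_bcontfun v (c (fst p) * s, snd p))) \<le> B + L * norm v"
        using gb[of "c (fst p) * s" "snd p" "apply_bcontfun v (c (fst p) * s, snd p)"] norm_bounded[of v "(c (fst p) * s, snd p)"] T(3)
          mult_left_mono by (smt (verit))
    qed
    then show ?thesis using cont\<Phi> by (intro bcontfun_normI)
  qed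
  define \<Psi> where "\<Psi> v = Bcontfun (\<Phi> v)" for v
  have ap: "apply_bcontfun (\<Psi> v) = \<Phi> v" for v unfolding \<Psi>_def using Bcontfun_inverse[OF bc] .
  have "dist (\<Psi> v) (\<Psi> w) \<le> 1/2 * dist v w" for v w
  proof (rule dist_bound)
    fix p
    define F where "F v s = g (c (fst p) * s) (snd p) (apply_bcontfun v (c (fst p) * s, snd p))" for v s
    have "\<Phi> v p - \<Phi> w p = c (fst p) *\<^sub>R integral (cbox 0 1) (\<lambda>s. F v s - F w s)"
      unfolding \<Phi>_def F_def using integral_diff[OF inb inb] by (simp add: scaleR_right_diff_distrib)
    moreover have "norm (c (fst p) *\<^sub>R integral (cbox 0 1) (\<lambda>s. F v s - F w s)) \<le> T * (L * dist v w)"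
    proof (rule int_le)
      fix s :: real
      have "norm (F v s - F w s) \<le> L * dist (apply_bcontfun v (c (fst p) * s, snd p)) (apply_bcontfun w (c (fst p) * s, snd p))"
        unfolding F_def dist_norm by (rule lip)
      also have "\<dots> \<le> L * dist v w" using dist_bounded T(3) by (intro mult_left_mono) auto
      finally show "norm (F v s - F w s) \<le> L * dist v w" .
    qed (use inb in \<open>auto simp: F_def intro!: integrable_diff\<close>)
    moreover have "T * (L * dist v w) \<le> 1/2 * dist v w"
      using mult_right_mono[OF T(2), of "dist v w"] by (simp add: mult.assoc)
    ultimately show "dist (apply_bcontfun (\<Psi> v) p) (apply_bcontfun (\<Psi> w) p) \<le> 1/2 * dist v w"
      unfolding ap dist_norm[of "\<Phi> v p"] by simp
  qed
  then obtain u where u: "\<Psi> u = u"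
    using banach_fix_type[of "1/2" \<Psi>] by auto
  define \<psi> where "\<psi> t q = apply_bcontfun u (t, q)" for t q
  have fp: "\<psi> t q = c t *\<^sub>R integral (cbox 0 1) (\<lambda>s. g (c t * s) q (\<psi> (c t * s) q))" for t q
    using arg_cong[OF u, of "\<lambda>w. apply_bcontfun w (t, q)"] unfolding ap \<Phi>_def \<psi>_def by simp
  show ?thesis
  proof (rule that[of \<psi>])
    show c\<psi>: "continuous_on UNIV (\<lambda>(t, q). \<psi> t q)" unfolding \<psi>_def split_beta using cv[of UNIV u] by simp
    show "\<psi> 0 q = 0" for q using fp[of 0 q] T unfolding c_def by simp
    show "norm (\<psi> t q) \<le> T * K" if "\<And>t v. norm (g t q v) \<le> K" for t q K
      unfolding fp[of t q] by (rule int_le) (use that inb[of "(t, q)" u] in \<open>auto simp: \<psi>_def\<close>)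
    show "((\<lambda>t. \<psi> t q) has_vector_derivative g t q (\<psi> t q)) (at t)" if t: "t \<in> {-T<..<T}" for t q
    proof -
      have "continuous_on {-T..T} (\<lambda>t. g t q (\<psi> t q))"
        unfolding \<psi>_def
        by (rule continuous_on_compose2[OF cont, unfolded split_beta, of _ "\<lambda>t. (t, q, apply_bcontfun u (t, q))", simplified])
           (intro continuous_intros continuous_on_compose2[OF cv], auto)
      from scaled_integral_deriv[OF this t]
      have "((\<lambda>t. t *\<^sub>R integral {0..1} (\<lambda>s. g (t * s) q (\<psi> (t * s) q))) has_vector_derivative g t q (\<psi> t q)) (at t)" .
      moreover have "s *\<^sub>R integral {0..1} (\<lambda>r. g (s * r) q (\<psi> (s * r) q)) = \<psi> s q" if "s \<in> {-T<..<T}" for s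
      proof -
        have "c s = s" unfolding c_def using that by auto
        from fp[of s q, unfolded this box_real] show ?thesis by (rule sym)
      qed
      ultimately show ?thesis
        by (rule has_vector_derivative_transform_within_open[OF _ open_greaterThanLessThan t])
    qed
  qed
qed

definition flow_box :: "('a::real_normed_vector \<Rightarrow> 'a) \<Rightarrow> 'a set \<Rightarrow> real \<Rightarrow> 'a set \<Rightarrow> (real \<Rightarrow> 'a \<Rightarrow> 'a) \<Rightarrow> bool" where
  "flow_box f U \<delta> N \<phi> \<longleftrightarrow> 0 < \<delta> \<and> open N \<and> (\<forall>x\<in>N. \<phi> 0 x = x) \<and>
     (\<forall>x\<in>N. \<forall>t\<in>{-\<delta><..<\<delta>}. \<phi> t x \<in> U \<and> ((\<lambda>t. \<phi> t x) has_vector_derivative f (\<phi> t x)) (at t))"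

lemma flow_box_subset:
  assumes "flow_box f U \<delta> N \<phi>" "0 < \<delta>'" "\<delta>' \<le> \<delta>" "open N'" "N' \<subseteq> N"
  shows "flow_box f U \<delta>' N' \<phi>"
  using assms unfolding flow_box_def by (auto simp: subset_iff)

definition has_Ck_flow :: "nat \<Rightarrow> ('a::euclidean_space \<Rightarrow> 'a) \<Rightarrow> 'a set \<Rightarrow> 'a \<Rightarrow> bool" where
  "has_Ck_flow k f U x0 \<longleftrightarrow> (\<exists>\<delta> N \<phi>. x0 \<in> N \<and> flow_box f U \<delta> N \<phi> \<and> Ck_on k (\<lambda>(t, x). \<phi> t x) ({-\<delta><..<\<delta>} \<times> N))"

text \<open>Hadamard's trick: with \<open>A x y = \<integral> Df (x + s (y - x)) ds\<close> one has
  \<open>\<phi> t y - \<phi> t x = R (y - x)\<close>, where \<open>R\<close> solves the linear equation \<open>R' = A (\<phi> t x) (\<phi> t y) R\<close> and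
  is continuous in all arguments. This gives differentiability and the variational equation at once.\<close>

lemma C1_flow:
  fixes f :: "'a::euclidean_space \<Rightarrow> 'a"
  assumes U: "open U" "x0 \<in> U" and f: "Ck_on (Suc k) f U"
  obtains \<delta> N \<phi> where "x0 \<in> N" "flow_box f U \<delta> N \<phi>" "Ck_on (Suc 0) (\<lambda>(t, x). \<phi> t x) ({-\<delta><..<\<delta>} \<times> N)"
    "\<And>t x. t \<in> {-\<delta><..<\<delta>} \<Longrightarrow> x \<in> N \<Longrightarrow> \<phi> t differentiable at x"
    "\<And>t x v. t \<in> {-\<delta><..<\<delta>} \<Longrightarrow> x \<in> N \<Longrightarrow>
      ((\<lambda>t. dd (\<phi> t) v x) has_vector_derivative dd f (dd (\<phi> t) v x) (\<phi> t x)) (at t)"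
proof -
  note Df = Ck_on_1_Dblin(1)[OF U(1) f] and cDf = Ck_on_1_Dblin(2)[OF U(1) f]
  obtain r where r: "r > 0" "cball x0 r \<subseteq> U" using U open_contains_cball by blast
  define C where "C = cball x0 r"
  have C: "compact C" "convex C" "closed C" "C \<noteq> {}" "C \<subseteq> U" using r unfolding C_def by auto
  have "compact (Dblin f ` C)" "compact (f ` C)"
    using C Ck_on_continuous[OF f U(1)] cDf by (auto intro!: compact_continuous_image intro: continuous_on_subset)
  then obtain L B where L: "L > 0" "\<And>x. x \<in> C \<Longrightarrow> norm (Dblin f x) \<le> L" and B: "B > 0" "\<And>x. x \<in> C \<Longrightarrow> norm (f x) \<le> B"
    using compact_imp_bounded bounded_pos by (metis imageI)
  \<comment> \<open>Composition with the nearest-point map onto the convex ball \<open>C\<close>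
    makes \<open>f\<close> bounded and Lipschitz everywhere and bounds the averaged derivative
    \<open>A\<close>. Curves that stay in \<open>C\<close> do not notice it.\<close>
  define \<pi> where "\<pi> = closest_point C"
  have \<pi>C: "\<pi> x \<in> C" for x unfolding \<pi>_def using closest_point_in_set[OF C(3,4)] .
  have \<pi>id: "\<pi> x = x" if "x \<in> C" for x unfolding \<pi>_def using closest_point_self[OF that] .
  have \<pi>c: "continuous_on S \<pi>" for S unfolding \<pi>_def using continuous_on_closest_point[OF C(2,3,4)] .
  have \<pi>l: "norm (\<pi> x - \<pi> y) \<le> norm (x - y)" for x y
    using closest_point_lipschitz[OF C(2,3,4)] unfolding \<pi>_def dist_norm .
  have seg: "\<pi> x + s *\<^sub>R (\<pi> y - \<pi> x) \<in> C" if "s \<in> {0..1}" for x y s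
  proof -
    have "(1 - s) *\<^sub>R \<pi> x + s *\<^sub>R \<pi> y \<in> C" using convexD_alt[OF C(2) \<pi>C \<pi>C] that by auto
    then show ?thesis by (simp add: algebra_simps)
  qed
  define A where "A x y = integral (cbox 0 1) (\<lambda>s. Dblin f (\<pi> x + s *\<^sub>R (\<pi> y - \<pi> x)))" for x y
  have ci: "continuous_on (S \<times> cbox 0 1) (\<lambda>(p, s). Dblin f (\<pi> (fst p) + s *\<^sub>R (\<pi> (snd p) - \<pi> (fst p))))" for S
    unfolding split_beta
    by (rule continuous_on_compose2[OF continuous_on_subset[OF cDf C(5)]])
       (use seg in \<open>auto intro!: continuous_intros continuous_on_compose2[OF \<pi>c]\<close>)
  have cA: "continuous_on UNIV (\<lambda>p. A (fst p) (snd p))"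
    unfolding A_def by (rule integral_continuous_on_param[OF ci])
  have iA: "(\<lambda>s. Dblin f (\<pi> x + s *\<^sub>R (\<pi> y - \<pi> x))) integrable_on cbox 0 1" for x y
  proof (rule integrable_continuous)
    have "continuous_on (cbox 0 1) (\<lambda>s. (\<lambda>(p, s). Dblin f (\<pi> (fst p) + s *\<^sub>R (\<pi> (snd p) - \<pi> (fst p)))) ((x, y), s))"
      by (rule continuous_on_compose2[OF ci]) (auto intro!: continuous_intros)
    then show "continuous_on (cbox 0 1) (\<lambda>s. Dblin f (\<pi> x + s *\<^sub>R (\<pi> y - \<pi> x)))" by simp
  qed
  have nA: "norm (A x y) \<le> L" for x y
  proof -
    have "norm (A x y) \<le> L * measure lborel (cbox 0 (1::real))"
      unfolding A_def by (rule integrable_bound) (use iA L seg in \<open>auto simp: less_imp_le\<close>)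
    then show ?thesis by simp
  qed
  have Ad: "blinfun_apply (A x y) (\<pi> y - \<pi> x) = f (\<pi> y) - f (\<pi> x)" for x y
  proof -
    have "f (\<pi> x + (\<pi> y - \<pi> x)) - f (\<pi> x) = integral {0..1} (\<lambda>s. blinfun_apply (Dblin f (\<pi> x + s *\<^sub>R (\<pi> y - \<pi> x))) (\<pi> y - \<pi> x))"
      by (rule mvt_integral[of C f "\<lambda>x. blinfun_apply (Dblin f x)"])
         (use Df C(5) seg in \<open>auto intro: has_derivative_at_withinI\<close>)
    also have "\<dots> = blinfun_apply (A x y) (\<pi> y - \<pi> x)"
      unfolding A_def using integral_linear[OF iA blinfun.bounded_linear_left[of "\<pi> y - \<pi> x"], of x y]
      by (simp add: o_def)
    finally show ?thesis by simp
  qed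
  have Ax: "A x x = Dblin f (\<pi> x)" for x unfolding A_def by simp
  define h where "h x = f (\<pi> x)" for x
  have hl: "norm (h x - h y) \<le> L * norm (x - y)" for x y
  proof -
    have "norm (h x - h y) = norm (blinfun_apply (A y x) (\<pi> x - \<pi> y))" unfolding Ad h_def by simp
    also have "\<dots> \<le> norm (A y x) * norm (\<pi> x - \<pi> y)" by (rule norm_blinfun)
    also have "\<dots> \<le> L * norm (x - y)" using nA \<pi>l L by (intro mult_mono) auto
    finally show ?thesis .
  qed
  have hc: "continuous_on S h" for S
    unfolding h_def by (rule continuous_on_compose2[OF continuous_on_subset[OF Ck_on_continuous[OF f U(1)] C(5)] \<pi>c]) (use \<pi>C in auto)
  \<comment> \<open>The first bound makes the integral operator a contraction by 1/2. The second
    keeps orbits that start in \<open>N\<close>, within \<open>r/2\<close> of \<open>x0\<close>,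
    inside \<open>C\<close>.\<close>
  define T where "T = min (1/(2*L)) (r/(2*B))"
  have T: "0 < T" "T * L \<le> 1/2" "T * B \<le> r/2"
  proof -
    show "0 < T" unfolding T_def using L B r by simp
    have "T \<le> 1/(2*L)" "T \<le> r/(2*B)" unfolding T_def by auto
    from mult_right_mono[OF this(1), of L] mult_right_mono[OF this(2), of B]
    show "T * L \<le> 1/2" "T * B \<le> r/2" using L(1) B(1) by simp_all
  qed
  obtain \<psi> where \<psi>c: "continuous_on UNIV (\<lambda>(t, q). \<psi> t q)" and \<psi>0: "\<And>q::'a. \<psi> 0 q = 0"
    and \<psi>d: "\<And>t q. t \<in> {-T<..<T} \<Longrightarrow> ((\<lambda>t. \<psi> t q) has_vector_derivative h (q + \<psi> t q)) (at t)"
    and \<psi>b: "\<And>t q K. (\<And>t::real. \<And>v. norm (h (q + v)) \<le> K) \<Longrightarrow> norm (\<psi> t q) \<le> T * K"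
    using picard[of "\<lambda>t q v. h (q + v)" L B T]
  proof -
    have "continuous_on UNIV (\<lambda>(t::real, q, v). h (q + v))"
      unfolding split_beta by (intro continuous_on_compose2[OF hc[of UNIV]] continuous_intros) auto
    moreover have "norm (h (q + v) - h (q + w)) \<le> L * norm (v - w)" for q v w using hl[of "q + v" "q + w"] by simp
    moreover have "norm (h (q + 0)) \<le> B" for q unfolding h_def using B \<pi>C by simp
    ultimately show ?thesis using picard[of "\<lambda>t q v. h (q + v)" L B T] T L that by (smt (verit, best))
  qed
  define \<phi> where "\<phi> t x = x + \<psi> t x" for t x
  define N where "N = ball x0 (r/2)"
  have N: "open N" "convex N" "x0 \<in> N" unfolding N_def using r by auto
  have \<phi>c: "continuous_on S (\<lambda>p. \<phi> (fst p) (snd p))" for S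
    unfolding \<phi>_def using continuous_on_subset[OF \<psi>c, of S] by (intro continuous_intros) (auto simp: split_beta)
  have \<phi>C: "\<phi> t x \<in> C" if "x \<in> N" for t x
  proof -
    have "norm (\<psi> t x) \<le> T * B" by (rule \<psi>b) (use B \<pi>C in \<open>auto simp: h_def\<close>)
    moreover have "norm (x - x0) < r/2" using that unfolding N_def by (simp add: dist_norm norm_minus_commute)
    ultimately have "norm (x - x0 + \<psi> t x) \<le> r" using norm_triangle_ineq[of "x - x0" "\<psi> t x"] T by linarith
    then show ?thesis unfolding C_def \<phi>_def by (simp add: dist_norm norm_minus_commute algebra_simps)
  qed
  have \<phi>d: "((\<lambda>t. \<phi> t x) has_vector_derivative f (\<phi> t x)) (at t)" if "x \<in> N" "t \<in> {-T<..<T}" for t x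
  proof -
    have "((\<lambda>t. x + \<psi> t x) has_vector_derivative 0 + h (x + \<psi> t x)) (at t)"
      by (intro has_vector_derivative_add \<psi>d that has_vector_derivative_const)
    then show ?thesis using \<pi>id[OF \<phi>C[OF that(1)]] unfolding h_def \<phi>_def by simp
  qed
  \<comment> \<open>Since \<open>picard\<close> starts at 0, \<open>R\<close> is written as the
    identity plus \<open>\<rho>\<close>. The parameter is the pair of starting points.\<close>
  define G where "G t p V = A (\<phi> t (fst p)) (\<phi> t (snd p)) o\<^sub>L (id_blinfun + V)" for t p and V :: "'a \<Rightarrow>\<^sub>L 'a"
  have Gl: "norm (G t p v - G t p w) \<le> L * norm (v - w)" for t p v w
  proof -
    have "G t p v - G t p w = A (\<phi> t (fst p)) (\<phi> t (snd p)) o\<^sub>L (v - w)"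
      unfolding G_def by (intro blinfun_eqI) (simp add: blinfun.bilinear_simps)
    also have "norm \<dots> \<le> norm (A (\<phi> t (fst p)) (\<phi> t (snd p))) * norm (v - w)" by (rule norm_blinfun_compose)
    also have "\<dots> \<le> L * norm (v - w)" using nA by (intro mult_right_mono) auto
    finally show ?thesis .
  qed
  have G0: "norm (G t p 0) \<le> L" for t p
  proof -
    have "G t p 0 = A (\<phi> t (fst p)) (\<phi> t (snd p))" unfolding G_def by (intro blinfun_eqI) simp
    then show ?thesis using nA by simp
  qed
  have Gc: "continuous_on UNIV (\<lambda>(t, p, v). G t p v)"
  proof -
    have "continuous_on UNIV (\<lambda>z::real \<times> ('a \<times> 'a) \<times> ('a \<Rightarrow>\<^sub>L 'a). A (\<phi> (fst z) (fst (fst (snd z)))) (\<phi> (fst z) (snd (fst (snd z)))))"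
      by (rule continuous_on_compose2[OF cA, of _ "\<lambda>z. (\<phi> (fst z) (fst (fst (snd z))), \<phi> (fst z) (snd (fst (snd z))))", simplified])
         (intro continuous_intros continuous_on_compose2[OF \<phi>c[of UNIV], of _ "\<lambda>z. (fst z, fst (fst (snd z)))", simplified]
           continuous_on_compose2[OF \<phi>c[of UNIV], of _ "\<lambda>z. (fst z, snd (fst (snd z)))", simplified])
    then show ?thesis unfolding G_def split_beta
      by (intro bounded_bilinear.continuous_on[OF bounded_bilinear_blinfun_compose] continuous_intros)
  qed
  obtain \<rho> where \<rho>c: "continuous_on UNIV (\<lambda>(t, q). \<rho> t q)" and \<rho>0: "\<And>q. \<rho> 0 q = 0"
    and \<rho>d: "\<And>t q. t \<in> {-T<..<T} \<Longrightarrow> ((\<lambda>t. \<rho> t q) has_vector_derivative G t q (\<rho> t q)) (at t)"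
    by (rule picard[OF Gc Gl G0 T(1,2) less_imp_le[OF L(1)]]) (rule that)
  define R where "R t x y = id_blinfun + \<rho> t (x, y)" for t x y
  have Rd: "((\<lambda>t. blinfun_apply (R t x y) v) has_vector_derivative
      blinfun_apply (A (\<phi> t x) (\<phi> t y)) (blinfun_apply (R t x y) v)) (at t)" if "t \<in> {-T<..<T}" for t x y v
  proof -
    have "((\<lambda>t. id_blinfun + \<rho> t (x, y)) has_vector_derivative 0 + G t (x, y) (\<rho> t (x, y))) (at t)"
      by (intro has_vector_derivative_add \<rho>d that has_vector_derivative_const)
    from bounded_linear.has_vector_derivative[OF blinfun.bounded_linear_left[of v] this]
    show ?thesis unfolding G_def R_def by simp
  qed
  have Rc: "continuous_on S (\<lambda>z. R (fst z) (fst (snd z)) (snd (snd z)))" for S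
    unfolding R_def using continuous_on_subset[OF \<rho>c, of S] by (intro continuous_intros) (auto simp: split_beta)
  have main: "\<phi> t y - \<phi> t x = blinfun_apply (R t x y) (y - x)" if t: "t \<in> {-T<..<T}" and xy: "x \<in> N" "y \<in> N" for t x y
  proof -
    define a b where "a = min 0 t" and "b = max 0 t"
    have ab: "{a..b} \<subseteq> {-T<..<T}" "0 \<in> {a..b}" "t \<in> {a..b}" using t T unfolding a_def b_def by auto
    have "\<phi> t y - \<phi> t x - blinfun_apply (R t x y) (y - x) = 0"
    proof (rule linear_growth_zero[where d="\<lambda>t. \<phi> t y - \<phi> t x - blinfun_apply (R t x y) (y - x)"
        and d'="\<lambda>t. f (\<phi> t y) - f (\<phi> t x) - blinfun_apply (A (\<phi> t x) (\<phi> t y)) (blinfun_apply (R t x y) (y - x))" and L=L and ?t0.0=0])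
      fix s assume "s \<in> {a..b}"
      then have s: "s \<in> {-T<..<T}" using ab by auto
      show "((\<lambda>t. \<phi> t y - \<phi> t x - blinfun_apply (R t x y) (y - x)) has_vector_derivative
         f (\<phi> s y) - f (\<phi> s x) - blinfun_apply (A (\<phi> s x) (\<phi> s y)) (blinfun_apply (R s x y) (y - x))) (at s)"
        by (intro has_vector_derivative_diff \<phi>d Rd s xy)
      have "f (\<phi> s y) - f (\<phi> s x) = blinfun_apply (A (\<phi> s x) (\<phi> s y)) (\<phi> s y - \<phi> s x)"
        using Ad[of "\<phi> s x" "\<phi> s y"] \<pi>id[OF \<phi>C] xy by simp
      then have "f (\<phi> s y) - f (\<phi> s x) - blinfun_apply (A (\<phi> s x) (\<phi> s y)) (blinfun_apply (R s x y) (y - x))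
         = blinfun_apply (A (\<phi> s x) (\<phi> s y)) (\<phi> s y - \<phi> s x - blinfun_apply (R s x y) (y - x))"
        by (simp add: blinfun.diff_right)
      also have "norm \<dots> \<le> norm (A (\<phi> s x) (\<phi> s y)) * norm (\<phi> s y - \<phi> s x - blinfun_apply (R s x y) (y - x))"
        by (rule norm_blinfun)
      also have "\<dots> \<le> L * norm (\<phi> s y - \<phi> s x - blinfun_apply (R s x y) (y - x))"
        using nA by (intro mult_right_mono) auto
      finally show "norm (f (\<phi> s y) - f (\<phi> s x) - blinfun_apply (A (\<phi> s x) (\<phi> s y)) (blinfun_apply (R s x y) (y - x)))
        \<le> L * norm (\<phi> s y - \<phi> s x - blinfun_apply (R s x y) (y - x))" .
    qed (use ab in \<open>auto simp: \<phi>_def \<psi>0 R_def \<rho>0\<close>)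
    then show ?thesis by simp
  qed
  have \<phi>x: "(\<phi> t has_derivative blinfun_apply (R t x x)) (at x)" if t: "t \<in> {-T<..<T}" and x: "x \<in> N" for t x
    unfolding has_derivative_at_alt
  proof (intro conjI allI impI blinfun.bounded_linear_right)
    fix e :: real assume e: "e > 0"
    have "isCont (\<lambda>y. R t x y) x"
      using continuous_on_compose2[OF Rc[of UNIV], of UNIV "\<lambda>y. (t, x, y)"]
      by (auto simp: continuous_on_eq_continuous_at intro!: continuous_intros)
    then obtain d where d: "d > 0" "\<And>y. norm (y - x) < d \<Longrightarrow> norm (R t x y - R t x x) < e"
      using e unfolding continuous_at_eps_delta dist_norm by meson
    obtain d' where d': "d' > 0" "ball x d' \<subseteq> N" using N(1) x open_contains_ball by blast
    show "\<exists>d>0. \<forall>y. norm (y - x) < d \<longrightarrow> norm (\<phi> t y - \<phi> t x - blinfun_apply (R t x x) (y - x)) \<le> e * norm (y - x)"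
    proof (intro exI[of _ "min d d'"] conjI allI impI)
      fix y assume y: "norm (y - x) < min d d'"
      then have "y \<in> N" using d' by (auto simp: dist_norm norm_minus_commute subset_iff)
      then have "\<phi> t y - \<phi> t x - blinfun_apply (R t x x) (y - x) = blinfun_apply (R t x y - R t x x) (y - x)"
        using main[OF t x] by (simp add: blinfun.diff_left)
      also have "norm \<dots> \<le> norm (R t x y - R t x x) * norm (y - x)" by (rule norm_blinfun)
      also have "\<dots> \<le> e * norm (y - x)" using d(2)[of y] y by (intro mult_right_mono) auto
      finally show "norm (\<phi> t y - \<phi> t x - blinfun_apply (R t x x) (y - x)) \<le> e * norm (y - x)" .
    qed (use d d' in auto)
  qed
  have ddR: "dd (\<phi> t) v x = blinfun_apply (R t x x) v" if "t \<in> {-T<..<T}" "x \<in> N" for t x v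
    using dd_eqI[OF \<phi>x[OF that]] .
  show ?thesis
  proof (rule that[of N T \<phi>])
    show "x0 \<in> N" by (rule N)
    show "flow_box f U T N \<phi>"
      unfolding flow_box_def using T N \<phi>C C(5) \<phi>d by (auto simp: \<phi>_def[of 0] \<psi>0)
    show "\<phi> t differentiable at x" if "t \<in> {-T<..<T}" "x \<in> N" for t x
      using \<phi>x[OF that] differentiableI by blast
    show "((\<lambda>t. dd (\<phi> t) v x) has_vector_derivative dd f (dd (\<phi> t) v x) (\<phi> t x)) (at t)"
      if t: "t \<in> {-T<..<T}" and x: "x \<in> N" for t x v
    proof -
      have "blinfun_apply (A (\<phi> t x) (\<phi> t x)) w = dd f w (\<phi> t x)" for w
        unfolding Ax \<pi>id[OF \<phi>C[OF x]] using dd_eqI[OF Df] \<phi>C[OF x] C(5) by (metis subsetD)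
      then have "((\<lambda>t. blinfun_apply (R t x x) v) has_vector_derivative dd f (dd (\<phi> t) v x) (\<phi> t x)) (at t)"
        using Rd[OF t, of x x v] ddR[OF t x] by simp
      then show ?thesis
        by (rule has_vector_derivative_transform_within_open[where S="{-T<..<T}"]) (use t x ddR in auto)
    qed
    have op: "open ({-T<..<T} \<times> N)" using N by (intro open_Times) auto
    show "Ck_on (Suc 0) (\<lambda>(t, x). \<phi> t x) ({-T<..<T} \<times> N)"
    proof (rule Ck_on_SucI[OF op, where f'="\<lambda>q (\<tau>, v). \<tau> *\<^sub>R f (\<phi> (fst q) (snd q)) + blinfun_apply (R (fst q) (snd q) (snd q)) v"])
      fix q assume q: "q \<in> {-T<..<T} \<times> N"
      obtain t x where tx: "q = (t, x)" "t \<in> {-T<..<T}" "x \<in> N" using q by auto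
      have "((\<lambda>(t, x). \<phi> t x) has_derivative (\<lambda>(\<tau>, v). \<tau> *\<^sub>R f (\<phi> t x) + blinfun_apply (R t x x) v)) (at (t, x) within {-T<..<T} \<times> N)"
      \<comment> \<open>The partial derivatives combine to a joint one because the derivative in
        \<open>x\<close> is continuous in \<open>(t, x)\<close>.\<close>
      proof (rule has_derivative_partialsI)
        show "((\<lambda>t. \<phi> t x) has_derivative (\<lambda>\<tau>. \<tau> *\<^sub>R f (\<phi> t x))) (at t within {-T<..<T})"
          using \<phi>d[OF tx(3,2)] unfolding has_vector_derivative_def by (rule has_derivative_at_withinI)
        show "(\<phi> t has_derivative blinfun_apply (R t x x)) (at x within N)" if "t \<in> {-T<..<T}" "x \<in> N" for t x
          using \<phi>x[OF that] by (rule has_derivative_at_withinI)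
        have "continuous_on ({-T<..<T} \<times> N) (\<lambda>(t, x). R t x x)"
        proof -
          have "continuous_on ({-T<..<T} \<times> N) (\<lambda>z. (fst z, snd z, snd z))" by (intro continuous_intros)
          from continuous_on_compose2[OF Rc[of UNIV] this] show ?thesis by (simp add: split_beta)
        qed
        then show "continuous (at (t, x) within {-T<..<T} \<times> N) (\<lambda>(t, x). R t x x)"
          using tx by (auto simp: continuous_on_eq_continuous_within)
      qed (use tx N in auto)
      then show "((\<lambda>(t, x). \<phi> t x) has_derivative (\<lambda>(\<tau>, v). \<tau> *\<^sub>R f (\<phi> (fst q) (snd q)) + blinfun_apply (R (fst q) (snd q) (snd q)) v)) (at q)"
        using tx at_within_open[OF q op] by simp
    next
      fix b :: "real \<times> 'a"
      have "continuous_on ({-T<..<T} \<times> N) (\<lambda>q. f (\<phi> (fst q) (snd q)))"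
        by (rule continuous_on_compose2[OF Ck_on_continuous[OF f U(1)] \<phi>c]) (use \<phi>C C(5) in auto)
      moreover have "continuous_on ({-T<..<T} \<times> N) (\<lambda>z. R (fst z) (snd z) (snd z))"
      proof -
        have "continuous_on ({-T<..<T} \<times> N) (\<lambda>z. (fst z, snd z, snd z))" by (intro continuous_intros)
        from continuous_on_compose2[OF Rc[of UNIV] this] show ?thesis by simp
      qed
      ultimately show "Ck_on 0 (\<lambda>q. case b of (\<tau>, v) \<Rightarrow> \<tau> *\<^sub>R f (\<phi> (fst q) (snd q)) + blinfun_apply (R (fst q) (snd q) (snd q)) v) ({-T<..<T} \<times> N)"
        unfolding split_beta Ck_on.simps by (intro continuous_intros)
    qed
  qed
qed

lemma Ck_flow_1:
  fixes f :: "'a::euclidean_space \<Rightarrow> 'a"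
  assumes "open U" "x0 \<in> U" "Ck_on (Suc 0) f U"
  shows "has_Ck_flow (Suc 0) f U x0"
  using C1_flow[OF assms] unfolding has_Ck_flow_def by metis

text \<open>The flow of \<open>(f x, Df x v)\<close> is \<open>(\<phi> t x, D\<phi> t x v)\<close>, so each degree of smoothness is gained by
  doubling the space.\<close>

lemma Ck_flow_step:
  fixes f :: "'a::euclidean_space \<Rightarrow> 'a"
  assumes IH: "\<And>U f x0. open U \<Longrightarrow> x0 \<in> U \<Longrightarrow> Ck_on (Suc k) f U \<Longrightarrow> has_Ck_flow (Suc k) (f :: 'a \<times> 'a \<Rightarrow> 'a \<times> 'a) U x0"
    and U: "open U" "x0 \<in> U" and f: "Ck_on (Suc (Suc k)) f U"
  shows "has_Ck_flow (Suc (Suc k)) f U x0"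
proof -
  obtain \<delta> N \<phi> where N: "x0 \<in> N" and fb: "flow_box f U \<delta> N \<phi>"
    and \<phi>1: "Ck_on (Suc 0) (\<lambda>(t, x). \<phi> t x) ({-\<delta><..<\<delta>} \<times> N)"
    and \<phi>x: "\<And>t x. t \<in> {-\<delta><..<\<delta>} \<Longrightarrow> x \<in> N \<Longrightarrow> \<phi> t differentiable at x"
    and var: "\<And>t x v. t \<in> {-\<delta><..<\<delta>} \<Longrightarrow> x \<in> N \<Longrightarrow>
      ((\<lambda>t. dd (\<phi> t) v x) has_vector_derivative dd f (dd (\<phi> t) v x) (\<phi> t x)) (at t)"
    by (rule C1_flow[OF U f]) (rule that)
  have f1: "Ck_on (Suc k) f U" using Ck_on_Suc_imp[OF f U(1)] .
  define F where "F p = (f (fst p), dd f (snd p) (fst p))" for p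
  have V: "open (U \<times> (UNIV :: 'a set))" using U by (intro open_Times) auto
  have F: "Ck_on (Suc k) F (U \<times> UNIV)"
  proof -
    have "Ck_on (Suc k) (\<lambda>p. \<Sum>b\<in>Basis. (snd p \<bullet> b) *\<^sub>R dd f b (fst p)) (U \<times> (UNIV :: 'a set))"
    proof (rule Ck_on_sum[OF V], rule Ck_on_scaleR[OF V])
      fix b :: 'a assume "b \<in> Basis"
      show "Ck_on (Suc k) (\<lambda>p. snd p \<bullet> b) (U \<times> (UNIV :: 'a set))"
        by (rule Ck_on_inner[OF V Ck_on_snd[OF V Ck_on_id[OF V]]])
      show "Ck_on (Suc k) (\<lambda>p. dd f b (fst p)) (U \<times> (UNIV :: 'a set))"
        by (rule Ck_on_compose[OF V U(1) Ck_on_dd[OF U(1) f] Ck_on_fst[OF V Ck_on_id[OF V]]]) auto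
    qed
    then have "Ck_on (Suc k) (\<lambda>p. dd f (snd p) (fst p)) (U \<times> UNIV)"
    proof (rule Ck_on_cong[OF V, rotated])
      fix p assume "p \<in> U \<times> (UNIV :: 'a set)"
      then show "(\<Sum>b\<in>Basis. (snd p \<bullet> b) *\<^sub>R dd f b (fst p)) = dd f (snd p) (fst p)"
        by (intro dd_Basis_expansion[symmetric] Ck_on_Suc_differentiable[OF f U(1)]) auto
    qed
    moreover have "Ck_on (Suc k) (\<lambda>p. f (fst p)) (U \<times> (UNIV :: 'a set))"
      by (rule Ck_on_compose[OF V U(1) f1 Ck_on_fst[OF V Ck_on_id[OF V]]]) auto
    ultimately show ?thesis unfolding F_def by (intro Ck_on_Pair[OF V])
  qed
  obtain \<delta>' N' \<Phi> where N': "(x0, 0) \<in> N'" and fb': "flow_box F (U \<times> UNIV) \<delta>' N' \<Phi>"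
    and \<Phi>k: "Ck_on (Suc k) (\<lambda>(t, x). \<Phi> t x) ({-\<delta>'<..<\<delta>'} \<times> N')"
    using IH[OF V _ F, of "(x0, 0)"] U(2) unfolding has_Ck_flow_def by auto
  have "open N'" using fb' unfolding flow_box_def by blast
  then obtain N1 N2 where N12: "open N1" "open N2" "x0 \<in> N1" "0 \<in> N2" "N1 \<times> N2 \<subseteq> N'"
    using N' open_prod_elim by (metis mem_Sigma_iff)
  obtain e where e: "e > 0" "ball 0 e \<subseteq> N2" using N12 open_contains_ball by blast
  define M where "M = N \<inter> N1"
  define \<eta> where "\<eta> = min \<delta> \<delta>'"
  have oN: "open N" and \<delta>: "\<delta> > 0" "\<delta>' > 0" using fb fb' unfolding flow_box_def by auto
  have M: "open M" "x0 \<in> M" "M \<subseteq> N" "M \<subseteq> N1" unfolding M_def using oN N N12 by auto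
  have \<eta>: "\<eta> > 0" "\<eta> \<le> \<delta>" "{-\<eta><..<\<eta>} \<subseteq> {-\<delta><..<\<delta>}" "{-\<eta><..<\<eta>} \<subseteq> {-\<delta>'<..<\<delta>'}" unfolding \<eta>_def using \<delta> by auto
  have op: "open ({-\<eta><..<\<eta>} \<times> M)" using M by (intro open_Times) auto
  \<comment> \<open>Both sides solve the doubled equation with the same initial value. Only small
    \<open>v\<close> are reached, since \<open>N'\<close> is merely a neighbourhood of
    \<open>(x0, 0)\<close>.\<close>
  have eq: "\<Phi> t (x, v) = (\<phi> t x, dd (\<phi> t) v x)" if t: "t \<in> {-\<eta><..<\<eta>}" and x: "x \<in> M" and v: "norm v < e" for t x v
  proof (rule ode_unique[OF V F])
    have xv: "(x, v) \<in> N'" using x v e N12 M by (auto simp: subset_iff)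
    have xN: "x \<in> N" using x M by auto
    show "\<Phi> t (x, v) \<in> U \<times> UNIV \<and> ((\<lambda>t. \<Phi> t (x, v)) has_vector_derivative F (\<Phi> t (x, v))) (at t)" if "t \<in> {-\<eta><..<\<eta>}" for t
      using fb' xv \<eta>(4) that unfolding flow_box_def by blast
    show "(\<phi> t x, dd (\<phi> t) v x) \<in> U \<times> UNIV \<and> ((\<lambda>t. (\<phi> t x, dd (\<phi> t) v x)) has_vector_derivative F (\<phi> t x, dd (\<phi> t) v x)) (at t)"
      if t: "t \<in> {-\<eta><..<\<eta>}" for t
    proof -
      have t': "t \<in> {-\<delta><..<\<delta>}" using \<eta>(3) t by auto
      have 1: "\<phi> t x \<in> U" "((\<lambda>t. \<phi> t x) has_vector_derivative f (\<phi> t x)) (at t)"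
        using fb xN t' unfolding flow_box_def by blast+
      have "((\<lambda>t. (\<phi> t x, dd (\<phi> t) v x)) has_vector_derivative (f (\<phi> t x), dd f (dd (\<phi> t) v x) (\<phi> t x))) (at t)"
        by (rule has_vector_derivative_Pair[OF 1(2) var[OF t' xN]])
      then show ?thesis using 1 unfolding F_def by simp
    qed
    have "dd (\<phi> 0) v x = dd (\<lambda>x. x) v x"
      by (rule dd_cong_open[OF oN xN]) (use fb in \<open>auto simp: flow_box_def\<close>)
    also have "\<dots> = v" by (rule dd_eqI[OF has_derivative_ident])
    finally show "\<Phi> 0 (x, v) = (\<phi> 0 x, dd (\<phi> 0) v x)" using fb fb' xv xN unfolding flow_box_def by simp
  qed (use \<eta> t in auto)
  have \<Phi>c: "Ck_on (Suc k) (\<lambda>q. \<Phi> (fst q) (snd q, v)) ({-\<eta><..<\<eta>} \<times> M)" if v: "norm v < e" for v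
  proof -
    have "Ck_on (Suc k) (\<lambda>q. (\<lambda>(t, x). \<Phi> t x) (fst q, snd q, v)) ({-\<eta><..<\<eta>} \<times> M)"
    proof (rule Ck_on_compose[OF op _ \<Phi>k])
      show "Ck_on (Suc k) (\<lambda>q. (fst q, snd q, v)) ({-\<eta><..<\<eta>} \<times> M)"
        by (intro Ck_on_Pair[OF op] Ck_on_fst[OF op] Ck_on_snd[OF op] Ck_on_id[OF op] Ck_on_const[OF op])
      show "open ({-\<delta>'<..<\<delta>'} \<times> N')" using \<open>open N'\<close> by (intro open_Times) auto
      show "(\<lambda>q. (fst q, snd q, v)) ` ({-\<eta><..<\<eta>} \<times> M) \<subseteq> {-\<delta>'<..<\<delta>'} \<times> N'"
        using \<eta>(4) M(4) N12(5) e(2) v by (force simp: subset_iff)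
    qed
    then show ?thesis by simp
  qed
  have \<phi>k: "Ck_on (Suc k) (\<lambda>q. \<phi> (fst q) (snd q)) ({-\<eta><..<\<eta>} \<times> M)"
    by (rule Ck_on_cong[OF op _ Ck_on_fst[OF op \<Phi>c[of 0]]]) (use eq e in auto)
  have fbM: "flow_box f U \<eta> M \<phi>" by (rule flow_box_subset[OF fb \<eta>(1,2) M(1,3)])
  have "Ck_on (Suc (Suc k)) (\<lambda>(t, x). \<phi> t x) ({-\<eta><..<\<eta>} \<times> M)"
  proof (rule Ck_on_SucI[OF op, where f'="\<lambda>q v. dd (\<lambda>(t, x). \<phi> t x) v q"])
    have op': "open ({-\<delta><..<\<delta>} \<times> N)" using oN by (intro open_Times) auto
    have hd: "((\<lambda>(t, x). \<phi> t x) has_derivative (\<lambda>v. dd (\<lambda>(t, x). \<phi> t x) v q)) (at q)" if "q \<in> {-\<eta><..<\<eta>} \<times> M" for q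
      using Ck_on_has_derivative[OF \<phi>1 op'] that \<eta>(3) M(3) by blast
    then show "((\<lambda>(t, x). \<phi> t x) has_derivative (\<lambda>v. dd (\<lambda>(t, x). \<phi> t x) v q)) (at q)" if "q \<in> {-\<eta><..<\<eta>} \<times> M" for q
      using that by blast
    fix b :: "real \<times> 'a" assume "b \<in> Basis"
    then consider "b = (1, 0)" | b' where "b' \<in> Basis" "b = (0, b')" unfolding Basis_prod_def by auto
    then show "Ck_on (Suc k) (dd (\<lambda>(t, x). \<phi> t x) b) ({-\<eta><..<\<eta>} \<times> M)"
    proof cases
      case 1
      have "Ck_on (Suc k) (\<lambda>q. f (\<phi> (fst q) (snd q))) ({-\<eta><..<\<eta>} \<times> M)"
        by (rule Ck_on_compose[OF op U(1) f1 \<phi>k]) (use fbM in \<open>auto simp: flow_box_def\<close>)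
      then show ?thesis
      proof (rule Ck_on_cong[OF op, rotated])
        fix q assume q: "q \<in> {-\<eta><..<\<eta>} \<times> M"
        obtain t x where tx: "q = (t, x)" by (cases q)
        have "((\<lambda>s. (s, x)) has_derivative (\<lambda>h. (h, 0))) (at t)" by (auto intro!: derivative_eq_intros)
        from has_derivative_compose[OF this hd[OF q, unfolded tx]]
        have "((\<lambda>t. \<phi> t x) has_derivative (\<lambda>h. dd (\<lambda>(t, x). \<phi> t x) (h, 0) (t, x))) (at t)" by simp
        moreover have "((\<lambda>t. \<phi> t x) has_derivative (\<lambda>h. h *\<^sub>R f (\<phi> t x))) (at t)"
          using fbM q tx unfolding flow_box_def has_vector_derivative_def by auto
        ultimately have "(\<lambda>h. dd (\<lambda>(t, x). \<phi> t x) (h, 0) (t, x)) = (\<lambda>h. h *\<^sub>R f (\<phi> t x))" by (rule has_derivative_unique)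
        from fun_cong[OF this, of 1] show "f (\<phi> (fst q) (snd q)) = dd (\<lambda>(t, x). \<phi> t x) b q" unfolding 1 tx by simp
      qed
    next
      case 2
      \<comment> \<open>A basis vector may be too long for \<open>eq\<close>; it is scaled down and
        the factor is undone by linearity.\<close>
      define v where "v = (e/2) *\<^sub>R b'"
      have v: "norm v < e" unfolding v_def using 2(1) e by simp
      have "Ck_on (Suc k) (\<lambda>q. (2/e) *\<^sub>R snd (\<Phi> (fst q) (snd q, v))) ({-\<eta><..<\<eta>} \<times> M)"
        by (intro Ck_on_scaleR[OF op] Ck_on_const[OF op] Ck_on_snd[OF op] \<Phi>c[OF v])
      then show ?thesis
      proof (rule Ck_on_cong[OF op, rotated])
        fix q assume q: "q \<in> {-\<eta><..<\<eta>} \<times> M"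
        obtain t x where tx: "q = (t, x)" by (cases q)
        have t: "t \<in> {-\<eta><..<\<eta>}" "x \<in> M" using q tx by auto
        have "((\<lambda>y. (t, y)) has_derivative (\<lambda>h. (0, h))) (at x)" by (auto intro!: derivative_eq_intros)
        from has_derivative_compose[OF this hd[OF q, unfolded tx]]
        have "(\<phi> t has_derivative (\<lambda>h. dd (\<lambda>(t, x). \<phi> t x) (0, h) (t, x))) (at x)" by simp
        from dd_eqI[OF this] have "dd (\<phi> t) b' x = dd (\<lambda>(t, x). \<phi> t x) b q" unfolding 2 tx .
        moreover have "dd (\<phi> t) v x = (e/2) *\<^sub>R dd (\<phi> t) b' x"
          unfolding v_def by (rule linear_scale[OF dd_linear[OF \<phi>x]]) (use t \<eta>(3) M(3) in auto)
        ultimately show "(2/e) *\<^sub>R snd (\<Phi> (fst q) (snd q, v)) = dd (\<lambda>(t, x). \<phi> t x) b q"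
          using eq[OF t v] e unfolding tx by simp
      qed
    qed
  qed
  then show ?thesis unfolding has_Ck_flow_def using M(2) fbM by (intro exI[of _ \<eta>] exI[of _ M] exI[of _ \<phi>]) simp
qed

text \<open>Every application of \<open>Ck_flow_step\<close> passes from
  \<open>'a \<times> 'a\<close> to \<open>'a\<close>. As the type changes, this is no induction on
  the order inside HOL, and six steps from order 1 are unrolled. Order 7 leaves class 5 after two
  derivatives in \<open>X\<close>.\<close>

lemma Ck_flow_7:
  fixes f :: "'a::euclidean_space \<Rightarrow> 'a"
  assumes "open U" "x0 \<in> U" "Ck_on 7 f U"
  shows "has_Ck_flow 7 f U x0"
proof -
  note s = Ck_flow_step
  have "has_Ck_flow (Suc (Suc (Suc (Suc (Suc (Suc (Suc 0))))))) f U x0"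
    by (rule s[OF s[OF s[OF s[OF s[OF s[OF Ck_flow_1]]]]]]) (use assms in \<open>simp_all add: eval_nat_numeral del: Ck_on.simps\<close>)
  then show ?thesis by (simp add: eval_nat_numeral)
qed

lemma Ck_flow_2:
  fixes f :: "'a::euclidean_space \<Rightarrow> 'a"
  assumes "open U" "x0 \<in> U" "Ck_on 2 f U"
  shows "has_Ck_flow 2 f U x0"
  using Ck_flow_step[OF Ck_flow_1 assms(1,2)] assms(3) by (simp add: numeral_2_eq_2 del: Ck_on.simps)

section \<open>Inverse functions and parametric integrals of class \<open>C\<^sup>k\<close>\<close>

text \<open>An injective \<open>A x\<close> is bounded below by some \<open>B\<close>, and
  perturbations of norm at most \<open>B/2\<close> leave half of that bound. This makes solutions of
  linear equations stable near \<open>x\<close>.\<close>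

lemma linear_solve_bound:
  fixes A :: "'a::euclidean_space \<Rightarrow> 'b::euclidean_space \<Rightarrow>\<^sub>L 'c::euclidean_space"
  assumes S: "open S" "x \<in> S" and A: "continuous_on S A" and inj: "inj (blinfun_apply (A x))"
  obtains m d where "m > 0" "d > 0" "ball x d \<subseteq> S" "\<And>y v. y \<in> ball x d \<Longrightarrow> m * norm v \<le> norm (A y v)"
proof -
  obtain B where B: "B > 0" "\<And>v. B * norm v \<le> norm (A x v)"
    using linear_inj_bounded_below_pos[OF _ inj] blinfun.bounded_linear_right bounded_linear.linear by blast
  have "isCont A x" using A S by (simp add: continuous_on_eq_continuous_at)
  then obtain d1 where d1: "d1 > 0" "\<And>y. dist y x < d1 \<Longrightarrow> dist (A y) (A x) < B/2"
    unfolding continuous_at_eps_delta using B(1) by (meson half_gt_zero)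
  obtain d2 where d2: "d2 > 0" "ball x d2 \<subseteq> S" using S open_contains_ball by blast
  show ?thesis
  proof (rule that[of "B/2" "min d1 d2"])
    fix y v assume "y \<in> ball x (min d1 d2)"
    then have "norm (A y - A x) \<le> B/2" using d1(2)[of y] by (simp add: dist_commute dist_norm[symmetric])
    then have "norm ((A y - A x) v) \<le> B/2 * norm v"
      using norm_blinfun[of "A y - A x" v] mult_right_mono[of "norm (A y - A x)" "B/2" "norm v"] by simp
    moreover have "norm (A x v) \<le> norm (A y v) + norm ((A y - A x) v)"
      using norm_triangle_ineq4[of "A y v" "(A y - A x) v"] by (simp add: blinfun.diff_left)
    ultimately show "B/2 * norm v \<le> norm (A y v)" using B(2)[of v] by (simp add: algebra_simps)
  qed (use B d1 d2 in auto)
qed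

lemma linear_solve_continuous:
  fixes A :: "'a::euclidean_space \<Rightarrow> 'b::euclidean_space \<Rightarrow>\<^sub>L 'c::euclidean_space"
  assumes S: "open S" and A: "continuous_on S A" and inj: "\<And>y. y \<in> S \<Longrightarrow> inj (blinfun_apply (A y))"
    and b: "continuous_on S b" and v: "\<And>y. y \<in> S \<Longrightarrow> A y (v y) = b y"
  shows "continuous_on S v"
proof (rule continuous_at_imp_continuous_on, rule ballI)
  fix x assume x: "x \<in> S"
  obtain m d where md: "m > 0" "d > 0" "ball x d \<subseteq> S" "\<And>y v. y \<in> ball x d \<Longrightarrow> m * norm v \<le> norm (A y v)"
    by (rule linear_solve_bound[OF S x A inj[OF x]]) (rule that)
  have lims: "((\<lambda>y. A y (v x)) \<longlongrightarrow> A x (v x)) (at x)" "(b \<longlongrightarrow> b x) (at x)"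
    using A b x S by (auto simp: continuous_on_eq_continuous_at continuous_at intro!: tendsto_intros)
  have "((\<lambda>y. norm (b y - A y (v x)) / m) \<longlongrightarrow> norm (b x - A x (v x)) / m) (at x)"
    by (rule tendsto_divide[OF tendsto_norm[OF tendsto_diff[OF lims(2,1)]] tendsto_const]) (use md(1) in simp)
  then have lim: "((\<lambda>y. norm (b y - A y (v x)) / m) \<longlongrightarrow> 0) (at x)" using v[OF x] by simp
  have "((\<lambda>y. v y - v x) \<longlongrightarrow> 0) (at x)"
  proof (rule Lim_null_comparison[OF _ lim])
    have "\<forall>\<^sub>F y in at x. y \<in> ball x d" using md(2) by (intro eventually_at_in_open') auto
    then show "\<forall>\<^sub>F y in at x. norm (v y - v x) \<le> norm (b y - A y (v x)) / m"
    proof eventually_elim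
      case (elim y)
      have eq: "A y (v y - v x) = b y - A y (v x)" using v elim md(3) by (auto simp: blinfun.diff_right)
      show ?case using md(4)[OF elim, of "v y - v x"] md(1) unfolding eq by (simp add: pos_le_divide_eq mult.commute)
    qed
  qed
  then show "isCont v x" by (simp add: continuous_at Lim_null[symmetric])
qed

text \<open>Implicit differentiation of \<open>A x (v x) = b x\<close> gives another linear equation
  with the same operator and right-hand side \<open>dd b h x - dd A h x (v x)\<close>. So the
  induction needs no smoothness of operator inversion.\<close>

lemma Ck_on_linear_solve:
  fixes A :: "'a::euclidean_space \<Rightarrow> 'b::euclidean_space \<Rightarrow>\<^sub>L 'c::euclidean_space"
  assumes S: "open S" and A: "Ck_on k A S" and bij: "\<And>y. y \<in> S \<Longrightarrow> bij (blinfun_apply (A y))"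
    and b: "Ck_on k b S" and v: "\<And>y. y \<in> S \<Longrightarrow> A y (v y) = b y"
  shows "Ck_on k v S"
  using A b v
proof (induction k arbitrary: b v)
  case 0
  have "continuous_on S A" "continuous_on S b" using 0 by simp_all
  from linear_solve_continuous[OF S this(1) bij_is_inj[OF bij] this(2) 0(3)] show ?case by simp
next
  case (Suc k)
  have cA: "continuous_on S A" and cb: "continuous_on S b" using Ck_on_continuous Suc.prems S by blast+
  have cv: "continuous_on S v" by (rule linear_solve_continuous[OF S cA bij_is_inj[OF bij] cb]) (use Suc.prems in auto)
  have A1: "Ck_on k A S" by (rule Ck_on_Suc_imp[OF Suc.prems(1) S])
  have vk: "Ck_on k v S" using Suc.IH[OF A1 Ck_on_Suc_imp[OF Suc.prems(2) S]] Suc.prems(3) by blast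
  define w where "w h x = inv (blinfun_apply (A x)) (dd b h x - dd A h x (v x))" for h x
  have Aw: "A x (w h x) = dd b h x - dd A h x (v x)" if "x \<in> S" for h x
    unfolding w_def using surj_f_inv_f[OF bij_is_surj[OF bij[OF that]]] .
  have hd: "(v has_derivative (\<lambda>h. w h x)) (at x)" if x: "x \<in> S" for x
  proof -
    obtain m d where md: "m > 0" "d > 0" "ball x d \<subseteq> S" "\<And>y v. y \<in> ball x d \<Longrightarrow> m * norm v \<le> norm (A y v)"
      by (rule linear_solve_bound[OF S x cA bij_is_inj[OF bij[OF x]]]) (rule that)
    have dA: "(A has_derivative (\<lambda>h. dd A h x)) (at x)" and db: "(b has_derivative (\<lambda>h. dd b h x)) (at x)"
      using Ck_on_has_derivative Suc.prems S x by blast+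
    have lin: "linear (\<lambda>h. w h x)"
    proof (rule linearI)
      have la: "linear (\<lambda>h. dd A h x)" "linear (\<lambda>h. dd b h x)" using dA db has_derivative_linear by blast+
      have inj: "u = u'" if "A x u = A x u'" for u u' using injD[OF bij_is_inj[OF bij[OF x]] that] .
      show "w (h + h') x = w h x + w h' x" for h h'
        by (rule inj) (simp add: Aw[OF x] blinfun.bilinear_simps linear_add[OF la(1)] linear_add[OF la(2)])
      show "w (r *\<^sub>R h) x = r *\<^sub>R w h x" for r h
        by (rule inj) (simp add: Aw[OF x] blinfun.bilinear_simps linear_scale[OF la(1)] linear_scale[OF la(2)] scaleR_diff_right)
    qed
    \<comment> \<open>The value of \<open>A x\<close> on the candidate remainder of
      \<open>v\<close>: two Taylor remainders, of \<open>b\<close> and of \<open>A\<close>, and a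
      product of two small factors. Each is small compared with \<open>norm (y - x)\<close>.\<close>
    define E where "E y = (b y - b x - dd b (y - x) x) - (A y - A x - dd A (y - x) x) (v y) - dd A (y - x) x (v y - v x)" for y
    have eq: "A x (v y - v x - w (y - x) x) = E y" if "y \<in> S" for y
      using Aw[OF x] Suc.prems(3)[OF x] Suc.prems(3)[OF that] unfolding E_def by (simp add: blinfun.bilinear_simps)
    have x0: "x \<in> ball x d" using md by simp
    obtain K where K: "K > 0" "\<And>h. norm (dd A h x) \<le> norm h * K"
      using bounded_linear.pos_bounded[OF has_derivative_bounded_linear[OF dA]] by blast
    have lims: "((\<lambda>y. norm (b y - b x - dd b (y - x) x) / norm (y - x)) \<longlongrightarrow> 0) (at x)"
      "((\<lambda>y. norm (A y - A x - dd A (y - x) x) / norm (y - x)) \<longlongrightarrow> 0) (at x)"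
      using dA db unfolding has_derivative_at2 has_derivative_iff_norm by auto
    have "((\<lambda>y. v y) \<longlongrightarrow> v x) (at x)" using cv S x by (simp add: continuous_on_eq_continuous_at continuous_at)
    then have "((\<lambda>y. (norm (b y - b x - dd b (y - x) x) / norm (y - x) + norm (A y - A x - dd A (y - x) x) / norm (y - x) * norm (v y)
        + K * norm (v y - v x)) / m) \<longlongrightarrow> (0 + 0 * norm (v x) + K * norm (v x - v x)) / m) (at x)"
      using md(1) by (intro tendsto_intros lims) auto
    then have L: "((\<lambda>y. (norm (b y - b x - dd b (y - x) x) / norm (y - x) + norm (A y - A x - dd A (y - x) x) / norm (y - x) * norm (v y)
        + K * norm (v y - v x)) / m) \<longlongrightarrow> 0) (at x)" by simp
    have "((\<lambda>y. norm (v y - v x - w (y - x) x) / norm (y - x)) \<longlongrightarrow> 0) (at x)"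
    proof (rule Lim_null_comparison[OF _ L])
      have "\<forall>\<^sub>F y in at x. y \<in> ball x d" using md(2) by (intro eventually_at_in_open') auto
      moreover have "\<forall>\<^sub>F y in at x. y \<noteq> x" by (rule eventually_neq_at_within)
      ultimately show "\<forall>\<^sub>F y in at x. norm (norm (v y - v x - w (y - x) x) / norm (y - x)) \<le>
         (norm (b y - b x - dd b (y - x) x) / norm (y - x) + norm (A y - A x - dd A (y - x) x) / norm (y - x) * norm (v y)
        + K * norm (v y - v x)) / m"
      proof eventually_elim
        case (elim y)
        have n: "norm (y - x) > 0" using elim by simp
        have "m * norm (v y - v x - w (y - x) x) \<le> norm (E y)"
          using md(4)[OF x0, of "v y - v x - w (y - x) x"] eq[of y] elim md(3) by auto
        also have "\<dots> \<le> norm (b y - b x - dd b (y - x) x) + norm ((A y - A x - dd A (y - x) x) (v y)) + norm (dd A (y - x) x (v y - v x))"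
          unfolding E_def by (meson add_right_mono norm_triangle_ineq4 order_trans)
        also have "\<dots> \<le> norm (b y - b x - dd b (y - x) x) + norm (A y - A x - dd A (y - x) x) * norm (v y) + (norm (y - x) * K) * norm (v y - v x)"
          using norm_blinfun[of "A y - A x - dd A (y - x) x" "v y"]
            order_trans[OF norm_blinfun[of "dd A (y - x) x" "v y - v x"] mult_right_mono[OF K(2) norm_ge_zero]]
          by (intro add_mono) auto
        finally show ?case using n md(1) by (simp add: field_simps)
      qed
    qed
    then show ?thesis unfolding has_derivative_iff_norm using lin by (simp add: linear_conv_bounded_linear)
  qed
  show ?case
  proof (rule Ck_on_SucI[OF S hd])
    fix h :: 'a assume h: "h \<in> Basis"
    have "Ck_on k (\<lambda>x. dd b h x - dd A h x (v x)) S"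
      by (intro Ck_on_diff[OF S] Ck_on_dd_Basis[OF Suc.prems(2) h]
          Ck_on_bilinear[OF bounded_bilinear_blinfun_apply S Ck_on_dd_Basis[OF Suc.prems(1) h] vk])
    then show "Ck_on k (\<lambda>x. w h x) S" by (rule Suc.IH[OF A1 _ Aw])
  qed
qed

lemma Ck_on_Dblin:
  assumes S: "open S" and f: "Ck_on (Suc k) (f :: 'a::euclidean_space \<Rightarrow> 'b::euclidean_space) S"
  shows "Ck_on k (Dblin f) S"
proof -
  define e where "e b = Blinfun (\<lambda>v::'a. (v \<bullet> b))" for b
  have e: "blinfun_apply (e b) v = v \<bullet> b" for b v
    unfolding e_def by (simp add: bounded_linear_Blinfun_apply bounded_linear_inner_left)
  have "Ck_on k (\<lambda>x. \<Sum>b\<in>Basis. blinfun_scaleR_left (dd f b x) o\<^sub>L e b) S"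
    by (rule Ck_on_sum[OF S], rule Ck_on_bounded_linear_comp[OF _ S Ck_on_dd_Basis[OF f]])
       (rule bounded_linear_compose[OF bounded_bilinear.bounded_linear_left[OF bounded_bilinear_blinfun_compose] bounded_linear_blinfun_scaleR_left])
  then show ?thesis
  proof (rule Ck_on_cong[OF S, rotated])
    fix x assume "x \<in> S"
    note d = Ck_on_Suc_differentiable[OF f S this]
    show "(\<Sum>b\<in>Basis. blinfun_scaleR_left (dd f b x) o\<^sub>L e b) = Dblin f x"
    proof (rule blinfun_eqI)
      fix v
      show "blinfun_apply (\<Sum>b\<in>Basis. blinfun_scaleR_left (dd f b x) o\<^sub>L e b) v = blinfun_apply (Dblin f x) v"
        unfolding blinfun_apply_Dblin[OF d] dd_Basis_expansion[OF d, of v] by (simp add: blinfun.sum_left e)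
    qed
  qed
qed

text \<open>Bootstrapping: \<open>g' y b\<close> solves a linear equation whose operator is the
  derivative of \<open>f\<close> at \<open>g y\<close>. If \<open>g\<close> is of class
  \<open>j\<close>, so is \<open>g'\<close>, and \<open>g\<close> gains one order.\<close>

lemma Ck_on_inverse_function:
  fixes f :: "'a::euclidean_space \<Rightarrow> 'a"
  assumes S: "open S" "open V" and f: "Ck_on (Suc k) f S" and g: "\<And>y. y \<in> V \<Longrightarrow> g y \<in> S"
    and dg: "\<And>y. y \<in> V \<Longrightarrow> (g has_derivative g' y) (at y)"
    and bij: "\<And>y. y \<in> V \<Longrightarrow> bij (\<lambda>v. dd f v (g y))" and g': "\<And>y. y \<in> V \<Longrightarrow> g' y = inv (\<lambda>v. dd f v (g y))"
  shows "Ck_on (Suc k) g V"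
proof -
  have D: "blinfun_apply (Dblin f (g y)) = (\<lambda>v. dd f v (g y))" if "y \<in> V" for y
    using blinfun_apply_Dblin[OF Ck_on_Suc_differentiable[OF f S(1) g[OF that]]] .
  have step: "Ck_on (Suc j) g V" if j: "j \<le> k" and gj: "Ck_on j g V" for j
  proof (rule Ck_on_SucI[OF S(2) dg])
    fix b :: 'a assume "b \<in> Basis"
    show "Ck_on j (\<lambda>y. g' y b) V"
    proof (rule Ck_on_linear_solve[OF S(2)])
      have "Ck_on (Suc j) f S" by (rule Ck_on_mono[OF f]) (use j S in auto)
      then show "Ck_on j (\<lambda>y. Dblin f (g y)) V"
        by (intro Ck_on_compose[OF S(2,1) Ck_on_Dblin[OF S(1)] gj]) (use g in auto)
      show "bij (blinfun_apply (Dblin f (g y)))" if "y \<in> V" for y using D bij that by simp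
      show "Ck_on j (\<lambda>y. b) V" by (rule Ck_on_const[OF S(2)])
      show "blinfun_apply (Dblin f (g y)) (g' y b) = b" if "y \<in> V" for y
        using D[OF that] g'[OF that] surj_f_inv_f[OF bij_is_surj[OF bij[OF that]]] by simp
    qed
  qed
  have "Ck_on 0 g V" using dg by (auto intro!: continuous_at_imp_continuous_on has_derivative_continuous)
  then have "Ck_on j g V" if "j \<le> Suc k" for j using that
  proof (induction j)
    case (Suc j) then show ?case using step[of j] by auto
  qed auto
  then show ?thesis by blast
qed

text \<open>Injectivity of the derivative at one point suffices because both spaces are the same; it
  yields the left inverse from which the continuously differentiable theorem starts. The order of
  the inverse is then raised by \<open>Ck_on_inverse_function\<close>.\<close>

theorem Ck_inverse_function_theorem:
  fixes f :: "'a::euclidean_space \<Rightarrow> 'a"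
  assumes S: "open S" "x0 \<in> S" and f: "Ck_on (Suc k) f S" and inj: "\<And>v. dd f v x0 = 0 \<Longrightarrow> v = 0"
  obtains U V g where "open U" "U \<subseteq> S" "x0 \<in> U" "open V" "f x0 \<in> V" "f ` U = V" "g ` V = U"
    "\<And>x. x \<in> U \<Longrightarrow> g (f x) = x" "\<And>y. y \<in> V \<Longrightarrow> f (g y) = y" "Ck_on (Suc k) g V"
    "\<And>x. x \<in> U \<Longrightarrow> bij (\<lambda>v. dd f v x)"
proof -
  have D: "blinfun_apply (Dblin f x) = (\<lambda>v. dd f v x)" if "x \<in> S" for x
    using blinfun_apply_Dblin[OF Ck_on_Suc_differentiable[OF f S(1) that]] .
  have lin: "linear (\<lambda>v. dd f v x0)" using dd_linear[OF Ck_on_Suc_differentiable[OF f S]] .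
  have "inj (\<lambda>v. dd f v x0)" using inj linear_injective_0[OF lin] by blast
  then obtain h where h: "linear h" "h \<circ> (\<lambda>v. dd f v x0) = id" using linear_injective_left_inverse[OF lin] by blast
  have "Blinfun h o\<^sub>L Dblin f x0 = id_blinfun"
    using h by (intro blinfun_eqI) (simp add: D[OF S(2)] bounded_linear_Blinfun_apply linear_conv_bounded_linear o_def fun_eq_iff)
  from inverse_function_theorem[OF S(1) Ck_on_1_Dblin(1)[OF S(1) f] Ck_on_1_Dblin(2)[OF S(1) f] S(2) this]
  obtain U V g g' where U: "open U" "U \<subseteq> S" "x0 \<in> U" "open V" "f x0 \<in> V" "homeomorphism U V f g"
    and g: "\<And>y. y \<in> V \<Longrightarrow> (g has_derivative g' y) (at y)"
      "\<And>y. y \<in> V \<Longrightarrow> g' y = inv (blinfun_apply (Dblin f (g y)))"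
      "\<And>y. y \<in> V \<Longrightarrow> bij (blinfun_apply (Dblin f (g y)))" by metis
  have hm: "f ` U = V" "g ` V = U" "\<And>x. x \<in> U \<Longrightarrow> g (f x) = x" "\<And>y. y \<in> V \<Longrightarrow> f (g y) = y"
    using U(6) unfolding homeomorphism_def by auto
  have gS: "g y \<in> S" if "y \<in> V" for y using that hm U(2) by blast
  have bij: "bij (\<lambda>v. dd f v (g y))" if "y \<in> V" for y using g(3)[OF that] D[OF gS[OF that]] by simp
  show ?thesis
  proof (rule that[OF U(1-5) hm])
    show "Ck_on (Suc k) g V"
      by (rule Ck_on_inverse_function[OF S(1) U(4) f gS g(1) bij]) (use g(2) D gS in auto)
    show "bij (\<lambda>v. dd f v x)" if "x \<in> U" for x using bij[of "f x"] hm that by auto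
  qed
qed

text \<open>\<open>T\<close> is an open set around the range of integration because
  \<open>Ck_on\<close> is meant for open sets. Differentiation under the integral gives an integral
  of the same kind, which drives the induction.\<close>

lemma Ck_on_integral:
  fixes K :: "real \<times> 'a::euclidean_space \<Rightarrow> 'b::euclidean_space"
  assumes T: "open T" "{0..1} \<subseteq> T" and S: "open S" and K: "Ck_on k K (T \<times> S)"
  shows "Ck_on k (\<lambda>q. integral {0..1} (\<lambda>t. K (t, q))) S"
    and "\<And>j q v. k = Suc j \<Longrightarrow> q \<in> S \<Longrightarrow> ((\<lambda>q. integral {0..1} (\<lambda>t. K (t, q))) has_derivative
           (\<lambda>v. integral {0..1} (\<lambda>t. dd K (0, v) (t, q)))) (at q)"
proof -
  have TS: "open (T \<times> S)" using T S by (intro open_Times)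
  have cont: "continuous_on (V \<times> cbox 0 1) (\<lambda>(q, t). K (t, q))"
    if "continuous_on (T \<times> S) K" "V \<subseteq> S" for K :: "real \<times> 'a \<Rightarrow> 'b" and V
    unfolding split_beta
    by (rule continuous_on_compose2[OF that(1)]) (use T that in \<open>auto intro!: continuous_intros\<close>)
  have integrable: "(\<lambda>t. K (t, q)) integrable_on {0..1}"
    if "continuous_on (T \<times> S) K" "q \<in> S" for K :: "real \<times> 'a \<Rightarrow> 'b" and q
    by (rule integrable_continuous_real, rule continuous_on_compose2[OF that(1)]) (use T that in \<open>auto intro!: continuous_intros\<close>)
  have hd: "((\<lambda>q. integral {0..1} (\<lambda>t. K (t, q))) has_derivative (\<lambda>v. integral {0..1} (\<lambda>t. dd K (0, v) (t, q)))) (at q)"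
    if K: "Ck_on (Suc j) K (T \<times> S)" and q: "q \<in> S" for j and K :: "real \<times> 'a \<Rightarrow> 'b" and q
  proof -
    obtain e where e: "e > 0" "ball q e \<subseteq> S" using S q open_contains_ball by blast
    define D where "D x t = Blinfun (\<lambda>v. dd K (0, v) (t, x))" for x t
    have kd: "(K has_derivative (\<lambda>v. dd K v (t, x))) (at (t, x))" if "x \<in> S" "t \<in> {0..1}" for x t
      using Ck_on_has_derivative[OF K TS] T that by blast
    have hdx: "((\<lambda>x. K (t, x)) has_derivative (\<lambda>v. dd K (0, v) (t, x))) (at x)" if "x \<in> S" "t \<in> {0..1}" for x t
    proof -
      have "((\<lambda>x. (t, x)) has_derivative (\<lambda>h. (0, h))) (at x)" by (auto intro!: derivative_eq_intros)
      from has_derivative_compose[OF this kd[OF that]] show ?thesis .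
    qed
    have D: "blinfun_apply (D x t) = (\<lambda>v. dd K (0, v) (t, x))" if "x \<in> S" "t \<in> {0..1}" for x t
      unfolding D_def by (rule bounded_linear_Blinfun_apply[OF has_derivative_bounded_linear[OF hdx[OF that]]])
    have Dc: "continuous_on (ball q e \<times> cbox 0 1) (\<lambda>(x, t). D x t)"
    proof (rule continuous_on_blinfun_componentwise)
      fix i :: 'a assume "i \<in> Basis"
      have "continuous_on (T \<times> S) (dd K (0, i))" by (rule Ck_on_continuous[OF Ck_on_dd[OF TS K] TS])
      from cont[OF this e(2)] show "continuous_on (ball q e \<times> cbox 0 1) (\<lambda>x. blinfun_apply (case x of (x, t) \<Rightarrow> D x t) i)"
        by (rule continuous_on_eq) (use D e in \<open>auto simp: subset_iff\<close>)
    qed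
    have cK: "continuous_on (T \<times> S) K" by (rule Ck_on_continuous[OF K TS])
    have "((\<lambda>x. integral (cbox 0 1) (\<lambda>t. K (t, x))) has_derivative blinfun_apply (integral (cbox 0 1) (D q))) (at q within ball q e)"
    proof (rule leibniz_rule[where fx=D])
      show "((\<lambda>x. K (t, x)) has_derivative blinfun_apply (D x t)) (at x within ball q e)" if "x \<in> ball q e" "t \<in> cbox 0 1" for x t
      proof -
        have "x \<in> S" "t \<in> {0..1}" using that e by auto
        then show ?thesis using has_derivative_at_withinI[OF hdx] D by simp
      qed
      show "(\<lambda>t. K (t, x)) integrable_on cbox 0 1" if "x \<in> ball q e" for x
        using integrable[OF cK] that e by auto
    qed (use Dc e in auto)
    moreover have "blinfun_apply (integral (cbox 0 1) (D q)) = (\<lambda>v. integral {0..1} (\<lambda>t. dd K (0, v) (t, q)))"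
    proof (rule ext)
      fix v
      have "continuous_on (cbox 0 1) (\<lambda>t. (\<lambda>(x, t). D x t) (q, t))"
        by (rule continuous_on_compose2[OF Dc]) (use e in \<open>auto intro!: continuous_intros\<close>)
      then have "D q integrable_on cbox 0 1" by (auto intro!: integrable_continuous_real)
      from integral_linear[OF this blinfun.bounded_linear_left[of v]]
      have "blinfun_apply (integral (cbox 0 1) (D q)) v = integral (cbox 0 1) (\<lambda>t. blinfun_apply (D q t) v)" by (simp add: o_def)
      also have "\<dots> = integral (cbox 0 1) (\<lambda>t. dd K (0, v) (t, q))" by (rule integral_cong) (use D q in auto)
      finally show "blinfun_apply (integral (cbox 0 1) (D q)) v = integral {0..1} (\<lambda>t. dd K (0, v) (t, q))" by simp
    qed
    ultimately show ?thesis using e at_within_open[of q "ball q e"] by simp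
  qed
  show "((\<lambda>q. integral {0..1} (\<lambda>t. K (t, q))) has_derivative (\<lambda>v. integral {0..1} (\<lambda>t. dd K (0, v) (t, q)))) (at q)"
    if "k = Suc j" "q \<in> S" for j q using hd K that by blast
  show "Ck_on k (\<lambda>q. integral {0..1} (\<lambda>t. K (t, q))) S"
    using K
  proof (induction k arbitrary: K)
    case 0
    then have "continuous_on (T \<times> S) K" by simp
    from integral_continuous_on_param[OF cont[OF this order_refl]] show ?case by simp
  next
    case (Suc k)
    show ?case
    proof (rule Ck_on_SucI[OF S hd[OF Suc.prems]])
      show "Ck_on k (\<lambda>q. integral {0..1} (\<lambda>t. dd K (0, b) (t, q))) S" for b
        by (rule Suc.IH[OF Ck_on_dd[OF TS Suc.prems]])
    qed
  qed
qed

section \<open>Pointwise algebra of the system\<close>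

text \<open>The total derivative \<open>d/dX\<close> as a vector field on jet space; its integral
  curves are the lifted solutions of the system, with \<open>X\<close> as time.\<close>

definition jet_field :: "(jet \<Rightarrow> real^2) \<Rightarrow> jet \<Rightarrow> jet" where
  "jet_field F q = (1, snd (snd q), F q)"

lemma vec2_expansion: "(v :: real^2) = v $ 1 *\<^sub>R axis 1 1 + v $ 2 *\<^sub>R axis 2 1"
  by (simp add: vec_eq_iff forall_2 axis_def)

lemma differentiable_bounded_linear:
  "bounded_linear L \<Longrightarrow> f differentiable at q \<Longrightarrow> (\<lambda>x. L (f x)) differentiable at q"
  unfolding differentiable_def using bounded_linear.has_derivative by blast

lemma dd_jet_expand:
  assumes "F differentiable at r"
  shows "dd F (0, a, b) r = a $ 1 *\<^sub>R dd F (dY 1) r + a $ 2 *\<^sub>R dd F (dY 2) r + b $ 1 *\<^sub>R dd F (dP 1) r + b $ 2 *\<^sub>R dd F (dP 2) r"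
proof -
  have e: "(0, a, b) = a $ 1 *\<^sub>R dY 1 + a $ 2 *\<^sub>R dY 2 + b $ 1 *\<^sub>R dP 1 + b $ 2 *\<^sub>R dP 2"
    using vec2_expansion[of a] vec2_expansion[of b] by (simp add: dY_def dP_def)
  show ?thesis unfolding e using linear_add[OF dd_linear[OF assms]] linear_scale[OF dd_linear[OF assms]] by simp
qed

lemma total_deriv_eq_dd:
  assumes "f differentiable at q"
  shows "total_deriv F f q = dd f (jet_field F q) q"
proof -
  note l = linear_add[OF dd_linear[OF assms]] linear_scale[OF dd_linear[OF assms]]
  have "jet_field F q = dX + (snd (snd q) $ 1 *\<^sub>R dY 1 + snd (snd q) $ 2 *\<^sub>R dY 2) + (F q $ 1 *\<^sub>R dP 1 + F q $ 2 *\<^sub>R dP 2)"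
    using vec2_expansion[of "snd (snd q)"] vec2_expansion[of "F q"]
    by (simp add: jet_field_def dX_def dY_def dP_def)
  then show ?thesis unfolding total_deriv_def sum_2 pd_eq_dd[OF assms] by (simp add: l)
qed

lemma pd_component:
  fixes F :: "'a::real_normed_vector \<Rightarrow> real^'n"
  assumes "F differentiable at q" shows "pd (\<lambda>r. F r $ A) v q = dd F v q $ A"
proof -
  have "(\<lambda>r. F r $ A) differentiable at q"
    using differentiable_bounded_linear[OF bounded_linear_vec_nth assms] .
  then show ?thesis using pd_eq_dd dd_vec_nth[OF assms] by metis
qed

text \<open>Trace-freeness stands in place of a potential. For a \<open>Lambda_system\<close> it is
  derived from \<open>\<Lambda>\<close>; for the system of the twistor lines it is found first, and
  the potential is built from it.\<close>

locale jet_system =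
  fixes F :: "jet \<Rightarrow> real^2" and D :: "jet set"
  assumes D: "open D" and F2: "Ck_on 2 F D"
    and trace_free: "\<And>q. q \<in> D \<Longrightarrow> dd F (dP 1) q $ 1 + dd F (dP 2) q $ 2 = 0"
begin

lemma F_diff: "q \<in> D \<Longrightarrow> F differentiable at q"
  using F2 D Ck_on_Suc_differentiable[of 1 F D q] by (simp add: numeral_2_eq_2)

lemma dF_diff: "q \<in> D \<Longrightarrow> (\<lambda>r. dd F v r $ A) differentiable at q"
proof -
  assume q: "q \<in> D"
  have "Ck_on (Suc 0) (dd F v) D" using Ck_on_dd[OF D, of "Suc 0" F v] F2 by (simp add: numeral_2_eq_2)
  from Ck_on_Suc_differentiable[OF this D q] show ?thesis
    using differentiable_bounded_linear[OF bounded_linear_vec_nth] by blast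
qed

lemma trace2: "q \<in> D \<Longrightarrow> dd F (dP 1) q $ 1 = - dd F (dP 2) q $ 2"
  using trace_free[of q] by simp

lemma dd_trace: "q \<in> D \<Longrightarrow> dd (\<lambda>r. dd F (dP 1) r $ 1) v q = - dd (\<lambda>r. dd F (dP 2) r $ 2) v q"
  using dd_cong_open[OF D, of q "\<lambda>r. dd F (dP 1) r $ 1" "\<lambda>r. - dd F (dP 2) r $ 2" v] trace2
    dd_minus[OF dF_diff] by simp

lemma Omega_sq_zero: "q \<in> D \<Longrightarrow> Omega_sq F q = 0"
  unfolding Omega_sq_def sum_2 using pd_component[OF F_diff] trace_free by simp

lemma phi_eq:
  assumes q: "q \<in> D"
  shows "phi F 1 1 q = - dd F (dP 1) q $ 2 / 2" "phi F 2 2 q = dd F (dP 2) q $ 1 / 2"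
    "phi F 1 2 q = - dd F (dP 2) q $ 2 / 2" "phi F 2 1 q = - dd F (dP 2) q $ 2 / 2"
  unfolding phi_def sum_2 pd_component[OF F_diff[OF q]] using trace2[OF q] by (simp_all add: eps_def)

lemma total_deriv_cong:
  assumes q: "q \<in> D" and fg: "\<And>r. r \<in> D \<Longrightarrow> f r = g r" and g: "g differentiable at q"
  shows "total_deriv F f q = dd g (jet_field F q) q"
proof -
  have "total_deriv F f q = total_deriv F g q" unfolding total_deriv_def using pd_cong_open[OF D q fg] by simp
  then show ?thesis using total_deriv_eq_dd[OF g] by simp
qed

lemma total_deriv_phi:
  assumes q: "q \<in> D"
  shows "total_deriv F (phi F 1 1) q = - dd (\<lambda>r. dd F (dP 1) r $ 2) (jet_field F q) q / 2"
    "total_deriv F (phi F 2 2) q = dd (\<lambda>r. dd F (dP 2) r $ 1) (jet_field F q) q / 2"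
    "total_deriv F (phi F 1 2) q = - dd (\<lambda>r. dd F (dP 2) r $ 2) (jet_field F q) q / 2"
    "total_deriv F (phi F 2 1) q = - dd (\<lambda>r. dd F (dP 2) r $ 2) (jet_field F q) q / 2"
proof -
  have h: "(\<lambda>r. f r / 2) differentiable at q" "dd (\<lambda>r. f r / 2) v q = dd f v q / 2"
    "(\<lambda>r. - f r / 2) differentiable at q" "dd (\<lambda>r. - f r / 2) v q = - dd f v q / 2"
    if "f differentiable at q" for f :: "jet \<Rightarrow> real" and v
    using differentiable_bounded_linear[OF bounded_linear_divide that, of 2] dd_bounded_linear[OF bounded_linear_divide that, of 2 v]
      differentiable_bounded_linear[OF bounded_linear_minus[OF bounded_linear_divide] that, of 2]
      dd_bounded_linear[OF bounded_linear_minus[OF bounded_linear_divide] that, of 2 v] by simp_all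
  show "total_deriv F (phi F 1 1) q = - dd (\<lambda>r. dd F (dP 1) r $ 2) (jet_field F q) q / 2"
    using total_deriv_cong[OF q phi_eq(1)] h[OF dF_diff[OF q]] by simp
  show "total_deriv F (phi F 2 2) q = dd (\<lambda>r. dd F (dP 2) r $ 1) (jet_field F q) q / 2"
    using total_deriv_cong[OF q phi_eq(2)] h[OF dF_diff[OF q]] by simp
  show "total_deriv F (phi F 1 2) q = - dd (\<lambda>r. dd F (dP 2) r $ 2) (jet_field F q) q / 2"
    using total_deriv_cong[OF q phi_eq(3)] h[OF dF_diff[OF q]] by simp
  show "total_deriv F (phi F 2 1) q = - dd (\<lambda>r. dd F (dP 2) r $ 2) (jet_field F q) q / 2"
    using total_deriv_cong[OF q phi_eq(4)] h[OF dF_diff[OF q]] by simp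
qed

text \<open>With trace-free \<open>F_P\<close> the matrix \<open>phi\<close> is symmetric and
  \<open>Omega_sq\<close> vanishes, so the four equations reduce to three for the entries of
  \<open>F_P\<close>.\<close>

lemma phi_equation_iff:
  assumes q: "q \<in> D"
  shows "phi_equation F q \<longleftrightarrow>
    dd (\<lambda>r. dd F (dP 1) r $ 2) (jet_field F q) q = 2 * dd F (dY 1) q $ 2 \<and>
    dd (\<lambda>r. dd F (dP 2) r $ 1) (jet_field F q) q = 2 * dd F (dY 2) q $ 1 \<and>
    dd (\<lambda>r. dd F (dP 2) r $ 2) (jet_field F q) q = dd F (dY 2) q $ 2 - dd F (dY 1) q $ 1"
  unfolding phi_equation_def forall_2 sum_2 Omega_sq_zero[OF q] total_deriv_phi[OF q] pd_component[OF F_diff[OF q]]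
  by (auto simp: eps_def)

text \<open>The square of a trace-free 2 by 2 matrix is a multiple of the identity, so the quadratic
  term of \<open>T\<close> drops out of the trace-free part. What is left is the trace-free part of
  half of \<open>dF_P/dX\<close> minus \<open>F_Y\<close>, and that is the evolution equation of
  \<open>phi\<close>.\<close>

lemma wilczynski:
  assumes q: "q \<in> D" and eq: "phi_equation F q"
  shows "wilczynski_T F q - ((1/2) * trace (wilczynski_T F q)) *\<^sub>R mat 1 = 0"
proof -
  have td: "total_deriv F (\<lambda>r. pd (\<lambda>s. F s $ A) v r) q = dd (\<lambda>r. dd F v r $ A) (jet_field F q) q" for A v
    by (rule total_deriv_cong[OF q pd_component[OF F_diff] dF_diff[OF q]])
  note e = eq[unfolded phi_equation_iff[OF q]]
  have T: "wilczynski_T F q $ 1 $ 2 = 0" "wilczynski_T F q $ 2 $ 1 = 0" "wilczynski_T F q $ 1 $ 1 = wilczynski_T F q $ 2 $ 2"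
    unfolding wilczynski_T_def using e trace2[OF q] dd_trace[OF q, of "jet_field F q"]
    by (simp_all add: sum_2 td pd_component[OF F_diff[OF q]] algebra_simps)
  then show ?thesis by (simp add: vec_eq_iff forall_2 trace_def sum_2 mat_def)
qed

end

text \<open>Trace-freeness is the symmetry of the second \<open>P\<close>-derivatives of
  \<open>\<Lambda>\<close>. However, \<open>\<Lambda>\<close> is only known to be differentiable
  with smooth enough \<open>P\<close>-derivatives, so Clairaut is applied to its restriction to the
  plane through \<open>q\<close> in the \<open>P\<close>-directions, which is of class 2.\<close>

lemma Lambda_system_trace_free:
  assumes D: "open D" and \<Lambda>: "\<Lambda> differentiable_on D" and F: "Ck_on (Suc 0) (Lambda_system \<Lambda>) D" and q: "q \<in> D"
  shows "dd (Lambda_system \<Lambda>) (dP 1) q $ 1 + dd (Lambda_system \<Lambda>) (dP 2) q $ 2 = 0"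
proof -
  define l where "l A r = dd \<Lambda> (dP A) r" for A r
  have \<Lambda>d: "\<Lambda> differentiable at r" if "r \<in> D" for r using \<Lambda> D that by (simp add: differentiable_on_eq_differentiable_at)
  have F12: "Lambda_system \<Lambda> r $ 1 = 2 * l 2 r" "Lambda_system \<Lambda> r $ 2 = - 2 * l 1 r" if "r \<in> D" for r
    unfolding Lambda_system_def l_def using pd_eq_dd[OF \<Lambda>d[OF that]] by simp_all
  have c: "Ck_on (Suc 0) (\<lambda>r. (1/2) * (Lambda_system \<Lambda> r $ 1)) D" "Ck_on (Suc 0) (\<lambda>r. (-1/2) * (Lambda_system \<Lambda> r $ 2)) D"
    by (intro Ck_on_cmult[OF D] Ck_on_vec_nth[OF D F])+
  have l: "Ck_on (Suc 0) (l 2) D" "Ck_on (Suc 0) (l 1) D"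
    by (rule Ck_on_cong[OF D _ c(1)], simp add: F12, rule Ck_on_cong[OF D _ c(2)], simp add: F12)
  define p where "p a = q + fst a *\<^sub>R dP 1 + snd a *\<^sub>R dP 2" for a :: "real \<times> real"
  have pd: "(p has_derivative (\<lambda>h. fst h *\<^sub>R dP 1 + snd h *\<^sub>R dP 2)) (at a)" for a
    unfolding p_def by (auto intro!: derivative_eq_intros)
  define S where "S = p -` D"
  have pc: "continuous_on UNIV p" unfolding p_def by (intro continuous_intros)
  have S: "open S" unfolding S_def using open_vimage[OF D pc] .
  have S0: "0 \<in> S" unfolding S_def p_def using q by simp
  have pS: "Ck_on (Suc 0) p S"
    by (rule Ck_on_SucI[OF S pd]) (simp add: S)
  have lp: "Ck_on (Suc 0) (\<lambda>a. l 2 (p a)) S" "Ck_on (Suc 0) (\<lambda>a. l 1 (p a)) S"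
    by (rule Ck_on_compose[OF S D l(1) pS], force simp: S_def, rule Ck_on_compose[OF S D l(2) pS], force simp: S_def)
  have hd: "((\<lambda>a. \<Lambda> (p a)) has_derivative (\<lambda>h. fst h * l 1 (p a) + snd h * l 2 (p a))) (at a)" if "a \<in> S" for a
  proof -
    have d: "\<Lambda> differentiable at (p a)" using \<Lambda>d that unfolding S_def by simp
    note li = linear_add[OF dd_linear[OF d]] linear_scale[OF dd_linear[OF d]]
    from has_derivative_compose[OF pd has_derivative_dd[OF d]] show ?thesis by (simp add: li l_def)
  qed
  have h2: "Ck_on 2 (\<lambda>a. \<Lambda> (p a)) S"
    unfolding numeral_2_eq_2
  proof (rule Ck_on_SucI[OF S hd])
    fix b :: "real \<times> real"
    show "Ck_on (Suc 0) (\<lambda>a. fst b * l 1 (p a) + snd b * l 2 (p a)) S"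
      by (rule Ck_on_add[OF S Ck_on_cmult[OF S lp(2)] Ck_on_cmult[OF S lp(1)]])
  qed
  have e: "dd (\<lambda>a. \<Lambda> (p a)) h a = fst h * l 1 (p a) + snd h * l 2 (p a)" if "a \<in> S" for a h by (rule dd_eqI[OF hd[OF that]])
  have ld: "l A differentiable at q" if "A = 1 \<or> A = 2" for A using Ck_on_Suc_differentiable[OF l(1) D q] Ck_on_Suc_differentiable[OF l(2) D q] that by auto
  have p0: "p 0 = q" unfolding p_def by simp
  have c: "dd (\<lambda>a. l A (p a)) h 0 = dd (l A) (fst h *\<^sub>R dP 1 + snd h *\<^sub>R dP 2) q" if "A = 1 \<or> A = 2" for A h
    by (rule dd_eqI) (use has_derivative_compose[OF pd[of 0], of "l A"] has_derivative_dd[OF ld[OF that]] p0 in simp)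
  have "dd (dd (\<lambda>a. \<Lambda> (p a)) (1, 0)) (0, 1) 0 = dd (dd (\<lambda>a. \<Lambda> (p a)) (0, 1)) (1, 0) 0"
    by (rule dd_commute[OF S S0 h2])
  moreover have "dd (dd (\<lambda>a. \<Lambda> (p a)) (1, 0)) (0, 1) 0 = dd (\<lambda>a. l 1 (p a)) (0, 1) 0"
    by (rule dd_cong_open[OF S S0]) (simp add: e)
  moreover have "dd (dd (\<lambda>a. \<Lambda> (p a)) (0, 1)) (1, 0) 0 = dd (\<lambda>a. l 2 (p a)) (1, 0) 0"
    by (rule dd_cong_open[OF S S0]) (simp add: e)
  ultimately have com: "dd (l 1) (dP 2) q = dd (l 2) (dP 1) q" by (simp add: c)
  have Fd: "Lambda_system \<Lambda> differentiable at q" using Ck_on_Suc_differentiable[OF F D q] .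
  have sc: "dd (\<lambda>r. c * l A r) v q = c * dd (l A) v q" if "A = 1 \<or> A = 2" for c A v
    by (rule dd_bounded_linear[OF bounded_linear_mult_right ld[OF that]])
  have "dd (Lambda_system \<Lambda>) (dP 1) q $ 1 = dd (\<lambda>r. 2 * l 2 r) (dP 1) q"
    unfolding dd_vec_nth[OF Fd, symmetric] by (rule dd_cong_open[OF D q F12(1)])
  also have "\<dots> = 2 * dd (l 2) (dP 1) q" by (rule sc) simp
  finally have A1: "dd (Lambda_system \<Lambda>) (dP 1) q $ 1 = 2 * dd (l 2) (dP 1) q" .
  have "dd (Lambda_system \<Lambda>) (dP 2) q $ 2 = dd (\<lambda>r. - 2 * l 1 r) (dP 2) q"
    unfolding dd_vec_nth[OF Fd, symmetric] by (rule dd_cong_open[OF D q F12(2)])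
  also have "\<dots> = - 2 * dd (l 1) (dP 2) q" by (rule sc) simp
  finally show ?thesis using com A1 by linarith
qed

lemma Lambda_solution_jet_system:
  assumes "Lambda_solution \<Theta> U X\<^sub>0 D \<Lambda>" shows "jet_system (Lambda_system \<Lambda>) D"
proof
  have 5: "Ck_on 5 (Lambda_system \<Lambda>) D" and D: "open D" using assms unfolding Lambda_solution_def by auto
  show "open D" by (rule D)
  show "Ck_on 2 (Lambda_system \<Lambda>) D" by (rule Ck_on_mono[OF 5 _ D]) simp
  have "Ck_on (Suc 0) (Lambda_system \<Lambda>) D" by (rule Ck_on_mono[OF 5 _ D]) simp
  then show "dd (Lambda_system \<Lambda>) (dP 1) q $ 1 + dd (Lambda_system \<Lambda>) (dP 2) q $ 2 = 0" if "q \<in> D" for q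
    using Lambda_system_trace_free[OF D _ _ that, of \<Lambda>] assms unfolding Lambda_solution_def by blast
qed

section \<open>Alpha-planes of the heavenly metric\<close>

lemma vector_4 [simp]:
  "(vector [x,y,z,w] ::('a::zero)^4)$1 = x" "(vector [x,y,z,w] ::('a::zero)^4)$2 = y"
  "(vector [x,y,z,w] ::('a::zero)^4)$3 = z" "(vector [x,y,z,w] ::('a::zero)^4)$4 = w"
  unfolding vector_def by simp_all

lemma det_4:
  "det (A::'a::comm_ring_1^4^4) =
    A$1$1 * (A$2$2 * A$3$3 * A$4$4 + A$2$3 * A$3$4 * A$4$2 + A$2$4 * A$3$2 * A$4$3
       - A$2$2 * A$3$4 * A$4$3 - A$2$3 * A$3$2 * A$4$4 - A$2$4 * A$3$3 * A$4$2)
  - A$1$2 * (A$2$1 * A$3$3 * A$4$4 + A$2$3 * A$3$4 * A$4$1 + A$2$4 * A$3$1 * A$4$3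
       - A$2$1 * A$3$4 * A$4$3 - A$2$3 * A$3$1 * A$4$4 - A$2$4 * A$3$3 * A$4$1)
  + A$1$3 * (A$2$1 * A$3$2 * A$4$4 + A$2$2 * A$3$4 * A$4$1 + A$2$4 * A$3$1 * A$4$2
       - A$2$1 * A$3$4 * A$4$2 - A$2$2 * A$3$1 * A$4$4 - A$2$4 * A$3$2 * A$4$1)
  - A$1$4 * (A$2$1 * A$3$2 * A$4$3 + A$2$2 * A$3$3 * A$4$1 + A$2$3 * A$3$1 * A$4$2
       - A$2$1 * A$3$3 * A$4$2 - A$2$2 * A$3$1 * A$4$3 - A$2$3 * A$3$2 * A$4$1)"
proof -
  have f: "finite {2::4, 3, 4}" "1 \<notin> {2::4, 3, 4}" "finite {3::4, 4}" "2 \<notin> {3::4, 4}" "finite {4::4}" "3 \<notin> {4::4}" by auto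
  show ?thesis
    unfolding det_def UNIV_4
    unfolding sum_over_permutations_insert[OF f(1,2)]
    unfolding sum_over_permutations_insert[OF f(3,4)]
    unfolding sum_over_permutations_insert[OF f(5,6)]
    unfolding permutes_sing
    by (simp add: sign_swap_id permutation_swap_id permutation_compose sign_compose sign_id swap_id_eq transpose_def algebra_simps)
qed

text \<open>\<open>a\<close>, \<open>b\<close>, \<open>c\<close> stand for the derivatives of
  \<open>\<Theta>\<close> by \<open>xx\<close>, \<open>xy\<close>, \<open>yy\<close>. The entries
  1/2 come from polarization.\<close>

definition hmat :: "real \<Rightarrow> real \<Rightarrow> real \<Rightarrow> real^4^4" where
  "hmat a b c = vector [vector [- c, b, 1/2, 0], vector [b, - a, 0, 1/2], vector [1/2, 0, 0, 0], vector [0, 1/2, 0, 0]]"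

lemma heavenly_metric_eq: "heavenly_metric \<Theta> p = hmat (pd2 \<Theta> 3 3 p) (pd2 \<Theta> 3 4 p) (pd2 \<Theta> 4 4 p)"
  unfolding heavenly_metric_def hmat_def heavenly_form_def
  by (simp add: vec_eq_iff forall_4 axis_def algebra_simps power2_eq_square)

text \<open>The covectors \<open>v$3 - c * v$1 + b * v$2\<close> and
  \<open>v$4 + b * v$1 - a * v$2\<close>, later called \<open>ex\<close> and \<open>ey\<close>,
  complete \<open>v$1\<close> and \<open>v$2\<close> to a null coframe, in which the coefficients of
  the metric are constant.\<close>

lemma hmat_inner:
  "u \<bullet> (hmat a b c *v v) = (u$1 * (v$3 - c * v$1 + b * v$2) + u$2 * (v$4 + b * v$1 - a * v$2) +
     v$1 * (u$3 - c * u$1 + b * u$2) + v$2 * (u$4 + b * u$1 - a * u$2)) / 2"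
  unfolding inner_vec_def matrix_vector_mult_def hmat_def by (simp add: sum_4 algebra_simps)

lemma det_hmat: "det (hmat a b c) = 1/16" unfolding hmat_def by (simp add: det_4)

lemma hodge_lower_scale: "hodge_lower g (r *\<^sub>R B) = r *\<^sub>R hodge_lower g B"
  unfolding hodge_lower_def by (simp add: vec_eq_iff sum_distrib_left algebra_simps)

lemma lower_scale: "lower g (r *\<^sub>R B) = r *\<^sub>R lower g B"
  unfolding lower_def by (simp add: vec_eq_iff sum_distrib_left algebra_simps)

text \<open>The two vectors are the later \<open>L0\<close> and \<open>L1\<close> with parameter
  \<open>s\<close>. For \<open>s = 0\<close> they span the plane \<open>w = z = const\<close>, the
  one that fixes the orientation.\<close>

lemma self_dual_basis:
  "self_dual_bivector (hmat a b c) (wedge (vector [0, - s, 1 + s * b, - s * a]) (vector [s, 0, s * c, 1 - s * b]))"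
  unfolding self_dual_bivector_def hodge_lower_def det_hmat
  by (simp add: vec_eq_iff forall_4 lower_def sum_4 wedge_def hmat_def levi_civita_def det_4 axis_def algebra_simps real_sqrt_divide)

lemma alpha_plane_hmat:
  assumes P: "P = {v. v$1 = s * (v$4 + b * v$1 - a * v$2) \<and> v$2 = - s * (v$3 - c * v$1 + b * v$2)}"
  shows "alpha_plane (hmat a b c) P"
proof -
  define e f :: "real^4" where "e = vector [0, - s, 1 + s * b, - s * a]" and "f = vector [s, 0, s * c, 1 - s * b]"
  define L where "L v = (v$1) *\<^sub>R e + (v$2) *\<^sub>R f" for v :: "real^2"
  have L: "linear L" unfolding L_def by (intro linearI) (simp_all add: algebra_simps)
  \<comment> \<open>The two null covectors serve as coordinates on \<open>P\<close> with respect to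
    the basis \<open>e\<close>, \<open>f\<close>.\<close>
  have PL: "v \<in> P \<longleftrightarrow> v = L (vector [v$3 - c * v$1 + b * v$2, v$4 + b * v$1 - a * v$2])" for v
  proof
    assume "v \<in> P"
    then have "v$1 = s * (v$4 + b * v$1 - a * v$2)" "v$2 = - s * (v$3 - c * v$1 + b * v$2)" using P by auto
    then have "v$3 = (v$3 - c * v$1 + b * v$2) * (1 + s * b) + (v$4 + b * v$1 - a * v$2) * (s * c)"
      "v$4 = (v$3 - c * v$1 + b * v$2) * (- s * a) + (v$4 + b * v$1 - a * v$2) * (1 - s * b)"
      "v$1 = (v$4 + b * v$1 - a * v$2) * s" "v$2 = (v$3 - c * v$1 + b * v$2) * (- s)" by algebra+
    then show "v = L (vector [v$3 - c * v$1 + b * v$2, v$4 + b * v$1 - a * v$2])"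
      unfolding L_def e_def f_def vec_eq_iff forall_4 by simp
  next
    assume "v = L (vector [v$3 - c * v$1 + b * v$2, v$4 + b * v$1 - a * v$2])"
    then have "v $ i = L (vector [v$3 - c * v$1 + b * v$2, v$4 + b * v$1 - a * v$2]) $ i" for i by simp
    from this[of 1] this[of 2] show "v \<in> P" unfolding P L_def e_def f_def by (simp add: mult.commute)
  qed
  have LP: "L v \<in> P" for v unfolding P L_def e_def f_def by (simp add: algebra_simps)
  have PL': "P = L ` UNIV" using PL LP by blast
  have sub: "subspace P" unfolding PL' by (rule linear_subspace_image[OF L subspace_UNIV])
  have inj: "inj L"
  proof (rule linear_injective_0[OF L, THEN iffD2], intro allI impI)
    fix v assume "L v = 0"
    then have z: "L v $ i = 0" for i by simp
    have "v $ 1 = L v $ 3 - c * L v $ 1 + b * L v $ 2" "v $ 2 = L v $ 4 + b * L v $ 1 - a * L v $ 2"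
      unfolding L_def e_def f_def by (simp_all add: algebra_simps)
    then show "v = 0" using z by (simp add: vec_eq_iff forall_2)
  qed
  have dim: "dim P = 2" unfolding PL' using dim_image_eq[OF L, of UNIV] inj by simp
  have null: "u \<bullet> (hmat a b c *v v) = 0" if "u \<in> P" "v \<in> P" for u v
  proof -
    have "u$1 = s * (u$4 + b * u$1 - a * u$2)" "u$2 = - s * (u$3 - c * u$1 + b * u$2)"
      "v$1 = s * (v$4 + b * v$1 - a * v$2)" "v$2 = - s * (v$3 - c * v$1 + b * v$2)" using that P by auto
    then have "u$1 * (v$3 - c * v$1 + b * v$2) + u$2 * (v$4 + b * v$1 - a * v$2) +
      v$1 * (u$3 - c * u$1 + b * u$2) + v$2 * (u$4 + b * u$1 - a * u$2) = 0" by algebra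
    then show ?thesis unfolding hmat_inner by simp
  qed
  have sd: "self_dual_bivector (hmat a b c) (wedge u v)" if "u \<in> P" "v \<in> P" for u v
  proof -
    obtain u' v' where uv: "u = L u'" "v = L v'" using \<open>u \<in> P\<close> \<open>v \<in> P\<close> unfolding PL' by blast
    have "wedge u v = (u'$1 * v'$2 - u'$2 * v'$1) *\<^sub>R wedge e f"
      unfolding uv wedge_def L_def by (simp add: vec_eq_iff algebra_simps)
    then show ?thesis using self_dual_basis[of a b c s] unfolding self_dual_bivector_def e_def[symmetric] f_def[symmetric]
      by (simp add: hodge_lower_scale lower_scale)
  qed
  show ?thesis unfolding alpha_plane_def using sub dim null sd by blast
qed

text \<open>\<open>indep\<close> makes the kernel a complement of the null plane spanned by
  \<open>e1\<close> and \<open>e2\<close>, hence a graph over the span of \<open>e3\<close> and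
  \<open>e4\<close>. A null graph has an antisymmetric matrix, so a single number \<open>c1\<close>
  describes it, and this is the parameter of a plane from \<open>alpha_plane_hmat\<close>. Being a
  null graph thus already implies self-duality.\<close>

lemma null_kernel_alpha_plane:
  fixes m :: "real^4 \<Rightarrow> real^2"
  assumes m: "linear m"
    and indep: "m (vector [1, 0, c, - b]) $ 1 * m (vector [0, 1, - b, a]) $ 2 - m (vector [0, 1, - b, a]) $ 1 * m (vector [1, 0, c, - b]) $ 2 \<noteq> 0"
    and null: "\<And>v. m v = 0 \<Longrightarrow> v$1 * (v$3 - c * v$1 + b * v$2) + v$2 * (v$4 + b * v$1 - a * v$2) = 0"
  shows "alpha_plane (hmat a b c) {v. m v = 0}" and "surj m"
proof -
  define e1 e2 e3 e4 :: "real^4" where "e1 = vector [1, 0, c, - b]" and "e2 = vector [0, 1, - b, a]"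
    and "e3 = vector [0, 0, 1, 0]" and "e4 = vector [0, 0, 0, 1]"
  define d where "d = m e1 $ 1 * m e2 $ 2 - m e2 $ 1 * m e1 $ 2"
  have d: "d \<noteq> 0" using indep unfolding d_def e1_def e2_def .
  have lin: "m (r *\<^sub>R u + s *\<^sub>R v) = r *\<^sub>R m u + s *\<^sub>R m v" for r s u v
    by (simp add: linear_add[OF m] linear_scale[OF m])
  have solve: "\<exists>r s. m (r *\<^sub>R e1 + s *\<^sub>R e2) = y" for y
  proof (intro exI)
    show "m (((y$1 * m e2 $ 2 - y$2 * m e2 $ 1) / d) *\<^sub>R e1 + ((y$2 * m e1 $ 1 - y$1 * m e1 $ 2) / d) *\<^sub>R e2) = y"
      using d unfolding lin by (simp add: vec_eq_iff forall_2 field_simps) (simp add: d_def algebra_simps)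
  qed
  then show "surj m" unfolding surj_def by metis
  have uniq: "r = 0 \<and> s = 0" if z: "m (r *\<^sub>R e1 + s *\<^sub>R e2) = 0" for r s
  proof -
    have "r * m e1 $ 1 + s * m e2 $ 1 = 0" "r * m e1 $ 2 + s * m e2 $ 2 = 0"
      using z unfolding lin by (simp_all add: vec_eq_iff forall_2)
    then have "r * d = 0" "s * d = 0" unfolding d_def by algebra+
    then show ?thesis using d by simp
  qed
  obtain a1 b1 where ab: "m (a1 *\<^sub>R e1 + b1 *\<^sub>R e2) = - m e3" using solve by blast
  obtain c1 d1 where cd: "m (c1 *\<^sub>R e1 + d1 *\<^sub>R e2) = - m e4" using solve by blast
  define f1 f2 where "f1 = e3 + (a1 *\<^sub>R e1 + b1 *\<^sub>R e2)" and "f2 = e4 + (c1 *\<^sub>R e1 + d1 *\<^sub>R e2)"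
  have mf: "m f1 = 0" "m f2 = 0" "m (f1 + f2) = 0" unfolding f1_def f2_def using ab cd by (simp_all add: linear_add[OF m])
  have co: "f1 $ 1 = a1" "f1 $ 2 = b1" "f1 $ 3 = 1 + a1 * c - b1 * b" "f1 $ 4 = - a1 * b + b1 * a"
     "f2 $ 1 = c1" "f2 $ 2 = d1" "f2 $ 3 = c1 * c - d1 * b" "f2 $ 4 = 1 - c1 * b + d1 * a"
    unfolding f1_def f2_def e1_def e2_def e3_def e4_def by simp_all
  \<comment> \<open>Nullity of \<open>f1\<close> and \<open>f2\<close> kills the diagonal of the
    matrix, and nullity of \<open>f1 + f2\<close> makes it antisymmetric.\<close>
  have "a1 = 0" using null[OF mf(1)] unfolding co by algebra
  moreover have "d1 = 0" using null[OF mf(2)] unfolding co by algebra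
  moreover have "a1 + b1 + c1 + d1 = 0" using null[OF mf(3)] unfolding vector_add_component co by algebra
  ultimately have z: "a1 = 0" "d1 = 0" "b1 = - c1" by auto
  have "m v = 0 \<longleftrightarrow> v$1 = c1 * (v$4 + b * v$1 - a * v$2) \<and> v$2 = - c1 * (v$3 - c * v$1 + b * v$2)" for v
  proof -
    define x y where "x = v$3 - c * v$1 + b * v$2" and "y = v$4 + b * v$1 - a * v$2"
    have v: "v = (x *\<^sub>R f1 + y *\<^sub>R f2) + ((v$1 - c1 * y) *\<^sub>R e1 + (v$2 + c1 * x) *\<^sub>R e2)"
      by (simp add: vec_eq_iff forall_4 co z e1_def e2_def x_def y_def algebra_simps)
    have mv: "m v = m ((v$1 - c1 * y) *\<^sub>R e1 + (v$2 + c1 * x) *\<^sub>R e2)"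
      by (subst v) (simp add: linear_add[OF m] linear_scale[OF m] mf)
    have "m v = 0 \<longleftrightarrow> v$1 - c1 * y = 0 \<and> v$2 + c1 * x = 0"
      using uniq[of "v$1 - c1 * y" "v$2 + c1 * x"] linear_0[OF m] unfolding mv by auto
    then show ?thesis unfolding x_def y_def by auto
  qed
  then have "{v. m v = 0} = {v. v$1 = c1 * (v$4 + b * v$1 - a * v$2) \<and> v$2 = - c1 * (v$3 - c * v$1 + b * v$2)}" by blast
  then show "alpha_plane (hmat a b c) {v. m v = 0}" by (rule alpha_plane_hmat)
qed

section \<open>The correspondence\<close>

lemma Ck_on_vector_2:
  assumes "open S" "Ck_on k f S" "Ck_on k g S" shows "Ck_on k (\<lambda>q. vector [f q, g q] :: real^2) S"
proof (rule Ck_on_vec[OF assms(1)])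
  show "Ck_on k (\<lambda>q. (vector [f q, g q] :: real^2) $ i) S" for i using exhaust_2[of i] assms by auto
qed

lemma Ck_on_vector_4:
  assumes "open S" "Ck_on k f S" "Ck_on k g S" "Ck_on k h S" "Ck_on k j S" shows "Ck_on k (\<lambda>q. vector [f q, g q, h q, j q] :: real^4) S"
proof (rule Ck_on_vec[OF assms(1)])
  show "Ck_on k (\<lambda>q. (vector [f q, g q, h q, j q] :: real^4) $ i) S" for i using exhaust_4[of i] assms by auto
qed

section \<open>Jets as points of a product with \<open>real^4\<close>, and the system on the initial
  slice\<close>

lemma bounded_linear_data_of_point: "bounded_linear (\<lambda>q. data_of_point (fst q) (snd q))"
  unfolding data_of_point_def linear_conv_bounded_linear[symmetric]
  by (intro linearI) (simp_all add: vec_eq_iff forall_2)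

text \<open>A linear isomorphism that brings maps from \<open>(X, p)\<close> to jets into the form
  of self-maps of one space, as the inverse function theorem requires.\<close>

definition point_of_jet :: "jet \<Rightarrow> real \<times> (real^4)" where
  "point_of_jet q = (fst q, point_of_data (fst (snd q)) (snd (snd q)))"

lemma bounded_linear_point_of_jet: "bounded_linear point_of_jet"
  unfolding point_of_jet_def point_of_data_def linear_conv_bounded_linear[symmetric]
  by (intro linearI) (simp_all add: vec_eq_iff forall_4)

lemma point_of_jet_data [simp]: "point_of_jet (data_of_point X p) = (X, p)"
  by (simp add: point_of_jet_def point_of_data_def data_of_point_def vec_eq_iff forall_4)

lemma data_point_of_jet [simp]: "data_of_point (fst (point_of_jet q)) (snd (point_of_jet q)) = q"
  by (cases q) (simp add: point_of_jet_def point_of_data_def data_of_point_def vec_eq_iff forall_2)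

lemma inj_point_of_jet: "point_of_jet q = point_of_jet r \<Longrightarrow> q = r"
  using data_point_of_jet by metis

lemma smooth_dd:
  assumes "open U" "smooth_on \<Theta> U" shows "smooth_on (dd \<Theta> v) U"
  using assms Ck_on_dd unfolding smooth_on_def by blast

lemma smooth_differentiable:
  assumes "open U" "smooth_on \<Theta> U" "p \<in> U" shows "\<Theta> differentiable at p"
  using assms Ck_on_Suc_differentiable[of 0] unfolding smooth_on_def by blast

lemma smooth_pd2:
  assumes "open U" "smooth_on \<Theta> U" "p \<in> U"
  shows "pd2 \<Theta> a b p = dd (dd \<Theta> (axis a 1)) (axis b 1) p"
proof -
  have "pd2 \<Theta> a b p = pd (dd \<Theta> (axis a 1)) (axis b 1) p"
    unfolding pd2_def by (rule pd_cong_open[OF assms(1,3) pd_eq_dd[OF smooth_differentiable[OF assms(1,2)]]])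
  then show ?thesis using pd_eq_dd[OF smooth_differentiable[OF assms(1) smooth_dd[OF assms(1,2)] assms(3)]] by simp
qed

lemma smooth_dd_commute:
  fixes \<Theta> :: "'a::euclidean_space \<Rightarrow> real"
  assumes "open U" "smooth_on \<Theta> U" "p \<in> U" shows "dd (dd \<Theta> u) v p = dd (dd \<Theta> v) u p"
  by (rule dd_commute[OF assms(1,3)]) (use assms(2) in \<open>simp add: smooth_on_def del: Ck_on.simps\<close>)

text \<open>Only the values of \<open>f\<close> on \<open>X = X\<^sub>0\<close> are known, so just
  the directions inside that slice are accessible; \<open>pd\<close> needs no more. The swap of
  indices and the sign come from \<open>x = Z'\<close> and \<open>y = - Y'\<close>. It is applied to
  \<open>\<Lambda>\<close> and then to the components of the system.\<close>

lemma pd_initial_slice: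
  fixes g :: "real^4 \<Rightarrow> real"
  assumes D: "open D" and fg: "\<And>Y P. (X\<^sub>0, Y, P) \<in> D \<Longrightarrow> f (X\<^sub>0, Y, P) = g (point_of_data Y P)"
    and q: "(X\<^sub>0, Y, P) \<in> D" and g: "g differentiable at (point_of_data Y P)"
  shows "pd f (dP 1) (X\<^sub>0, Y, P) = - dd g (axis 4 1) (point_of_data Y P)"
    and "pd f (dP 2) (X\<^sub>0, Y, P) = dd g (axis 3 1) (point_of_data Y P)"
proof -
  have ev: "\<forall>\<^sub>F t in nhds 0. (X\<^sub>0, Y, P) + t *\<^sub>R dP A \<in> D" for A
  proof -
    have "((\<lambda>t::real. (X\<^sub>0, Y, P) + t *\<^sub>R dP A) \<longlongrightarrow> (X\<^sub>0, Y, P) + 0 *\<^sub>R dP A) (nhds 0)"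
      by (intro tendsto_intros filterlim_ident)
    then show ?thesis using D q topological_tendstoD by fastforce
  qed
  have e: "pd f (dP A) (X\<^sub>0, Y, P) = pd g v (point_of_data Y P)"
    if v: "\<And>t. point_of_data Y (P + t *\<^sub>R axis A 1) = point_of_data Y P + t *\<^sub>R v" for A v
    unfolding pd_def
  proof (rule deriv_cong_ev)
    show "\<forall>\<^sub>F t in nhds 0. f ((X\<^sub>0, Y, P) + t *\<^sub>R dP A) = g (point_of_data Y P + t *\<^sub>R v)"
      using ev[of A] by eventually_elim (simp add: dP_def fg v)
  qed simp
  have "pd f (dP 1) (X\<^sub>0, Y, P) = pd g (- axis 4 1) (point_of_data Y P)"
    by (rule e) (simp add: point_of_data_def vec_eq_iff forall_4 axis_def)
  then show "pd f (dP 1) (X\<^sub>0, Y, P) = - dd g (axis 4 1) (point_of_data Y P)"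
    using pd_eq_dd[OF g] linear_neg[OF dd_linear[OF g]] by simp
  have "pd f (dP 2) (X\<^sub>0, Y, P) = pd g (axis 3 1) (point_of_data Y P)"
    by (rule e) (simp add: point_of_data_def vec_eq_iff forall_4 axis_def)
  then show "pd f (dP 2) (X\<^sub>0, Y, P) = dd g (axis 3 1) (point_of_data Y P)" using pd_eq_dd[OF g] by simp
qed

lemma point_of_data_split: "point_of_data (fst (snd (data_of_point X p))) (snd (snd (data_of_point X p))) = p"
  using point_of_jet_data[of X p] unfolding point_of_jet_def by simp

text \<open>On the slice the right-hand side is \<open>(- 2 * \<Theta>_x, - 2 * \<Theta>_y)\<close>.
  Differentiating once more by \<open>P\<close> gives the second derivatives of
  \<open>\<Theta>\<close>, which makes \<open>phi\<close> at \<open>X\<^sub>0\<close> the quadratic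
  part of the heavenly metric.\<close>

lemma Lambda_system_initial:
  assumes sol: "Lambda_solution \<Theta> U X\<^sub>0 D \<Lambda>" and U: "open U" "smooth_on \<Theta> U"
    and q: "data_of_point X\<^sub>0 p \<in> D"
  shows "p \<in> U" "dd (Lambda_system \<Lambda>) (dP 1) (data_of_point X\<^sub>0 p) $ 2 = 2 * pd2 \<Theta> 4 4 p"
    "dd (Lambda_system \<Lambda>) (dP 2) (data_of_point X\<^sub>0 p) $ 1 = - 2 * pd2 \<Theta> 3 3 p"
    "dd (Lambda_system \<Lambda>) (dP 2) (data_of_point X\<^sub>0 p) $ 2 = - 2 * pd2 \<Theta> 3 4 p"
proof -
  have D: "open D" and F: "Ck_on 5 (Lambda_system \<Lambda>) D"
    and init: "\<And>Y P. (X\<^sub>0, Y, P) \<in> D \<Longrightarrow> point_of_data Y P \<in> U \<and> \<Lambda> (X\<^sub>0, Y, P) = - \<Theta> (point_of_data Y P)"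
    using sol unfolding Lambda_solution_def by auto
  obtain Y P where YP: "data_of_point X\<^sub>0 p = (X\<^sub>0, Y, P)" unfolding data_of_point_def by blast
  have pp: "point_of_data Y P = p" using point_of_data_split[of X\<^sub>0 p] unfolding YP by simp
  show pU: "p \<in> U" using init q YP pp by auto
  have \<Theta>d: "\<Theta> differentiable at r" if "r \<in> U" for r using smooth_differentiable[OF U that] .
  have d2: "dd \<Theta> v differentiable at r" if "r \<in> U" for r v using smooth_differentiable[OF U(1) smooth_dd[OF U] that] .
  have dm: "dd (\<lambda>r. - \<Theta> r) v r = - dd \<Theta> v r" if "r \<in> U" for r v using dd_minus[OF \<Theta>d[OF that]] .
  have md: "(\<lambda>r. - \<Theta> r) differentiable at r" if "r \<in> U" for r using \<Theta>d[OF that] by (rule differentiable_minus)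
  have L1: "pd \<Lambda> (dP 1) (X\<^sub>0, Y, P) = dd \<Theta> (axis 4 1) (point_of_data Y P)"
    and L2: "pd \<Lambda> (dP 2) (X\<^sub>0, Y, P) = - dd \<Theta> (axis 3 1) (point_of_data Y P)" if "(X\<^sub>0, Y, P) \<in> D" for Y P
    using pd_initial_slice[OF D, of X\<^sub>0 \<Lambda> "\<lambda>r. - \<Theta> r", OF _ that md] init dm that by auto
  have F1: "Lambda_system \<Lambda> (X\<^sub>0, Y, P) $ 1 = - 2 * dd \<Theta> (axis 3 1) (point_of_data Y P)"
    and F2: "Lambda_system \<Lambda> (X\<^sub>0, Y, P) $ 2 = - 2 * dd \<Theta> (axis 4 1) (point_of_data Y P)" if "(X\<^sub>0, Y, P) \<in> D" for Y P
    unfolding Lambda_system_def using L1[OF that] L2[OF that] by simp_all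
  have Fd: "Lambda_system \<Lambda> differentiable at (X\<^sub>0, Y, P)"
    using Ck_on_Suc_differentiable[of 4 "Lambda_system \<Lambda>" D] F D q YP by (simp add: eval_nat_numeral del: Ck_on.simps)
  have q': "(X\<^sub>0, Y, P) \<in> D" using q YP by simp
  have sc: "dd (\<lambda>r. c * dd \<Theta> u r) v p = c * dd (dd \<Theta> u) v p" "(\<lambda>r. c * dd \<Theta> u r) differentiable at p" for c u v
    using dd_bounded_linear[OF bounded_linear_mult_right d2[OF pU]] differentiable_bounded_linear[OF bounded_linear_mult_right d2[OF pU]] by blast+
  have s1: "pd (\<lambda>r. Lambda_system \<Lambda> r $ 1) (dP 2) (X\<^sub>0, Y, P) = dd (\<lambda>r. - 2 * dd \<Theta> (axis 3 1) r) (axis 3 1) p"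
    by (rule pd_initial_slice(2)[where Y=Y and P=P and g="\<lambda>r. - 2 * dd \<Theta> (axis 3 1) r", unfolded pp, OF D]) (erule F1, rule q', rule sc(2))
  have s2: "pd (\<lambda>r. Lambda_system \<Lambda> r $ 2) (dP 1) (X\<^sub>0, Y, P) = - dd (\<lambda>r. - 2 * dd \<Theta> (axis 4 1) r) (axis 4 1) p"
    by (rule pd_initial_slice(1)[where Y=Y and P=P and g="\<lambda>r. - 2 * dd \<Theta> (axis 4 1) r", unfolded pp, OF D]) (erule F2, rule q', rule sc(2))
  have s3: "pd (\<lambda>r. Lambda_system \<Lambda> r $ 2) (dP 2) (X\<^sub>0, Y, P) = dd (\<lambda>r. - 2 * dd \<Theta> (axis 4 1) r) (axis 3 1) p"
    by (rule pd_initial_slice(2)[where Y=Y and P=P and g="\<lambda>r. - 2 * dd \<Theta> (axis 4 1) r", unfolded pp, OF D]) (erule F2, rule q', rule sc(2))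
  show "dd (Lambda_system \<Lambda>) (dP 1) (data_of_point X\<^sub>0 p) $ 2 = 2 * pd2 \<Theta> 4 4 p"
    unfolding YP pd_component[OF Fd, symmetric] s2 sc(1) smooth_pd2[OF U pU] by simp
  show "dd (Lambda_system \<Lambda>) (dP 2) (data_of_point X\<^sub>0 p) $ 1 = - 2 * pd2 \<Theta> 3 3 p"
    unfolding YP pd_component[OF Fd, symmetric] s1 sc(1) smooth_pd2[OF U pU] by simp
  show "dd (Lambda_system \<Lambda>) (dP 2) (data_of_point X\<^sub>0 p) $ 2 = - 2 * pd2 \<Theta> 3 4 p"
    unfolding YP pd_component[OF Fd, symmetric] s3 sc(1) smooth_pd2[OF U pU] using smooth_dd_commute[OF U pU] by simp
qed

text \<open>The curvature bound for the convexity argument. \<open>C\<close> is fixed before the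
  neighbourhood is shrunk, so that radii can be compared with \<open>1/C\<close>.\<close>

lemma second_derivative_bound:
  fixes H :: "'a::euclidean_space \<Rightarrow> 'b::euclidean_space"
  assumes V: "open V" "y0 \<in> V" and H: "Ck_on 2 H V"
  obtains C W where "C > 0" "open W" "y0 \<in> W" "W \<subseteq> V" "\<And>y \<Delta>. y \<in> W \<Longrightarrow> norm (dd (dd H \<Delta>) \<Delta> y) \<le> C * norm \<Delta> * norm \<Delta>"
proof -
  have H2: "Ck_on (Suc (Suc 0)) H V" using H by (simp add: numeral_2_eq_2)
  have D1: "Ck_on (Suc 0) (Dblin H) V" by (rule Ck_on_Dblin[OF V(1) H2])
  define C where "C = norm (Dblin (Dblin H) y0) + 1"
  define W where "W = {y \<in> V. norm (Dblin (Dblin H) y) < C}"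
  have c: "continuous_on V (\<lambda>y. norm (Dblin (Dblin H) y))"
    using Ck_on_1_Dblin(2)[OF V(1) D1] by (rule continuous_on_norm)
  have "W = V \<inter> (\<lambda>y. norm (Dblin (Dblin H) y)) -` {..<C}" unfolding W_def by auto
  then have W: "open W" using continuous_open_preimage[OF c V(1), of "{..<C}"] by simp
  show ?thesis
  proof (rule that[of C W])
    show "C > 0" unfolding C_def by (simp add: add_nonneg_pos)
    show "y0 \<in> W" unfolding W_def C_def using V by simp
    fix y \<Delta> assume y: "y \<in> W"
    then have yV: "y \<in> V" and n: "norm (Dblin (Dblin H) y) < C" unfolding W_def by auto
    have Dd: "Dblin H differentiable at y" by (rule Ck_on_Suc_differentiable[OF D1 V(1) yV])
    have "dd (dd H \<Delta>) \<Delta> y = dd (\<lambda>z. blinfun_apply (Dblin H z) \<Delta>) \<Delta> y"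
      by (rule dd_cong_open[OF V(1) yV]) (simp add: blinfun_apply_Dblin[OF Ck_on_Suc_differentiable[OF H2 V(1)]])
    also have "\<dots> = blinfun_apply (dd (Dblin H) \<Delta> y) \<Delta>"
      by (rule dd_bounded_linear[OF blinfun.bounded_linear_left Dd])
    also have "\<dots> = blinfun_apply (blinfun_apply (Dblin (Dblin H) y) \<Delta>) \<Delta>"
      by (simp add: blinfun_apply_Dblin[OF Dd])
    also have "norm \<dots> \<le> norm (blinfun_apply (Dblin (Dblin H) y) \<Delta>) * norm \<Delta>" by (rule norm_blinfun)
    also have "\<dots> \<le> norm (Dblin (Dblin H) y) * norm \<Delta> * norm \<Delta>" by (intro mult_right_mono norm_blinfun) auto
    also have "\<dots> \<le> C * norm \<Delta> * norm \<Delta>" using n by (intro mult_right_mono) auto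
    finally show "norm (dd (dd H \<Delta>) \<Delta> y) \<le> C * norm \<Delta> * norm \<Delta>" .
  qed (use W in \<open>auto simp: W_def\<close>)
qed

section \<open>Invariance of the quadratic form along solutions\<close>

lemma interval_min_max_subset:
  fixes I :: "real set"
  assumes "is_interval I" "x \<in> I" "y \<in> I" shows "{min x y..max x y} \<subseteq> I"
proof
  fix z assume z: "z \<in> {min x y..max x y}"
  have "min x y \<in> I" "max x y \<in> I" using assms(2,3) unfolding min_def max_def by simp_all
  then show "z \<in> I" using assms(1) z unfolding is_interval_1 by (meson atLeastAtMost_iff)
qed

text \<open>\<open>e\<close> and \<open>p\<close> are variations of \<open>Y\<close> and
  \<open>P\<close>; \<open>A\<close>, \<open>B\<close>, \<open>C\<close> play the role of the
  entries 21, 22, 12 of \<open>F_P\<close>. It serves both directions of the correspondence: for a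
  known system, and for coefficients from which the system is still to be recognised.\<close>

lemma quadratic_deriv:
  fixes e1 e2 p1 p2 A B C :: "real \<Rightarrow> real"
  assumes "(e1 has_real_derivative e1') (at X)" "(e2 has_real_derivative e2') (at X)"
    "(p1 has_real_derivative p1') (at X)" "(p2 has_real_derivative p2') (at X)"
    "(A has_real_derivative A') (at X)" "(B has_real_derivative B') (at X)" "(C has_real_derivative C') (at X)"
  shows "((\<lambda>t. e1 t * p2 t - e2 t * p1 t - A t / 2 * (e1 t)\<^sup>2 - B t * (e1 t * e2 t) + C t / 2 * (e2 t)\<^sup>2) has_real_derivative
     e1' * p2 X + e1 X * p2' - (e2' * p1 X + e2 X * p1') - (A' / 2 * (e1 X)\<^sup>2 + A X * e1 X * e1')
     - (B' * (e1 X * e2 X) + B X * (e1' * e2 X + e1 X * e2')) + (C' / 2 * (e2 X)\<^sup>2 + C X * e2 X * e2')) (at X)"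
  unfolding power2_eq_square
  by (rule DERIV_cong[OF DERIV_add[OF DERIV_diff[OF DERIV_diff[OF DERIV_diff[OF DERIV_mult[OF assms(1,4)] DERIV_mult[OF assms(2,3)]]
    DERIV_mult[OF DERIV_cdivide[OF assms(5)] DERIV_mult[OF assms(1,1)]]] DERIV_mult[OF assms(6) DERIV_mult[OF assms(1,2)]]]
    DERIV_mult[OF DERIV_cdivide[OF assms(7)] DERIV_mult[OF assms(2,2)]]]]) (simp add: algebra_simps)

text \<open>\<open>cc (X, p)\<close> is the jet at \<open>X\<close> of the solution whose jet at \<open>X\<^sub>0\<close> is \<open>data_of_point X\<^sub>0 p\<close>.\<close>

locale solution_patch =
  fixes \<Theta> :: "real^4 \<Rightarrow> real" and U :: "(real^4) set" and X\<^sub>0 :: real and D :: "jet set" and \<Lambda> :: "jet \<Rightarrow> real"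
    and cc :: "real \<times> (real^4) \<Rightarrow> jet" and I\<^sub>0 :: "real set" and N\<^sub>0 :: "(real^4) set" and p\<^sub>0 :: "real^4"
  assumes U: "open U" "smooth_on \<Theta> U" and sol: "Lambda_solution \<Theta> U X\<^sub>0 D \<Lambda>"
    and I0: "open I\<^sub>0" "is_interval I\<^sub>0" "X\<^sub>0 \<in> I\<^sub>0" and N0: "open N\<^sub>0" "p\<^sub>0 \<in> N\<^sub>0" "N\<^sub>0 \<subseteq> U"
    and cc2: "Ck_on 2 cc (I\<^sub>0 \<times> N\<^sub>0)" and cc_fst: "\<And>q. fst (cc q) = fst q"
    and cc_D: "\<And>q. q \<in> I\<^sub>0 \<times> N\<^sub>0 \<Longrightarrow> cc q \<in> D"
    and cc_flow: "\<And>q. q \<in> I\<^sub>0 \<times> N\<^sub>0 \<Longrightarrow> dd cc (1, 0) q = jet_field (Lambda_system \<Lambda>) (cc q)"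
    and cc_init: "\<And>p. p \<in> N\<^sub>0 \<Longrightarrow> cc (X\<^sub>0, p) = data_of_point X\<^sub>0 p"

sublocale solution_patch \<subseteq> jet_system "Lambda_system \<Lambda>" D
  by (rule Lambda_solution_jet_system[OF sol])

context solution_patch
begin

abbreviation F where "F \<equiv> Lambda_system \<Lambda>"
abbreviation \<Omega>\<^sub>0 where "\<Omega>\<^sub>0 \<equiv> I\<^sub>0 \<times> N\<^sub>0"

definition gam where "gam q = fst (snd (cc q))"
definition gam' where "gam' q = snd (snd (cc q))"

lemma cc_eq: "cc q = (fst q, gam q, gam' q)"
  by (simp add: gam_def gam'_def cc_fst[symmetric])

lemma \<Omega>: "open \<Omega>\<^sub>0" using I0 N0 by (intro open_Times)

lemma base: "(X\<^sub>0, p\<^sub>0) \<in> \<Omega>\<^sub>0" using I0 N0 by simp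

lemma cc2': "Ck_on (Suc (Suc 0)) cc \<Omega>\<^sub>0" using cc2 by (simp add: numeral_2_eq_2)

lemma gam2: "Ck_on (Suc (Suc 0)) gam \<Omega>\<^sub>0" "Ck_on (Suc (Suc 0)) gam' \<Omega>\<^sub>0"
  unfolding gam_def gam'_def by (intro Ck_on_fst[OF \<Omega>] Ck_on_snd[OF \<Omega>] cc2')+

lemma diffs: "q \<in> \<Omega>\<^sub>0 \<Longrightarrow> cc differentiable at q" "q \<in> \<Omega>\<^sub>0 \<Longrightarrow> gam differentiable at q" "q \<in> \<Omega>\<^sub>0 \<Longrightarrow> gam' differentiable at q"
  "q \<in> \<Omega>\<^sub>0 \<Longrightarrow> dd gam v differentiable at q" "q \<in> \<Omega>\<^sub>0 \<Longrightarrow> dd gam' v differentiable at q"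
  using Ck_on_Suc_differentiable[OF cc2' \<Omega>] Ck_on_Suc_differentiable[OF gam2(1) \<Omega>] Ck_on_Suc_differentiable[OF gam2(2) \<Omega>]
    Ck_on_Suc_differentiable[OF Ck_on_dd[OF \<Omega> gam2(1)] \<Omega>] Ck_on_Suc_differentiable[OF Ck_on_dd[OF \<Omega> gam2(2)] \<Omega>] by blast+

lemma dd_cc: "q \<in> \<Omega>\<^sub>0 \<Longrightarrow> dd cc v q = (fst v, dd gam v q, dd gam' v q)"
proof -
  assume q: "q \<in> \<Omega>\<^sub>0"
  have "((\<lambda>q. (fst q, gam q, gam' q)) has_derivative (\<lambda>v. (fst v, dd gam v q, dd gam' v q))) (at q)"
    by (rule has_derivative_Pair[OF has_derivative_fst[OF has_derivative_ident]
          has_derivative_Pair[OF has_derivative_dd[OF diffs(2)[OF q]] has_derivative_dd[OF diffs(3)[OF q]]]])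
  from dd_eqI[OF this[unfolded cc_eq[symmetric]]] show ?thesis .
qed

lemma dX_gam: "q \<in> \<Omega>\<^sub>0 \<Longrightarrow> dd gam (1, 0) q = gam' q" "q \<in> \<Omega>\<^sub>0 \<Longrightarrow> dd gam' (1, 0) q = F (cc q)"
  using cc_flow[of q] dd_cc[of q "(1, 0)"] by (simp_all add: jet_field_def gam'_def[of q])

lemma line_X:
  assumes "f differentiable at (X, p)"
  shows "((\<lambda>t. f (t, p)) has_vector_derivative dd f (1, 0) (X, p)) (at X)"
  using has_vector_derivative_line[of f "(0, p)" X "(1, 0)"] assms by simp

text \<open>Exchanging the derivatives in \<open>X\<close> and \<open>p\<close> shows that the
  variations of \<open>gam\<close> and \<open>gam'\<close> solve the linearised system: they are the
  Jacobi fields along a solution.\<close>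

lemma dXv:
  assumes q: "q \<in> \<Omega>\<^sub>0"
  shows "dd (dd gam (0, v)) (1, 0) q = dd gam' (0, v) q"
    and "dd (dd gam' (0, v)) (1, 0) q = dd F (0, dd gam (0, v) q, dd gam' (0, v) q) (cc q)"
proof -
  have "dd (dd gam (0, v)) (1, 0) q = dd (dd gam (1, 0)) (0, v) q"
    by (rule dd_commute[OF \<Omega> q]) (use gam2 in \<open>simp add: numeral_2_eq_2 del: Ck_on.simps\<close>)
  also have "\<dots> = dd gam' (0, v) q" by (rule dd_cong_open[OF \<Omega> q dX_gam(1)])
  finally show "dd (dd gam (0, v)) (1, 0) q = dd gam' (0, v) q" .
  have "dd (dd gam' (0, v)) (1, 0) q = dd (dd gam' (1, 0)) (0, v) q"
    by (rule dd_commute[OF \<Omega> q]) (use gam2 in \<open>simp add: numeral_2_eq_2 del: Ck_on.simps\<close>)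
  also have "\<dots> = dd (\<lambda>q. F (cc q)) (0, v) q" by (rule dd_cong_open[OF \<Omega> q dX_gam(2)])
  also have "\<dots> = dd F (dd cc (0, v) q) (cc q)" by (rule dd_compose[OF F_diff[OF cc_D[OF q]] diffs(1)[OF q]])
  finally show "dd (dd gam' (0, v)) (1, 0) q = dd F (0, dd gam (0, v) q, dd gam' (0, v) q) (cc q)"
    using dd_cc[OF q] by simp
qed

text \<open>The form \<open>\<epsilon> dY dP + \<phi> dY dY\<close> pulled back to the solution
  space and evaluated on \<open>v\<close>, with \<open>\<phi>\<close> written through
  \<open>F_P\<close>. Its \<open>Y'Z'\<close>-type cross term has coefficient
  \<open>2 * phi F 1 2\<close>.\<close>

definition Q where "Q v q = dd gam (0, v) q $ 1 * dd gam' (0, v) q $ 2 - dd gam (0, v) q $ 2 * dd gam' (0, v) q $ 1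
   - dd F (dP 1) (cc q) $ 2 / 2 * (dd gam (0, v) q $ 1)\<^sup>2
   - dd F (dP 2) (cc q) $ 2 * (dd gam (0, v) q $ 1 * dd gam (0, v) q $ 2)
   + dd F (dP 2) (cc q) $ 1 / 2 * (dd gam (0, v) q $ 2)\<^sup>2"

text \<open>Along a Jacobi field the products of \<open>y\<close> and \<open>p\<close> cancel
  because \<open>F_P\<close> is trace-free, and the products of two components of \<open>y\<close>
  cancel by the evolution equation of \<open>phi\<close>.\<close>

lemma Q_const_deriv:
  assumes q: "(X, p) \<in> \<Omega>\<^sub>0"
  shows "((\<lambda>t. Q v (t, p)) has_real_derivative 0) (at X)"
proof -
  let ?q = "(X, p)"
  have r: "cc ?q \<in> D" by (rule cc_D[OF q])
  have comp: "((\<lambda>t. f (t, p) $ i) has_real_derivative (dd f (1, 0) ?q) $ i) (at X)" if "f differentiable at ?q" for f :: "_ \<Rightarrow> real^2" and i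
    using bounded_linear.has_vector_derivative[OF bounded_linear_vec_nth line_X[OF that]]
    by (simp add: has_real_derivative_iff_has_vector_derivative)
  have Fc: "((\<lambda>t. dd F w (cc (t, p)) $ i) has_real_derivative dd (\<lambda>r. dd F w r $ i) (jet_field F (cc ?q)) (cc ?q)) (at X)" for w i
  proof -
    have c: "((\<lambda>t. cc (t, p)) has_vector_derivative jet_field F (cc ?q)) (at X)"
      using line_X[OF diffs(1)[OF q]] cc_flow[OF q] by simp
    have d: "(\<lambda>r. dd F w r $ i) differentiable at (cc ?q)" by (rule dF_diff[OF r])
    from has_derivative_compose[OF c[unfolded has_vector_derivative_def] has_derivative_dd[OF d]]
    show ?thesis unfolding has_field_derivative_def by (simp add: linear_scale[OF dd_linear[OF d]] mult_commute_abs)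
  qed
  note g1 = comp[OF diffs(4)[OF q, of "(0, v)"], unfolded dXv[OF q]] and g2 = comp[OF diffs(5)[OF q, of "(0, v)"], unfolded dXv[OF q]]
  have eqs: "phi_equation F (cc ?q)" using sol r unfolding Lambda_solution_def by blast
  note e = eqs[unfolded phi_equation_iff[OF r]]
  note dQ = quadratic_deriv[OF g1[of 1] g1[of 2] g2[of 1] g2[of 2] Fc[of "dP 1" 2] Fc[of "dP 2" 2] Fc[of "dP 2" 1]]
  show ?thesis
    unfolding Q_def
    by (rule DERIV_cong[OF dQ], unfold dd_jet_expand[OF F_diff[OF r]] e[THEN conjunct1] e[THEN conjunct2, THEN conjunct1] e[THEN conjunct2, THEN conjunct2])
       (simp add: trace2[OF r] algebra_simps power2_eq_square)
qed

lemma Q_const: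
  assumes "X \<in> I\<^sub>0" "p \<in> N\<^sub>0" shows "Q v (X, p) = Q v (X\<^sub>0, p)"
proof -
  define a b where "a = min X\<^sub>0 X" and "b = max X\<^sub>0 X"
  have ab: "{a..b} \<subseteq> I\<^sub>0" "a \<le> b" using interval_min_max_subset[OF I0(2,3) assms(1)] unfolding a_def b_def by auto
  have "\<exists>c. \<forall>x\<in>{a..b}. Q v (x, p) = c"
  proof (rule has_field_derivative_zero_constant)
    show "((\<lambda>t. Q v (t, p)) has_real_derivative 0) (at x within {a..b})" if "x \<in> {a..b}" for x
      by (rule has_field_derivative_at_within[OF Q_const_deriv]) (use that ab assms in auto)
  qed simp
  moreover have "X \<in> {a..b}" "X\<^sub>0 \<in> {a..b}" unfolding a_def b_def by auto
  ultimately show ?thesis by metis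
qed

lemma dd_gam_initial:
  assumes p: "p \<in> N\<^sub>0"
  shows "dd gam (0, v) (X\<^sub>0, p) = vector [v$1, v$2]" "dd gam' (0, v) (X\<^sub>0, p) = vector [- v$4, v$3]"
proof -
  have q: "(X\<^sub>0, p) \<in> \<Omega>\<^sub>0" using p I0 by simp
  have "((\<lambda>p. (X\<^sub>0, p)) has_derivative (\<lambda>v. (0, v))) (at p)" by (auto intro!: derivative_eq_intros)
  from has_derivative_compose[OF this has_derivative_dd[OF diffs(1)[OF q]]]
  have 1: "((\<lambda>p. cc (X\<^sub>0, p)) has_derivative (\<lambda>v. dd cc (0, v) (X\<^sub>0, p))) (at p)" .
  have b: "bounded_linear (\<lambda>q. data_of_point (fst q) (snd q))" by (rule bounded_linear_data_of_point)
  have "((\<lambda>p. (X\<^sub>0, p)) has_derivative (\<lambda>v. (0, v))) (at p)" by (auto intro!: derivative_eq_intros)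
  from bounded_linear.has_derivative[OF b this]
  have 2: "((\<lambda>p. data_of_point X\<^sub>0 p) has_derivative (\<lambda>v. data_of_point 0 v)) (at p)" by simp
  have "((\<lambda>p. cc (X\<^sub>0, p)) has_derivative (\<lambda>v. data_of_point 0 v)) (at p)"
    by (rule has_derivative_transform_within_open[OF 2 N0(1) p]) (use cc_init in simp)
  from has_derivative_unique[OF this 1] have "data_of_point 0 v = dd cc (0, v) (X\<^sub>0, p)" by (rule fun_cong)
  then show "dd gam (0, v) (X\<^sub>0, p) = vector [v$1, v$2]" "dd gam' (0, v) (X\<^sub>0, p) = vector [- v$4, v$3]"
    unfolding dd_cc[OF q] data_of_point_def by auto
qed

lemma Q_eq:
  assumes "X \<in> I\<^sub>0" "p \<in> N\<^sub>0" shows "Q v (X, p) = heavenly_form \<Theta> p v"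
proof -
  have "data_of_point X\<^sub>0 p \<in> D" using cc_D[of "(X\<^sub>0, p)"] cc_init[OF assms(2)] assms I0 by simp
  note L = Lambda_system_initial[OF sol U this]
  show ?thesis unfolding Q_const[OF assms] unfolding Q_def cc_init[OF assms(2)] dd_gam_initial[OF assms(2)] L heavenly_form_def
    by (simp add: algebra_simps power2_eq_square)
qed

end

section \<open>Charts, neighbourhoods and the proof of the correspondence\<close>

lemma open_norm_less:
  fixes f :: "'a::real_normed_vector \<Rightarrow> 'b::real_normed_vector"
  assumes "open S" "continuous_on S f" shows "open {q \<in> S. norm (f q - c) < e}"
proof -
  have "{q \<in> S. norm (f q - c) < e} = S \<inter> f -` ball c e" by (auto simp: dist_norm norm_minus_commute)
  then show ?thesis using continuous_open_preimage[OF assms(2,1) open_ball] by simp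
qed

lemma norm_vec4_le: "norm (v :: real^4) \<le> \<bar>v$1\<bar> + \<bar>v$2\<bar> + \<bar>v$3\<bar> + \<bar>v$4\<bar>"
  using norm_le_l1_cart[of v] by (simp add: sum_4)

lemma ball_times_subset:
  fixes a :: "'a::metric_space" and b :: "'b::metric_space"
  assumes "open W" "(a, b) \<in> W"
  obtains e where "e > 0" "ball a e \<times> ball b e \<subseteq> W"
proof -
  obtain A B where AB: "open A" "open B" "(a, b) \<in> A \<times> B" "A \<times> B \<subseteq> W" using open_prod_elim[OF assms] by metis
  obtain r where r: "r > 0" "ball a r \<subseteq> A" using AB open_contains_ball by (metis mem_Sigma_iff)
  obtain s where s: "s > 0" "ball b s \<subseteq> B" using AB open_contains_ball by (metis mem_Sigma_iff)
  have "ball a (min r s) \<subseteq> A" "ball b (min r s) \<subseteq> B" using r s by (auto simp: subset_iff)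
  then have "ball a (min r s) \<times> ball b (min r s) \<subseteq> W" using AB(4) by blast
  then show ?thesis using that[of "min r s"] r s by simp
qed

context solution_patch
begin

text \<open>The jet map in the coordinates \<open>(X, w, z, x, y)\<close>. At
  \<open>X = X\<^sub>0\<close> it is the identity, so nearby it is a small perturbation of
  it.\<close>

definition Kt where "Kt q = point_of_jet (cc q)"

definition Gl1 :: "real^2 \<Rightarrow> real \<times> (real^4)" where "Gl1 y = (0, vector [y$1, y$2, 0, 0])"
definition Gl2 :: "real \<times> (real^4) \<Rightarrow> real \<times> (real^4)" where "Gl2 q = (fst q, vector [0, 0, snd q $ 3, snd q $ 4])"
text \<open>Replaces \<open>w, z\<close> by the values of \<open>gam\<close> and keeps
  \<open>X, x, y\<close>. In this chart the fibres of \<open>gam (X, _)\<close> are affine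
  planes.\<close>

definition Gt where "Gt q = Gl1 (gam q) + Gl2 q"

lemma bl: "bounded_linear Gl1" "bounded_linear Gl2"
  unfolding Gl1_def Gl2_def linear_conv_bounded_linear[symmetric]
  by (auto intro!: linearI simp: vec_eq_iff forall_4)

lemma Kt2: "Ck_on (Suc (Suc 0)) Kt \<Omega>\<^sub>0"
  unfolding Kt_def by (rule Ck_on_bounded_linear_comp[OF bounded_linear_point_of_jet \<Omega> cc2'])

lemma Gt2: "Ck_on (Suc (Suc 0)) Gt \<Omega>\<^sub>0"
  unfolding Gt_def by (rule Ck_on_add[OF \<Omega> Ck_on_bounded_linear_comp[OF bl(1) \<Omega> gam2(1)] Ck_on_bounded_linear[OF bl(2) \<Omega>]])

lemma dd_Kt: "q \<in> \<Omega>\<^sub>0 \<Longrightarrow> dd Kt v q = point_of_jet (dd cc v q)"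
  unfolding Kt_def by (rule dd_bounded_linear[OF bounded_linear_point_of_jet diffs(1)])

lemma dd_Gt: "q \<in> \<Omega>\<^sub>0 \<Longrightarrow> dd Gt v q = Gl1 (dd gam v q) + Gl2 v"
  unfolding Gt_def
  by (rule dd_eqI[OF has_derivative_add[OF bounded_linear.has_derivative[OF bl(1) has_derivative_dd[OF diffs(2)]]
     bounded_linear_imp_has_derivative[OF bl(2)]]])

lemma Gt_eqs: "fst (Gt q) = fst q" "snd (Gt q) = vector [gam q $ 1, gam q $ 2, snd q $ 3, snd q $ 4]"
  unfolding Gt_def Gl1_def Gl2_def by (simp_all add: vec_eq_iff forall_4)

lemma Kt_eqs: "Kt q = (fst q, vector [gam q $ 1, gam q $ 2, gam' q $ 2, - gam' q $ 1])"
  unfolding Kt_def point_of_jet_def point_of_data_def by (simp add: cc_eq)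

lemma Kt_inj: "dd Kt v (X\<^sub>0, p\<^sub>0) = 0 \<Longrightarrow> v = 0"
proof -
  assume z: "dd Kt v (X\<^sub>0, p\<^sub>0) = 0"
  have "dd cc v (X\<^sub>0, p\<^sub>0) = data_of_point (fst (dd Kt v (X\<^sub>0, p\<^sub>0))) (snd (dd Kt v (X\<^sub>0, p\<^sub>0)))"
    unfolding dd_Kt[OF base] by simp
  then have "dd cc v (X\<^sub>0, p\<^sub>0) = 0" unfolding z by (simp add: data_of_point_def vec_eq_iff forall_2 zero_prod_def)
  then have *: "fst v = 0" "dd gam v (X\<^sub>0, p\<^sub>0) = 0" "dd gam' v (X\<^sub>0, p\<^sub>0) = 0" unfolding dd_cc[OF base] by (auto simp: zero_prod_def)
  then have v: "v = (0, snd v)" by (cases v) simp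
  show "v = 0" using *(2,3) dd_gam_initial[OF N0(2), of "snd v"] v[symmetric]
    by (cases v) (auto simp: vec_eq_iff forall_2 forall_4 zero_prod_def)
qed

lemma Gt_inj: "dd Gt v (X\<^sub>0, p\<^sub>0) = 0 \<Longrightarrow> v = 0"
proof -
  assume z: "dd Gt v (X\<^sub>0, p\<^sub>0) = 0"
  then have f: "fst v = 0" unfolding dd_Gt[OF base] Gl1_def Gl2_def by (simp add: zero_prod_def)
  then have v: "v = (0, snd v)" by (cases v) simp
  have "snd (dd Gt v (X\<^sub>0, p\<^sub>0)) $ i = 0" for i using z by simp
  from this[of 1] this[of 2] this[of 3] this[of 4]
  show "v = 0" unfolding dd_Gt[OF base] Gl1_def Gl2_def using dd_gam_initial(1)[OF N0(2), of "snd v"] v[symmetric]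
    by (cases v) (auto simp: vec_eq_iff forall_2 forall_4 zero_prod_def)
qed

definition E1 where "E1 q = (0::real, vector [1, 0, pd2 \<Theta> 4 4 (snd q), - pd2 \<Theta> 3 4 (snd q)] :: real^4)"
definition E2 where "E2 q = (0::real, vector [0, 1, - pd2 \<Theta> 3 4 (snd q), pd2 \<Theta> 3 3 (snd q)] :: real^4)"
text \<open>The determinant required by \<open>null_kernel_alpha_plane\<close>, taken at
  \<open>(X, p)\<close>. It is 1 at the base point, hence nonzero near it.\<close>

definition dt where "dt q = dd gam (E1 q) q $ 1 * dd gam (E2 q) q $ 2 - dd gam (E2 q) q $ 1 * dd gam (E1 q) q $ 2"

lemma dt_cont: "continuous_on \<Omega>\<^sub>0 dt"
proof -
  have pc: "Ck_on (Suc 0) (\<lambda>q. pd2 \<Theta> a b (snd q)) \<Omega>\<^sub>0" for a b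
  proof -
    have "smooth_on (dd (dd \<Theta> (axis a 1)) (axis b 1)) U" by (intro smooth_dd U)
    then have "Ck_on (Suc 0) (dd (dd \<Theta> (axis a 1)) (axis b 1)) U" unfolding smooth_on_def by blast
    from Ck_on_compose[OF \<Omega> U(1) this Ck_on_snd[OF \<Omega> Ck_on_id[OF \<Omega>]]]
    have "Ck_on (Suc 0) (\<lambda>q. dd (dd \<Theta> (axis a 1)) (axis b 1) (snd q)) \<Omega>\<^sub>0" using N0(3) by auto
    then show ?thesis by (rule Ck_on_cong[OF \<Omega>, rotated]) (use smooth_pd2[OF U] N0(3) in auto)
  qed
  have "Ck_on (Suc 0) E1 \<Omega>\<^sub>0" "Ck_on (Suc 0) E2 \<Omega>\<^sub>0" unfolding E1_def E2_def
    by (intro Ck_on_Pair[OF \<Omega>] Ck_on_vector_4[OF \<Omega>] Ck_on_const[OF \<Omega>] Ck_on_minus[OF \<Omega>] pc)+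
  from Ck_on_dd_var[OF \<Omega> gam2(1) this(1)] Ck_on_dd_var[OF \<Omega> gam2(1) this(2)]
  have "Ck_on (Suc 0) dt \<Omega>\<^sub>0" unfolding dt_def
    by (intro Ck_on_diff[OF \<Omega>] Ck_on_mult[OF \<Omega>] Ck_on_vec_nth[OF \<Omega>])
  then show ?thesis by (rule Ck_on_continuous[OF _ \<Omega>])
qed

lemma dt_base: "dt (X\<^sub>0, p\<^sub>0) = 1"
  unfolding dt_def E1_def E2_def by (simp add: dd_gam_initial[OF N0(2)])

text \<open>Each term of \<open>Q v\<close> contains a component of \<open>dd gam (0, v)\<close>, so
  the kernel is null for \<open>Q\<close>, which by \<open>Q_eq\<close> is the heavenly form at
  every \<open>X\<close>.\<close>

lemma alpha_plane_kernel:
  assumes q: "(X, p) \<in> \<Omega>\<^sub>0" and dt: "dt (X, p) \<noteq> 0"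
  shows "alpha_plane (heavenly_metric \<Theta> p) {v. dd gam (0, v) (X, p) = 0}" "surj (\<lambda>v. dd gam (0, v) (X, p))"
proof -
  have lin: "linear (\<lambda>v. dd gam (0, v) (X, p))"
  proof -
    have l: "linear (\<lambda>v. dd gam v (X, p))" by (rule dd_linear[OF diffs(2)[OF q]])
    show ?thesis using linear_add[OF l, of "(0, _)" "(0, _)"] linear_scale[OF l, of _ "(0, _)"] by (intro linearI) simp_all
  qed
  have null: "v$1 * (v$3 - pd2 \<Theta> 4 4 p * v$1 + pd2 \<Theta> 3 4 p * v$2) + v$2 * (v$4 + pd2 \<Theta> 3 4 p * v$1 - pd2 \<Theta> 3 3 p * v$2) = 0"
    if "dd gam (0, v) (X, p) = 0" for v
  proof -
    have "heavenly_form \<Theta> p v = Q v (X, p)" using Q_eq[of X p v] q by simp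
    also have "\<dots> = 0" unfolding Q_def that by simp
    finally show ?thesis unfolding heavenly_form_def by (simp add: algebra_simps power2_eq_square)
  qed
  show "alpha_plane (heavenly_metric \<Theta> p) {v. dd gam (0, v) (X, p) = 0}" "surj (\<lambda>v. dd gam (0, v) (X, p))"
    unfolding heavenly_metric_eq
    using null_kernel_alpha_plane[OF lin _ null] dt unfolding dt_def E1_def E2_def by simp_all
qed

lemma line_p:
  assumes "f differentiable at (X, p)"
  shows "((\<lambda>p. f (X, p)) has_derivative (\<lambda>v. dd f (0, v) (X, p))) (at p)"
proof -
  have "((\<lambda>p. (X, p)) has_derivative (\<lambda>v. (0, v))) (at p)" by (auto intro!: derivative_eq_intros)
  from has_derivative_compose[OF this has_derivative_dd[OF assms]] show ?thesis .
qed

text \<open>The squared distance from \<open>p\<^sub>0\<close> is convex along the images of segments in the chart \<open>(X, gam, x, y)\<close>,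
  so the fibres of \<open>gam (X, _)\<close> in a small ball are connected.\<close>

theorem corresponds: "corresponds_near (heavenly_metric \<Theta>) U F D p\<^sub>0 (data_of_point X\<^sub>0 p\<^sub>0)"
proof -
  obtain U1 V1 g1 where 1: "open U1" "U1 \<subseteq> \<Omega>\<^sub>0" "(X\<^sub>0, p\<^sub>0) \<in> U1" "open V1" "Kt (X\<^sub>0, p\<^sub>0) \<in> V1" "Kt ` U1 = V1" "g1 ` V1 = U1"
    "\<And>x. x \<in> U1 \<Longrightarrow> g1 (Kt x) = x" "\<And>y. y \<in> V1 \<Longrightarrow> Kt (g1 y) = y" "Ck_on (Suc (Suc 0)) g1 V1"
    by (rule Ck_inverse_function_theorem[OF \<Omega> base Kt2 Kt_inj], assumption, rule that)
  obtain U2 V2 H where 2: "open U2" "U2 \<subseteq> \<Omega>\<^sub>0" "(X\<^sub>0, p\<^sub>0) \<in> U2" "open V2" "Gt (X\<^sub>0, p\<^sub>0) \<in> V2" "Gt ` U2 = V2" "H ` V2 = U2"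
    "\<And>x. x \<in> U2 \<Longrightarrow> H (Gt x) = x" "\<And>y. y \<in> V2 \<Longrightarrow> Gt (H y) = y" "Ck_on (Suc (Suc 0)) H V2"
    by (rule Ck_inverse_function_theorem[OF \<Omega> base Gt2 Gt_inj], assumption, rule that)
  \<comment> \<open>The deviation of the jet map from the identity in \<open>p\<close>; its
    \<open>p\<close>-derivative vanishes at the base point.\<close>
  define K' where "K' q = snd (Kt q) - snd q" for q
  have K'2: "Ck_on (Suc (Suc 0)) K' \<Omega>\<^sub>0"
    unfolding K'_def by (intro Ck_on_diff[OF \<Omega>] Ck_on_snd[OF \<Omega>] Kt2 Ck_on_id[OF \<Omega>])
  have K'd: "K' differentiable at q" if "q \<in> \<Omega>\<^sub>0" for q by (rule Ck_on_Suc_differentiable[OF K'2 \<Omega> that])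
  have K'0: "dd K' (0, v) (X\<^sub>0, p\<^sub>0) = 0" for v
  proof -
    have "dd K' (0, v) (X\<^sub>0, p\<^sub>0) = snd (dd Kt (0, v) (X\<^sub>0, p\<^sub>0)) - v"
    proof -
      have "((\<lambda>q. snd (Kt q) - snd q) has_derivative (\<lambda>w. snd (dd Kt w (X\<^sub>0, p\<^sub>0)) - snd w)) (at (X\<^sub>0, p\<^sub>0))"
        by (intro has_derivative_diff has_derivative_snd has_derivative_ident has_derivative_dd Ck_on_Suc_differentiable[OF Kt2 \<Omega> base])
      from dd_eqI[OF this] show ?thesis unfolding K'_def by simp
    qed
    also have "\<dots> = 0" unfolding dd_Kt[OF base] dd_cc[OF base] dd_gam_initial[OF N0(2)]
      by (simp add: point_of_jet_def point_of_data_def vec_eq_iff forall_4)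
    finally show ?thesis .
  qed
  \<comment> \<open>With 1/8, four components bounded by \<open>norm d / 8\<close> add up to half of
    \<open>norm d\<close>, which forces \<open>d = 0\<close> in \<open>unique_pt\<close>.\<close>
  define W1 where "W1 = {q \<in> \<Omega>\<^sub>0. norm (Dblin K' q - Dblin K' (X\<^sub>0, p\<^sub>0)) < 1/8}"
  have W1: "open W1" "(X\<^sub>0, p\<^sub>0) \<in> W1" "W1 \<subseteq> \<Omega>\<^sub>0"
    unfolding W1_def by (rule open_norm_less[OF \<Omega> Ck_on_1_Dblin(2)[OF \<Omega> K'2]]) (use base in auto)
  have W1b: "norm (dd K' (0, v) q) \<le> 1/8 * norm v" if "q \<in> W1" for q v
  proof -
    have q: "q \<in> \<Omega>\<^sub>0" "norm (Dblin K' q - Dblin K' (X\<^sub>0, p\<^sub>0)) \<le> 1/8" using that unfolding W1_def by auto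
    have "dd K' (0, v) q = blinfun_apply (Dblin K' q - Dblin K' (X\<^sub>0, p\<^sub>0)) (0, v)"
      unfolding blinfun.diff_left blinfun_apply_Dblin[OF K'd[OF q(1)]] blinfun_apply_Dblin[OF K'd[OF base]] K'0 by simp
    also have "norm \<dots> \<le> norm (Dblin K' q - Dblin K' (X\<^sub>0, p\<^sub>0)) * norm (0::real, v)" by (rule norm_blinfun)
    also have "\<dots> \<le> 1/8 * norm v" using mult_right_mono[OF q(2) norm_ge_zero[of v]] by (simp add: norm_Pair)
    finally show ?thesis .
  qed
  define W2 where "W2 = {q \<in> \<Omega>\<^sub>0. norm (dt q - dt (X\<^sub>0, p\<^sub>0)) < 1}"
  have W2: "open W2" "(X\<^sub>0, p\<^sub>0) \<in> W2" "\<And>q. q \<in> W2 \<Longrightarrow> dt q \<noteq> 0"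
    unfolding W2_def using open_norm_less[OF \<Omega> dt_cont] base by (auto simp: dt_base)
  define b0 where "b0 = Gt (X\<^sub>0, p\<^sub>0)"
  have b0V: "b0 \<in> V2" unfolding b0_def by (rule 2(5))
  have H2: "Ck_on 2 H V2" using 2(10) by (simp add: numeral_2_eq_2)
  obtain C W where W: "C > 0" "open W" "b0 \<in> W" "W \<subseteq> V2" "\<And>y \<Delta>. y \<in> W \<Longrightarrow> norm (dd (dd H \<Delta>) \<Delta> y) \<le> C * norm \<Delta> * norm \<Delta>"
    by (rule second_derivative_bound[OF 2(4) b0V H2]) (rule that)
  have Hc: "continuous_on W H" using Ck_on_continuous[OF H2 2(4)] W(4) continuous_on_subset by blast
  \<comment> \<open>Within distance \<open>1/C\<close> of \<open>p\<^sub>0\<close> the curvature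
    term of the squared distance cannot exceed the square of the speed.\<close>
  have "open {y \<in> W. norm (snd (H y) - p\<^sub>0) < 1/C}" by (rule open_norm_less[OF W(2) continuous_on_snd[OF Hc]])
  moreover have "b0 \<in> {y \<in> W. norm (snd (H y) - p\<^sub>0) < 1/C}" using W(1,3) 2(8)[OF 2(3)] unfolding b0_def by simp
  ultimately obtain e0 where e0: "e0 > 0" "ball b0 e0 \<subseteq> {y \<in> W. norm (snd (H y) - p\<^sub>0) < 1/C}" using open_contains_ball by blast
  define W3 where "W3 = {q \<in> \<Omega>\<^sub>0. norm (Gt q - b0) < e0}"
  have W3: "open W3" "(X\<^sub>0, p\<^sub>0) \<in> W3"
    unfolding W3_def using open_norm_less[OF \<Omega> Ck_on_continuous[OF Gt2 \<Omega>]] base e0(1) by (auto simp: b0_def)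
  have "open (U1 \<inter> U2 \<inter> W1 \<inter> W2 \<inter> W3)" "(X\<^sub>0, p\<^sub>0) \<in> U1 \<inter> U2 \<inter> W1 \<inter> W2 \<inter> W3"
    using 1(1,3) 2(1,3) W1 W2 W3 by auto
  from ball_times_subset[OF this] obtain r where r: "r > 0" "ball X\<^sub>0 r \<times> ball p\<^sub>0 r \<subseteq> U1 \<inter> U2 \<inter> W1 \<inter> W2 \<inter> W3" by blast
  define I M where "I = ball X\<^sub>0 r" and "M = ball p\<^sub>0 r"
  have IM: "I \<times> M \<subseteq> U1" "I \<times> M \<subseteq> U2" "I \<times> M \<subseteq> W1" "I \<times> M \<subseteq> W2" "I \<times> M \<subseteq> W3" "I \<times> M \<subseteq> \<Omega>\<^sub>0"
    and oI: "open I" "X\<^sub>0 \<in> I" and oM: "open M" "p\<^sub>0 \<in> M" "convex M"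
    using r 1(2) unfolding I_def M_def by auto
  have in\<Omega>: "(X, p) \<in> \<Omega>\<^sub>0" if "X \<in> I" "p \<in> M" for X p using IM(6) that by blast
  have oIM: "open (I \<times> M)" using oI oM by (intro open_Times)
  have iI: "is_interval I" unfolding I_def by (rule is_interval_ball_real)
  define J where "J = cc ` (I \<times> M)"
  have Jeq: "J = {q. point_of_jet q \<in> V1 \<and> g1 (point_of_jet q) \<in> I \<times> M}"
  proof (intro equalityI subsetI)
    fix q assume "q \<in> J"
    then obtain z where z: "z \<in> I \<times> M" "q = cc z" unfolding J_def by blast
    then show "q \<in> {q. point_of_jet q \<in> V1 \<and> g1 (point_of_jet q) \<in> I \<times> M}"
      using IM(1) 1(6) 1(8)[of z] unfolding Kt_def by auto
  next
    fix q assume q: "q \<in> {q. point_of_jet q \<in> V1 \<and> g1 (point_of_jet q) \<in> I \<times> M}"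
    then have "point_of_jet (cc (g1 (point_of_jet q))) = point_of_jet q" using 1(9) unfolding Kt_def by blast
    then have "cc (g1 (point_of_jet q)) = q" using data_point_of_jet by metis
    then show "q \<in> J" unfolding J_def using q by (metis (mono_tags, lifting) imageI mem_Collect_eq)
  qed
  have pjc: "continuous_on UNIV point_of_jet" by (rule bounded_linear.continuous_on[OF bounded_linear_point_of_jet continuous_on_id])
  have g1c: "continuous_on V1 g1" by (rule Ck_on_continuous[OF 1(10,4)])
  have oJ: "open J"
  proof -
    have "J = point_of_jet -` (V1 \<inter> g1 -` (I \<times> M))" unfolding Jeq by auto
    then show ?thesis using open_vimage[OF continuous_open_preimage[OF g1c 1(4) oIM] pjc] by simp
  qed
  have JD: "J \<subseteq> D" unfolding J_def using cc_D IM(6) by blast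
  have fe: "(\<lambda>(X, p). (X, gam (X, p), gam' (X, p))) = cc" using cc_eq by (auto simp: fun_eq_iff)
  have injcc: "inj_on cc (I \<times> M)"
    by (rule inj_onI) (metis 1(8) IM(1) Kt_def subsetD)
  have diffeo: "C1_diffeo cc (I \<times> M) J"
    unfolding C1_diffeo_def
  proof (intro conjI oIM oJ)
    show "bij_betw cc (I \<times> M) J" unfolding J_def using injcc by (rule inj_on_imp_bij_betw)
    show "Ck_on 1 cc (I \<times> M)" using Ck_on_subset[OF Ck_on_Suc_imp[OF cc2' \<Omega>] IM(6)] by simp
    have "open V1" by (rule 1)
    have "Ck_on (Suc 0) (\<lambda>q. g1 (point_of_jet q)) J"
      by (rule Ck_on_compose[OF oJ 1(4) Ck_on_Suc_imp[OF 1(10,4)] Ck_on_bounded_linear[OF bounded_linear_point_of_jet oJ]]) (auto simp: Jeq)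
    then have "Ck_on (Suc 0) (inv_into (I \<times> M) cc) J"
    proof (rule Ck_on_cong[OF oJ, rotated])
      fix q assume "q \<in> J"
      then obtain z where z: "z \<in> I \<times> M" "q = cc z" unfolding J_def by blast
      then show "g1 (point_of_jet q) = inv_into (I \<times> M) cc q"
        using inv_into_f_f[OF injcc z(1)] 1(8)[of z] IM(1) unfolding Kt_def by auto
    qed
    then show "Ck_on 1 (inv_into (I \<times> M) cc) J" by simp
  qed
  define Wt where "Wt = (\<lambda>(X, p). (X, gam (X, p))) ` (I \<times> M)"
  have WtJ: "Wt = (\<lambda>q. (fst q, fst (snd q))) ` J"
    unfolding Wt_def J_def image_image by (auto simp: cc_eq image_def)
  \<comment> \<open>The set is a projection of the open set \<open>J\<close>; fixing the
    \<open>P\<close>-component of a jet gives an open slice around each of its points.\<close>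
  have oW: "open Wt"
    unfolding open_subopen[of Wt]
  proof
    fix \<tau> assume "\<tau> \<in> Wt"
    then obtain q where q: "q \<in> J" "\<tau> = (fst q, fst (snd q))" unfolding WtJ by blast
    define P where "P = snd (snd q)"
    have "open ((\<lambda>\<tau>. (fst \<tau>, snd \<tau>, P)) -` J)" by (rule open_vimage[OF oJ]) (intro continuous_intros)
    moreover have "\<tau> \<in> (\<lambda>\<tau>. (fst \<tau>, snd \<tau>, P)) -` J" using q unfolding P_def by simp
    moreover have "(\<lambda>\<tau>. (fst \<tau>, snd \<tau>, P)) -` J \<subseteq> Wt" unfolding WtJ by (force simp: image_iff)
    ultimately show "\<exists>T. open T \<and> \<tau> \<in> T \<and> T \<subseteq> Wt" by blast
  qed
  define S where "S \<tau> = {p \<in> M. gam (fst \<tau>, p) = snd \<tau>}" for \<tau>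
  have Wt_fst: "fst \<tau> \<in> I" if "\<tau> \<in> Wt" for \<tau> using that unfolding Wt_def by auto
  have S_ne: "\<exists>p. p \<in> S \<tau>" if "\<tau> \<in> Wt" for \<tau> using that unfolding Wt_def S_def by auto
  have K_est: "norm ((snd (Kt (X, p2)) - p2) - (snd (Kt (X, p1)) - p1)) \<le> 1/8 * norm (p2 - p1)"
    if X: "X \<in> I" and p: "p1 \<in> M" "p2 \<in> M" for X p1 p2
  proof -
    have "norm (K' (X, p2) - K' (X, p1)) \<le> 1/8 * norm (p2 - p1)"
    proof (rule differentiable_bound[OF oM(3) _ _ p(2,1), of "\<lambda>p. K' (X, p)" "\<lambda>p v. dd K' (0, v) (X, p)"])
      fix p assume p: "p \<in> M"
      show "((\<lambda>p. K' (X, p)) has_derivative (\<lambda>v. dd K' (0, v) (X, p))) (at p within M)"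
        by (rule has_derivative_at_withinI[OF line_p[OF K'd[OF in\<Omega>[OF X p]]]])
      show "onorm (\<lambda>v. dd K' (0, v) (X, p)) \<le> 1/8"
        by (rule onorm_le, rule W1b) (use X p IM(3) in auto)
    qed
    then show ?thesis unfolding K'_def by simp
  qed
  \<comment> \<open>Two twistor lines that meet at two values of \<open>X\<close> coincide. The
    values agree at \<open>X\<close>, the derivatives agree somewhere in between, and the jet map is
    close to the identity in \<open>p\<close>.\<close>
  have unique_pt: "p1 = p2" if p: "p1 \<in> M" "p2 \<in> M" and X: "X \<in> I" "X' \<in> I" "X \<noteq> X'"
    and eq: "gam (X, p1) = gam (X, p2)" "gam (X', p1) = gam (X', p2)" for p1 p2 X X'
  proof -
    \<comment> \<open>Rolle gives one \<open>\<xi>\<close> per component. They may differ, which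
      does no harm as \<open>K_est\<close> holds for all \<open>X\<close> in
      \<open>I\<close>.\<close>
    have mvt: "\<exists>\<xi>\<in>I. gam' (\<xi>, p1) $ i = gam' (\<xi>, p2) $ i" for i
    proof -
      define a b where "a = min X X'" and "b = max X X'"
      have ab: "a < b" "{a..b} \<subseteq> I" using X(3) interval_min_max_subset[OF iI X(1,2)] unfolding a_def b_def by auto
      define f where "f t = gam (t, p1) $ i - gam (t, p2) $ i" for t
      have fd: "(f has_real_derivative (gam' (t, p1) $ i - gam' (t, p2) $ i)) (at t)" if "t \<in> I" for t
      proof -
        have c: "((\<lambda>t. gam (t, p) $ i) has_real_derivative gam' (t, p) $ i) (at t)" if p: "p \<in> M" for p
          using bounded_linear.has_vector_derivative[OF bounded_linear_vec_nth line_X[OF diffs(2)[OF in\<Omega>[OF \<open>t \<in> I\<close> p]]]]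
            dX_gam(1)[OF in\<Omega>[OF \<open>t \<in> I\<close> p]]
          by (simp add: has_real_derivative_iff_has_vector_derivative)
        show ?thesis unfolding f_def by (intro DERIV_diff c p)
      qed
      have fab: "f a = f b" using eq unfolding f_def a_def b_def by (auto simp: min_def max_def)
      have "\<exists>z. a < z \<and> z < b \<and> f b - f a = (b - a) * (gam' (z, p1) $ i - gam' (z, p2) $ i)"
        by (rule MVT2[OF ab(1)]) (use fd ab(2) in auto)
      then obtain z where z: "a < z" "z < b" "gam' (z, p1) $ i - gam' (z, p2) $ i = 0" using ab fab by auto
      then show ?thesis using ab(2) by (intro bexI[of _ z]) auto
    qed
    define d where "d = p2 - p1"
    have cb: "\<bar>(snd (Kt (Z, p2)) - snd (Kt (Z, p1)) - d) $ i\<bar> \<le> 1/8 * norm d" if "Z \<in> I" for Z i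
      using order_trans[OF component_le_norm_cart K_est[OF that p], of i] unfolding d_def by (simp add: algebra_simps)
    have "\<bar>d $ 1\<bar> \<le> 1/8 * norm d" using cb[OF X(1), of 1] eq(1) unfolding Kt_eqs by simp
    moreover have "\<bar>d $ 2\<bar> \<le> 1/8 * norm d" using cb[OF X(1), of 2] eq(1) unfolding Kt_eqs by simp
    moreover have "\<bar>d $ 3\<bar> \<le> 1/8 * norm d"
    proof -
      obtain \<xi> where "\<xi> \<in> I" "gam' (\<xi>, p1) $ 2 = gam' (\<xi>, p2) $ 2" using mvt by blast
      then show ?thesis using cb[of \<xi> 3] unfolding Kt_eqs by simp
    qed
    moreover have "\<bar>d $ 4\<bar> \<le> 1/8 * norm d"
    proof -
      obtain \<xi> where "\<xi> \<in> I" "gam' (\<xi>, p1) $ 1 = gam' (\<xi>, p2) $ 1" using mvt by blast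
      then show ?thesis using cb[of \<xi> 4] unfolding Kt_eqs by simp
    qed
    ultimately have "norm d \<le> 0" using norm_vec4_le[of d] by linarith
    then show ?thesis unfolding d_def by simp
  qed
  have HG: "gam (fst y, snd (H y)) $ 1 = snd y $ 1" "gam (fst y, snd (H y)) $ 2 = snd y $ 2"
    "snd (H y) $ 3 = snd y $ 3" "snd (H y) $ 4 = snd y $ 4" "fst (H y) = fst y" if y: "y \<in> V2" for y
  proof -
    have f: "fst (H y) = fst y" using arg_cong[OF 2(9)[OF y], of fst] unfolding Gt_eqs .
    then have Hy: "H y = (fst y, snd (H y))" by (cases "H y") simp
    have s: "vector [gam (H y) $ 1, gam (H y) $ 2, snd (H y) $ 3, snd (H y) $ 4] = snd y" using arg_cong[OF 2(9)[OF y], of snd] unfolding Gt_eqs .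
    show "gam (fst y, snd (H y)) $ 1 = snd y $ 1" "gam (fst y, snd (H y)) $ 2 = snd y $ 2"
      "snd (H y) $ 3 = snd y $ 3" "snd (H y) $ 4 = snd y $ 4" "fst (H y) = fst y"
      unfolding Hy[symmetric] s[symmetric] using f by simp_all
  qed
  \<comment> \<open>A surface with two points determines \<open>X\<close>: otherwise the twistor
    lines of these points would meet twice. The second point is reached by a small move of the
    coordinate \<open>x\<close> in the chart \<open>Gt\<close>.\<close>
  have two: "\<exists>p1 p2. p1 \<in> S \<tau> \<and> p2 \<in> S \<tau> \<and> p1 \<noteq> p2" if \<tau>: "\<tau> \<in> Wt" for \<tau>
  proof -
    obtain p1 where p1: "p1 \<in> S \<tau>" using S_ne[OF \<tau>] by blast
    define X where "X = fst \<tau>"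
    have X: "X \<in> I" "p1 \<in> M" "gam (X, p1) = snd \<tau>" using Wt_fst[OF \<tau>] p1 unfolding S_def X_def by auto
    have u: "(X, p1) \<in> U2" using IM(2) X by blast
    define y where "y t = Gt (X, p1) + (0, t *\<^sub>R axis 3 1)" for t :: real
    have y0: "y 0 = Gt (X, p1)" unfolding y_def by (simp add: zero_prod_def[symmetric])
    have "open (V2 \<inter> H -` (UNIV \<times> M))"
      by (rule continuous_open_preimage[OF Ck_on_continuous[OF 2(10,4)] 2(4)]) (intro open_Times oM(1) open_UNIV)
    moreover have "continuous_on UNIV y" unfolding y_def by (intro continuous_intros)
    ultimately have "open (y -` (V2 \<inter> H -` (UNIV \<times> M)))" by (rule open_vimage)
    moreover have "0 \<in> y -` (V2 \<inter> H -` (UNIV \<times> M))" using y0 2(6) 2(8)[OF u] u X(2) by auto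
    ultimately obtain e where e: "e > 0" "ball 0 e \<subseteq> y -` (V2 \<inter> H -` (UNIV \<times> M))" using open_contains_ball by blast
    then have "e/2 \<in> y -` (V2 \<inter> H -` (UNIV \<times> M))" by (auto simp: subset_iff)
    then have yV: "y (e/2) \<in> V2" and HM: "snd (H (y (e/2))) \<in> M" by auto
    have fy: "fst (y (e/2)) = X" "snd (y (e/2)) = vector [gam (X, p1) $ 1, gam (X, p1) $ 2, p1 $ 3 + e/2, p1 $ 4]"
      unfolding y_def by (simp_all add: Gt_eqs vec_eq_iff forall_4 axis_def)
    have "gam (X, snd (H (y (e/2)))) = gam (X, p1)" using HG(1,2)[OF yV] unfolding fy by (simp add: vec_eq_iff forall_2)
    then have "snd (H (y (e/2))) \<in> S \<tau>" unfolding S_def using HM X(3) X_def by simp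
    moreover have "snd (H (y (e/2))) \<noteq> p1" using HG(3)[OF yV] e(1) unfolding fy by auto
    ultimately show ?thesis using p1 by blast
  qed
  have injS: "inj_on S Wt"
  proof (rule inj_onI)
    fix \<tau> \<tau>' assume t: "\<tau> \<in> Wt" "\<tau>' \<in> Wt" and eq: "S \<tau> = S \<tau>'"
    obtain p1 p2 where p: "p1 \<in> S \<tau>" "p2 \<in> S \<tau>" "p1 \<noteq> p2" using two[OF t(1)] by blast
    then have p': "p1 \<in> S \<tau>'" "p2 \<in> S \<tau>'" using eq by auto
    have "fst \<tau> = fst \<tau>'"
    proof (rule ccontr)
      assume "fst \<tau> \<noteq> fst \<tau>'"
      from unique_pt[OF _ _ Wt_fst[OF t(1)] Wt_fst[OF t(2)] this, of p1 p2] show False using p p' unfolding S_def by auto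
    qed
    moreover have "snd \<tau> = snd \<tau>'" using p(1) p'(1) calculation unfolding S_def by auto
    ultimately show "\<tau> = \<tau>'" by (simp add: prod_eq_iff)
  qed
  have conn: "connected (S \<tau>)" if \<tau>: "\<tau> \<in> Wt" for \<tau>
  proof (rule path_connected_imp_connected, unfold path_connected_def, intro ballI)
    fix p1 p2 assume p: "p1 \<in> S \<tau>" "p2 \<in> S \<tau>"
    define X where "X = fst \<tau>"
    have X: "X \<in> I" using Wt_fst[OF \<tau>] unfolding X_def .
    have pM: "p1 \<in> M" "p2 \<in> M" and g: "gam (X, p1) = snd \<tau>" "gam (X, p2) = snd \<tau>" using p unfolding S_def X_def by auto
    define y1 y2 where "y1 = Gt (X, p1)" and "y2 = Gt (X, p2)"
    define \<Delta> where "\<Delta> = y2 - y1"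
    define y where "y t = y1 + t *\<^sub>R \<Delta>" for t
    define z where "z t = snd (H (y t))" for t
    have yB: "y1 \<in> ball b0 e0" "y2 \<in> ball b0 e0"
      using IM(5) X pM unfolding W3_def y1_def y2_def by (auto simp: dist_norm norm_minus_commute)
    have yt: "y t \<in> ball b0 e0" if "t \<in> {0..1}" for t
    proof -
      have "(1 - t) *\<^sub>R y1 + t *\<^sub>R y2 \<in> ball b0 e0" using convexD_alt[OF convex_ball yB] that by auto
      then show ?thesis unfolding y_def \<Delta>_def by (simp add: algebra_simps)
    qed
    have yW: "y t \<in> W" "norm (z t - p\<^sub>0) < 1/C" if "t \<in> {0..1}" for t using yt[OF that] e0(2) unfolding z_def by auto
    have z01: "z 0 = p1" "z 1 = p2"
      unfolding z_def y_def \<Delta>_def y1_def y2_def using 2(8)[of "(X, p1)"] 2(8)[of "(X, p2)"] IM(2) X pM by auto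
    have fstD: "fst \<Delta> = 0" and sD: "snd \<Delta> $ 1 = 0" "snd \<Delta> $ 2 = 0"
      unfolding \<Delta>_def y1_def y2_def using g by (simp_all add: Gt_eqs)
    have fy: "fst (y t) = X" "snd (y t) $ 1 = gam (X, p1) $ 1" "snd (y t) $ 2 = gam (X, p1) $ 2"
      "snd (y t) $ 3 = snd y1 $ 3 + t * snd \<Delta> $ 3" "snd (y t) $ 4 = snd y1 $ 4 + t * snd \<Delta> $ 4" for t
      unfolding y_def using fstD sD by (simp_all add: y1_def Gt_eqs)
    have zg: "gam (X, z t) = snd \<tau>" if "t \<in> {0..1}" for t
      using HG(1,2)[of "y t"] yW(1)[OF that] W(4) g(1) unfolding z_def fy by (auto simp: vec_eq_iff forall_2)
    have Hd: "H differentiable at w" "dd H v differentiable at w" if "w \<in> W" for w v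
      using Ck_on_Suc_differentiable[OF 2(10,4)] Ck_on_Suc_differentiable[OF Ck_on_dd[OF 2(4,10)] 2(4)] that W(4) by blast+
    define z' z'' where "z' t = snd (dd H \<Delta> (y t))" and "z'' t = snd (dd (dd H \<Delta>) \<Delta> (y t))" for t
    have dz: "(z has_vector_derivative z' t) (at t)" if "t \<in> {0..1}" for t
      unfolding z_def z'_def y_def
      by (rule bounded_linear.has_vector_derivative[OF bounded_linear_snd has_vector_derivative_line]) (use Hd(1)[OF yW(1)[OF that]] y_def in simp)
    have dz': "(z' has_vector_derivative z'' t) (at t)" if "t \<in> {0..1}" for t
      unfolding z''_def z'_def y_def
      by (rule bounded_linear.has_vector_derivative[OF bounded_linear_snd has_vector_derivative_line]) (use Hd(2)[OF yW(1)[OF that]] y_def in simp)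
    \<comment> \<open>The chart keeps \<open>x\<close> and \<open>y\<close>, and the segment moves
      in these two coordinates only, so they alone already contribute the full speed of the
      segment.\<close>
    have nz': "norm \<Delta> * norm \<Delta> \<le> z' t \<bullet> z' t" if t: "t \<in> {0..1}" for t
    proof -
      have "z' t $ i = snd \<Delta> $ i" if i: "i = 3 \<or> i = 4" for i
      proof -
        have 1: "((\<lambda>t. z t $ i) has_vector_derivative z' t $ i) (at t)"
          by (rule bounded_linear.has_vector_derivative[OF bounded_linear_vec_nth dz[OF t]])
        have o: "open (y -` W)" by (rule open_vimage[OF W(2)]) (auto simp: y_def intro!: continuous_intros)
        have ty: "t \<in> y -` W" using yW(1)[OF t] by simp
        have li: "((\<lambda>t. snd y1 $ i + t * snd \<Delta> $ i) has_vector_derivative snd \<Delta> $ i) (at t)"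
          by (auto intro!: derivative_eq_intros simp: has_real_derivative_iff_has_vector_derivative[symmetric])
        have "((\<lambda>t. z t $ i) has_vector_derivative snd \<Delta> $ i) (at t)"
        proof (rule has_vector_derivative_transform_within_open[OF li o ty])
          show "snd y1 $ i + t * snd \<Delta> $ i = z t $ i" if "t \<in> y -` W" for t
            using HG(3,4)[of "y t"] that W(4) i fy unfolding z_def by auto
        qed
        with 1 show ?thesis by (rule vector_derivative_unique_at)
      qed
      then have "z' t $ 3 = snd \<Delta> $ 3" "z' t $ 4 = snd \<Delta> $ 4" by auto
      moreover have "norm \<Delta> * norm \<Delta> = (snd \<Delta> $ 3)\<^sup>2 + (snd \<Delta> $ 4)\<^sup>2"
        using fstD sD by (simp add: power2_eq_square[symmetric] norm_prod_def power2_norm_eq_inner inner_vec_def sum_4 del: real_norm_def)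
      ultimately show ?thesis by (simp add: inner_vec_def sum_4 power2_eq_square)
    qed
    define k where "k t = (z t - p\<^sub>0) \<bullet> (z t - p\<^sub>0)" for t
    have "convex_on {0..1} k"
    proof (rule f''_ge0_imp_convex)
      fix t :: real assume t: "t \<in> {0..1}"
      have d0: "((\<lambda>t. z t - p\<^sub>0) has_vector_derivative z' t) (at t)" using dz[OF t] by (auto intro!: derivative_eq_intros)
      have ip: "((\<lambda>t. f t \<bullet> h t) has_real_derivative f t \<bullet> h' + f' \<bullet> h t) (at t)"
        if "(f has_vector_derivative f') (at t)" "(h has_vector_derivative h') (at t)" for f h :: "real \<Rightarrow> real^4" and f' h'
        using has_derivative_inner[OF that[unfolded has_vector_derivative_def]]
        unfolding has_field_derivative_def by (rule has_derivative_eq_rhs) (auto simp: algebra_simps)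
      show "(k has_real_derivative 2 * ((z t - p\<^sub>0) \<bullet> z' t)) (at t)"
        unfolding k_def by (rule DERIV_cong[OF ip[OF d0 d0]]) (simp add: inner_commute)
      show "((\<lambda>t. 2 * ((z t - p\<^sub>0) \<bullet> z' t)) has_real_derivative 2 * ((z t - p\<^sub>0) \<bullet> z'' t + z' t \<bullet> z' t)) (at t)"
        by (rule DERIV_cmult[OF ip[OF d0 dz'[OF t]]])
      have "norm (z'' t) \<le> norm (dd (dd H \<Delta>) \<Delta> (y t))" unfolding z''_def by (metis norm_snd_le prod.collapse)
      then have n2: "norm (z'' t) \<le> C * norm \<Delta> * norm \<Delta>" using W(5)[OF yW(1)[OF t], of \<Delta>] by linarith
      have "\<bar>(z t - p\<^sub>0) \<bullet> z'' t\<bar> \<le> norm (z t - p\<^sub>0) * norm (z'' t)" by (rule Cauchy_Schwarz_ineq2)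
      also have "\<dots> \<le> 1/C * (C * norm \<Delta> * norm \<Delta>)" using yW(2)[OF t] n2 W(1) by (intro mult_mono) auto
      also have "\<dots> = norm \<Delta> * norm \<Delta>" using W(1) by simp
      finally have "0 \<le> (z t - p\<^sub>0) \<bullet> z'' t + z' t \<bullet> z' t" using nz'[OF t] by linarith
      then show "0 \<le> 2 * ((z t - p\<^sub>0) \<bullet> z'' t + z' t \<bullet> z' t)" by simp
    qed simp
    have kend: "k 0 < r\<^sup>2" "k 1 < r\<^sup>2"
      using pM r(1) unfolding k_def z01 M_def dot_square_norm by (auto simp: dist_norm norm_minus_commute intro!: power_strict_mono)
    \<comment> \<open>A convex function below \<open>r\<^sup>2\<close> at both ends is below it in
      between, so the curve does not leave the ball \<open>M\<close>.\<close>
    have zM: "z t \<in> M" if t: "t \<in> {0..1}" for t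
    proof -
      have "k ((1 - t) *\<^sub>R 0 + t *\<^sub>R 1) \<le> (1 - t) * k 0 + t * k 1"
        by (rule convex_onD[OF \<open>convex_on {0..1} k\<close>]) (use t in auto)
      also have "\<dots> < r\<^sup>2"
      proof (cases "t = 0")
        case False
        then have "t * k 1 < t * r\<^sup>2" "(1 - t) * k 0 \<le> (1 - t) * r\<^sup>2" using kend t by (auto intro: mult_left_mono)
        then show ?thesis by (simp add: algebra_simps)
      qed (use kend in simp)
      finally have "(norm (z t - p\<^sub>0))\<^sup>2 < r\<^sup>2" unfolding k_def dot_square_norm by simp
      then have "norm (z t - p\<^sub>0) < r" using r(1) power2_less_imp_less by fastforce
      then show ?thesis unfolding M_def by (simp add: dist_norm norm_minus_commute)
    qed
    show "\<exists>g. path g \<and> path_image g \<subseteq> S \<tau> \<and> pathstart g = p1 \<and> pathfinish g = p2"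
    proof (intro exI conjI)
      show "path z" unfolding path_def using dz
        by (intro continuous_at_imp_continuous_on ballI) (rule has_vector_derivative_continuous)
      show "path_image z \<subseteq> S \<tau>" unfolding path_image_def S_def using zM zg X_def by auto
    qed (simp_all add: pathstart_def pathfinish_def z01)
  qed
  have alpha: "alpha_surface (heavenly_metric \<Theta>) M (S \<tau>)" if \<tau>: "\<tau> \<in> Wt" for \<tau>
    unfolding alpha_surface_def
  proof (intro conjI ballI)
    define X where "X = fst \<tau>"
    have X: "X \<in> I" using Wt_fst[OF \<tau>] unfolding X_def .
    show "S \<tau> \<noteq> {}" using S_ne[OF \<tau>] by blast
    show "S \<tau> \<subseteq> M" unfolding S_def by blast
    show "connected (S \<tau>)" by (rule conn[OF \<tau>])
    fix p assume p: "p \<in> S \<tau>"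
    have fd: "((\<lambda>p. gam (X, p)) has_derivative (\<lambda>v. dd gam (0, v) (X, q))) (at q)" if "q \<in> M" for q
      by (rule line_p[OF diffs(2)[OF in\<Omega>[OF X that]]])
    have fr: "frechet_derivative (\<lambda>p. gam (X, p)) (at q) = (\<lambda>v. dd gam (0, v) (X, q))" if "q \<in> M" for q
      using frechet_derivative_at[OF fd[OF that]] by simp
    have dtn: "dt (X, q) \<noteq> 0" if "q \<in> M" for q using W2(3) IM(4) X that by blast
    show "\<exists>N (f :: real^4 \<Rightarrow> real^2). open N \<and> p \<in> N \<and> N \<subseteq> M \<and> Ck_on 1 f N \<and>
        (\<forall>q\<in>N. surj (frechet_derivative f (at q))) \<and> S \<tau> \<inter> N = {q\<in>N. f q = f p} \<and>
        (\<forall>q\<in>S \<tau>\<inter>N. alpha_plane (heavenly_metric \<Theta> q) {v. frechet_derivative f (at q) v = 0})"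
    proof (intro exI[of _ M] exI[of _ "\<lambda>p. gam (X, p)"] conjI ballI oM(1) order_refl)
      show pM: "p \<in> M" using p unfolding S_def by blast
      have "Ck_on (Suc 0) (\<lambda>p. gam (X, p)) M"
        by (rule Ck_on_compose[OF oM(1) \<Omega> Ck_on_Suc_imp[OF gam2(1) \<Omega>] Ck_on_Pair[OF oM(1) Ck_on_const[OF oM(1)] Ck_on_id[OF oM(1)]]])
           (use in\<Omega>[OF X] in auto)
      then show "Ck_on 1 (\<lambda>p. gam (X, p)) M" by simp
      show "surj (frechet_derivative (\<lambda>p. gam (X, p)) (at q))" if "q \<in> M" for q
        unfolding fr[OF that] by (rule alpha_plane_kernel(2)[OF in\<Omega>[OF X that] dtn[OF that]])
      show "S \<tau> \<inter> M = {q \<in> M. gam (X, q) = gam (X, p)}" using p unfolding S_def X_def by auto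
      show "alpha_plane (heavenly_metric \<Theta> q) {v. frechet_derivative (\<lambda>p. gam (X, p)) (at q) v = 0}" if "q \<in> S \<tau> \<inter> M" for q
      proof -
        have qM: "q \<in> M" using that by blast
        show ?thesis unfolding fr[OF qM] by (rule alpha_plane_kernel(1)[OF in\<Omega>[OF X qM] dtn[OF qM]])
      qed
    qed
  qed
  have MU: "M \<subseteq> U" using IM(6) oI(2) N0(3) by blast
  show ?thesis
    unfolding corresponds_near_def
  proof (rule exI[of _ M], rule exI[of _ I], rule exI[of _ J], rule exI[of _ Wt], rule exI[of _ S],
      rule exI[of _ "\<lambda>X p. gam (X, p)"], rule exI[of _ "\<lambda>X p. gam' (X, p)"], intro conjI ballI oM(1,2) MU oI(1) iI oJ JD)
    fix p X assume pX: "p \<in> M" "X \<in> I"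
    note q = in\<Omega>[OF pX(2,1)]
    show "((\<lambda>t. gam (t, p)) has_vector_derivative gam' (X, p)) (at X)"
      using line_X[OF diffs(2)[OF q]] dX_gam(1)[OF q] by simp
    show "((\<lambda>t. gam' (t, p)) has_vector_derivative F (X, gam (X, p), gam' (X, p))) (at X)"
      using line_X[OF diffs(3)[OF q]] dX_gam(2)[OF q] cc_eq[of "(X, p)"] by simp
  next
    show "C1_diffeo (\<lambda>(X, p). (X, gam (X, p), gam' (X, p))) (I \<times> M) J" unfolding fe by (rule diffeo)
    show "fst (data_of_point X\<^sub>0 p\<^sub>0) \<in> I" using oI by (simp add: data_of_point_def)
    show "data_of_point X\<^sub>0 p\<^sub>0 = (fst (data_of_point X\<^sub>0 p\<^sub>0), gam (fst (data_of_point X\<^sub>0 p\<^sub>0), p\<^sub>0), gam' (fst (data_of_point X\<^sub>0 p\<^sub>0), p\<^sub>0))"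
      using cc_init[OF N0(2)] cc_eq[of "(X\<^sub>0, p\<^sub>0)"] by (simp add: data_of_point_def)
    show "Wt = (\<lambda>(X, p). (X, gam (X, p))) ` (I \<times> M)" by (rule Wt_def)
    show "twistor_patch (heavenly_metric \<Theta>) M Wt S" unfolding twistor_patch_def using oW injS alpha by blast
    fix p assume p: "p \<in> M"
    show "twistor_line Wt S p = (\<lambda>X. (X, gam (X, p))) ` I"
    proof (intro equalityI subsetI)
      fix \<tau> assume "\<tau> \<in> twistor_line Wt S p"
      then have t: "\<tau> \<in> Wt" "gam (fst \<tau>, p) = snd \<tau>" unfolding twistor_line_def S_def by auto
      then show "\<tau> \<in> (\<lambda>X. (X, gam (X, p))) ` I" using Wt_fst[OF t(1)] by (intro image_eqI[of _ _ "fst \<tau>"]) auto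
    qed (use p in \<open>auto simp: twistor_line_def S_def Wt_def\<close>)
  qed
qed

end

text \<open>\<open>X\<close> is itself a coordinate of the autonomous field \<open>jet_field\<close>
  and advances at unit speed. The flow for time \<open>X - X\<^sub>0\<close>, started on the initial
  slice, therefore ends over \<open>X\<close>.\<close>

lemma Lambda_solution_patch:
  assumes U: "open U" "smooth_on \<Theta> U" and sol: "Lambda_solution \<Theta> U X\<^sub>0 D \<Lambda>"
    and p0: "p\<^sub>0 \<in> U" "data_of_point X\<^sub>0 p\<^sub>0 \<in> D"
  obtains cc I\<^sub>0 N\<^sub>0 where "solution_patch \<Theta> U X\<^sub>0 D \<Lambda> cc I\<^sub>0 N\<^sub>0 p\<^sub>0"
proof -
  interpret jet_system "Lambda_system \<Lambda>" D by (rule Lambda_solution_jet_system[OF sol])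
  let ?V = "jet_field (Lambda_system \<Lambda>)"
  have V: "Ck_on 2 ?V D"
    unfolding jet_field_def
    by (intro Ck_on_Pair[OF D] Ck_on_const[OF D] Ck_on_snd[OF D] Ck_on_id[OF D] F2)
  obtain \<delta> N \<phi> where N: "data_of_point X\<^sub>0 p\<^sub>0 \<in> N" and fb: "flow_box ?V D \<delta> N \<phi>" and \<phi>2: "Ck_on 2 (\<lambda>(t, x). \<phi> t x) ({-\<delta><..<\<delta>} \<times> N)"
    using Ck_flow_2[OF D p0(2) V] unfolding has_Ck_flow_def by blast
  have \<delta>: "\<delta> > 0" and oN: "open N" and fb0: "\<And>x. x \<in> N \<Longrightarrow> \<phi> 0 x = x"
    and fbd: "\<And>x t. x \<in> N \<Longrightarrow> t \<in> {-\<delta><..<\<delta>} \<Longrightarrow> \<phi> t x \<in> D \<and> ((\<lambda>t. \<phi> t x) has_vector_derivative ?V (\<phi> t x)) (at t)"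
    using fb unfolding flow_box_def by blast+
  define I\<^sub>0 where "I\<^sub>0 = {X\<^sub>0 - \<delta><..<X\<^sub>0 + \<delta>}"
  define N\<^sub>0 where "N\<^sub>0 = U \<inter> (\<lambda>p. data_of_point X\<^sub>0 p) -` N"
  have dc: "continuous_on S (\<lambda>p. data_of_point X\<^sub>0 p)" for S
  proof -
    have "continuous_on S (\<lambda>p. (\<lambda>q. data_of_point (fst q) (snd q)) (X\<^sub>0, p))"
      by (rule continuous_on_compose2[OF bounded_linear.continuous_on[OF bounded_linear_data_of_point continuous_on_id, of UNIV]])
         (auto intro!: continuous_intros)
    then show ?thesis by simp
  qed
  have N0: "open N\<^sub>0" "p\<^sub>0 \<in> N\<^sub>0" "N\<^sub>0 \<subseteq> U"
    unfolding N\<^sub>0_def using continuous_open_preimage[OF dc U(1) oN] p0 N by auto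
  have I0: "open I\<^sub>0" "is_interval I\<^sub>0" "X\<^sub>0 \<in> I\<^sub>0" unfolding I\<^sub>0_def using \<delta> by (auto simp: is_interval_1)
  have \<Omega>: "open (I\<^sub>0 \<times> N\<^sub>0)" using I0 N0 by (intro open_Times)
  define ps where "ps q = \<phi> (fst q - X\<^sub>0) (data_of_point X\<^sub>0 (snd q))" for q
  \<comment> \<open>The first component is set by hand because the locale demands
    \<open>fst (cc q) = fst q\<close> for every \<open>q\<close>, also where the flow is not
    controlled.\<close>
  define cc where "cc q = (fst q, snd (ps q))" for q
  have inN: "fst q - X\<^sub>0 \<in> {-\<delta><..<\<delta>}" "data_of_point X\<^sub>0 (snd q) \<in> N" if "q \<in> I\<^sub>0 \<times> N\<^sub>0" for q
    using that unfolding I\<^sub>0_def N\<^sub>0_def by auto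
  have fst_ps: "fst (ps q) = fst q" if q: "q \<in> I\<^sub>0 \<times> N\<^sub>0" for q
  proof -
    define x where "x = data_of_point X\<^sub>0 (snd q)"
    define a b where "a = min 0 (fst q - X\<^sub>0)" and "b = max 0 (fst q - X\<^sub>0)"
    have ab: "{a..b} \<subseteq> {-\<delta><..<\<delta>}" "0 \<in> {a..b}" "fst q - X\<^sub>0 \<in> {a..b}" using inN(1)[OF q] \<delta> unfolding a_def b_def by auto
    have "fst (\<phi> (fst q - X\<^sub>0) x) - X\<^sub>0 - (fst q - X\<^sub>0) = 0"
    proof (rule linear_growth_zero[where d="\<lambda>t. fst (\<phi> t x) - X\<^sub>0 - t" and d'="\<lambda>t. 0" and L=0 and ?t0.0=0, OF _ _ ab(2) _ ab(3)])
      fix t assume "t \<in> {a..b}"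
      then have "((\<lambda>t. \<phi> t x) has_vector_derivative ?V (\<phi> t x)) (at t)" using fbd inN(2)[OF q] ab(1) unfolding x_def by blast
      from bounded_linear.has_vector_derivative[OF bounded_linear_fst this]
      have "((\<lambda>t. fst (\<phi> t x)) has_vector_derivative 1) (at t)" by (simp add: jet_field_def)
      then show "((\<lambda>t. fst (\<phi> t x) - X\<^sub>0 - t) has_vector_derivative 0) (at t)"
        by (auto intro!: derivative_eq_intros simp: has_real_derivative_iff_has_vector_derivative[symmetric])
    qed (use fb0[OF inN(2)[OF q]] in \<open>auto simp: x_def data_of_point_def\<close>)
    then show ?thesis unfolding ps_def x_def by simp
  qed
  have cp: "cc q = ps q" if "q \<in> I\<^sub>0 \<times> N\<^sub>0" for q
    using fst_ps[OF that] unfolding cc_def by (simp add: prod_eq_iff)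
  have ps2: "Ck_on 2 ps (I\<^sub>0 \<times> N\<^sub>0)"
  proof -
    have "Ck_on 2 (\<lambda>q. (\<lambda>(t, x). \<phi> t x) (fst q - X\<^sub>0, data_of_point X\<^sub>0 (snd q))) (I\<^sub>0 \<times> N\<^sub>0)"
    proof (rule Ck_on_compose[OF \<Omega> _ \<phi>2])
      show "open ({-\<delta><..<\<delta>} \<times> N)" using oN by (intro open_Times) auto
      have "Ck_on 2 (\<lambda>q. (\<lambda>r. data_of_point (fst r) (snd r)) (X\<^sub>0, snd q)) (I\<^sub>0 \<times> N\<^sub>0)"
        by (rule Ck_on_bounded_linear_comp[OF bounded_linear_data_of_point \<Omega> Ck_on_Pair[OF \<Omega> Ck_on_const[OF \<Omega>] Ck_on_snd[OF \<Omega> Ck_on_id[OF \<Omega>]]]])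
      then show "Ck_on 2 (\<lambda>q. (fst q - X\<^sub>0, data_of_point X\<^sub>0 (snd q))) (I\<^sub>0 \<times> N\<^sub>0)"
        by (intro Ck_on_Pair[OF \<Omega>] Ck_on_diff[OF \<Omega>] Ck_on_const[OF \<Omega>] Ck_on_fst[OF \<Omega> Ck_on_id[OF \<Omega>]]) simp
    qed (use inN in auto)
    then show ?thesis unfolding ps_def by simp
  qed
  have cc2: "Ck_on 2 cc (I\<^sub>0 \<times> N\<^sub>0)" by (rule Ck_on_cong[OF \<Omega> cp[symmetric] ps2])
  show ?thesis
  proof (rule that, unfold_locales)
    show "cc q \<in> D" if "q \<in> I\<^sub>0 \<times> N\<^sub>0" for q
      unfolding cp[OF that] ps_def using fbd[OF inN(2)[OF that] inN(1)[OF that]] by simp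
    show "cc (X\<^sub>0, p) = data_of_point X\<^sub>0 p" if p: "p \<in> N\<^sub>0" for p
    proof -
      have q: "(X\<^sub>0, p) \<in> I\<^sub>0 \<times> N\<^sub>0" using p I0 by simp
      show ?thesis unfolding cp[OF q] ps_def using fb0[OF inN(2)[OF q]] by simp
    qed
    show "dd cc (1, 0) q = ?V (cc q)" if q: "q \<in> I\<^sub>0 \<times> N\<^sub>0" for q
    proof -
      obtain X p where Xp: "q = (X, p)" by (cases q)
      have "Ck_on (Suc (Suc 0)) cc (I\<^sub>0 \<times> N\<^sub>0)" using cc2 by (simp add: numeral_2_eq_2)
      from Ck_on_Suc_differentiable[OF this \<Omega> q] have d: "cc differentiable at ((0, p) + X *\<^sub>R (1, 0))" unfolding Xp by simp
      have "((\<lambda>t. cc ((0, p) + t *\<^sub>R (1, 0))) has_vector_derivative dd cc (1, 0) ((0, p) + X *\<^sub>R (1, 0))) (at X)"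
        by (rule has_vector_derivative_line[OF d])
      then have 1: "((\<lambda>t. cc (t, p)) has_vector_derivative dd cc (1, 0) (X, p)) (at X)" by simp
      have "((\<lambda>t. t - X\<^sub>0) has_vector_derivative 1) (at X)" by (auto intro!: derivative_eq_intros simp: has_real_derivative_iff_has_vector_derivative[symmetric])
      moreover have "((\<lambda>t. \<phi> t (data_of_point X\<^sub>0 p)) has_vector_derivative ?V (ps q)) (at (X - X\<^sub>0))"
        using fbd inN[OF q] unfolding ps_def Xp by simp
      ultimately have "((\<lambda>t. ps (t, p)) has_vector_derivative ?V (ps q)) (at X)"
        using vector_diff_chain_at[of "\<lambda>t. t - X\<^sub>0" 1 X "\<lambda>t. \<phi> t (data_of_point X\<^sub>0 p)"] unfolding ps_def by (simp add: o_def)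
      then have 2: "((\<lambda>t. cc (t, p)) has_vector_derivative ?V (ps q)) (at X)"
        by (rule has_vector_derivative_transform_within_open[where S=I\<^sub>0]) (use I0 q Xp cp in auto)
      from vector_derivative_unique_at[OF 1 2] show ?thesis unfolding Xp[symmetric] cp[OF q] .
    qed
    show "fst (cc q) = fst q" for q by (simp add: cc_def)
  qed (use U sol I0 N0 cc2 in auto)
qed

section \<open>The Lax distribution of a solution of the heavenly equation\<close>

lemma Ck_on_smooth: "smooth_on f S \<Longrightarrow> Ck_on k f S"
  unfolding smooth_on_def by blast

lemma dd_vector_4:
  assumes "f differentiable at q" "g differentiable at q" "h differentiable at q" "j differentiable at q"
  shows "dd (\<lambda>q. vector [f q, g q, h q, j q] :: real^4) v q = vector [dd f v q, dd g v q, dd h v q, dd j v q]"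
proof -
  have e: "vector [x, y, z, w] = x *\<^sub>R axis 1 1 + y *\<^sub>R axis 2 1 + z *\<^sub>R axis 3 1 + w *\<^sub>R (axis 4 1 :: real^4)" for x y z w
    by (simp add: vec_eq_iff forall_4 axis_def)
  have "((\<lambda>q. f q *\<^sub>R axis 1 1 + g q *\<^sub>R axis 2 1 + h q *\<^sub>R axis 3 1 + j q *\<^sub>R (axis 4 1 :: real^4)) has_derivative
     (\<lambda>v. dd f v q *\<^sub>R axis 1 1 + dd g v q *\<^sub>R axis 2 1 + dd h v q *\<^sub>R axis 3 1 + dd j v q *\<^sub>R axis 4 1)) (at q)"
    by (intro has_derivative_add has_derivative_scaleR_left has_derivative_dd assms)
  from dd_eqI[OF this] show ?thesis unfolding e .
qed

lemma dd_snd: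
  assumes "f differentiable at (snd q)" shows "dd (\<lambda>q. f (snd q)) v q = dd f (snd v) (snd q)"
    and "(\<lambda>q. f (snd q)) differentiable at q"
proof -
  have "((\<lambda>q. f (snd q)) has_derivative (\<lambda>v. dd f (snd v) (snd q))) (at q)"
    by (rule has_derivative_compose[OF has_derivative_snd[OF has_derivative_ident] has_derivative_dd[OF assms]])
  then show "dd (\<lambda>q. f (snd q)) v q = dd f (snd v) (snd q)" "(\<lambda>q. f (snd q)) differentiable at q"
    using dd_eqI differentiableI by blast+
qed

locale heavenly =
  fixes \<Theta> :: "real^4 \<Rightarrow> real" and U :: "(real^4) set" and X\<^sub>0 :: real
  assumes U: "open U" and smooth: "smooth_on \<Theta> U" and heavenly: "\<And>p. p \<in> U \<Longrightarrow> second_heavenly \<Theta> p"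
begin

definition fx where "fx = dd \<Theta> (axis 3 1)"
definition fy where "fy = dd \<Theta> (axis 4 1)"
definition Ta where "Ta = dd fx (axis 3 1)"
definition Tb where "Tb = dd fx (axis 4 1)"
definition Tc where "Tc = dd fy (axis 4 1)"

lemma smooths: "smooth_on fx U" "smooth_on fy U" "smooth_on Ta U" "smooth_on Tb U" "smooth_on Tc U"
  unfolding fx_def fy_def Ta_def Tb_def Tc_def by (intro smooth_dd U smooth)+

lemma diffs: "p \<in> U \<Longrightarrow> \<Theta> differentiable at p" "p \<in> U \<Longrightarrow> fx differentiable at p" "p \<in> U \<Longrightarrow> fy differentiable at p" "p \<in> U \<Longrightarrow> Ta differentiable at p"
  "p \<in> U \<Longrightarrow> Tb differentiable at p" "p \<in> U \<Longrightarrow> Tc differentiable at p"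
  "p \<in> U \<Longrightarrow> dd fx v differentiable at p" "p \<in> U \<Longrightarrow> dd fy v differentiable at p"
  using smooth_differentiable[OF U] smooth smooths smooth_dd[OF U] by blast+

lemma fy_x: "p \<in> U \<Longrightarrow> dd fy (axis 3 1) p = Tb p"
  unfolding fy_def Tb_def fx_def by (rule smooth_dd_commute[OF U smooth])

lemma Ta_y: "p \<in> U \<Longrightarrow> dd Ta (axis 4 1) p = dd Tb (axis 3 1) p"
  unfolding Ta_def Tb_def by (rule smooth_dd_commute[OF U smooths(1)])

lemma Tb_y: "p \<in> U \<Longrightarrow> dd Tb (axis 4 1) p = dd Tc (axis 3 1) p"
proof -
  assume p: "p \<in> U"
  have "dd Tc (axis 3 1) p = dd (dd fy (axis 3 1)) (axis 4 1) p" unfolding Tc_def by (rule smooth_dd_commute[OF U smooths(2) p])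
  also have "\<dots> = dd Tb (axis 4 1) p" by (rule dd_cong_open[OF U p fy_x])
  finally show ?thesis by simp
qed

lemma heavenly_eq: "p \<in> U \<Longrightarrow> dd fx (axis 1 1) p + dd fy (axis 2 1) p + Ta p * Tc p - (Tb p)\<^sup>2 = 0"
  using heavenly[of p] by (simp add: second_heavenly_def smooth_pd2[OF U smooth] Ta_def Tb_def Tc_def fx_def fy_def)

text \<open>The equation holds on an open set and may be differentiated. The directions
  \<open>y\<close> and \<open>x\<close> give the two components of the statement that
  \<open>e1v\<close> and \<open>e2v\<close> commute.\<close>

lemma heavenly_dd:
  assumes p: "p \<in> U"
  shows "dd (dd fx (axis 1 1)) v p + dd (dd fy (axis 2 1)) v p + (Ta p * dd Tc v p + dd Ta v p * Tc p) - 2 * Tb p * dd Tb v p = 0"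
proof -
  have "((\<lambda>p. dd fx (axis 1 1) p + dd fy (axis 2 1) p + Ta p * Tc p - Tb p * Tb p) has_derivative
     (\<lambda>v. dd (dd fx (axis 1 1)) v p + dd (dd fy (axis 2 1)) v p + (Ta p * dd Tc v p + dd Ta v p * Tc p) - (Tb p * dd Tb v p + dd Tb v p * Tb p))) (at p)"
    by (intro has_derivative_add has_derivative_diff has_derivative_mult has_derivative_dd diffs p)
  moreover have "((\<lambda>p. dd fx (axis 1 1) p + dd fy (axis 2 1) p + Ta p * Tc p - Tb p * Tb p) has_derivative (\<lambda>v. 0)) (at p)"
    by (rule has_derivative_transform_within_open[OF has_derivative_const U p]) (use heavenly_eq in \<open>simp add: power2_eq_square\<close>)
  ultimately have "(\<lambda>v. dd (dd fx (axis 1 1)) v p + dd (dd fy (axis 2 1)) v p + (Ta p * dd Tc v p + dd Ta v p * Tc p) - (Tb p * dd Tb v p + dd Tb v p * Tb p)) = (\<lambda>v. 0)"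
    by (rule has_derivative_unique)
  from fun_cong[OF this, of v] show ?thesis by simp
qed

lemma heavenly_y: "p \<in> U \<Longrightarrow> dd Tb (axis 1 1) p + dd Tc (axis 2 1) p + Ta p * dd Tc (axis 4 1) p + dd Tb (axis 3 1) p * Tc p
   - 2 * Tb p * dd Tc (axis 3 1) p = 0"
  using heavenly_dd[of p "axis 4 1"] smooth_dd_commute[OF U smooths(1), of p "axis 1 1" "axis 4 1"]
    smooth_dd_commute[OF U smooths(2), of p "axis 2 1" "axis 4 1"] Ta_y[of p] Tb_y[of p]
  unfolding Tb_def[symmetric] Tc_def[symmetric] by simp

lemma heavenly_x: "p \<in> U \<Longrightarrow> dd Ta (axis 1 1) p + dd Tb (axis 2 1) p + Ta p * dd Tc (axis 3 1) p + dd Ta (axis 3 1) p * Tc p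
   - 2 * Tb p * dd Tb (axis 3 1) p = 0"
proof -
  assume p: "p \<in> U"
  have "dd (dd fy (axis 2 1)) (axis 3 1) p = dd (dd fy (axis 3 1)) (axis 2 1) p" by (rule smooth_dd_commute[OF U smooths(2) p])
  also have "\<dots> = dd Tb (axis 2 1) p" by (rule dd_cong_open[OF U p fy_x])
  finally show ?thesis
    using heavenly_dd[OF p, of "axis 3 1"] smooth_dd_commute[OF U smooths(1) p, of "axis 1 1" "axis 3 1"]
    unfolding Ta_def[symmetric] by simp
qed

text \<open>\<open>e1v, e2v, \<partial>\<^sub>x, \<partial>\<^sub>y\<close> is a null frame, and \<open>L0, L1\<close> span the alpha-planes with parameter \<open>X - X\<^sub>0\<close>.\<close>

definition e1v :: "real \<times> (real^4) \<Rightarrow> real^4" where "e1v q = vector [1, 0, Tc (snd q), - Tb (snd q)]"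
definition e2v :: "real \<times> (real^4) \<Rightarrow> real^4" where "e2v q = vector [0, 1, - Tb (snd q), Ta (snd q)]"
definition L0 :: "real \<times> (real^4) \<Rightarrow> real^4" where "L0 q = axis 3 1 - (fst q - X\<^sub>0) *\<^sub>R e2v q"
definition L1 :: "real \<times> (real^4) \<Rightarrow> real^4" where "L1 q = axis 4 1 + (fst q - X\<^sub>0) *\<^sub>R e1v q"

abbreviation UU :: "(real \<times> (real^4)) set" where "UU \<equiv> UNIV \<times> U"

lemma UU: "open UU" using U by (intro open_Times) auto

lemma Ck_snd_U: "smooth_on f U \<Longrightarrow> Ck_on k (\<lambda>q. f (snd q)) UU"
  by (rule Ck_on_compose[OF UU U Ck_on_smooth Ck_on_snd[OF UU Ck_on_id[OF UU]]]) auto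

lemma frame_Ck: "Ck_on k e1v UU" "Ck_on k e2v UU" "Ck_on k L0 UU" "Ck_on k L1 UU"
proof -
  show 1: "Ck_on k e1v UU" "Ck_on k e2v UU" unfolding e1v_def e2v_def
    by (intro Ck_on_vector_4[OF UU] Ck_on_const[OF UU] Ck_on_minus[OF UU] Ck_snd_U smooths)+
  have s: "Ck_on k (\<lambda>q. fst q - X\<^sub>0) UU" by (intro Ck_on_diff[OF UU] Ck_on_fst[OF UU Ck_on_id[OF UU]] Ck_on_const[OF UU])
  show "Ck_on k L0 UU" "Ck_on k L1 UU" unfolding L0_def L1_def
    by (intro Ck_on_diff[OF UU] Ck_on_add[OF UU] Ck_on_const[OF UU] Ck_on_scaleR[OF UU s] 1)+
qed

lemma frame_diff: "q \<in> UU \<Longrightarrow> e1v differentiable at q" "q \<in> UU \<Longrightarrow> e2v differentiable at q"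
  "q \<in> UU \<Longrightarrow> L0 differentiable at q" "q \<in> UU \<Longrightarrow> L1 differentiable at q"
  using Ck_on_Suc_differentiable[OF frame_Ck(1)[of "Suc 0"] UU] Ck_on_Suc_differentiable[OF frame_Ck(2)[of "Suc 0"] UU]
    Ck_on_Suc_differentiable[OF frame_Ck(3)[of "Suc 0"] UU] Ck_on_Suc_differentiable[OF frame_Ck(4)[of "Suc 0"] UU] by blast+

lemma dd_frame:
  assumes q: "q \<in> UU"
  shows "dd e1v v q = vector [0, 0, dd Tc (snd v) (snd q), - dd Tb (snd v) (snd q)]"
    and "dd e2v v q = vector [0, 0, - dd Tb (snd v) (snd q), dd Ta (snd v) (snd q)]"
proof -
  have p: "snd q \<in> U" using q by auto
  note d = dd_snd[OF diffs(4)[OF p]] dd_snd[OF diffs(5)[OF p]] dd_snd[OF diffs(6)[OF p]]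
  have m: "(\<lambda>q. - Tb (snd q)) differentiable at q" "dd (\<lambda>q. - Tb (snd q)) v q = - dd Tb (snd v) (snd q)"
    using differentiable_minus[OF d(4)] dd_minus[OF d(4)] d(3) by simp_all
  show "dd e1v v q = vector [0, 0, dd Tc (snd v) (snd q), - dd Tb (snd v) (snd q)]"
    unfolding e1v_def[abs_def] using dd_vector_4[of "\<lambda>q. 1" q "\<lambda>q. 0" "\<lambda>q. Tc (snd q)" "\<lambda>q. - Tb (snd q)" v] d m by simp
  show "dd e2v v q = vector [0, 0, - dd Tb (snd v) (snd q), dd Ta (snd v) (snd q)]"
    unfolding e2v_def[abs_def] using dd_vector_4[of "\<lambda>q. 0" q "\<lambda>q. 1" "\<lambda>q. - Tb (snd q)" "\<lambda>q. Ta (snd q)" v] d m by simp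
qed

lemma dd_L:
  assumes q: "q \<in> UU"
  shows "dd L0 (0, v) q = - ((fst q - X\<^sub>0) *\<^sub>R dd e2v (0, v) q)" and "dd L1 (0, v) q = (fst q - X\<^sub>0) *\<^sub>R dd e1v (0, v) q"
proof -
  have s: "((\<lambda>q. fst q - X\<^sub>0) has_derivative (\<lambda>v. fst v)) (at q)" by (auto intro!: derivative_eq_intros)
  have "(L0 has_derivative (\<lambda>v. 0 - ((fst q - X\<^sub>0) *\<^sub>R dd e2v v q + fst v *\<^sub>R e2v q))) (at q)"
    unfolding L0_def[abs_def] by (intro has_derivative_diff has_derivative_const has_derivative_scaleR s has_derivative_dd frame_diff q)
  from dd_eqI[OF this] show "dd L0 (0, v) q = - ((fst q - X\<^sub>0) *\<^sub>R dd e2v (0, v) q)" by simp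
  have "(L1 has_derivative (\<lambda>v. 0 + ((fst q - X\<^sub>0) *\<^sub>R dd e1v v q + fst v *\<^sub>R e1v q))) (at q)"
    unfolding L1_def[abs_def] by (intro has_derivative_add has_derivative_const has_derivative_scaleR s has_derivative_dd frame_diff q)
  from dd_eqI[OF this] show "dd L1 (0, v) q = (fst q - X\<^sub>0) *\<^sub>R dd e1v (0, v) q" by simp
qed

lemma vec4_expansion: "(v :: real^4) = v$1 *\<^sub>R axis 1 1 + v$2 *\<^sub>R axis 2 1 + v$3 *\<^sub>R axis 3 1 + v$4 *\<^sub>R axis 4 1"
  by (simp add: vec_eq_iff forall_4 axis_def)

lemma dd_axes:
  fixes f :: "real^4 \<Rightarrow> 'b::real_normed_vector"
  assumes "f differentiable at p"
  shows "dd f v p = v$1 *\<^sub>R dd f (axis 1 1) p + v$2 *\<^sub>R dd f (axis 2 1) p + v$3 *\<^sub>R dd f (axis 3 1) p + v$4 *\<^sub>R dd f (axis 4 1) p"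
proof -
  have "dd f v p = dd f (v$1 *\<^sub>R axis 1 1 + v$2 *\<^sub>R axis 2 1 + v$3 *\<^sub>R axis 3 1 + v$4 *\<^sub>R axis 4 1) p" using vec4_expansion[of v] by simp
  then show ?thesis by (simp only: linear_add[OF dd_linear[OF assms]] linear_scale[OF dd_linear[OF assms]])
qed

text \<open>The bracket of \<open>L0\<close> and \<open>L1\<close> is quadratic in
  \<open>s = X - X\<^sub>0\<close>. Its linear term vanishes by symmetry of the third derivatives of
  \<open>\<Theta>\<close>, the quadratic one because \<open>e1v\<close> and \<open>e2v\<close>
  commute by the differentiated heavenly equation. The middle four facts say that bracketing the
  frame with \<open>L0\<close>, \<open>L1\<close> amounts to differentiating it by \<open>x\<close>,
  \<open>y\<close>.\<close>

lemma brackets: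
  assumes q: "q \<in> UU"
  shows "dd e2v (0, e1v q) q = dd e1v (0, e2v q) q"
    and "dd e1v (0, L0 q) q - dd L0 (0, e1v q) q = vector [0, 0, dd Tc (axis 3 1) (snd q), - dd Tb (axis 3 1) (snd q)]"
    and "dd e2v (0, L0 q) q - dd L0 (0, e2v q) q = vector [0, 0, - dd Tb (axis 3 1) (snd q), dd Ta (axis 3 1) (snd q)]"
    and "dd e1v (0, L1 q) q - dd L1 (0, e1v q) q = vector [0, 0, dd Tc (axis 4 1) (snd q), - dd Tb (axis 4 1) (snd q)]"
    and "dd e2v (0, L1 q) q - dd L1 (0, e2v q) q = vector [0, 0, - dd Tb (axis 4 1) (snd q), dd Ta (axis 4 1) (snd q)]"
    and "dd L1 (0, L0 q) q = dd L0 (0, L1 q) q"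
proof -
  have p: "snd q \<in> U" using q by auto
  note ax = dd_axes[OF diffs(4)[OF p]] dd_axes[OF diffs(5)[OF p]] dd_axes[OF diffs(6)[OF p]]
  note h = heavenly_x[OF p] heavenly_y[OF p] Ta_y[OF p] Tb_y[OF p]
  show 1: "dd e2v (0, e1v q) q = dd e1v (0, e2v q) q"
    unfolding dd_frame[OF q] vec_eq_iff forall_4
    using h by (simp add: ax[of "e1v q"] ax[of "e2v q"]) (simp add: e1v_def e2v_def algebra_simps power2_eq_square)
  have lin: "linear (\<lambda>v. dd e1v (0, v) q)" "linear (\<lambda>v. dd e2v (0, v) q)"
    using linear_add[OF dd_linear[OF frame_diff(1)[OF q]], of "(0, _)" "(0, _)"] linear_scale[OF dd_linear[OF frame_diff(1)[OF q]], of _ "(0, _)"]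
      linear_add[OF dd_linear[OF frame_diff(2)[OF q]], of "(0, _)" "(0, _)"] linear_scale[OF dd_linear[OF frame_diff(2)[OF q]], of _ "(0, _)"]
    by (auto intro!: linearI)
  note l = linear_add[OF lin(1)] linear_scale[OF lin(1)] linear_diff[OF lin(1)] linear_add[OF lin(2)] linear_scale[OF lin(2)] linear_diff[OF lin(2)]
  have a3: "dd e1v (0, axis 3 1) q = vector [0, 0, dd Tc (axis 3 1) (snd q), - dd Tb (axis 3 1) (snd q)]"
    "dd e2v (0, axis 3 1) q = vector [0, 0, - dd Tb (axis 3 1) (snd q), dd Ta (axis 3 1) (snd q)]"
    "dd e1v (0, axis 4 1) q = vector [0, 0, dd Tc (axis 4 1) (snd q), - dd Tb (axis 4 1) (snd q)]"
    "dd e2v (0, axis 4 1) q = vector [0, 0, - dd Tb (axis 4 1) (snd q), dd Ta (axis 4 1) (snd q)]"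
    unfolding dd_frame[OF q] by simp_all
  have L: "dd e1v (0, L0 q) q = dd e1v (0, axis 3 1) q - (fst q - X\<^sub>0) *\<^sub>R dd e1v (0, e2v q) q"
    "dd e2v (0, L0 q) q = dd e2v (0, axis 3 1) q - (fst q - X\<^sub>0) *\<^sub>R dd e2v (0, e2v q) q"
    "dd e1v (0, L1 q) q = dd e1v (0, axis 4 1) q + (fst q - X\<^sub>0) *\<^sub>R dd e1v (0, e1v q) q"
    "dd e2v (0, L1 q) q = dd e2v (0, axis 4 1) q + (fst q - X\<^sub>0) *\<^sub>R dd e2v (0, e1v q) q"
    unfolding L0_def L1_def l by simp_all
  show "dd e1v (0, L0 q) q - dd L0 (0, e1v q) q = vector [0, 0, dd Tc (axis 3 1) (snd q), - dd Tb (axis 3 1) (snd q)]"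
    unfolding dd_L[OF q] L 1 a3 by simp
  show "dd e2v (0, L0 q) q - dd L0 (0, e2v q) q = vector [0, 0, - dd Tb (axis 3 1) (snd q), dd Ta (axis 3 1) (snd q)]"
    unfolding dd_L[OF q] L 1 a3 by simp
  show "dd e1v (0, L1 q) q - dd L1 (0, e1v q) q = vector [0, 0, dd Tc (axis 4 1) (snd q), - dd Tb (axis 4 1) (snd q)]"
    unfolding dd_L[OF q] L 1 a3 by simp
  show "dd e2v (0, L1 q) q - dd L1 (0, e2v q) q = vector [0, 0, - dd Tb (axis 4 1) (snd q), dd Ta (axis 4 1) (snd q)]"
    unfolding dd_L[OF q] L 1 a3 by simp
  show "dd L1 (0, L0 q) q = dd L0 (0, L1 q) q"
    unfolding dd_L[OF q] L 1 a3 using h by (simp add: vec_eq_iff forall_4 algebra_simps)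
qed

text \<open>Uniqueness for the linearised equation along a given curve: the derivative of
  \<open>V\<close> is bounded on the compact image of the curve.\<close>

lemma variational_unique:
  fixes V :: "'s::euclidean_space \<Rightarrow> 's"
  assumes S: "open S" and V: "Ck_on (Suc 0) V S"
    and c: "continuous_on {a..b} c" "\<And>t. t \<in> {a..b} \<Longrightarrow> c t \<in> S"
    and J: "\<And>t. t \<in> {a..b} \<Longrightarrow> (J has_vector_derivative dd V (J t) (c t)) (at t)"
    and G: "\<And>t. t \<in> {a..b} \<Longrightarrow> (G has_vector_derivative dd V (G t) (c t)) (at t)"
    and t0: "t0 \<in> {a..b}" "J t0 = G t0" and t: "t \<in> {a..b}"
  shows "J t = G t"
proof -
  have "compact ((\<lambda>t. Dblin V (c t)) ` {a..b})"
    by (intro compact_continuous_image continuous_on_compose2[OF Ck_on_1_Dblin(2)[OF S V] c(1)]) (use c in auto)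
  then obtain L where L: "\<And>t. t \<in> {a..b} \<Longrightarrow> norm (Dblin V (c t)) \<le> L" using compact_imp_bounded bounded_pos by (metis imageI)
  have "J t - G t = 0"
  proof (rule linear_growth_zero[where d="\<lambda>t. J t - G t" and d'="\<lambda>t. dd V (J t) (c t) - dd V (G t) (c t)" and L=L and ?t0.0=t0, OF _ _ t0(1) _ t])
    fix s assume s: "s \<in> {a..b}"
    show "((\<lambda>t. J t - G t) has_vector_derivative dd V (J s) (c s) - dd V (G s) (c s)) (at s)"
      by (intro has_vector_derivative_diff J G s)
    have d: "V differentiable at (c s)" by (rule Ck_on_Suc_differentiable[OF V S c(2)[OF s]])
    have "dd V (J s) (c s) - dd V (G s) (c s) = blinfun_apply (Dblin V (c s)) (J s - G s)"
      unfolding blinfun_apply_Dblin[OF d] using linear_diff[OF dd_linear[OF d]] by simp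
    also have "norm \<dots> \<le> norm (Dblin V (c s)) * norm (J s - G s)" by (rule norm_blinfun)
    also have "\<dots> \<le> L * norm (J s - G s)" using L[OF s] by (intro mult_right_mono) auto
    finally show "norm (dd V (J s) (c s) - dd V (G s) (c s)) \<le> L * norm (J s - G s)" .
  qed (use t0 in simp)
  then show ?thesis by simp
qed

end

section \<open>Twistor coordinates from the flow of the Lax distribution\<close>

text \<open>For functions that agree only on a slice and not on an open set: derivatives in
  directions tangent to the slice still coincide.\<close>

lemma dd_eq_on_line:
  assumes f: "f differentiable at q" and g: "g differentiable at q" and e: "e > 0"
    and eq: "\<And>t::real. \<bar>t\<bar> < e \<Longrightarrow> f (q + t *\<^sub>R v) = g (q + t *\<^sub>R v)"
  shows "dd f v q = dd g v q"
proof -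
  have "((\<lambda>t. f (q + t *\<^sub>R v)) has_vector_derivative dd f v q) (at 0)" "((\<lambda>t. g (q + t *\<^sub>R v)) has_vector_derivative dd g v q) (at 0)"
    using has_vector_derivative_line[of f q 0 v] has_vector_derivative_line[of g q 0 v] f g by simp_all
  moreover from this(1) have "((\<lambda>t. g (q + t *\<^sub>R v)) has_vector_derivative dd f v q) (at 0)"
    by (rule has_vector_derivative_transform_within_open[where S="{-e<..<e}"]) (use eq e in \<open>auto simp: abs_less_iff\<close>)
  ultimately show ?thesis using vector_derivative_unique_at by blast
qed

lemma dd_const_on_line:
  assumes "f differentiable at q" and "\<And>t::real. f (q + t *\<^sub>R v) = f q"
  shows "dd f v q = 0"
  using dd_eq_on_line[of f q "\<lambda>_. f q" 1 v] assms by simp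

locale heavenly_at = heavenly +
  fixes p\<^sub>0 :: "real^4"
  assumes p0: "p\<^sub>0 \<in> U"
begin

text \<open>In the chart to be built, a point is labelled by \<open>c\<close>: its first two entries
  \<open>(w, z)\<close> choose a point of the transversal slice, the last two are parameters of the
  flows of \<open>L0\<close> and \<open>L1\<close>. \<open>pil\<close> forgets the flow parameters,
  and \<open>pis\<close> inserts the values of \<open>x\<close> and \<open>y\<close> at
  \<open>p\<^sub>0\<close> in their place.\<close>

definition pil :: "real^4 \<Rightarrow> real^4" where "pil v = vector [v$1, v$2, 0, 0]"
definition pis :: "real^4 \<Rightarrow> real^4" where "pis v = vector [v$1, v$2, p\<^sub>0$3, p\<^sub>0$4]"
definition c\<^sub>0 :: "real^4" where "c\<^sub>0 = pil p\<^sub>0"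

lemma pil: "bounded_linear pil"
  unfolding pil_def linear_conv_bounded_linear[symmetric] by (auto intro!: linearI simp: vec_eq_iff forall_4)

lemma pis_eq: "pis v = pil v + vector [0, 0, p\<^sub>0$3, p\<^sub>0$4]"
  unfolding pis_def pil_def by (simp add: vec_eq_iff forall_4)

lemma pis_c0: "pis c\<^sub>0 = p\<^sub>0" unfolding pis_def c\<^sub>0_def pil_def by (simp add: vec_eq_iff forall_4)

lemma pis_deriv: "((\<lambda>q. pis (snd q)) has_derivative (\<lambda>v. pil (snd v))) (at q)"
  unfolding pis_eq using bounded_linear.has_derivative[OF pil has_derivative_snd[OF has_derivative_ident]]
  by (auto intro!: derivative_eq_intros)

definition SD :: "(real \<times> (real^4)) set" where "SD = (\<lambda>q. pis (snd q)) -` U"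

lemma SD: "open SD" unfolding SD_def
  by (rule open_vimage[OF U]) (use pis_deriv in \<open>auto intro!: continuous_at_imp_continuous_on has_derivative_continuous\<close>)

lemma pis_Ck: "open S \<Longrightarrow> Ck_on k (\<lambda>q :: real \<times> (real^4). pis (snd q)) S"
  unfolding pis_eq by (intro Ck_on_add Ck_on_const Ck_on_bounded_linear_comp[OF pil] Ck_on_snd Ck_on_id)

lemma Ck_pis: "smooth_on f U \<Longrightarrow> Ck_on k (\<lambda>q. f (pis (snd q))) SD"
  by (rule Ck_on_compose[OF SD U Ck_on_smooth pis_Ck[OF SD]]) (auto simp: SD_def)

lemma dd_pis:
  assumes "f differentiable at (pis (snd q))"
  shows "((\<lambda>q. f (pis (snd q))) has_derivative (\<lambda>v. dd f (pil (snd v)) (pis (snd q)))) (at q)"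
  by (rule has_derivative_compose[OF pis_deriv has_derivative_dd[OF assms]])

text \<open>A slice transversal to the alpha-surfaces; it is bent so that \<open>w - s y\<^sub>0\<close> and, up to third
  order in \<open>s = X - X\<^sub>0\<close>, also \<open>z + s x\<^sub>0\<close> are the right initial values for the twistor coordinates.\<close>

definition sig :: "real \<times> (real^4) \<Rightarrow> real^4" where
  "sig q = vector [snd q $ 1, snd q $ 2, p\<^sub>0$3 + (fst q - X\<^sub>0) * fy (pis (snd q)), p\<^sub>0$4 - (fst q - X\<^sub>0) * fx (pis (snd q))]"

lemma s_Ck: "open S \<Longrightarrow> Ck_on k (\<lambda>q :: real \<times> (real^4). fst q - X\<^sub>0) S"
  by (intro Ck_on_diff Ck_on_fst Ck_on_id Ck_on_const)

lemma c_Ck: "open S \<Longrightarrow> Ck_on k (\<lambda>q :: real \<times> (real^4). snd q $ i) S"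
  by (intro Ck_on_vec_nth Ck_on_snd Ck_on_id)

lemma sig_Ck: "Ck_on k sig SD"
  unfolding sig_def
  by (intro Ck_on_vector_4[OF SD] Ck_on_add[OF SD] Ck_on_diff[OF SD Ck_on_const[OF SD]] Ck_on_const[OF SD] Ck_on_mult[OF SD s_Ck[OF SD]] c_Ck[OF SD] Ck_pis smooths)

lemma sig_diff: "q \<in> SD \<Longrightarrow> sig differentiable at q"
  using Ck_on_Suc_differentiable[OF sig_Ck[of "Suc 0"] SD] .

lemma dd_sig:
  assumes q: "q \<in> SD"
  shows "dd sig v q = vector [snd v $ 1, snd v $ 2,
     fst v * fy (pis (snd q)) + (fst q - X\<^sub>0) * dd fy (pil (snd v)) (pis (snd q)),
     - (fst v * fx (pis (snd q)) + (fst q - X\<^sub>0) * dd fx (pil (snd v)) (pis (snd q)))]"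
proof -
  have pU: "pis (snd q) \<in> U" using q unfolding SD_def by simp
  have s: "((\<lambda>q :: real \<times> (real^4). fst q - X\<^sub>0) has_derivative (\<lambda>v. fst v)) (at q)" by (auto intro!: derivative_eq_intros)
  have c: "((\<lambda>q :: real \<times> (real^4). snd q $ i) has_derivative (\<lambda>v. snd v $ i)) (at q)" for i
    by (rule bounded_linear.has_derivative[OF bounded_linear_vec_nth has_derivative_snd[OF has_derivative_ident]])
  have 3: "((\<lambda>q. p\<^sub>0$3 + (fst q - X\<^sub>0) * fy (pis (snd q))) has_derivative
     (\<lambda>v. 0 + ((fst q - X\<^sub>0) * dd fy (pil (snd v)) (pis (snd q)) + fst v * fy (pis (snd q))))) (at q)"
    by (intro has_derivative_add has_derivative_const has_derivative_mult s dd_pis diffs pU)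
  have 4: "((\<lambda>q. p\<^sub>0$4 - (fst q - X\<^sub>0) * fx (pis (snd q))) has_derivative
     (\<lambda>v. 0 - ((fst q - X\<^sub>0) * dd fx (pil (snd v)) (pis (snd q)) + fst v * fx (pis (snd q))))) (at q)"
    by (intro has_derivative_diff has_derivative_const has_derivative_mult s dd_pis diffs pU)
  note d = c[of 1, THEN differentiableI] c[of 2, THEN differentiableI] 3[THEN differentiableI] 4[THEN differentiableI]
  show ?thesis unfolding sig_def[abs_def] dd_vector_4[OF d] dd_eqI[OF c] dd_eqI[OF 3] dd_eqI[OF 4] by (simp add: algebra_simps)
qed

lemma sig_base: "sig (X\<^sub>0, c\<^sub>0) = p\<^sub>0" unfolding sig_def c\<^sub>0_def pil_def by (simp add: vec_eq_iff forall_4)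

lemma base_SD: "(X\<^sub>0, c\<^sub>0) \<in> SD" unfolding SD_def by (simp add: pis_c0 p0)

definition pq :: "real \<times> (real^4) \<times> (real^4) \<Rightarrow> real \<times> (real^4)" where "pq y = (fst y, snd (snd y))"
text \<open>The state is \<open>(X, c, p)\<close>. \<open>X\<close> and the label \<open>c\<close>
  stay constant and \<open>p\<close> follows the combination of \<open>L0\<close> and
  \<open>L1\<close> with coefficients \<open>c$3\<close>, \<open>c$4\<close>. As parameters are part
  of the state, regularity in them is regularity in initial values.\<close>

definition Vf :: "real \<times> (real^4) \<times> (real^4) \<Rightarrow> real \<times> (real^4) \<times> (real^4)" where
  "Vf y = (0, 0, (fst (snd y) $ 3) *\<^sub>R L0 (pq y) + (fst (snd y) $ 4) *\<^sub>R L1 (pq y))"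
definition SS :: "(real \<times> (real^4) \<times> (real^4)) set" where "SS = UNIV \<times> (UNIV \<times> U)"

lemma SS: "open SS" unfolding SS_def using U by (intro open_Times) auto

lemma pq: "bounded_linear pq"
  unfolding pq_def by (intro bounded_linear_Pair bounded_linear_fst bounded_linear_compose[OF bounded_linear_snd bounded_linear_snd])

lemma pq_UU: "y \<in> SS \<Longrightarrow> pq y \<in> UU" unfolding SS_def pq_def by auto

lemma L_Ck: "Ck_on k (\<lambda>y. L0 (pq y)) SS" "Ck_on k (\<lambda>y. L1 (pq y)) SS"
  by (rule Ck_on_compose[OF SS UU frame_Ck(3) Ck_on_bounded_linear[OF pq SS]], use pq_UU in blast,
      rule Ck_on_compose[OF SS UU frame_Ck(4) Ck_on_bounded_linear[OF pq SS]], use pq_UU in blast)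

lemma Vf_Ck: "Ck_on k Vf SS"
  unfolding Vf_def
  by (intro Ck_on_Pair[OF SS] Ck_on_const[OF SS] Ck_on_add[OF SS] Ck_on_scaleR[OF SS Ck_on_vec_nth[OF SS Ck_on_fst[OF SS Ck_on_snd[OF SS Ck_on_id[OF SS]]]]] L_Ck)

lemma dd_Vf:
  assumes y: "y \<in> SS"
  shows "dd Vf (0, u, v) y = (0, 0, (u$3 *\<^sub>R L0 (pq y) + u$4 *\<^sub>R L1 (pq y)) +
    (fst (snd y) $ 3 *\<^sub>R dd L0 (0, v) (pq y) + fst (snd y) $ 4 *\<^sub>R dd L1 (0, v) (pq y)))"
proof -
  have c: "((\<lambda>y :: real \<times> (real^4) \<times> (real^4). fst (snd y) $ i) has_derivative (\<lambda>h. fst (snd h) $ i)) (at y)" for i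
    by (rule bounded_linear.has_derivative[OF bounded_linear_vec_nth has_derivative_fst[OF has_derivative_snd[OF has_derivative_ident]]])
  have p: "(pq has_derivative pq) (at y)" by (rule bounded_linear_imp_has_derivative[OF pq])
  have L: "((\<lambda>y. L0 (pq y)) has_derivative (\<lambda>h. dd L0 (pq h) (pq y))) (at y)" "((\<lambda>y. L1 (pq y)) has_derivative (\<lambda>h. dd L1 (pq h) (pq y))) (at y)"
    by (rule has_derivative_compose[OF p has_derivative_dd[OF frame_diff(3)[OF pq_UU[OF y]]]],
        rule has_derivative_compose[OF p has_derivative_dd[OF frame_diff(4)[OF pq_UU[OF y]]]])
  have "(Vf has_derivative (\<lambda>h. (0, 0, (fst (snd y) $ 3 *\<^sub>R dd L0 (pq h) (pq y) + fst (snd h) $ 3 *\<^sub>R L0 (pq y))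
      + (fst (snd y) $ 4 *\<^sub>R dd L1 (pq h) (pq y) + fst (snd h) $ 4 *\<^sub>R L1 (pq y))))) (at y)"
    unfolding Vf_def[abs_def] by (intro has_derivative_Pair has_derivative_const has_derivative_add has_derivative_scaleR c L)
  from dd_eqI[OF this, of "(0, u, v)"] show ?thesis by (simp add: pq_def algebra_simps)
qed

text \<open>Frobenius for a commuting pair: one flow of the combined field replaces a composition of
  two flows, and the alpha-surfaces become the planes on which only \<open>c$3\<close> and
  \<open>c$4\<close> vary.\<close>

lemma flow_chart:
  obtains t0 \<Omega>c T where "t0 > 0" "open \<Omega>c" "(X\<^sub>0, c\<^sub>0) \<in> \<Omega>c" "\<Omega>c \<subseteq> SD" "Ck_on 7 T \<Omega>c"
    "\<And>q. q \<in> \<Omega>c \<Longrightarrow> T q \<in> U"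
    "\<And>q. q \<in> \<Omega>c \<Longrightarrow> dd T (0, axis 3 1) q = t0 *\<^sub>R L0 (fst q, T q)" "\<And>q. q \<in> \<Omega>c \<Longrightarrow> dd T (0, axis 4 1) q = t0 *\<^sub>R L1 (fst q, T q)"
    "\<And>q. q \<in> \<Omega>c \<Longrightarrow> snd q $ 3 = 0 \<Longrightarrow> snd q $ 4 = 0 \<Longrightarrow> T q = sig q"
proof -
  have y0: "(X\<^sub>0, c\<^sub>0, p\<^sub>0) \<in> SS" unfolding SS_def using p0 by simp
  obtain \<delta> N \<phi> where N: "(X\<^sub>0, c\<^sub>0, p\<^sub>0) \<in> N" and fb: "flow_box Vf SS \<delta> N \<phi>" and \<phi>7: "Ck_on 7 (\<lambda>(t, x). \<phi> t x) ({-\<delta><..<\<delta>} \<times> N)"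
    using Ck_flow_7[OF SS y0 Vf_Ck] unfolding has_Ck_flow_def by blast
  have \<delta>: "\<delta> > 0" and oN: "open N" and fb0: "\<And>x. x \<in> N \<Longrightarrow> \<phi> 0 x = x"
    and fbd: "\<And>x t. x \<in> N \<Longrightarrow> t \<in> {-\<delta><..<\<delta>} \<Longrightarrow> \<phi> t x \<in> SS \<and> ((\<lambda>t. \<phi> t x) has_vector_derivative Vf (\<phi> t x)) (at t)"
    using fb unfolding flow_box_def by blast+
  define \<Phi> where "\<Phi> = (\<lambda>(t, x). \<phi> t x)"
  define S where "S = {-\<delta><..<\<delta>} \<times> N"
  have S: "open S" unfolding S_def using oN by (intro open_Times) auto
  have \<Phi>7: "Ck_on 7 \<Phi> S" using \<phi>7 unfolding \<Phi>_def S_def .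
  have \<Phi>2: "Ck_on (Suc (Suc 0)) \<Phi> S" by (rule Ck_on_mono[OF \<Phi>7 _ S]) simp
  have \<Phi>d: "\<Phi> differentiable at z" "dd \<Phi> u differentiable at z" if "z \<in> S" for z u
    using Ck_on_Suc_differentiable[OF \<Phi>2 S that] Ck_on_Suc_differentiable[OF Ck_on_dd[OF S \<Phi>2] S that] by blast+
  have \<Phi>SS: "\<Phi> z \<in> SS" if "z \<in> S" for z using fbd that unfolding \<Phi>_def S_def by auto
  have line: "((\<lambda>t. f (t, y)) has_vector_derivative dd f (1, 0) (t, y)) (at t)"
    if "f differentiable at (t, y)" for f :: "real \<times> real \<times> (real^4) \<times> (real^4) \<Rightarrow> real \<times> (real^4) \<times> (real^4)" and t y
    using has_vector_derivative_line[of f "(0, y)" t "(1, 0)"] that by simp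
  have \<Phi>t: "dd \<Phi> (1, 0) z = Vf (\<Phi> z)" if z: "z \<in> S" for z
  proof -
    obtain t y where ty: "z = (t, y)" by (cases z)
    have "((\<lambda>t. \<Phi> (t, y)) has_vector_derivative Vf (\<Phi> z)) (at t)" using fbd z unfolding ty S_def \<Phi>_def by auto
    with line[OF \<Phi>d(1)[OF z, unfolded ty]] show ?thesis unfolding ty by (rule vector_derivative_unique_at)
  qed
  have var: "((\<lambda>t. dd \<Phi> (0, u) (t, y)) has_vector_derivative dd Vf (dd \<Phi> (0, u) (t, y)) (\<Phi> (t, y))) (at t)" if z: "(t, y) \<in> S" for t y u
  proof -
    have "dd (dd \<Phi> (0, u)) (1, 0) (t, y) = dd (dd \<Phi> (1, 0)) (0, u) (t, y)"
      by (rule dd_commute[OF S z]) (use \<Phi>2 in \<open>simp add: numeral_2_eq_2 del: Ck_on.simps\<close>)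
    also have "\<dots> = dd (\<lambda>z. Vf (\<Phi> z)) (0, u) (t, y)" by (rule dd_cong_open[OF S z \<Phi>t])
    also have "\<dots> = dd Vf (dd \<Phi> (0, u) (t, y)) (\<Phi> (t, y))"
      by (rule dd_compose[OF Ck_on_Suc_differentiable[OF Vf_Ck[of "Suc 0"] SS \<Phi>SS[OF z]] \<Phi>d(1)[OF z]])
    finally show ?thesis using line[OF \<Phi>d(2)[OF z, of "(0, u)"]] by simp
  qed
  have init: "dd \<Phi> (0, u) (0, y) = u" if y: "y \<in> N" for u y
  proof -
    have z: "(0, y) \<in> S" using y \<delta> unfolding S_def by simp
    have "((\<lambda>y. (0::real, y)) has_derivative (\<lambda>v. (0, v))) (at y)" by (auto intro!: derivative_eq_intros)
    from has_derivative_compose[OF this has_derivative_dd[OF \<Phi>d(1)[OF z]]]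
    have 1: "((\<lambda>y. \<Phi> (0, y)) has_derivative (\<lambda>v. dd \<Phi> (0, v) (0, y))) (at y)" .
    have "((\<lambda>y. \<Phi> (0, y)) has_derivative (\<lambda>v. v)) (at y)"
      by (rule has_derivative_transform_within_open[OF has_derivative_ident oN y]) (simp add: \<Phi>_def fb0)
    from has_derivative_unique[OF 1 this] show ?thesis by (rule fun_cong)
  qed
  have const: "fst (\<Phi> (t, y)) = fst y" "fst (snd (\<Phi> (t, y))) = fst (snd y)" if z: "(t, y) \<in> S" for t y
  proof -
    define a b where "a = min 0 t" and "b = max 0 t"
    have ab: "0 \<in> {a..b}" "t \<in> {a..b}" and S': "\<And>s. s \<in> {a..b} \<Longrightarrow> (s, y) \<in> S" using z \<delta> unfolding a_def b_def S_def by auto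
    have yN: "y \<in> N" using z unfolding S_def by simp
    have "(fst (\<Phi> (t, y)), fst (snd (\<Phi> (t, y)))) - (fst y, fst (snd y)) = 0"
    proof (rule linear_growth_zero[where d="\<lambda>t. (fst (\<Phi> (t, y)), fst (snd (\<Phi> (t, y)))) - (fst y, fst (snd y))" and d'="\<lambda>_. 0" and L=0 and ?t0.0=0, OF _ _ ab(1) _ ab(2)])
      fix s assume s: "s \<in> {a..b}"
      have h: "((\<lambda>t. \<Phi> (t, y)) has_vector_derivative Vf (\<Phi> (s, y))) (at s)" using line[OF \<Phi>d(1)[OF S'[OF s]]] \<Phi>t[OF S'[OF s]] by simp
      have "((\<lambda>t. (fst (\<Phi> (t, y)), fst (snd (\<Phi> (t, y)))) - (fst y, fst (snd y))) has_vector_derivative (fst (Vf (\<Phi> (s, y))), fst (snd (Vf (\<Phi> (s, y))))) - 0) (at s)"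
        by (intro has_vector_derivative_diff has_vector_derivative_const has_vector_derivative_Pair
          bounded_linear.has_vector_derivative[OF bounded_linear_fst h] bounded_linear.has_vector_derivative[OF bounded_linear_fst bounded_linear.has_vector_derivative[OF bounded_linear_snd h]])
      then show "((\<lambda>t. (fst (\<Phi> (t, y)), fst (snd (\<Phi> (t, y)))) - (fst y, fst (snd y))) has_vector_derivative 0) (at s)"
        by (simp add: Vf_def zero_prod_def)
    qed (use fb0[OF yN] in \<open>auto simp: \<Phi>_def zero_prod_def\<close>)
    then show "fst (\<Phi> (t, y)) = fst y" "fst (snd (\<Phi> (t, y))) = fst (snd y)" by (auto simp: zero_prod_def)
  qed
  \<comment> \<open>Since \<open>L0\<close> and \<open>L1\<close> commute,
    \<open>t *\<^sub>R L\<close> along the orbit solves the same linearised equation as the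
    derivative by \<open>c$3\<close> or \<open>c$4\<close>, and both start from the same
    value.\<close>
  have J: "dd \<Phi> (0, 0, axis i 1, 0) (t, y) = (0, axis i 1, t *\<^sub>R L (pq (\<Phi> (t, y))))"
    if z: "(t, y) \<in> S" and iL: "i = 3 \<and> L = L0 \<or> i = 4 \<and> L = L1" for t y i L
  proof -
    define a b where "a = min 0 t" and "b = max 0 t"
    have ab: "0 \<in> {a..b}" "t \<in> {a..b}" and S': "\<And>s. s \<in> {a..b} \<Longrightarrow> (s, y) \<in> S" using z \<delta> unfolding a_def b_def S_def by auto
    have yN: "y \<in> N" using z unfolding S_def by simp
    show ?thesis
    proof (rule variational_unique[OF SS Vf_Ck, where c="\<lambda>t. \<Phi> (t, y)" and J="\<lambda>t. dd \<Phi> (0, 0, axis i 1, 0) (t, y)" and G="\<lambda>t. (0, axis i 1, t *\<^sub>R L (pq (\<Phi> (t, y))))", OF _ _ _ _ ab(1) _ ab(2)])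
      show "continuous_on {a..b} (\<lambda>t. \<Phi> (t, y))"
        using line[OF \<Phi>d(1)[OF S']] by (intro continuous_at_imp_continuous_on ballI) (rule has_vector_derivative_continuous)
      fix s assume s: "s \<in> {a..b}"
      note z' = S'[OF s]
      define Y where "Y = \<Phi> (s, y)"
      have YS: "Y \<in> SS" unfolding Y_def by (rule \<Phi>SS[OF z'])
      show "\<Phi> (s, y) \<in> SS" by (rule \<Phi>SS[OF z'])
      show "((\<lambda>t. dd \<Phi> (0, 0, axis i 1, 0) (t, y)) has_vector_derivative dd Vf (dd \<Phi> (0, 0, axis i 1, 0) (s, y)) (\<Phi> (s, y))) (at s)"
        by (rule var[OF z'])
      have Ld: "L differentiable at (pq Y)" using iL frame_diff(3,4)[OF pq_UU[OF YS]] by auto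
      have h: "((\<lambda>t. \<Phi> (t, y)) has_vector_derivative Vf Y) (at s)" using line[OF \<Phi>d(1)[OF z']] \<Phi>t[OF z'] unfolding Y_def by simp
      define w where "w = snd (snd (Vf Y))"
      have pV: "pq (Vf Y) = (0, w)" unfolding pq_def w_def Vf_def by simp
      have hp: "((\<lambda>t. pq (\<Phi> (t, y))) has_vector_derivative (0, w)) (at s)"
        using bounded_linear.has_vector_derivative[OF pq h] unfolding pV .
      have hL: "((\<lambda>t. L (pq (\<Phi> (t, y)))) has_vector_derivative dd L (0, w) (pq Y)) (at s)"
      proof -
        have "dd L (x *\<^sub>R (0, w)) (pq Y) = x *\<^sub>R dd L (0, w) (pq Y)" for x by (rule linear_scale[OF dd_linear[OF Ld]])
        with has_derivative_compose[OF hp[unfolded has_vector_derivative_def] has_derivative_dd[OF Ld[unfolded Y_def]]]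
        show ?thesis unfolding has_vector_derivative_def Y_def by simp
      qed
      have "((\<lambda>t. (0::real, axis i 1 :: real^4, t *\<^sub>R L (pq (\<Phi> (t, y))))) has_vector_derivative (0, 0, s *\<^sub>R dd L (0, w) (pq Y) + 1 *\<^sub>R L (pq Y))) (at s)"
        using has_vector_derivative_scaleR[OF DERIV_ident hL]
        by (intro has_vector_derivative_Pair has_vector_derivative_const) (simp add: Y_def)
      moreover have "dd Vf (0, axis i 1, s *\<^sub>R L (pq Y)) Y = (0, 0, s *\<^sub>R dd L (0, w) (pq Y) + 1 *\<^sub>R L (pq Y))"
      proof -
        have sc: "dd L0 (0, s *\<^sub>R v) (pq Y) = s *\<^sub>R dd L0 (0, v) (pq Y)" "dd L1 (0, s *\<^sub>R v) (pq Y) = s *\<^sub>R dd L1 (0, v) (pq Y)" for v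
          using linear_scale[OF dd_linear[OF frame_diff(3)[OF pq_UU[OF YS]]], of s "(0, v)"] linear_scale[OF dd_linear[OF frame_diff(4)[OF pq_UU[OF YS]]], of s "(0, v)"] by simp_all
        have w: "(0, w) = fst (snd Y) $ 3 *\<^sub>R (0, L0 (pq Y)) + fst (snd Y) $ 4 *\<^sub>R (0, L1 (pq Y))" unfolding w_def Vf_def by simp
        have Lw: "dd L (0, w) (pq Y) = fst (snd Y) $ 3 *\<^sub>R dd L (0, L0 (pq Y)) (pq Y) + fst (snd Y) $ 4 *\<^sub>R dd L (0, L1 (pq Y)) (pq Y)"
          unfolding w linear_add[OF dd_linear[OF Ld]] linear_scale[OF dd_linear[OF Ld]] ..
        show ?thesis unfolding dd_Vf[OF YS] sc Lw using iL brackets(6)[OF pq_UU[OF YS]] by (auto simp: axis_def scaleR_add_right mult.commute)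
      qed
      ultimately show "((\<lambda>t. (0, axis i 1, t *\<^sub>R L (pq (\<Phi> (t, y))))) has_vector_derivative dd Vf (0, axis i 1, s *\<^sub>R L (pq (\<Phi> (s, y)))) (\<Phi> (s, y))) (at s)"
        unfolding Y_def by simp
    qed (use init[OF yN] in simp)
  qed
  \<comment> \<open>Orbits start on the slice \<open>sig\<close>, which does not depend on the flow
    parameters.\<close>
  define em where "em q = (fst q, snd q, sig q)" for q :: "real \<times> (real^4)"
  have em_Ck: "Ck_on k em SD" for k unfolding em_def
    by (intro Ck_on_Pair[OF SD] Ck_on_fst[OF SD] Ck_on_snd[OF SD] Ck_on_id[OF SD] sig_Ck)
  define \<Omega>c where "\<Omega>c = SD \<inter> em -` N"
  have \<Omega>c: "open \<Omega>c" unfolding \<Omega>c_def by (rule continuous_open_preimage[OF Ck_on_continuous[OF em_Ck SD] SD oN])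
  \<comment> \<open>Time 1 may lie outside the flow box, so a fixed smaller time is used; this is
    the factor \<open>t0\<close> in front of \<open>L0\<close> and \<open>L1\<close>.\<close>
  define t0 where "t0 = \<delta>/2"
  have t0: "t0 > 0" "t0 \<in> {-\<delta><..<\<delta>}" unfolding t0_def using \<delta> by auto
  define T where "T q = snd (snd (\<Phi> (t0, em q)))" for q
  have zS: "(t0, em q) \<in> S" if "q \<in> \<Omega>c" for q using that t0 unfolding S_def \<Omega>c_def by auto
  have \<Omega>SD: "\<Omega>c \<subseteq> SD" unfolding \<Omega>c_def by auto
  have T7: "Ck_on 7 T \<Omega>c"
  proof -
    have "Ck_on 7 (\<lambda>q. \<Phi> (t0, em q)) \<Omega>c"
      by (rule Ck_on_compose[OF \<Omega>c S \<Phi>7 Ck_on_Pair[OF \<Omega>c Ck_on_const[OF \<Omega>c] Ck_on_subset[OF em_Ck \<Omega>SD]]]) (use zS in auto)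
    then show ?thesis unfolding T_def by (intro Ck_on_snd[OF \<Omega>c])
  qed
  have ddT: "dd T (0, axis i 1) q = t0 *\<^sub>R L (fst q, T q)" if q: "q \<in> \<Omega>c" and iL: "i = 3 \<and> L = L0 \<or> i = 4 \<and> L = L1" for q i L
  proof -
    have qS: "q \<in> SD" using q \<Omega>SD by auto
    have sg: "dd sig (0, axis i 1) q = 0"
    proof -
      have pU: "pis (snd q) \<in> U" using qS unfolding SD_def by simp
      have p: "pil (axis i 1) = 0" and a: "(axis i 1 :: real^4) $ 1 = 0" "(axis i 1 :: real^4) $ 2 = 0"
        using iL by (auto simp: pil_def axis_def vec_eq_iff forall_4)
      show ?thesis
        unfolding dd_sig[OF qS] snd_conv fst_conv p a linear_0[OF dd_linear[OF diffs(2)[OF pU]]] linear_0[OF dd_linear[OF diffs(3)[OF pU]]]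
        by (simp add: vec_eq_iff forall_4)
    qed
    have emd: "(em has_derivative (\<lambda>v. (fst v, snd v, dd sig v q))) (at q)"
      unfolding em_def[abs_def] by (intro has_derivative_Pair has_derivative_fst has_derivative_snd has_derivative_ident has_derivative_dd sig_diff qS)
    have "((\<lambda>q. (t0, em q)) has_derivative (\<lambda>v. (0, fst v, snd v, dd sig v q))) (at q)"
      by (rule has_derivative_Pair[OF has_derivative_const emd])
    from has_derivative_snd[OF has_derivative_snd[OF has_derivative_compose[OF this has_derivative_dd[OF \<Phi>d(1)[OF zS[OF q]]]]]]
    have "(T has_derivative (\<lambda>v. snd (snd (dd \<Phi> (0, fst v, snd v, dd sig v q) (t0, em q))))) (at q)" unfolding T_def[abs_def] .
    from dd_eqI[OF this] have "dd T (0, axis i 1) q = snd (snd (dd \<Phi> (0, 0, axis i 1, 0) (t0, em q)))" using sg by simp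
    also have "\<dots> = t0 *\<^sub>R L (pq (\<Phi> (t0, em q)))" using J[OF zS[OF q] iL] by simp
    also have "pq (\<Phi> (t0, em q)) = (fst q, T q)" unfolding pq_def const(1)[OF zS[OF q]] T_def by (simp add: em_def)
    finally show ?thesis .
  qed
  \<comment> \<open>For zero flow parameters the field vanishes at the starting state, so the orbit
    is at rest.\<close>
  have slice: "T q = sig q" if q: "q \<in> \<Omega>c" and z: "snd q $ 3 = 0" "snd q $ 4 = 0" for q
  proof -
    have eN: "em q \<in> N" using q unfolding \<Omega>c_def by auto
    have "\<phi> t0 (em q) = em q"
    proof (rule ode_unique[OF SS Vf_Ck[of "Suc 0"], where u="\<lambda>t. \<phi> t (em q)" and v="\<lambda>t. em q" and a="-\<delta>" and b=\<delta> and ?t0.0=0])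
      show "\<phi> t (em q) \<in> SS \<and> ((\<lambda>t. \<phi> t (em q)) has_vector_derivative Vf (\<phi> t (em q))) (at t)" if "t \<in> {-\<delta><..<\<delta>}" for t using fbd[OF eN that] .
      have "Vf (em q) = 0" unfolding Vf_def em_def using z by (simp add: zero_prod_def)
      moreover have "em q \<in> SS" using fbd[OF eN, of 0] fb0[OF eN] \<delta> by simp
      ultimately show "em q \<in> SS \<and> ((\<lambda>t. em q) has_vector_derivative Vf (em q)) (at t)" for t by simp
    qed (use t0 \<delta> fb0[OF eN] in auto)
    then show ?thesis unfolding T_def \<Phi>_def em_def by simp
  qed
  show ?thesis
  proof (rule that[OF t0(1) \<Omega>c _ \<Omega>SD T7])
    show "(X\<^sub>0, c\<^sub>0) \<in> \<Omega>c" unfolding \<Omega>c_def em_def using base_SD sig_base N by simp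
    show "T q \<in> U" if "q \<in> \<Omega>c" for q using \<Phi>SS[OF zS[OF that]] unfolding T_def SS_def by auto
  qed (use ddT slice in auto)
qed

end

section \<open>Functions annihilated by the Lax distribution\<close>

lemma dd_dd_var:
  fixes Y :: "'a::euclidean_space \<Rightarrow> 'b::euclidean_space"
  assumes V: "open V" "q \<in> V" and Y: "Ck_on (Suc (Suc 0)) Y V" and w: "(w has_derivative w') (at q)"
  shows "((\<lambda>q. dd Y (w q) q) has_derivative (\<lambda>u. dd (dd Y (w q)) u q + dd Y (w' u) q)) (at q)"
proof -
  have Yd: "Y differentiable at x" if "x \<in> V" for x by (rule Ck_on_Suc_differentiable[OF Y V(1) that])
  have D: "Dblin Y differentiable at q" by (rule Ck_on_Suc_differentiable[OF Ck_on_Dblin[OF V(1) Y] V])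
  have e: "blinfun_apply (Dblin Y x) = (\<lambda>v. dd Y v x)" if "x \<in> V" for x by (rule blinfun_apply_Dblin[OF Yd[OF that]])
  have "dd (dd Y v) u q = dd (\<lambda>z. blinfun_apply (Dblin Y z) v) u q" for v u
    by (rule dd_cong_open[OF V]) (simp add: e)
  then have d2: "dd (dd Y v) u q = blinfun_apply (dd (Dblin Y) u q) v" for v u
    using dd_bounded_linear[OF blinfun.bounded_linear_left D] by simp
  have "((\<lambda>q. blinfun_apply (Dblin Y q) (w q)) has_derivative (\<lambda>u. blinfun_apply (Dblin Y q) (w' u) + blinfun_apply (dd (Dblin Y) u q) (w q))) (at q)"
    by (rule bounded_bilinear.FDERIV[OF bounded_bilinear_blinfun_apply has_derivative_dd[OF D] w])
  then have "((\<lambda>q. blinfun_apply (Dblin Y q) (w q)) has_derivative (\<lambda>u. dd (dd Y (w q)) u q + dd Y (w' u) q)) (at q)"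
    unfolding d2 e[OF V(2)] by (simp add: add.commute)
  then show ?thesis by (rule has_derivative_transform_within_open[OF _ V]) (simp add: e)
qed

lemma dd_vector_2:
  assumes "f differentiable at q" "g differentiable at q"
  shows "dd (\<lambda>q. vector [f q, g q] :: real^2) v q = vector [dd f v q, dd g v q]"
    and "(\<lambda>q. vector [f q, g q] :: real^2) differentiable at q"
proof -
  have e: "vector [x, y] = x *\<^sub>R axis 1 1 + y *\<^sub>R (axis 2 1 :: real^2)" for x y
    by (simp add: vec_eq_iff forall_2 axis_def)
  have "((\<lambda>q. f q *\<^sub>R axis 1 1 + g q *\<^sub>R (axis 2 1 :: real^2)) has_derivative
     (\<lambda>v. dd f v q *\<^sub>R axis 1 1 + dd g v q *\<^sub>R axis 2 1)) (at q)"
    by (intro has_derivative_add has_derivative_scaleR_left has_derivative_dd assms)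
  from dd_eqI[OF this] differentiableI[OF this] show "dd (\<lambda>q. vector [f q, g q] :: real^2) v q = vector [dd f v q, dd g v q]"
    "(\<lambda>q. vector [f q, g q] :: real^2) differentiable at q" unfolding e by auto
qed

lemma zero_deriv_unit_interval:
  fixes f :: "real \<Rightarrow> 'a::real_inner"
  assumes "\<And>t. t \<in> {0..1} \<Longrightarrow> (f has_vector_derivative 0) (at t)" shows "f 1 = f 0"
proof -
  have "f 1 - f 0 = 0"
    by (rule linear_growth_zero[where d="\<lambda>t. f t - f 0" and d'="\<lambda>_. 0" and a=0 and b=1 and L=0 and ?t0.0=0])
       (use assms in \<open>auto intro!: derivative_eq_intros\<close>)
  then show ?thesis by simp
qed

context heavenly
begin

text \<open>\<open>ex\<close> and \<open>ey\<close> give the coefficients of the coordinate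
  directions \<open>x\<close> and \<open>y\<close> in the frame that \<open>e1v\<close>,
  \<open>e2v\<close> complete.\<close>

definition ex where "ex p v = v$3 - Tc p * v$1 + Tb p * v$2"
definition ey where "ey p v = v$4 + Tb p * v$1 - Ta p * v$2"

text \<open>\<open>Y\<close> is constant along alpha-surfaces for every \<open>X\<close>: together
  with \<open>X\<close> these are functions on twistor space.\<close>

definition lax_pair :: "(real \<times> (real^4)) set \<Rightarrow> (real \<times> (real^4) \<Rightarrow> real^2) \<Rightarrow> bool" where
  "lax_pair V Y \<longleftrightarrow> open V \<and> V \<subseteq> UU \<and> Ck_on (Suc (Suc 0)) Y V \<and>
     (\<forall>q\<in>V. dd Y (0, L0 q) q = 0 \<and> dd Y (0, L1 q) q = 0)"

definition M0 where "M0 Y q = dd Y (0, e1v q) q" for Y :: "_ \<Rightarrow> real^2"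
definition M1 where "M1 Y q = dd Y (0, e2v q) q" for Y :: "_ \<Rightarrow> real^2"
text \<open>\<open>detM Y = 1\<close> says that \<open>dY \<and> dZ\<close> is the parallel self-dual two-form with parameter \<open>X - X\<^sub>0\<close>.\<close>

definition detM where "detM Y q = M0 Y q $ 1 * M1 Y q $ 2 - M0 Y q $ 2 * M1 Y q $ 1"

context
  fixes V Y assumes lp: "lax_pair V Y"
begin

lemma V: "open V" "V \<subseteq> UU" and Y2: "Ck_on (Suc (Suc 0)) Y V"
  and LY: "q \<in> V \<Longrightarrow> dd Y (0, L0 q) q = 0" "q \<in> V \<Longrightarrow> dd Y (0, L1 q) q = 0"
  using lp unfolding lax_pair_def by auto

lemma Yd: "q \<in> V \<Longrightarrow> Y differentiable at q" by (rule Ck_on_Suc_differentiable[OF Y2 V(1)])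

lemma Y_lin: "q \<in> V \<Longrightarrow> dd Y (0, u + v) q = dd Y (0, u) q + dd Y (0, v) q" "q \<in> V \<Longrightarrow> dd Y (0, r *\<^sub>R v) q = r *\<^sub>R dd Y (0, v) q"
  "q \<in> V \<Longrightarrow> dd Y (0, u - v) q = dd Y (0, u) q - dd Y (0, v) q"
  using linear_add[OF dd_linear[OF Yd], of q "(0, u)" "(0, v)"] linear_scale[OF dd_linear[OF Yd], of q r "(0, v)"]
    linear_diff[OF dd_linear[OF Yd], of q "(0, u)" "(0, v)"] by simp_all

lemma Y_axes: "q \<in> V \<Longrightarrow> dd Y (0, axis 3 1) q = (fst q - X\<^sub>0) *\<^sub>R M1 Y q" "q \<in> V \<Longrightarrow> dd Y (0, axis 4 1) q = - (fst q - X\<^sub>0) *\<^sub>R M0 Y q"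
proof -
  assume q: "q \<in> V"
  show "dd Y (0, axis 3 1) q = (fst q - X\<^sub>0) *\<^sub>R M1 Y q"
    using LY(1)[OF q] Y_lin(3)[OF q, of "axis 3 1" "(fst q - X\<^sub>0) *\<^sub>R e2v q"] Y_lin(2)[OF q, of "fst q - X\<^sub>0" "e2v q"] unfolding L0_def M1_def by simp
  have "dd Y (0, axis 4 1) q + (fst q - X\<^sub>0) *\<^sub>R M0 Y q = 0"
    using LY(2)[OF q] Y_lin(1)[OF q, of "axis 4 1" "(fst q - X\<^sub>0) *\<^sub>R e1v q"] Y_lin(2)[OF q, of "fst q - X\<^sub>0" "e1v q"] unfolding L1_def M0_def by simp
  then have "dd Y (0, axis 4 1) q = - ((fst q - X\<^sub>0) *\<^sub>R M0 Y q)" by (rule eq_neg_iff_add_eq_0[THEN iffD2])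
  then show "dd Y (0, axis 4 1) q = - (fst q - X\<^sub>0) *\<^sub>R M0 Y q" by (simp only: scaleR_minus_left)
qed

text \<open>As \<open>L0\<close> and \<open>L1\<close> are annihilated, \<open>dY\<close> factors
  through the quotient by the alpha-plane. The two coefficients are the covectors that define this
  plane in \<open>alpha_plane_hmat\<close>.\<close>

lemma Y_eq:
  assumes q: "q \<in> V"
  shows "dd Y (0, v) q = (v$1 - (fst q - X\<^sub>0) * ey (snd q) v) *\<^sub>R M0 Y q + (v$2 + (fst q - X\<^sub>0) * ex (snd q) v) *\<^sub>R M1 Y q"
proof -
  have "v = v$1 *\<^sub>R e1v q + (v$2 *\<^sub>R e2v q + (ex (snd q) v *\<^sub>R axis 3 1 + ey (snd q) v *\<^sub>R axis 4 1))"
    by (simp add: vec_eq_iff forall_4 e1v_def e2v_def ex_def ey_def axis_def algebra_simps)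
  then have "dd Y (0, v) q = dd Y (0, v$1 *\<^sub>R e1v q + (v$2 *\<^sub>R e2v q + (ex (snd q) v *\<^sub>R axis 3 1 + ey (snd q) v *\<^sub>R axis 4 1))) q" by simp
  also have "\<dots> = v$1 *\<^sub>R M0 Y q + (v$2 *\<^sub>R M1 Y q + (ex (snd q) v *\<^sub>R ((fst q - X\<^sub>0) *\<^sub>R M1 Y q) + ey (snd q) v *\<^sub>R (- (fst q - X\<^sub>0) *\<^sub>R M0 Y q)))"
    unfolding Y_lin(1,2)[OF q] Y_axes[OF q] M0_def M1_def ..
  finally show ?thesis by (simp add: algebra_simps)
qed

lemma M_Ck:
  assumes "Ck_on (Suc k) Y V" shows "Ck_on k (M0 Y) V" "Ck_on k (M1 Y) V"
proof -
  have "Ck_on k (\<lambda>q. (0::real, e1v q)) V" "Ck_on k (\<lambda>q. (0::real, e2v q)) V"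
    by (intro Ck_on_Pair[OF V(1)] Ck_on_const[OF V(1)] Ck_on_subset[OF frame_Ck(1) V(2)] Ck_on_subset[OF frame_Ck(2) V(2)])+
  then show "Ck_on k (M0 Y) V" "Ck_on k (M1 Y) V"
    unfolding M0_def[abs_def] M1_def[abs_def] by (auto intro: Ck_on_dd_var[OF V(1) assms])
qed

lemma M_derivs:
  assumes q: "q \<in> V"
  shows "(M0 Y has_derivative (\<lambda>u. dd (dd Y (0, e1v q)) u q + dd Y (0, dd e1v u q) q)) (at q)"
    and "(M1 Y has_derivative (\<lambda>u. dd (dd Y (0, e2v q)) u q + dd Y (0, dd e2v u q) q)) (at q)"
proof -
  have qU: "q \<in> UU" using q V by auto
  have "((\<lambda>q. (0::real, e1v q)) has_derivative (\<lambda>u. (0, dd e1v u q))) (at q)" "((\<lambda>q. (0::real, e2v q)) has_derivative (\<lambda>u. (0, dd e2v u q))) (at q)"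
    by (intro has_derivative_Pair has_derivative_const has_derivative_dd frame_diff qU)+
  note d = dd_dd_var[OF V(1) q Y2 this(1)] dd_dd_var[OF V(1) q Y2 this(2)]
  show "(M0 Y has_derivative (\<lambda>u. dd (dd Y (0, e1v q)) u q + dd Y (0, dd e1v u q) q)) (at q)"
    unfolding M0_def[abs_def] by (rule d(1))
  show "(M1 Y has_derivative (\<lambda>u. dd (dd Y (0, e2v q)) u q + dd Y (0, dd e2v u q) q)) (at q)"
    unfolding M1_def[abs_def] by (rule d(2))
qed

lemma Ydd_commute: "q \<in> V \<Longrightarrow> dd (dd Y u) v q = dd (dd Y v) u q"
  by (rule dd_commute[OF V(1)]) (use Y2 in \<open>simp_all add: numeral_2_eq_2 del: Ck_on.simps\<close>)

text \<open>Differentiating \<open>dd Y (0, L q) q = 0\<close> and exchanging the second derivatives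
  shows how derivatives of \<open>Y\<close> are transported along \<open>L\<close>.\<close>

lemma lie_derivative:
  assumes q: "q \<in> V" and L: "L differentiable at q" "\<And>q. q \<in> V \<Longrightarrow> dd Y (0, L q) q = 0"
  shows "dd (dd Y (0, w)) (0, L q) q = - dd Y (0, dd L (0, w) q) q"
proof -
  have "((\<lambda>q. (0::real, L q)) has_derivative (\<lambda>u. (0, dd L u q))) (at q)"
    by (intro has_derivative_Pair has_derivative_const has_derivative_dd L)
  from dd_dd_var[OF V(1) q Y2 this]
  have 1: "((\<lambda>q. dd Y (0, L q) q) has_derivative (\<lambda>u. dd (dd Y (0, L q)) u q + dd Y (0, dd L u q) q)) (at q)" .
  have "((\<lambda>q. dd Y (0, L q) q) has_derivative (\<lambda>u. 0)) (at q)"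
    by (rule has_derivative_transform_within_open[OF has_derivative_const V(1) q]) (use L(2) in simp)
  from fun_cong[OF has_derivative_unique[OF 1 this], of "(0, w)"]
  show ?thesis using Ydd_commute[OF q, of "(0, w)" "(0, L q)"] by (simp add: eq_neg_iff_add_eq_0)
qed

lemma Y_vert: "q \<in> V \<Longrightarrow> dd Y (0, vector [0, 0, r, t]) q = (fst q - X\<^sub>0) *\<^sub>R (r *\<^sub>R M1 Y q - t *\<^sub>R M0 Y q)"
  by (simp add: Y_eq ex_def ey_def algebra_simps)

lemma L_M:
  assumes q: "q \<in> V"
  shows "dd (M0 Y) (0, L0 q) q = (fst q - X\<^sub>0) *\<^sub>R (dd Tc (axis 3 1) (snd q) *\<^sub>R M1 Y q + dd Tb (axis 3 1) (snd q) *\<^sub>R M0 Y q)"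
    "dd (M1 Y) (0, L0 q) q = (fst q - X\<^sub>0) *\<^sub>R (- dd Tb (axis 3 1) (snd q) *\<^sub>R M1 Y q - dd Ta (axis 3 1) (snd q) *\<^sub>R M0 Y q)"
    "dd (M0 Y) (0, L1 q) q = (fst q - X\<^sub>0) *\<^sub>R (dd Tc (axis 4 1) (snd q) *\<^sub>R M1 Y q + dd Tb (axis 4 1) (snd q) *\<^sub>R M0 Y q)"
    "dd (M1 Y) (0, L1 q) q = (fst q - X\<^sub>0) *\<^sub>R (- dd Tb (axis 4 1) (snd q) *\<^sub>R M1 Y q - dd Ta (axis 4 1) (snd q) *\<^sub>R M0 Y q)"
proof -
  have qU: "q \<in> UU" using q V by auto
  have l: "dd (dd Y (0, w)) (0, L0 q) q = - dd Y (0, dd L0 (0, w) q) q" "dd (dd Y (0, w)) (0, L1 q) q = - dd Y (0, dd L1 (0, w) q) q" for w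
    by (rule lie_derivative[OF q frame_diff(3)[OF qU]], erule LY(1), rule lie_derivative[OF q frame_diff(4)[OF qU]], erule LY(2))
  have b: "- dd Y (0, u) q + dd Y (0, v) q = dd Y (0, v - u) q" for u v using Y_lin(3)[OF q] by simp
  show "dd (M0 Y) (0, L0 q) q = (fst q - X\<^sub>0) *\<^sub>R (dd Tc (axis 3 1) (snd q) *\<^sub>R M1 Y q + dd Tb (axis 3 1) (snd q) *\<^sub>R M0 Y q)"
    unfolding dd_eqI[OF M_derivs(1)[OF q]] l b brackets[OF qU] Y_vert[OF q] by simp
  show "dd (M1 Y) (0, L0 q) q = (fst q - X\<^sub>0) *\<^sub>R (- dd Tb (axis 3 1) (snd q) *\<^sub>R M1 Y q - dd Ta (axis 3 1) (snd q) *\<^sub>R M0 Y q)"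
    unfolding dd_eqI[OF M_derivs(2)[OF q]] l b brackets[OF qU] Y_vert[OF q] by simp
  show "dd (M0 Y) (0, L1 q) q = (fst q - X\<^sub>0) *\<^sub>R (dd Tc (axis 4 1) (snd q) *\<^sub>R M1 Y q + dd Tb (axis 4 1) (snd q) *\<^sub>R M0 Y q)"
    unfolding dd_eqI[OF M_derivs(1)[OF q]] l b brackets[OF qU] Y_vert[OF q] by simp
  show "dd (M1 Y) (0, L1 q) q = (fst q - X\<^sub>0) *\<^sub>R (- dd Tb (axis 4 1) (snd q) *\<^sub>R M1 Y q - dd Ta (axis 4 1) (snd q) *\<^sub>R M0 Y q)"
    unfolding dd_eqI[OF M_derivs(2)[OF q]] l b brackets[OF qU] Y_vert[OF q] by simp
qed

text \<open>By \<open>L_M\<close> the pair \<open>M0\<close>, \<open>M1\<close> is transported along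
  \<open>L0\<close> and \<open>L1\<close> by a matrix with diagonal \<open>Tb_x, - Tb_x\<close> or
  \<open>Tb_y, - Tb_y\<close>. It is trace-free, so the determinant is constant on alpha-surfaces
  and the normalisation has to be arranged on the slice only.\<close>

lemma L_detM:
  assumes q: "q \<in> V"
  shows "detM Y differentiable at q" "dd (detM Y) (0, L0 q) q = 0" "dd (detM Y) (0, L1 q) q = 0"
proof -
  note M = M_derivs[OF q, THEN differentiableI, THEN has_derivative_dd]
  have c: "((\<lambda>q. M0 Y q $ i) has_derivative (\<lambda>v. dd (M0 Y) v q $ i)) (at q)" "((\<lambda>q. M1 Y q $ i) has_derivative (\<lambda>v. dd (M1 Y) v q $ i)) (at q)" for i
    by (rule bounded_linear.has_derivative[OF bounded_linear_vec_nth M(1)], rule bounded_linear.has_derivative[OF bounded_linear_vec_nth M(2)])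
  have d: "(detM Y has_derivative (\<lambda>v. (M0 Y q $ 1 * dd (M1 Y) v q $ 2 + dd (M0 Y) v q $ 1 * M1 Y q $ 2) - (M0 Y q $ 2 * dd (M1 Y) v q $ 1 + dd (M0 Y) v q $ 2 * M1 Y q $ 1))) (at q)"
    unfolding detM_def[abs_def] by (intro has_derivative_diff has_derivative_mult c)
  show "detM Y differentiable at q" by (rule differentiableI[OF d])
  show "dd (detM Y) (0, L0 q) q = 0" "dd (detM Y) (0, L1 q) q = 0"
    unfolding dd_eqI[OF d] L_M[OF q] by (simp_all add: algebra_simps)
qed

end

end

section \<open>Normalised twistor coordinates with prescribed 2-jet at the initial slice\<close>

lemma dd_eq_on_slice:
  fixes h k :: "real \<times> 'a::euclidean_space \<Rightarrow> 'b::euclidean_space"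
  assumes V: "open V" "q \<in> V" and d: "h differentiable at q" "k differentiable at q"
    and eq: "\<And>r. r \<in> V \<Longrightarrow> fst r = fst q \<Longrightarrow> h r = k r"
  shows "dd h (0, v) q = dd k (0, v) q"
proof -
  have "open ((\<lambda>t::real. q + t *\<^sub>R (0, v)) -` V)" by (rule open_vimage[OF V(1)]) (intro continuous_intros)
  moreover have "0 \<in> (\<lambda>t::real. q + t *\<^sub>R (0, v)) -` V" using V by (simp add: zero_prod_def[symmetric])
  ultimately obtain e where e: "e > 0" "ball 0 e \<subseteq> (\<lambda>t::real. q + t *\<^sub>R (0, v)) -` V" using open_contains_ball by blast
  show ?thesis by (rule dd_eq_on_line[OF d e(1)], rule eq) (use e(2) in \<open>auto simp: subset_iff\<close>)
qed

context heavenly_at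
begin

text \<open>Expressing the tangent vectors of the slice through the alpha-plane covectors gives a 2
  by 2 matrix with determinant \<open>1 + s\<^sup>2 * rr\<close>, where
  \<open>s = fst q - X\<^sub>0\<close>; its terms of first order in \<open>s\<close> cancel. To have
  \<open>detM Y = 1\<close>, the \<open>(w, z)\<close>-Jacobian of the values of \<open>Y\<close> on
  the slice must equal this determinant.\<close>

definition rr :: "real \<times> (real^4) \<Rightarrow> real" where
  "rr q = dd fy (axis 2 1) (pis (snd q)) + dd fx (axis 1 1) (pis (snd q))
     - (- (fst q - X\<^sub>0) * dd fx (axis 1 1) (pis (snd q)) + Tb (sig q)) * ((fst q - X\<^sub>0) * dd fy (axis 2 1) (pis (snd q)) + Tb (sig q))
     + ((fst q - X\<^sub>0) * dd fy (axis 1 1) (pis (snd q)) - Tc (sig q)) * (- (fst q - X\<^sub>0) * dd fx (axis 2 1) (pis (snd q)) - Ta (sig q))"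

definition RD where "RD = SD \<inter> sig -` U"

lemma RD: "open RD" unfolding RD_def by (rule continuous_open_preimage[OF Ck_on_continuous[OF sig_Ck SD] SD U])

lemma rr_Ck: "Ck_on k rr RD"
proof -
  have p: "Ck_on k (\<lambda>q. f (pis (snd q))) RD" if "smooth_on f U" for f :: "real^4 \<Rightarrow> real"
    by (rule Ck_on_subset[OF Ck_pis[OF that]]) (auto simp: RD_def)
  have s: "Ck_on k (\<lambda>q. f (sig q)) RD" if "smooth_on f U" for f :: "real^4 \<Rightarrow> real"
    by (rule Ck_on_compose[OF RD U Ck_on_smooth[OF that] Ck_on_subset[OF sig_Ck]]) (auto simp: RD_def)
  note sm = smooth_dd[OF U smooths(1)] smooth_dd[OF U smooths(2)]
  have m: "Ck_on k (\<lambda>q. - (fst q - X\<^sub>0)) RD" by (rule Ck_on_minus[OF RD s_Ck[OF RD]])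
  show ?thesis unfolding rr_def
    by (intro Ck_on_add[OF RD] Ck_on_diff[OF RD] Ck_on_mult[OF RD] s_Ck[OF RD] m p s sm smooths)
qed

text \<open>At \<open>s = 0\<close> the expression is the left-hand side of the heavenly equation.
  Hence the correction \<open>s\<^sup>2 * RR\<close> is of third order in \<open>s\<close> and does
  not disturb the second derivative in \<open>X\<close>.\<close>

lemma rr_initial: "q \<in> RD \<Longrightarrow> fst q = X\<^sub>0 \<Longrightarrow> rr q = 0"
proof -
  assume q: "q \<in> RD" and X: "fst q = X\<^sub>0"
  have s: "sig q = pis (snd q)" unfolding sig_def pis_def by (simp add: X)
  have "pis (snd q) \<in> U" using q unfolding RD_def SD_def by auto
  from heavenly_eq[OF this] show ?thesis unfolding rr_def s by (simp add: X power2_eq_square algebra_simps)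
qed

definition seg :: "real \<Rightarrow> real^4 \<Rightarrow> real^4" where "seg t c = vector [c$1, c\<^sub>0$2 + t * (c$2 - c\<^sub>0$2), 0, 0]"
text \<open>The primitive of \<open>rr\<close> in the direction \<open>z\<close> that vanishes at
  \<open>z = c\<^sub>0$2\<close>, rescaled to the unit interval.\<close>

definition RR :: "real \<times> (real^4) \<Rightarrow> real" where
  "RR q = (snd q $ 2 - c\<^sub>0$2) * integral {0..1} (\<lambda>t. rr (fst q, seg t (snd q)))"
text \<open>The values of the twistor coordinates on the slice: \<open>w - s * y\<close> and
  \<open>z + s * x\<close> at the base values of \<open>x\<close> and \<open>y\<close>, plus the
  correction whose \<open>z\<close>-derivative is \<open>s\<^sup>2 * rr\<close>. Its Jacobian in
  \<open>(w, z)\<close> is then \<open>1 + s\<^sup>2 * rr\<close>.\<close>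

definition yy :: "real \<times> (real^4) \<Rightarrow> real^2" where
  "yy q = vector [snd q $ 1 - (fst q - X\<^sub>0) * p\<^sub>0$4, (fst q - X\<^sub>0) * p\<^sub>0$3 + snd q $ 2 + (fst q - X\<^sub>0)\<^sup>2 * RR q]"

lemma c0: "c\<^sub>0 $ 3 = 0" "c\<^sub>0 $ 4 = 0" "pil c\<^sub>0 = c\<^sub>0" unfolding c\<^sub>0_def pil_def by (simp_all add: vec_eq_iff forall_4)

lemma pil_near: "norm (pil c - c\<^sub>0) \<le> norm (c - c\<^sub>0)"
proof (rule norm_le_componentwise_cart)
  show "norm ((pil c - c\<^sub>0) $ i) \<le> norm ((c - c\<^sub>0) $ i)" for i
    using exhaust_4[of i] c0(1,2) by (auto simp: pil_def)
qed

lemma seg_near: assumes "\<bar>t\<bar> \<le> 2" shows "norm (seg t c - c\<^sub>0) \<le> 2 * norm (c - c\<^sub>0)"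
proof -
  have "norm (seg t c - c\<^sub>0) \<le> norm (2 *\<^sub>R (c - c\<^sub>0))"
  proof (rule norm_le_componentwise_cart)
    fix i :: 4
    have "\<bar>t * (c$2 - c\<^sub>0$2)\<bar> \<le> 2 * \<bar>c$2 - c\<^sub>0$2\<bar>" unfolding abs_mult using assms by (intro mult_right_mono) auto
    moreover have "\<bar>2 * c$2 - 2 * c\<^sub>0$2\<bar> = 2 * \<bar>c$2 - c\<^sub>0$2\<bar>" by (simp add: abs_if)
    ultimately show "norm ((seg t c - c\<^sub>0) $ i) \<le> norm ((2 *\<^sub>R (c - c\<^sub>0)) $ i)"
      using exhaust_4[of i] c0 by (auto simp: seg_def abs_mult)
  qed
  then show ?thesis by simp
qed

text \<open>\<open>yy\<close> is extended from the slice to be constant along the flow parameters of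
  the chart. The last three properties prescribe the 2-jet in \<open>X\<close> at
  \<open>X\<^sub>0\<close>; each is proved on the slice and spread by its derivatives in
  \<open>x\<close> and \<open>y\<close>.\<close>

lemma lax_pair_exists:
  obtains V Y where "lax_pair V Y" "(X\<^sub>0, p\<^sub>0) \<in> V" "Ck_on 7 Y V" "\<And>q. q \<in> V \<Longrightarrow> detM Y q = 1"
    "\<And>q. q \<in> V \<Longrightarrow> fst q = X\<^sub>0 \<Longrightarrow> Y q = vector [snd q $ 1, snd q $ 2]"
    "\<And>q. q \<in> V \<Longrightarrow> fst q = X\<^sub>0 \<Longrightarrow> dd Y (1, 0) q = vector [- snd q $ 4, snd q $ 3]"
    "\<And>q. q \<in> V \<Longrightarrow> fst q = X\<^sub>0 \<Longrightarrow> dd (dd Y (1, 0)) (1, 0) q = vector [- 2 * fx (snd q), - 2 * fy (snd q)]"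
proof -
  obtain t0 \<Omega>c T where t0: "t0 > 0" and \<Omega>c: "open \<Omega>c" "(X\<^sub>0, c\<^sub>0) \<in> \<Omega>c" "\<Omega>c \<subseteq> SD" and T7: "Ck_on 7 T \<Omega>c"
    and TU: "\<And>q. q \<in> \<Omega>c \<Longrightarrow> T q \<in> U"
    and T3: "\<And>q. q \<in> \<Omega>c \<Longrightarrow> dd T (0, axis 3 1) q = t0 *\<^sub>R L0 (fst q, T q)"
    and T4: "\<And>q. q \<in> \<Omega>c \<Longrightarrow> dd T (0, axis 4 1) q = t0 *\<^sub>R L1 (fst q, T q)"
    and Tsl: "\<And>q. q \<in> \<Omega>c \<Longrightarrow> snd q $ 3 = 0 \<Longrightarrow> snd q $ 4 = 0 \<Longrightarrow> T q = sig q"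
    by (rule flow_chart) (rule that)
  have Td: "T differentiable at q" if "q \<in> \<Omega>c" for q
    using Ck_on_Suc_differentiable[of 0 T, OF Ck_on_mono[OF T7 _ \<Omega>c(1)] \<Omega>c(1) that] by simp
  have Tsl_dd: "dd T v q = dd sig v q" if q: "q \<in> \<Omega>c" "snd q $ 3 = 0" "snd q $ 4 = 0" and v: "snd v $ 3 = 0" "snd v $ 4 = 0" for q v
  proof -
    have "open ((\<lambda>t::real. q + t *\<^sub>R v) -` \<Omega>c)" by (rule open_vimage[OF \<Omega>c(1)]) (intro continuous_intros)
    moreover have "0 \<in> (\<lambda>t::real. q + t *\<^sub>R v) -` \<Omega>c" using q by simp
    ultimately obtain e where e: "e > 0" "ball 0 e \<subseteq> (\<lambda>t::real. q + t *\<^sub>R v) -` \<Omega>c" using open_contains_ball by blast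
    show ?thesis
    proof (rule dd_eq_on_line[OF Td[OF q(1)] sig_diff e(1)])
      show "q \<in> SD" using q \<Omega>c by auto
      fix t :: real assume "\<bar>t\<bar> < e"
      then have "q + t *\<^sub>R v \<in> \<Omega>c" using e(2) by (auto simp: subset_iff)
      then show "T (q + t *\<^sub>R v) = sig (q + t *\<^sub>R v)" by (rule Tsl) (use q v in auto)
    qed
  qed
  define ps where "ps q = (fst q, T q)" for q
  have ps7: "Ck_on (Suc 6) ps \<Omega>c" unfolding ps_def
    using T7 by (intro Ck_on_Pair[OF \<Omega>c(1)] Ck_on_fst[OF \<Omega>c(1)] Ck_on_id[OF \<Omega>c(1)]) (simp_all del: Ck_on.simps)
  have psd: "(ps has_derivative (\<lambda>v. (fst v, dd T v q))) (at q)" if "q \<in> \<Omega>c" for q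
    unfolding ps_def[abs_def] by (intro has_derivative_Pair has_derivative_fst has_derivative_ident has_derivative_dd Td that)
  have ps_dd: "dd ps v q = (fst v, dd T v q)" if "q \<in> \<Omega>c" for v q by (rule dd_eqI[OF psd[OF that]])
  have T_lin: "dd T (0, u + v) q = dd T (0, u) q + dd T (0, v) q" "dd T (0, r *\<^sub>R v) q = r *\<^sub>R dd T (0, v) q" if "q \<in> \<Omega>c" for u v q r
    using linear_add[OF dd_linear[OF Td[OF that]], of "(0, u)" "(0, v)"] linear_scale[OF dd_linear[OF Td[OF that]], of r "(0, v)"] by simp_all
  have inj: "v = 0" if z: "dd ps v (X\<^sub>0, c\<^sub>0) = 0" for v
  proof -
    have f: "fst v = 0" and Tz: "dd T v (X\<^sub>0, c\<^sub>0) = 0" using z unfolding ps_dd[OF \<Omega>c(2)] by (auto simp: zero_prod_def)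
    define u where "u = snd v"
    have v: "v = (0, pil u + (u $ 3 *\<^sub>R axis 3 1 + u $ 4 *\<^sub>R axis 4 1))"
      using f unfolding u_def pil_def by (simp add: prod_eq_iff vec_eq_iff forall_4 axis_def)
    have "dd T (0, pil u) (X\<^sub>0, c\<^sub>0) = dd sig (0, pil u) (X\<^sub>0, c\<^sub>0)"
      by (rule Tsl_dd[OF \<Omega>c(2)]) (simp_all add: c0 pil_def)
    also have "\<dots> = vector [u$1, u$2, 0, 0]" unfolding dd_sig[OF base_SD] by (simp add: pil_def)
    finally have "vector [u$1, u$2, 0, 0] + (u $ 3 *\<^sub>R (t0 *\<^sub>R axis 3 1) + u $ 4 *\<^sub>R (t0 *\<^sub>R axis 4 1)) = (0 :: real^4)"
      using Tz[unfolded v T_lin[OF \<Omega>c(2)] T3[OF \<Omega>c(2)] T4[OF \<Omega>c(2)]] by (simp add: L0_def L1_def)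
    then have "u = 0" using t0 by (simp add: vec_eq_iff forall_4 axis_def)
    then show "v = 0" using f unfolding u_def by (simp add: prod_eq_iff)
  qed
  obtain U1 V1 g where U1: "open U1" "U1 \<subseteq> \<Omega>c" "(X\<^sub>0, c\<^sub>0) \<in> U1" "open V1" "ps (X\<^sub>0, c\<^sub>0) \<in> V1" "ps ` U1 = V1" "g ` V1 = U1"
    "\<And>x. x \<in> U1 \<Longrightarrow> g (ps x) = x" "\<And>y. y \<in> V1 \<Longrightarrow> ps (g y) = y" "Ck_on (Suc 6) g V1"
    by (rule Ck_inverse_function_theorem[OF \<Omega>c(1,2) ps7 inj], assumption, rule that)
  \<comment> \<open>Where \<open>s\<^sup>2 * rr\<close> is below 1 in absolute value,
    \<open>1 + s\<^sup>2 * rr\<close> is nonzero and can be cancelled in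
    \<open>det1\<close>.\<close>
  define R0 where "R0 = {q \<in> RD. norm ((fst q - X\<^sub>0)\<^sup>2 * rr q - 0) < 1}"
  have oR0: "open R0" unfolding R0_def
    by (rule open_norm_less[OF RD]) (intro continuous_intros Ck_on_continuous[OF rr_Ck RD])
  have bRD: "(X\<^sub>0, c\<^sub>0) \<in> RD" unfolding RD_def using base_SD sig_base p0 by simp
  have bR0: "(X\<^sub>0, c\<^sub>0) \<in> R0" unfolding R0_def using bRD by simp
  obtain e' where e': "e' > 0" "ball X\<^sub>0 e' \<times> ball c\<^sub>0 e' \<subseteq> U1 \<inter> R0"
    using ball_times_subset[of "U1 \<inter> R0" X\<^sub>0 c\<^sub>0] U1(1,3) oR0 bR0 by (metis Int_iff open_Int)
  \<comment> \<open>Half the radius leaves room for \<open>seg t c\<close> with \<open>t\<close> up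
    to 2 in absolute value, an open range of \<open>t\<close> around \<open>{0..1}\<close> being
    needed for the integral.\<close>
  define e where "e = e'/2"
  have e: "e > 0" "2 * e = e'" unfolding e_def using e'(1) by auto
  define B where "B = ball X\<^sub>0 e \<times> ball c\<^sub>0 e"
  have oB: "open B" unfolding B_def by (intro open_Times) auto
  have BU1: "B \<subseteq> U1" and BR0: "B \<subseteq> R0" and BRD: "B \<subseteq> RD" and B\<Omega>: "B \<subseteq> \<Omega>c"
    using e' e U1(2) unfolding B_def R0_def by (force simp: subset_iff)+
  have bB: "(X\<^sub>0, c\<^sub>0) \<in> B" unfolding B_def using e by simp
  have BSD: "B \<subseteq> SD" using BRD unfolding RD_def by auto
  have Bpil: "(X, pil c) \<in> B" if "(X, c) \<in> B" for X c
    using that pil_near[of c] unfolding B_def by (auto simp: dist_norm norm_minus_commute)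
  have Bseg: "(X, seg t c) \<in> RD" if "(X, c) \<in> B" "\<bar>t\<bar> \<le> 2" for X c t
  proof -
    have "norm (seg t c - c\<^sub>0) < e'" using seg_near[OF that(2), of c] that(1) e unfolding B_def by (auto simp: dist_norm norm_minus_commute)
    moreover have "X \<in> ball X\<^sub>0 e'" using that(1) e unfolding B_def by auto
    ultimately have "(X, seg t c) \<in> ball X\<^sub>0 e' \<times> ball c\<^sub>0 e'" by (simp add: dist_norm norm_minus_commute)
    then show ?thesis using e'(2) unfolding R0_def by blast
  qed
  define K where "K z = rr (fst (snd z), seg (fst z) (snd (snd z)))" for z :: "real \<times> real \<times> (real^4)"
  have oT: "open ({-2<..<2::real} \<times> B)" using oB by (intro open_Times) auto
  have K7: "Ck_on 7 K ({-2<..<2} \<times> B)"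
    unfolding K_def
  proof (rule Ck_on_compose[OF oT RD rr_Ck])
    note T' = Ck_on_snd[OF oT Ck_on_id[OF oT]]
    have c: "Ck_on 7 (\<lambda>z :: real \<times> real \<times> (real^4). snd (snd z) $ i) ({-2<..<2} \<times> B)" for i
      by (intro Ck_on_vec_nth[OF oT] Ck_on_snd[OF oT] Ck_on_id[OF oT])
    show "Ck_on 7 (\<lambda>z :: real \<times> real \<times> (real^4). (fst (snd z), seg (fst z) (snd (snd z)))) ({-2<..<2} \<times> B)"
      unfolding seg_def
      by (intro Ck_on_Pair[OF oT] Ck_on_fst[OF oT] Ck_on_vector_4[OF oT] Ck_on_add[OF oT] Ck_on_mult[OF oT] Ck_on_diff[OF oT] Ck_on_const[OF oT] c T' Ck_on_id[OF oT])
  qed (use Bseg in auto)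
  have R7: "Ck_on 7 RR B"
  proof -
    have "Ck_on 7 (\<lambda>q. integral {0..1} (\<lambda>t. K (t, q))) B" by (rule Ck_on_integral(1)[OF _ _ oB K7]) auto
    then show ?thesis unfolding RR_def K_def by (intro Ck_on_mult[OF oB] Ck_on_diff[OF oB] Ck_on_const[OF oB] c_Ck[OF oB]) simp
  qed
  have Rd: "RR differentiable at q" "dd RR v differentiable at q" if "q \<in> B" for q v
  proof -
    have R2: "Ck_on (Suc (Suc 0)) RR B" by (rule Ck_on_mono[OF R7 _ oB]) simp
    show "RR differentiable at q" "dd RR v differentiable at q"
      using Ck_on_Suc_differentiable[OF R2 oB that] Ck_on_Suc_differentiable[OF Ck_on_dd[OF oB R2] oB that] by auto
  qed
  have R0: "RR q = 0" if q: "q \<in> B" "fst q = X\<^sub>0" for q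
  proof -
    obtain X c where Xc: "q = (X, c)" by (cases q)
    have "integral {0..1} (\<lambda>t. rr (fst q, seg t (snd q))) = integral {0..1} (\<lambda>t::real. 0)"
      by (rule integral_cong) (use rr_initial Bseg[of X c] q Xc in auto)
    then show ?thesis unfolding RR_def by simp
  qed
  have R2: "dd RR (0, axis 2 1) q = rr (fst q, pil (snd q))" if q: "q \<in> B" for q
  proof -
    obtain X c where Xc: "q = (X, c)" by (cases q)
    have XcB: "(X, c) \<in> B" using q Xc by simp
    define G where "G x = rr (X, vector [c$1, c\<^sub>0$2 + x, 0, 0])" for x
    have inRD: "(X, vector [c$1, c\<^sub>0$2 + x, 0, 0]) \<in> RD" if x: "x \<in> {-e..e}" for x
    proof -
      define c' where "c' = (vector [c$1, c\<^sub>0$2 + x, 0, 0] :: real^4)"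
      have "norm (c' - c\<^sub>0) \<le> \<bar>(c' - c\<^sub>0)$1\<bar> + \<bar>(c' - c\<^sub>0)$2\<bar> + \<bar>(c' - c\<^sub>0)$3\<bar> + \<bar>(c' - c\<^sub>0)$4\<bar>" by (rule norm_vec4_le)
      also have "\<dots> = \<bar>(c - c\<^sub>0)$1\<bar> + \<bar>x\<bar>" unfolding c'_def by (simp add: c0)
      also have "\<dots> < e + e" using component_le_norm_cart[of "c - c\<^sub>0" 1] XcB x unfolding B_def by (auto simp: dist_norm norm_minus_commute)
      finally have "norm (c' - c\<^sub>0) < e'" using e by simp
      then have "(X, c') \<in> ball X\<^sub>0 e' \<times> ball c\<^sub>0 e'" using XcB e unfolding B_def by (auto simp: dist_norm norm_minus_commute)
      then show ?thesis using e'(2) unfolding R0_def c'_def by blast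
    qed
    have Gc: "continuous_on {-e..e} G"
      unfolding G_def
    proof (rule continuous_on_compose2[OF Ck_on_continuous[OF rr_Ck RD]])
      have v: "vector [x, y, 0, 0] = x *\<^sub>R axis 1 1 + y *\<^sub>R (axis 2 1 :: real^4)" for x y by (simp add: vec_eq_iff forall_4 axis_def)
      show "continuous_on {-e..e} (\<lambda>x. (X, vector [c $ 1, c\<^sub>0 $ 2 + x, 0, 0] :: real^4))" unfolding v by (intro continuous_intros)
    qed (use inRD in auto)
    have xe: "c$2 - c\<^sub>0$2 \<in> {-e<..<e}"
      using component_le_norm_cart[of "c - c\<^sub>0" 2] XcB unfolding B_def by (auto simp: dist_norm norm_minus_commute abs_less_iff)
    have "((\<lambda>x. x *\<^sub>R integral {0..1} (\<lambda>s. G (x * s))) has_vector_derivative G (c$2 - c\<^sub>0$2)) (at (c$2 - c\<^sub>0$2))"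
      by (rule scaled_integral_deriv[OF Gc xe])
    moreover have "((\<lambda>\<tau>. \<tau> + (c$2 - c\<^sub>0$2)) has_vector_derivative 1) (at 0)" by (auto intro!: derivative_eq_intros simp: has_real_derivative_iff_has_vector_derivative[symmetric])
    ultimately have "((\<lambda>\<tau>. (\<tau> + (c$2 - c\<^sub>0$2)) *\<^sub>R integral {0..1} (\<lambda>s. G ((\<tau> + (c$2 - c\<^sub>0$2)) * s))) has_vector_derivative G (c$2 - c\<^sub>0$2)) (at 0)"
      using vector_diff_chain_at[of "\<lambda>\<tau>. \<tau> + (c$2 - c\<^sub>0$2)" 1 0 "\<lambda>x. x *\<^sub>R integral {0..1} (\<lambda>s. G (x * s))" "G (c$2 - c\<^sub>0$2)"] by (simp add: o_def)
    moreover have "(\<tau> + (c$2 - c\<^sub>0$2)) *\<^sub>R integral {0..1} (\<lambda>s. G ((\<tau> + (c$2 - c\<^sub>0$2)) * s)) = RR (q + \<tau> *\<^sub>R (0, axis 2 1))" for \<tau>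
      unfolding RR_def G_def seg_def Xc by (simp add: axis_def algebra_simps)
    ultimately have 1: "((\<lambda>\<tau>. RR (q + \<tau> *\<^sub>R (0, axis 2 1))) has_vector_derivative G (c$2 - c\<^sub>0$2)) (at 0)" by simp
    have 2: "((\<lambda>\<tau>. RR (q + \<tau> *\<^sub>R (0, axis 2 1))) has_vector_derivative dd RR (0, axis 2 1) q) (at 0)"
      using has_vector_derivative_line[of RR q 0 "(0, axis 2 1)"] Rd(1)[OF q] by (simp add: zero_prod_def[symmetric])
    have "dd RR (0, axis 2 1) q = G (c$2 - c\<^sub>0$2)" by (rule vector_derivative_unique_at[OF 2 1])
    then show ?thesis unfolding G_def Xc pil_def by simp
  qed
  have R34: "dd RR (0, axis 3 1) q = 0" "dd RR (0, axis 4 1) q = 0" if q: "q \<in> B" for q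
    by (rule dd_const_on_line[OF Rd(1)[OF q]], simp add: RR_def seg_def axis_def, rule dd_const_on_line[OF Rd(1)[OF q]], simp add: RR_def seg_def axis_def)
  have yy7: "Ck_on 7 yy B" unfolding yy_def
    by (intro Ck_on_vector_2[OF oB] Ck_on_diff[OF oB] Ck_on_add[OF oB] Ck_on_mult[OF oB] Ck_on_power[OF oB] Ck_on_const[OF oB] s_Ck[OF oB] c_Ck[OF oB] R7)
  have yy_dd: "dd yy v q = vector [snd v $ 1 - fst v * p\<^sub>0$4, fst v * p\<^sub>0$3 + snd v $ 2 + (2 * (fst q - X\<^sub>0) * fst v * RR q + (fst q - X\<^sub>0)\<^sup>2 * dd RR v q)]"
    and yyd: "yy differentiable at q" if q: "q \<in> B" for q v
  proof -
    have c: "((\<lambda>q :: real \<times> (real^4). snd q $ i) has_derivative (\<lambda>v. snd v $ i)) (at q)" for i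
      by (rule bounded_linear.has_derivative[OF bounded_linear_vec_nth has_derivative_snd[OF has_derivative_ident]])
    have s: "((\<lambda>q :: real \<times> (real^4). fst q - X\<^sub>0) has_derivative (\<lambda>v. fst v)) (at q)" by (auto intro!: derivative_eq_intros)
    have s2: "((\<lambda>q :: real \<times> (real^4). (fst q - X\<^sub>0)\<^sup>2) has_derivative (\<lambda>v. 2 * (fst q - X\<^sub>0) * fst v)) (at q)"
      by (auto intro!: derivative_eq_intros)
    have 1: "((\<lambda>q. snd q $ 1 - (fst q - X\<^sub>0) * p\<^sub>0$4) has_derivative (\<lambda>v. snd v $ 1 - fst v * p\<^sub>0$4)) (at q)"
      by (intro has_derivative_diff c has_derivative_mult_left s)
    have 2: "((\<lambda>q. (fst q - X\<^sub>0) * p\<^sub>0$3 + snd q $ 2 + (fst q - X\<^sub>0)\<^sup>2 * RR q) has_derivative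
       (\<lambda>v. fst v * p\<^sub>0$3 + snd v $ 2 + ((fst q - X\<^sub>0)\<^sup>2 * dd RR v q + 2 * (fst q - X\<^sub>0) * fst v * RR q))) (at q)"
      by (intro has_derivative_add c has_derivative_mult_left s has_derivative_mult s2 has_derivative_dd Rd q)
    note d = dd_vector_2[OF differentiableI[OF 1] differentiableI[OF 2]]
    show "dd yy v q = vector [snd v $ 1 - fst v * p\<^sub>0$4, fst v * p\<^sub>0$3 + snd v $ 2 + (2 * (fst q - X\<^sub>0) * fst v * RR q + (fst q - X\<^sub>0)\<^sup>2 * dd RR v q)]"
      unfolding yy_def[abs_def] d(1) dd_eqI[OF 1] dd_eqI[OF 2] by (simp add: algebra_simps)
    show "yy differentiable at q" unfolding yy_def[abs_def] by (rule d(2))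
  qed
  define V where "V = V1 \<inter> g -` B"
  have g7: "Ck_on 7 g V1" using U1(10) by (simp del: Ck_on.simps)
  have oV: "open V" unfolding V_def by (rule continuous_open_preimage[OF Ck_on_continuous[OF g7 U1(4)] U1(4) oB])
  have psV: "ps q \<in> V" "g (ps q) = q" if q: "q \<in> B" for q
  proof -
    have qU: "q \<in> U1" using q BU1 by blast
    show "g (ps q) = q" by (rule U1(8)[OF qU])
    then show "ps q \<in> V" using qU q U1(6) unfolding V_def by blast
  qed
  have gV: "g q \<in> B" "ps (g q) = q" if "q \<in> V" for q using that U1(9) unfolding V_def by auto
  have V_cases: "\<exists>X c. (X, c) \<in> B \<and> q = ps (X, c) \<and> fst q = X" if "q \<in> V" for q
    using gV[OF that] by (metis fst_conv prod.collapse ps_def)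
  define Y where "Y q = yy (g q)" for q
  have Y7: "Ck_on 7 Y V" unfolding Y_def
    by (rule Ck_on_compose[OF oV oB yy7 Ck_on_subset[OF g7]]) (auto simp: V_def)
  have Y2: "Ck_on (Suc (Suc 0)) Y V" by (rule Ck_on_mono[OF Y7 _ oV]) simp
  have Yd: "Y differentiable at q" if "q \<in> V" for q by (rule Ck_on_Suc_differentiable[OF Y2 oV that])
  have Yps: "Y (ps q) = yy q" if "q \<in> B" for q unfolding Y_def psV(2)[OF that] ..
  have Ychain: "dd Y (fst v, dd T v q) (ps q) = dd yy v q" if q: "q \<in> B" for q v
  proof -
    have "dd (\<lambda>q. Y (ps q)) v q = dd Y (dd ps v q) (ps q)"
      by (rule dd_compose[OF Yd[OF psV(1)[OF q]] differentiableI[OF psd]]) (use q B\<Omega> in auto)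
    moreover have "dd (\<lambda>q. Y (ps q)) v q = dd yy v q" by (rule dd_cong_open[OF oB q Yps])
    ultimately show ?thesis using ps_dd[of q v] q B\<Omega> by auto
  qed
  have LY: "dd Y (0, L0 q') q' = 0 \<and> dd Y (0, L1 q') q' = 0" if q': "q' \<in> V" for q'
  proof -
    define q where "q = g q'"
    have q: "q \<in> B" "ps q = q'" using gV[OF q'] unfolding q_def by auto
    have qO: "q \<in> \<Omega>c" using q B\<Omega> by auto
    have eq: "(fst q, T q) = q'" using q(2) unfolding ps_def .
    have zy: "dd yy (0, axis 3 1) q = 0" "dd yy (0, axis 4 1) q = 0"
      unfolding yy_dd[OF q(1)] snd_conv R34[OF q(1)] by (simp_all add: axis_def vec_eq_iff forall_2)
    have "dd Y (0, t0 *\<^sub>R L0 q') q' = 0"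
      using Ychain[OF q(1), of "(0, axis 3 1)"] T3[OF qO] zy(1) unfolding eq q(2) by simp
    moreover have "dd Y (0, t0 *\<^sub>R L1 q') q' = 0"
      using Ychain[OF q(1), of "(0, axis 4 1)"] T4[OF qO] zy(2) unfolding eq q(2) by simp
    ultimately show ?thesis
      using linear_scale[OF dd_linear[OF Yd[OF q']], of t0 "(0, L0 q')"] linear_scale[OF dd_linear[OF Yd[OF q']], of t0 "(0, L1 q')"] t0 by simp
  qed
  have VU: "V \<subseteq> UU"
  proof
    fix q assume "q \<in> V"
    then have "snd q \<in> U" using gV[of q] TU[of "g q"] B\<Omega> unfolding ps_def by (metis snd_conv subsetD)
    then show "q \<in> UU" by (cases q) auto
  qed
  have lp: "lax_pair V Y" unfolding lax_pair_def using oV VU Y2 LY by blast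
  note Ml = Y_eq[OF lp] and M_der = M_derivs[OF lp] and Yax = Y_axes[OF lp]
  \<comment> \<open>In the chart, the segment from \<open>pil c\<close> to \<open>c\<close> moves
    along \<open>L0\<close> and \<open>L1\<close> only. A function annihilated by both, for one
    fixed \<open>X\<close>, is thus determined by its values on the slice.\<close>
  have slice_const: "h (ps (X, c)) = h (ps (X, pil c))"
    if Xc: "(X, c) \<in> B" and hd: "\<And>q. q \<in> V \<Longrightarrow> fst q = X \<Longrightarrow> h differentiable at q \<and> dd h (0, L0 q) q = 0 \<and> dd h (0, L1 q) q = 0"
    for h :: "real \<times> (real^4) \<Rightarrow> 'z::real_inner" and X c
  proof -
    define d where "d = c $ 3 *\<^sub>R axis 3 1 + c $ 4 *\<^sub>R (axis 4 1 :: real^4)"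
    have cd: "c = pil c + d" unfolding d_def pil_def by (simp add: vec_eq_iff forall_4 axis_def)
    define z where "z t = (X, pil c) + t *\<^sub>R (0, d)" for t :: real
    have zB: "z t \<in> B" if t: "t \<in> {0..1}" for t
    proof -
      have c': "c \<in> ball c\<^sub>0 e" "pil c \<in> ball c\<^sub>0 e" using Xc Bpil[OF Xc] unfolding B_def by auto
      have "(1 - t) *\<^sub>R pil c + t *\<^sub>R c \<in> ball c\<^sub>0 e" using convexD_alt[OF convex_ball c'(2,1)] t by auto
      also have "(1 - t) *\<^sub>R pil c + t *\<^sub>R c = pil c + t *\<^sub>R d" using cd by (simp add: algebra_simps) (metis scaleR_add_right)
      finally show ?thesis using Xc unfolding z_def B_def by simp
    qed
    have "h (ps (z 1)) = h (ps (z 0))"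
    proof (rule zero_deriv_unit_interval)
      fix t :: real assume t: "t \<in> {0..1}"
      note zt = zB[OF t]
      have zO: "z t \<in> \<Omega>c" using zt B\<Omega> by auto
      have pz: "(fst (z t), T (z t)) = ps (z t)" unfolding ps_def ..
      have f: "fst (ps (z t)) = X" unfolding ps_def z_def by simp
      note H = hd[OF psV(1)[OF zt] f]
      have "((\<lambda>t. ps (z t)) has_vector_derivative dd ps (0, d) (z t)) (at t)"
        unfolding z_def by (rule has_vector_derivative_line) (use differentiableI[OF psd[OF zO]] z_def in simp)
      moreover have "dd ps (0, d) (z t) = (c $ 3 * t0) *\<^sub>R (0, L0 (ps (z t))) + (c $ 4 * t0) *\<^sub>R (0, L1 (ps (z t)))"
        unfolding ps_dd[OF zO] d_def snd_conv T_lin[OF zO] T3[OF zO] T4[OF zO] pz by simp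
      ultimately have dps: "((\<lambda>t. ps (z t)) has_vector_derivative (c $ 3 * t0) *\<^sub>R (0, L0 (ps (z t))) + (c $ 4 * t0) *\<^sub>R (0, L1 (ps (z t)))) (at t)" by simp
      note lin = linear_add[OF dd_linear[OF H[THEN conjunct1]]] linear_scale[OF dd_linear[OF H[THEN conjunct1]]]
      from has_derivative_compose[OF dps[unfolded has_vector_derivative_def] has_derivative_dd[OF H[THEN conjunct1]]]
      show "((\<lambda>t. h (ps (z t))) has_vector_derivative 0) (at t)"
        unfolding has_vector_derivative_def using H by (simp only: lin) simp
    qed
    moreover have "z 0 = (X, pil c)" "z 1 = (X, c)" unfolding z_def using cd by (simp_all add: zero_prod_def[symmetric])
    ultimately show ?thesis by simp
  qed
  have psl: "ps (X, pil c) = (X, sig (X, pil c))" if "(X, c) \<in> B" for X c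
    unfolding ps_def using Tsl[of "(X, pil c)"] Bpil[OF that] B\<Omega> by (auto simp: pil_def)
  have pslT: "dd T v (X, pil c) = dd sig v (X, pil c)" if "(X, c) \<in> B" "snd v $ 3 = 0" "snd v $ 4 = 0" for X c v
    by (rule Tsl_dd) (use that Bpil[OF that(1)] B\<Omega> in \<open>auto simp: pil_def\<close>)
  have det1: "detM Y q' = 1" if q': "q' \<in> V" for q'
  proof -
    obtain X c where Xc: "(X, c) \<in> B" "q' = ps (X, c)" using V_cases[OF q'] by blast
    define q where "q = (X, pil c)"
    have q: "q \<in> B" "q \<in> SD" using Bpil[OF Xc(1)] BSD unfolding q_def by auto
    have "detM Y (ps (X, c)) = detM Y (ps q)" unfolding q_def
      by (rule slice_const[OF Xc(1)]) (use L_detM[OF lp] in auto)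
    have pq: "ps q = (X, sig q)" unfolding q_def by (rule psl[OF Xc(1)])
    define s where "s = X - X\<^sub>0"
    define kw kz lw lz where "kw = dd fy (axis 1 1) (pis (pil c))" and "kz = dd fy (axis 2 1) (pis (pil c))"
      and "lw = dd fx (axis 1 1) (pis (pil c))" and "lz = dd fx (axis 2 1) (pis (pil c))"
    have pa: "pil (axis 1 1) = axis 1 1" "pil (axis 2 1) = axis 2 1" unfolding pil_def by (simp_all add: vec_eq_iff forall_4 axis_def)
    have ax: "(axis 1 1 :: real^4) $ 1 = (1::real)" "(axis 1 1 :: real^4) $ 2 = (0::real)" "(axis 1 1 :: real^4) $ 3 = (0::real)" "(axis 1 1 :: real^4) $ 4 = (0::real)"
      "(axis 2 1 :: real^4) $ 1 = (0::real)" "(axis 2 1 :: real^4) $ 2 = (1::real)" "(axis 2 1 :: real^4) $ 3 = (0::real)" "(axis 2 1 :: real^4) $ 4 = (0::real)" by (simp_all add: axis_def)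
    have Tw: "dd T (0, axis 1 1) q = vector [1, 0, s * kw, - (s * lw)]"
      using pslT[OF Xc(1), of "(0, axis 1 1)"] unfolding q_def[symmetric] dd_sig[OF q(2)] snd_conv fst_conv pa
      by (simp add: ax kw_def lw_def s_def q_def)
    have Tz: "dd T (0, axis 2 1) q = vector [0, 1, s * kz, - (s * lz)]"
      using pslT[OF Xc(1), of "(0, axis 2 1)"] unfolding q_def[symmetric] dd_sig[OF q(2)] snd_conv fst_conv pa
      by (simp add: ax kz_def lz_def s_def q_def)
    have 1: "dd Y (0, dd T (0, axis 1 1) q) (ps q) = vector [1, s\<^sup>2 * dd RR (0, axis 1 1) q]"
      using Ychain[OF q(1), of "(0, axis 1 1)"] unfolding yy_dd[OF q(1)] by (simp add: axis_def s_def q_def)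
    have rq: "rr (fst q, pil (snd q)) = rr q" unfolding q_def pil_def by simp
    have 2: "dd Y (0, dd T (0, axis 2 1) q) (ps q) = vector [0, 1 + s\<^sup>2 * rr q]"
      using Ychain[OF q(1), of "(0, axis 2 1)"] unfolding yy_dd[OF q(1)] R2[OF q(1)] rq by (simp add: axis_def s_def q_def)
    define a b cc where "a = Ta (sig q)" and "b = Tb (sig q)" and "cc = Tc (sig q)"
    define m0 m1 where "m0 = M0 Y (ps q)" and "m1 = M1 Y (ps q)"
    have f: "fst (ps q) - X\<^sub>0 = s" "snd (ps q) = sig q" unfolding pq s_def by simp_all
    note Y1 = 1[unfolded Tw Ml[OF psV(1)[OF q(1)]] f, folded m0_def m1_def] and Y2' = 2[unfolded Tz Ml[OF psV(1)[OF q(1)]] f, folded m0_def m1_def]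
    have A1: "(1 - s * (- s * lw + b)) * m0 $ 1 + (s * (s * kw - cc)) * m1 $ 1 = 1"
      "(- s * (- s * lz - a)) * m0 $ 1 + (1 + s * (s * kz + b)) * m1 $ 1 = 0"
      "(- s * (- s * lz - a)) * m0 $ 2 + (1 + s * (s * kz + b)) * m1 $ 2 = 1 + s\<^sup>2 * rr q"
      using arg_cong[OF Y1, of "\<lambda>v. v $ 1"] arg_cong[OF Y2', of "\<lambda>v. v $ 1"] arg_cong[OF Y2', of "\<lambda>v. v $ 2"]
      by (simp_all add: ex_def ey_def a_def b_def cc_def algebra_simps)
    have A2: "(1 - s * (- s * lw + b)) * m0 $ 2 + (s * (s * kw - cc)) * m1 $ 2 = s\<^sup>2 * dd RR (0, axis 1 1) q"
      using arg_cong[OF Y1, of "\<lambda>v. v $ 2"] by (simp add: ex_def ey_def a_def b_def cc_def algebra_simps)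
    have rr: "rr q = kz + lw - (- s * lw + b) * (s * kz + b) + (s * kw - cc) * (- s * lz - a)"
      unfolding rr_def a_def b_def cc_def kw_def kz_def lw_def lz_def s_def by (simp add: q_def)
    have rho: "(1 - s * (- s * lw + b)) * (1 + s * (s * kz + b)) - (s * (s * kw - cc)) * (- s * (- s * lz - a)) = 1 + s\<^sup>2 * rr q"
      unfolding rr by (simp add: algebra_simps power2_eq_square)
    define al be ga de where "al = 1 - s * (- s * lw + b)" and "be = s * (s * kw - cc)" and "ga = - s * (- s * lz - a)" and "de = 1 + s * (s * kz + b)"
    \<comment> \<open>Multiplicativity of the determinant: the derivatives of \<open>yy\<close>
      along the slice are this coefficient matrix applied to \<open>M0\<close> and
      \<open>M1\<close>.\<close>
    have "(al * de - be * ga) * (m0 $ 1 * m1 $ 2 - m0 $ 2 * m1 $ 1) =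
       (al * m0 $ 1 + be * m1 $ 1) * (ga * m0 $ 2 + de * m1 $ 2) - (al * m0 $ 2 + be * m1 $ 2) * (ga * m0 $ 1 + de * m1 $ 1)"
      by (simp add: algebra_simps)
    also have "\<dots> = 1 + s\<^sup>2 * rr q" unfolding al_def be_def ga_def de_def A1 A2 by simp
    finally have "(1 + s\<^sup>2 * rr q) * detM Y (ps q) = 1 + s\<^sup>2 * rr q"
      unfolding detM_def m0_def[symmetric] m1_def[symmetric] using rho unfolding al_def be_def ga_def de_def by simp
    moreover have "1 + s\<^sup>2 * rr q \<noteq> 0" using q(1) BR0 unfolding R0_def s_def by (auto simp: q_def)
    ultimately show ?thesis using \<open>detM Y (ps (X, c)) = detM Y (ps q)\<close> Xc(2) by simp
  qed
  have Linit: "L0 q = axis 3 1" "L1 q = axis 4 1" if "fst q = X\<^sub>0" for q unfolding L0_def L1_def using that by simp_all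
  \<comment> \<open>At \<open>X\<^sub>0\<close> the fields \<open>L0\<close> and \<open>L1\<close>
    are the coordinate directions \<open>x\<close> and \<open>y\<close>, so equality of the
    derivatives in these directions and of the values on the slice is enough.\<close>
  have cinit: "h q = k q" if q: "q \<in> V" "fst q = X\<^sub>0"
    and h: "\<And>q. q \<in> V \<Longrightarrow> fst q = X\<^sub>0 \<Longrightarrow> h differentiable at q \<and> k differentiable at q \<and> dd h (0, axis 3 1) q = dd k (0, axis 3 1) q \<and> dd h (0, axis 4 1) q = dd k (0, axis 4 1) q"
    and sl: "\<And>c. (X\<^sub>0, c) \<in> B \<Longrightarrow> h (X\<^sub>0, pis (pil c)) = k (X\<^sub>0, pis (pil c))"
    for h k :: "real \<times> (real^4) \<Rightarrow> real^2" and q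
  proof -
    obtain X c where "(X, c) \<in> B" "q = ps (X, c)" "fst q = X" using V_cases[OF q(1)] by blast
    then have Xc: "(X\<^sub>0, c) \<in> B" "q = ps (X\<^sub>0, c)" using q(2) by auto
    have "h (ps (X\<^sub>0, c)) - k (ps (X\<^sub>0, c)) = h (ps (X\<^sub>0, pil c)) - k (ps (X\<^sub>0, pil c))"
    proof (rule slice_const[OF Xc(1), of "\<lambda>q. h q - k q"])
      fix q assume "q \<in> V" "fst q = X\<^sub>0"
      note H = h[OF this]
      show "(\<lambda>q. h q - k q) differentiable at q \<and> dd (\<lambda>q. h q - k q) (0, L0 q) q = 0 \<and> dd (\<lambda>q. h q - k q) (0, L1 q) q = 0"
        using H dd_diff[of h q k] Linit[OF \<open>fst q = X\<^sub>0\<close>] by simp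
    qed
    also have "\<dots> = 0" using sl[OF Xc(1)] unfolding psl[OF Xc(1)] by (simp add: sig_def pis_def)
    finally show ?thesis unfolding Xc(2) by simp
  qed
  have sd: "((\<lambda>q :: real \<times> (real^4). vector [r * snd q $ i, snd q $ j] :: real^2) has_derivative (\<lambda>v. vector [r * snd v $ i, snd v $ j])) (at q)" for i j q and r :: real
    by (rule bounded_linear_imp_has_derivative) (auto simp: linear_conv_bounded_linear[symmetric] vec_eq_iff forall_2 algebra_simps intro!: linearI)
  have sdd: "(\<lambda>q :: real \<times> (real^4). vector [r * snd q $ i, snd q $ j] :: real^2) differentiable at q" for i j q and r :: real
    by (rule differentiableI[OF sd])
  have init0: "Y q = vector [1 * snd q $ 1, snd q $ 2]" if q: "q \<in> V" "fst q = X\<^sub>0" for q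
  proof (rule cinit[OF q])
    fix q assume q: "q \<in> V" "fst q = X\<^sub>0"
    show "Y differentiable at q \<and> (\<lambda>q. vector [1 * snd q $ 1, snd q $ 2] :: real^2) differentiable at q \<and>
      dd Y (0, axis 3 1) q = dd (\<lambda>q. vector [1 * snd q $ 1, snd q $ 2]) (0, axis 3 1) q \<and> dd Y (0, axis 4 1) q = dd (\<lambda>q. vector [1 * snd q $ 1, snd q $ 2]) (0, axis 4 1) q"
      unfolding dd_eqI[OF sd] Yax[OF q(1)] using q(2) by (intro conjI Yd[OF q(1)] sdd) (simp_all add: axis_def vec_eq_iff forall_2)
  next
    fix c assume Xc: "(X\<^sub>0, c) \<in> B"
    have "Y (X\<^sub>0, pis (pil c)) = yy (X\<^sub>0, pil c)"
      using Yps[OF Bpil[OF Xc]] unfolding psl[OF Xc] by (simp add: sig_def pis_def)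
    then show "Y (X\<^sub>0, pis (pil c)) = vector [1 * snd (X\<^sub>0, pis (pil c)) $ 1, snd (X\<^sub>0, pis (pil c)) $ 2]"
      unfolding yy_def by (simp add: pis_def)
  qed
  have Yv: "dd Y (0, v) q = vector [1 * v $ 1, v $ 2]" if q: "q \<in> V" "fst q = X\<^sub>0" for q v
  proof -
    have "dd Y (0, v) q = dd (\<lambda>q. vector [1 * snd q $ 1, snd q $ 2]) (0, v) q"
      by (rule dd_eq_on_slice[OF oV q(1) Yd[OF q(1)] sdd], rule init0) (use q(2) in simp_all)
    then show ?thesis unfolding dd_eqI[OF sd] by simp
  qed
  have M01: "M0 Y q = vector [1, 0]" "M1 Y q = vector [0, 1]" if q: "q \<in> V" "fst q = X\<^sub>0" for q
    unfolding M0_def M1_def Yv[OF q] e1v_def e2v_def by simp_all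
  define P where "P = dd Y (1, 0)"
  have P2: "Ck_on (Suc (Suc 0)) P V" unfolding P_def by (rule Ck_on_dd[OF oV Ck_on_mono[OF Y7 _ oV]]) simp
  have Pd: "P differentiable at q" "dd P v differentiable at q" if "q \<in> V" for q v
    using Ck_on_Suc_differentiable[OF P2 oV that] Ck_on_Suc_differentiable[OF Ck_on_dd[OF oV P2] oV that] by auto
  have s_der: "((\<lambda>q :: real \<times> (real^4). fst q - X\<^sub>0) has_derivative (\<lambda>v. fst v)) (at q)" for q by (auto intro!: derivative_eq_intros)
  have sM: "((\<lambda>q. (fst q - X\<^sub>0) *\<^sub>R h q) has_derivative (\<lambda>v. (fst q - X\<^sub>0) *\<^sub>R dd h v q + fst v *\<^sub>R h q)) (at q)"
    if "h differentiable at q" for h :: "real \<times> (real^4) \<Rightarrow> real^2" and q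
    by (rule has_derivative_scaleR[OF s_der has_derivative_dd[OF that]])
  have Md: "M0 Y differentiable at q" "M1 Y differentiable at q" if "q \<in> V" for q
    using M_der[OF that, THEN differentiableI] by auto
  \<comment> \<open>Obtained by differentiating \<open>Y_axes\<close> in \<open>X\<close>; the
    factor \<open>fst q - X\<^sub>0\<close> there produces the terms without it.\<close>
  have Pax: "dd P (0, axis 3 1) q = (fst q - X\<^sub>0) *\<^sub>R dd (M1 Y) (1, 0) q + M1 Y q"
    "dd P (0, axis 4 1) q = - ((fst q - X\<^sub>0) *\<^sub>R dd (M0 Y) (1, 0) q + M0 Y q)" if q: "q \<in> V" for q
  proof -
    have "dd P (0, axis 3 1) q = dd (dd Y (0, axis 3 1)) (1, 0) q" unfolding P_def by (rule Ydd_commute[OF lp q])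
    also have "\<dots> = dd (\<lambda>q. (fst q - X\<^sub>0) *\<^sub>R M1 Y q) (1, 0) q" by (rule dd_cong_open[OF oV q Yax(1)])
    also have "\<dots> = (fst q - X\<^sub>0) *\<^sub>R dd (M1 Y) (1, 0) q + M1 Y q" using dd_eqI[OF sM[OF Md(2)[OF q]], of "(1, 0)"] by simp
    finally show "dd P (0, axis 3 1) q = (fst q - X\<^sub>0) *\<^sub>R dd (M1 Y) (1, 0) q + M1 Y q" .
    have "dd P (0, axis 4 1) q = dd (dd Y (0, axis 4 1)) (1, 0) q" unfolding P_def by (rule Ydd_commute[OF lp q])
    also have "\<dots> = dd (\<lambda>q. - ((fst q - X\<^sub>0) *\<^sub>R M0 Y q)) (1, 0) q" by (rule dd_cong_open[OF oV q]) (simp only: Yax(2) scaleR_minus_left)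
    also have "\<dots> = - ((fst q - X\<^sub>0) *\<^sub>R dd (M0 Y) (1, 0) q + M0 Y q)"
      using dd_eqI[OF has_derivative_minus[OF sM[OF Md(1)[OF q]]], of "(1, 0)"] by simp
    finally show "dd P (0, axis 4 1) q = - ((fst q - X\<^sub>0) *\<^sub>R dd (M0 Y) (1, 0) q + M0 Y q)" .
  qed
  \<comment> \<open>The \<open>X\<close>-derivative of \<open>Y\<close> composed with the chart. The
    slice moves with \<open>X\<close>, so besides \<open>P\<close> there is a term from the bending
    of \<open>sig\<close>.\<close>
  have slP: "P (X, sig (X, pil c)) + (X - X\<^sub>0) *\<^sub>R (fy (pis (pil c)) *\<^sub>R M1 Y (X, sig (X, pil c)) + fx (pis (pil c)) *\<^sub>R M0 Y (X, sig (X, pil c)))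
     = vector [- p\<^sub>0$4, p\<^sub>0$3 + (2 * (X - X\<^sub>0) * RR (X, pil c) + (X - X\<^sub>0)\<^sup>2 * dd RR (1, 0) (X, pil c))]" if Xc: "(X, c) \<in> B" for X c
  proof -
    define q where "q = (X, pil c)"
    have q: "q \<in> B" "q \<in> SD" using Bpil[OF Xc] BSD unfolding q_def by auto
    have pz: "pil 0 = 0" unfolding pil_def by (simp add: vec_eq_iff forall_4)
    have pU: "pis (snd q) \<in> U" using q(2) unfolding SD_def by simp
    have Tx: "dd T (1, 0) q = vector [0, 0, fy (pis (pil c)), - fx (pis (pil c))]"
      using pslT[OF Xc, of "(1, 0)"] unfolding q_def[symmetric] dd_sig[OF q(2)]
      by (simp add: pz linear_0[OF dd_linear[OF diffs(2)[OF pU]]] linear_0[OF dd_linear[OF diffs(3)[OF pU]]]) (simp add: q_def)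
    have sp: "(1::real, dd T (1, 0) q) = (1, 0) + (0, dd T (1, 0) q)" by simp
    have "dd Y (1, dd T (1, 0) q) (ps q) = dd Y (1, 0) (ps q) + dd Y (0, dd T (1, 0) q) (ps q)"
      unfolding sp by (rule linear_add[OF dd_linear[OF Yd[OF psV(1)[OF q(1)]]]])
    then have "P (ps q) + dd Y (0, vector [0, 0, fy (pis (pil c)), - fx (pis (pil c))]) (ps q) = dd yy (1, 0) q"
      using Ychain[OF q(1), of "(1, 0)"] unfolding P_def Tx by simp
    then show ?thesis unfolding Y_vert[OF lp psV(1)[OF q(1)]] yy_dd[OF q(1)] unfolding q_def psl[OF Xc] by simp
  qed
  have init1: "P q = vector [- 1 * snd q $ 4, snd q $ 3]" if q: "q \<in> V" "fst q = X\<^sub>0" for q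
  proof (rule cinit[OF q])
    fix q assume q: "q \<in> V" "fst q = X\<^sub>0"
    show "P differentiable at q \<and> (\<lambda>q. vector [- 1 * snd q $ 4, snd q $ 3] :: real^2) differentiable at q \<and>
      dd P (0, axis 3 1) q = dd (\<lambda>q. vector [- 1 * snd q $ 4, snd q $ 3]) (0, axis 3 1) q \<and> dd P (0, axis 4 1) q = dd (\<lambda>q. vector [- 1 * snd q $ 4, snd q $ 3]) (0, axis 4 1) q"
      unfolding dd_eqI[OF sd] Pax[OF q(1)] M01[OF q] using q(2) by (intro conjI Pd(1)[OF q(1)] sdd) (simp_all add: axis_def vec_eq_iff forall_2)
  next
    fix c assume Xc: "(X\<^sub>0, c) \<in> B"
    have "sig (X\<^sub>0, pil c) = pis (pil c)" by (simp add: sig_def pis_def)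
    then show "P (X\<^sub>0, pis (pil c)) = vector [- 1 * snd (X\<^sub>0, pis (pil c)) $ 4, snd (X\<^sub>0, pis (pil c)) $ 3]"
      using slP[OF Xc] by (simp add: pis_def)
  qed
  have Pv: "dd P (0, v) q = vector [- 1 * v $ 4, v $ 3]" if q: "q \<in> V" "fst q = X\<^sub>0" for q v
  proof -
    have "dd P (0, v) q = dd (\<lambda>q. vector [- 1 * snd q $ 4, snd q $ 3]) (0, v) q"
      by (rule dd_eq_on_slice[OF oV q(1) Pd(1)[OF q(1)] sdd], rule init1) (use q(2) in simp_all)
    then show ?thesis unfolding dd_eqI[OF sd] by simp
  qed
  define A where "A = dd P (1, 0)"
  have Ad: "A differentiable at q" if "q \<in> V" for q unfolding A_def by (rule Pd(2)[OF that])
  have dMX: "dd (M0 Y) (1, 0) q = dd P (0, e1v q) q" "dd (M1 Y) (1, 0) q = dd P (0, e2v q) q" if q: "q \<in> V" for q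
  proof -
    have qU: "q \<in> UU" "snd q \<in> U" using q VU by auto
    have z: "dd e1v (1, 0) q = 0" "dd e2v (1, 0) q = 0"
      unfolding dd_frame[OF qU(1)] using linear_0[OF dd_linear[OF diffs(4)[OF qU(2)]]] linear_0[OF dd_linear[OF diffs(5)[OF qU(2)]]] linear_0[OF dd_linear[OF diffs(6)[OF qU(2)]]]
      by (simp_all add: vec_eq_iff forall_4)
    have z2: "dd Y (0, 0) q = 0" using linear_0[OF dd_linear[OF Yd[OF q]]] by (simp add: zero_prod_def)
    show "dd (M0 Y) (1, 0) q = dd P (0, e1v q) q" "dd (M1 Y) (1, 0) q = dd P (0, e2v q) q"
      unfolding dd_eqI[OF M_der(1)[OF q]] dd_eqI[OF M_der(2)[OF q]] z z2 P_def using Ydd_commute[OF lp q] by simp_all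
  qed
  have M1x: "((\<lambda>q. (fst q - X\<^sub>0) *\<^sub>R dd h (1, 0) q + h q) has_derivative (\<lambda>v. (fst q - X\<^sub>0) *\<^sub>R dd (dd h (1, 0)) v q + fst v *\<^sub>R dd h (1, 0) q + dd h v q)) (at q)"
    if "h differentiable at q" "dd h (1, 0) differentiable at q" for h :: "real \<times> (real^4) \<Rightarrow> real^2" and q
    by (rule has_derivative_add[OF sM[OF that(2)] has_derivative_dd[OF that(1)]])
  have M2: "Ck_on (Suc (Suc 0)) (M0 Y) V" "Ck_on (Suc (Suc 0)) (M1 Y) V"
    by (rule M_Ck[OF lp Ck_on_mono[OF Y7 _ oV]], simp)+
  have Mdd: "dd (M0 Y) v differentiable at q" "dd (M1 Y) v differentiable at q" if "q \<in> V" for q v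
    using Ck_on_Suc_differentiable[OF Ck_on_dd[OF oV M2(1)] oV that] Ck_on_Suc_differentiable[OF Ck_on_dd[OF oV M2(2)] oV that] by auto
  \<comment> \<open>At \<open>X\<^sub>0\<close> the \<open>X\<close>-derivative of
    \<open>s * dM/dX + M\<close> is twice \<open>dM/dX\<close>, and \<open>dM/dX\<close> is the
    derivative of the known \<open>P\<close> along the frame.\<close>
  have Aax: "dd A (0, axis 3 1) q = vector [- 2 * Ta (snd q), - 2 * Tb (snd q)]" "dd A (0, axis 4 1) q = vector [- 2 * Tb (snd q), - 2 * Tc (snd q)]"
    if q: "q \<in> V" "fst q = X\<^sub>0" for q
  proof -
    have cm: "dd (dd P u) v q = dd (dd P v) u q" for u v
      by (rule dd_commute[OF oV q(1)]) (use P2 in \<open>simp add: numeral_2_eq_2 del: Ck_on.simps\<close>)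
    have "dd A (0, axis 3 1) q = dd (dd P (0, axis 3 1)) (1, 0) q" unfolding A_def by (rule cm)
    also have "\<dots> = dd (\<lambda>q. (fst q - X\<^sub>0) *\<^sub>R dd (M1 Y) (1, 0) q + M1 Y q) (1, 0) q" by (rule dd_cong_open[OF oV q(1) Pax(1)])
    also have "\<dots> = 2 *\<^sub>R dd (M1 Y) (1, 0) q" using dd_eqI[OF M1x[OF Md(2)[OF q(1)] Mdd(2)[OF q(1)]], of "(1, 0)"] q(2) by (simp add: scaleR_2)
    also have "\<dots> = vector [- 2 * Ta (snd q), - 2 * Tb (snd q)]" unfolding dMX[OF q(1)] Pv[OF q] e2v_def by (simp add: vec_eq_iff forall_2)
    finally show "dd A (0, axis 3 1) q = vector [- 2 * Ta (snd q), - 2 * Tb (snd q)]" .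
    have "dd A (0, axis 4 1) q = dd (dd P (0, axis 4 1)) (1, 0) q" unfolding A_def by (rule cm)
    also have "\<dots> = dd (\<lambda>q. - ((fst q - X\<^sub>0) *\<^sub>R dd (M0 Y) (1, 0) q + M0 Y q)) (1, 0) q" by (rule dd_cong_open[OF oV q(1) Pax(2)])
    also have "\<dots> = - (2 *\<^sub>R dd (M0 Y) (1, 0) q)"
      using dd_eqI[OF has_derivative_minus[OF M1x[OF Md(1)[OF q(1)] Mdd(1)[OF q(1)]]], of "(1, 0)"] q(2) by (simp add: scaleR_2)
    also have "\<dots> = vector [- 2 * Tb (snd q), - 2 * Tc (snd q)]" unfolding dMX[OF q(1)] Pv[OF q] e1v_def by (simp add: vec_eq_iff forall_2)
    finally show "dd A (0, axis 4 1) q = vector [- 2 * Tb (snd q), - 2 * Tc (snd q)]" .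
  qed
  have slA: "A (X\<^sub>0, pis (pil c)) = vector [- 2 * fx (pis (pil c)), - 2 * fy (pis (pil c))]" if Xc: "(X\<^sub>0, c) \<in> B" for c
  proof -
    define k l where "k = fy (pis (pil c))" and "l = fx (pis (pil c))"
    define z where "z t = (X\<^sub>0, pil c) + t *\<^sub>R (1, 0)" for t :: real
    have z: "z t = (X\<^sub>0 + t, pil c)" for t unfolding z_def by simp
    define q where "q = (X\<^sub>0, pil c)"
    have q: "q \<in> B" "q \<in> \<Omega>c" using Bpil[OF Xc] B\<Omega> unfolding q_def by auto
    have pq: "ps q = (X\<^sub>0, pis (pil c))" unfolding q_def psl[OF Xc] by (simp add: sig_def pis_def)
    have pV: "ps q \<in> V" by (rule psV(1)[OF q(1)])
    have B': "(X\<^sub>0 + t, c) \<in> B" if "t \<in> {-e<..<e}" for t using Xc that unfolding B_def by (auto simp: dist_norm)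
    have dps: "((\<lambda>t. ps (z t)) has_vector_derivative (1, dd T (1, 0) q)) (at 0)"
      using has_vector_derivative_line[of ps q 0 "(1, 0)"] differentiableI[OF psd[OF q(2)]] ps_dd[OF q(2)] unfolding z_def q_def by simp
    define HH where "HH q = k *\<^sub>R M1 Y q + l *\<^sub>R M0 Y q" for q
    have HHd: "HH differentiable at (ps q)" unfolding HH_def using Md[OF pV] by (intro differentiable_add differentiable_scaleR) auto
    have hp: "((\<lambda>t. h (ps (z t))) has_vector_derivative dd h (1, dd T (1, 0) q) (ps q)) (at 0)" if "h differentiable at (ps q)" for h :: "real \<times> (real^4) \<Rightarrow> real^2"
    proof -
      have z0: "z 0 = q" unfolding z q_def by simp
      have "dd h (x *\<^sub>R (1, dd T (1, 0) q)) (ps q) = x *\<^sub>R dd h (1, dd T (1, 0) q) (ps q)" for x by (rule linear_scale[OF dd_linear[OF that]])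
      moreover have h0: "h differentiable at (ps (z 0))" using that unfolding z0 .
      ultimately show ?thesis
        using has_derivative_compose[OF dps[unfolded has_vector_derivative_def] has_derivative_dd[OF h0]] unfolding has_vector_derivative_def z0 by simp
    qed
    \<comment> \<open>The formula \<open>slP\<close> for \<open>P\<close> along the slice over a
      fixed \<open>c\<close>, to be differentiated once more at \<open>X\<^sub>0\<close>.\<close>
    define w where "w t = vector [- p\<^sub>0$4, p\<^sub>0$3 + (2 * t * RR (z t) + t\<^sup>2 * dd RR (1, 0) (z t))] - t *\<^sub>R HH (ps (z t))" for t
    have wP: "w t = P (ps (z t))" if t: "t \<in> {-e<..<e}" for t
      using slP[OF B'[OF t]] unfolding w_def z psl[OF B'[OF t]] HH_def k_def l_def by (simp add: algebra_simps)
    have Rz: "((\<lambda>t. f (z t)) has_real_derivative dd f (1, 0) q) (at 0)" if "f differentiable at q" for f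
      using has_vector_derivative_line[of f q 0 "(1, 0)"] that unfolding z_def q_def by (simp add: has_real_derivative_iff_has_vector_derivative)
    \<comment> \<open>Here the vanishing of \<open>rr\<close> at \<open>X\<^sub>0\<close> enters:
      without it the term \<open>2 * t * RR\<close> would contribute to the second
      derivative.\<close>
    have R00: "RR (z 0) = 0" unfolding z using R0[of "(X\<^sub>0, pil c)"] Bpil[OF Xc] by simp
    have n2: "((\<lambda>t. p\<^sub>0$3 + (2 * t * RR (z t) + t\<^sup>2 * dd RR (1, 0) (z t))) has_real_derivative 0) (at 0)"
      using Rz[OF Rd(1)[OF q(1)]] Rz[OF Rd(2)[OF q(1)], of "(1, 0)"] R00 by (auto intro!: derivative_eq_intros)
    have v2: "vector [x, y] = x *\<^sub>R axis 1 1 + y *\<^sub>R (axis 2 1 :: real^2)" for x y by (simp add: vec_eq_iff forall_2 axis_def)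
    have "((\<lambda>t. (- p\<^sub>0$4) *\<^sub>R axis 1 1 + (p\<^sub>0$3 + (2 * t * RR (z t) + t\<^sup>2 * dd RR (1, 0) (z t))) *\<^sub>R (axis 2 1 :: real^2)) has_vector_derivative 0 + (((p\<^sub>0$3 + (2 * 0 * RR (z 0) + 0\<^sup>2 * dd RR (1, 0) (z 0))) *\<^sub>R 0) + 0 *\<^sub>R axis 2 1)) (at 0)"
      by (intro has_vector_derivative_add has_vector_derivative_const has_vector_derivative_scaleR[OF n2 has_vector_derivative_const])
    moreover have "((\<lambda>t. t *\<^sub>R HH (ps (z t))) has_vector_derivative 0 *\<^sub>R dd HH (1, dd T (1, 0) q) (ps q) + 1 *\<^sub>R HH (ps (z 0))) (at 0)"
      by (rule has_vector_derivative_scaleR[OF DERIV_ident hp[OF HHd]])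
    ultimately have "(w has_vector_derivative (0 + (((p\<^sub>0$3 + (2 * 0 * RR (z 0) + 0\<^sup>2 * dd RR (1, 0) (z 0))) *\<^sub>R 0) + 0 *\<^sub>R axis 2 1)) - (0 *\<^sub>R dd HH (1, dd T (1, 0) q) (ps q) + 1 *\<^sub>R HH (ps (z 0)))) (at 0)"
      unfolding w_def[abs_def] v2 by (rule has_vector_derivative_diff)
    then have "(w has_vector_derivative - HH (ps q)) (at 0)" by (simp add: z q_def)
    then have "((\<lambda>t. P (ps (z t))) has_vector_derivative - HH (ps q)) (at 0)"
      by (rule has_vector_derivative_transform_within_open[where S="{-e<..<e}"]) (use e(1) wP in auto)
    from vector_derivative_unique_at[OF hp[OF Pd(1)[OF pV]] this]
    have eq: "dd P (1, dd T (1, 0) q) (ps q) = - HH (ps q)" .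
    have pz: "pil 0 = 0" unfolding pil_def by (simp add: vec_eq_iff forall_4)
    have qS: "q \<in> SD" using q(1) BSD by auto
    have pU: "pis (snd q) \<in> U" using qS unfolding SD_def by simp
    have Tx: "dd T (1, 0) q = vector [0, 0, k, - l]"
      using pslT[OF Xc, of "(1, 0)"] unfolding q_def[symmetric] dd_sig[OF qS] k_def l_def
      by (simp add: pz linear_0[OF dd_linear[OF diffs(2)[OF pU]]] linear_0[OF dd_linear[OF diffs(3)[OF pU]]]) (simp add: q_def)
    have sp: "(1::real, dd T (1, 0) q) = (1, 0) + (0, dd T (1, 0) q)" by simp
    have "A (ps q) + dd P (0, vector [0, 0, k, - l]) (ps q) = - HH (ps q)"
      using eq[unfolded sp] unfolding linear_add[OF dd_linear[OF Pd(1)[OF pV]]] Tx A_def .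
    moreover have "fst (ps q) = X\<^sub>0" unfolding pq by simp
    \<comment> \<open>One \<open>vector [l, k]\<close> comes from the motion of the slice through
      \<open>P\<close>, the other from the bending term of \<open>slP\<close>. Together they give
      the factor 2 in the prescribed second derivative.\<close>
    ultimately have "A (ps q) + vector [l, k] = - vector [l, k]"
      unfolding Pv[OF pV \<open>fst (ps q) = X\<^sub>0\<close>] HH_def M01[OF pV \<open>fst (ps q) = X\<^sub>0\<close>] by (simp add: vec_eq_iff forall_2)
    then show ?thesis unfolding pq k_def l_def by (simp add: vec_eq_iff forall_2 algebra_simps)
  qed
  have fd: "((\<lambda>q. vector [- 2 * fx (snd q), - 2 * fy (snd q)] :: real^2) has_derivative (\<lambda>v. vector [- 2 * dd fx (snd v) (snd q), - 2 * dd fy (snd v) (snd q)])) (at q)"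
    if "snd q \<in> U" for q :: "real \<times> (real^4)"
  proof -
    note d = dd_snd[OF diffs(2)[OF that]] dd_snd[OF diffs(3)[OF that]]
    have m: "(\<lambda>q. - 2 * f (snd q)) differentiable at q" "dd (\<lambda>q. - 2 * f (snd q)) v q = - 2 * dd (\<lambda>q. f (snd q)) v q"
      if "(\<lambda>q. f (snd q)) differentiable at q" for f :: "real^4 \<Rightarrow> real" and v
      using differentiable_bounded_linear[OF bounded_linear_mult_right that, of "-2"] dd_bounded_linear[OF bounded_linear_mult_right that, of "-2" v] by simp_all
    note v = dd_vector_2[OF m(1)[OF d(2)] m(1)[OF d(4)]]
    show ?thesis using has_derivative_dd[OF v(2)] unfolding v(1) m(2)[OF d(2)] m(2)[OF d(4)] d(1,3) .
  qed
  have init2: "A q = vector [- 2 * fx (snd q), - 2 * fy (snd q)]" if q: "q \<in> V" "fst q = X\<^sub>0" for q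
  proof (rule cinit[OF q])
    fix q assume q: "q \<in> V" "fst q = X\<^sub>0"
    have qU: "snd q \<in> U" using q VU by auto
    show "A differentiable at q \<and> (\<lambda>q. vector [- 2 * fx (snd q), - 2 * fy (snd q)] :: real^2) differentiable at q \<and>
      dd A (0, axis 3 1) q = dd (\<lambda>q. vector [- 2 * fx (snd q), - 2 * fy (snd q)]) (0, axis 3 1) q \<and> dd A (0, axis 4 1) q = dd (\<lambda>q. vector [- 2 * fx (snd q), - 2 * fy (snd q)]) (0, axis 4 1) q"
      unfolding dd_eqI[OF fd[OF qU]] Aax[OF q] using Ad[OF q(1)] differentiableI[OF fd[OF qU]] fy_x[OF qU] by (simp add: Ta_def Tb_def Tc_def)
  qed (use slA in simp)
  show ?thesis
  proof (rule that[OF lp _ Y7 det1])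
    show "(X\<^sub>0, p\<^sub>0) \<in> V" using psV(1)[OF bB] Tsl[OF \<Omega>c(2)] c0 sig_base unfolding ps_def by simp
    show "Y q = vector [snd q $ 1, snd q $ 2]" if "q \<in> V" "fst q = X\<^sub>0" for q using init0[OF that] by simp
    show "dd Y (1, 0) q = vector [- snd q $ 4, snd q $ 3]" if "q \<in> V" "fst q = X\<^sub>0" for q using init1[OF that] unfolding P_def by simp
    show "dd (dd Y (1, 0)) (1, 0) q = vector [- 2 * fx (snd q), - 2 * fy (snd q)]" if "q \<in> V" "fst q = X\<^sub>0" for q
      using init2[OF that] unfolding A_def P_def .
  qed
qed

end

section \<open>The system of the twistor lines and its potential\<close>

text \<open>With \<open>m, n\<close> the matrices with columns \<open>m\<^sub>0, m\<^sub>1\<close> and \<open>n\<^sub>0, n\<^sub>1\<close>, the coefficients are the entries of \<open>n m\<^sup>-\<^sup>1\<close>.\<close>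

lemma unimodular_form:
  fixes m01 m02 m11 m12 n01 n02 n11 n12 h k x y :: real
  assumes "m01 * m12 - m02 * m11 = 1"
  defines "y1 \<equiv> h * m01 + k * m11" and "y2 \<equiv> h * m02 + k * m12"
    and "p1 \<equiv> h * n01 + k * n11 - y * m01 + x * m11" and "p2 \<equiv> h * n02 + k * n12 - y * m02 + x * m12"
  shows "h * x + k * y = y1 * p2 - y2 * p1 - (n02 * m12 - n12 * m02) * y1\<^sup>2
     - (n12 * m01 - n02 * m11 - (n01 * m12 - n11 * m02)) * (y1 * y2) + (n11 * m01 - n01 * m11) * y2\<^sup>2"
proof -
  have b: "(n01 * m12 - n11 * m02) * y1 + (n11 * m01 - n01 * m11) * y2 = h * n01 + k * n11"
    "(n02 * m12 - n12 * m02) * y1 + (n12 * m01 - n02 * m11) * y2 = h * n02 + k * n12"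
    using assms(1) unfolding y1_def y2_def by algebra+
  have w: "y1 * m12 - y2 * m11 = h" "y2 * m01 - y1 * m02 = k" using assms(1) unfolding y1_def y2_def by algebra+
  have "h * x + k * y = (y1 * m12 - y2 * m11) * x + (y2 * m01 - y1 * m02) * y" unfolding w ..
  then show ?thesis unfolding p1_def p2_def b[symmetric] by (simp add: algebra_simps power2_eq_square)
qed

text \<open>The mixed terms identify the \<open>c\<close> with entries of \<open>F_P\<close> and
  yield trace-freeness as \<open>g22 = c22\<close>, \<open>g11 = - c22\<close>. The terms in
  \<open>y\<close> alone are the evolution equation, with \<open>d\<close> as derivative of
  \<open>c\<close> along the system.\<close>

lemma coefficient_comparison:
  fixes f11 f12 f21 f22 g11 g12 g21 g22 c21 c22 c12 d21 d22 d12 :: real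
  assumes "\<And>y1 y2 p1 p2. y1 * (f21 * y1 + f22 * y2 + g21 * p1 + g22 * p2) - y2 * (f11 * y1 + f12 * y2 + g11 * p1 + g12 * p2)
    = d21 / 2 * y1\<^sup>2 + d22 * (y1 * y2) - d12 / 2 * y2\<^sup>2 + c21 * y1 * p1 + c22 * (p1 * y2 + y1 * p2) - c12 * y2 * p2"
  shows "g21 = c21" "g22 = c22" "g11 = - c22" "g12 = c12" "d21 = 2 * f21" "d12 = 2 * f12" "d22 = f22 - f11"
  using assms[of 1 0 0 0] assms[of 0 1 0 0] assms[of 1 1 0 0] assms[of 1 0 1 0] assms[of 1 0 0 1] assms[of 0 1 1 0] assms[of 0 1 0 1]
  by simp_all

context heavenly
begin

lemma heavenly_form_eq: "p \<in> U \<Longrightarrow> heavenly_form \<Theta> p v = v$1 * ex p v + v$2 * ey p v"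
  unfolding heavenly_form_def smooth_pd2[OF U smooth] ex_def ey_def Ta_def Tb_def Tc_def fx_def fy_def
  by (simp add: algebra_simps power2_eq_square)

text \<open>The coefficients come from \<open>M0\<close>, \<open>M1\<close> and their
  \<open>X\<close>-derivatives, so the metric takes the form of \<open>Q\<close> before any system
  is known. The identity is the \<open>X\<close>-derivative of that formula, in which the left-hand
  side is constant.\<close>

lemma lax_pair_identity:
  assumes lp: "lax_pair V Y" and Y3: "Ck_on (Suc (Suc (Suc 0))) Y V" and det: "\<And>q. q \<in> V \<Longrightarrow> detM Y q = 1"
  obtains c21 c22 c12 where "\<And>q. q \<in> V \<Longrightarrow> c21 differentiable at q \<and> c22 differentiable at q \<and> c12 differentiable at q"
    "\<And>q v y p a. q \<in> V \<Longrightarrow> y = dd Y (0, v) q \<Longrightarrow> p = dd (dd Y (1, 0)) (0, v) q \<Longrightarrow> a = dd (dd (dd Y (1, 0)) (1, 0)) (0, v) q \<Longrightarrow>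
       y$1 * a$2 - y$2 * a$1 = dd c21 (1, 0) q / 2 * (y$1)\<^sup>2 + dd c22 (1, 0) q * (y$1 * y$2) - dd c12 (1, 0) q / 2 * (y$2)\<^sup>2
         + c21 q * y$1 * p$1 + c22 q * (p$1 * y$2 + y$1 * p$2) - c12 q * y$2 * p$2"
proof -
  note V = V[OF lp]
  define P where "P = dd Y (1, 0)"
  define N0 N1 where "N0 = dd (M0 Y) (1, 0)" and "N1 = dd (M1 Y) (1, 0)"
  note M2 = M_Ck[OF lp Y3]
  have N1: "Ck_on (Suc 0) N0 V" "Ck_on (Suc 0) N1 V" unfolding N0_def N1_def by (rule Ck_on_dd[OF V(1) M2(1)], rule Ck_on_dd[OF V(1) M2(2)])
  note M1' = Ck_on_Suc_imp[OF M2(1) V(1)] Ck_on_Suc_imp[OF M2(2) V(1)]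
  have Md: "M0 Y differentiable at q" "M1 Y differentiable at q" if "q \<in> V" for q
    using Ck_on_Suc_differentiable[OF M2(1) V(1) that] Ck_on_Suc_differentiable[OF M2(2) V(1) that] by auto
  have P2: "Ck_on (Suc (Suc 0)) P V" unfolding P_def by (rule Ck_on_dd[OF V(1) Y3])
  have Pd: "P differentiable at q" "dd P v differentiable at q" if "q \<in> V" for q v
    using Ck_on_Suc_differentiable[OF P2 V(1) that] Ck_on_Suc_differentiable[OF Ck_on_dd[OF V(1) P2] V(1) that] by auto
  have Y2d: "dd Y v differentiable at q" if "q \<in> V" for q v
    by (rule Ck_on_Suc_differentiable[OF Ck_on_dd[OF V(1) Y3] V(1) that])
  have yv: "dd P (0, v) q = (v$1 - (fst q - X\<^sub>0) * ey (snd q) v) *\<^sub>R N0 q + (v$2 + (fst q - X\<^sub>0) * ex (snd q) v) *\<^sub>R N1 q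
      - ey (snd q) v *\<^sub>R M0 Y q + ex (snd q) v *\<^sub>R M1 Y q" (is "_ = ?r") and
    pv: "dd (dd Y (0, v)) (1, 0) q = dd P (0, v) q" if q: "q \<in> V" for q v
  proof -
    define x y where "x = ex (snd q) v" and "y = ey (snd q) v"
    have sd: "((\<lambda>q :: real \<times> (real^4). fst q - X\<^sub>0) has_derivative (\<lambda>v. fst v)) (at q)" by (auto intro!: derivative_eq_intros)
    have 1: "((\<lambda>q. v$1 - (fst q - X\<^sub>0) * y) has_derivative (\<lambda>v. 0 - fst v * y)) (at q)"
      "((\<lambda>q. v$2 + (fst q - X\<^sub>0) * x) has_derivative (\<lambda>v. 0 + fst v * x)) (at q)"
      by (intro has_derivative_diff has_derivative_add has_derivative_const has_derivative_mult_left sd)+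
    define g where "g q = (v$1 - (fst q - X\<^sub>0) * y) *\<^sub>R M0 Y q + (v$2 + (fst q - X\<^sub>0) * x) *\<^sub>R M1 Y q" for q
    note gd = has_derivative_add[OF has_derivative_scaleR[OF 1(1) has_derivative_dd[OF Md(1)[OF q]]] has_derivative_scaleR[OF 1(2) has_derivative_dd[OF Md(2)[OF q]]],
      folded g_def]
    have "open ((\<lambda>t::real. q + t *\<^sub>R (1, 0)) -` V)" by (rule open_vimage[OF V(1)]) (intro continuous_intros)
    moreover have "0 \<in> (\<lambda>t::real. q + t *\<^sub>R (1, 0)) -` V" using q by (simp add: zero_prod_def[symmetric])
    ultimately obtain e where e: "e > 0" "ball 0 e \<subseteq> (\<lambda>t::real. q + t *\<^sub>R (1, 0)) -` V" using open_contains_ball by blast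
    have "dd (dd Y (0, v)) (1, 0) q = dd g (1, 0) q"
    proof (rule dd_eq_on_line[OF Y2d[OF q] differentiableI[OF gd] e(1)])
      fix t :: real assume "\<bar>t\<bar> < e"
      then have tV: "q + t *\<^sub>R (1, 0) \<in> V" using e(2) by (auto simp: subset_iff)
      show "dd Y (0, v) (q + t *\<^sub>R (1, 0)) = g (q + t *\<^sub>R (1, 0))"
        unfolding Y_eq[OF lp tV] g_def x_def y_def by simp
    qed
    also have "\<dots> = ?r" unfolding dd_eqI[OF gd] N0_def N1_def x_def y_def by simp
    finally have 2: "dd (dd Y (0, v)) (1, 0) q = ?r" .
    show "dd (dd Y (0, v)) (1, 0) q = dd P (0, v) q" unfolding P_def by (rule Ydd_commute[OF lp q])
    then show "dd P (0, v) q = ?r" using 2 by simp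
  qed
  define c21 where "c21 q = 2 * (N0 q $ 2 * M1 Y q $ 2 - N1 q $ 2 * M0 Y q $ 2)" for q
  define c22 where "c22 q = N1 q $ 2 * M0 Y q $ 1 - N0 q $ 2 * M1 Y q $ 1 - (N0 q $ 1 * M1 Y q $ 2 - N1 q $ 1 * M0 Y q $ 2)" for q
  define c12 where "c12 q = 2 * (N1 q $ 1 * M0 Y q $ 1 - N0 q $ 1 * M1 Y q $ 1)" for q
  have "Ck_on (Suc 0) c21 V" "Ck_on (Suc 0) c22 V" "Ck_on (Suc 0) c12 V" unfolding c21_def c22_def c12_def
    by (intro Ck_on_cmult[OF V(1)] Ck_on_diff[OF V(1)] Ck_on_mult[OF V(1)] Ck_on_vec_nth[OF V(1)] N1 M1')+
  then have cd: "c21 differentiable at q \<and> c22 differentiable at q \<and> c12 differentiable at q" if "q \<in> V" for q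
    using Ck_on_Suc_differentiable V(1) that by blast
  have form: "dd Y (0, v) q $ 1 * dd P (0, v) q $ 2 - dd Y (0, v) q $ 2 * dd P (0, v) q $ 1
      - c21 q / 2 * (dd Y (0, v) q $ 1)\<^sup>2 - c22 q * (dd Y (0, v) q $ 1 * dd Y (0, v) q $ 2) + c12 q / 2 * (dd Y (0, v) q $ 2)\<^sup>2
      = heavenly_form \<Theta> (snd q) v" if q: "q \<in> V" for q v
  proof -
    have qU: "snd q \<in> U" using q V by auto
    have hf: "heavenly_form \<Theta> (snd q) v = (v$1 - (fst q - X\<^sub>0) * ey (snd q) v) * ex (snd q) v + (v$2 + (fst q - X\<^sub>0) * ex (snd q) v) * ey (snd q) v"
      unfolding heavenly_form_eq[OF qU] by (simp add: algebra_simps)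
    have half: "c21 q / 2 = N0 q $ 2 * M1 Y q $ 2 - N1 q $ 2 * M0 Y q $ 2" "c12 q / 2 = N1 q $ 1 * M0 Y q $ 1 - N0 q $ 1 * M1 Y q $ 1"
      unfolding c21_def c12_def by simp_all
    show ?thesis
      unfolding yv[OF q] Y_eq[OF lp q] c22_def half hf
      using unimodular_form[OF det[OF q, unfolded detM_def], of "v$1 - (fst q - X\<^sub>0) * ey (snd q) v" "ex (snd q) v" "v$2 + (fst q - X\<^sub>0) * ex (snd q) v" "ey (snd q) v"
          "N0 q $ 2" "N1 q $ 2" "N0 q $ 1" "N1 q $ 1"] by simp
  qed
  have main: "y$1 * a$2 - y$2 * a$1 = dd c21 (1, 0) q / 2 * (y$1)\<^sup>2 + dd c22 (1, 0) q * (y$1 * y$2) - dd c12 (1, 0) q / 2 * (y$2)\<^sup>2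
         + c21 q * y$1 * p$1 + c22 q * (p$1 * y$2 + y$1 * p$2) - c12 q * y$2 * p$2"
    if q: "q \<in> V" and y: "y = dd Y (0, v) q" and p: "p = dd P (0, v) q" and a: "a = dd (dd P (1, 0)) (0, v) q" for q v y p a
  proof -
    obtain X r where Xr: "q = (X, r)" by (cases q)
    have line: "((\<lambda>t. f (t, r)) has_vector_derivative dd f (1, 0) q) (at X)" if "f differentiable at q" for f :: "real \<times> (real^4) \<Rightarrow> 'z::real_normed_vector"
      using has_vector_derivative_line[of f "(0, r)" X "(1, 0)"] that unfolding Xr by simp
    have comp: "((\<lambda>t. f (t, r) $ i) has_real_derivative dd f (1, 0) q $ i) (at X)" if "f differentiable at q" for f :: "real \<times> (real^4) \<Rightarrow> real^2" and i
      unfolding has_real_derivative_iff_has_vector_derivative by (rule bounded_linear.has_vector_derivative[OF bounded_linear_vec_nth line[OF that]])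
    have cr: "((\<lambda>t. f (t, r)) has_real_derivative dd f (1, 0) q) (at X)" if "f differentiable at q" for f :: "real \<times> (real^4) \<Rightarrow> real"
      unfolding has_real_derivative_iff_has_vector_derivative by (rule line[OF that])
    have pa: "dd (dd P (0, v)) (1, 0) q = a"
      unfolding a by (rule dd_commute[OF V(1) q]) (use P2 in \<open>simp add: numeral_2_eq_2 del: Ck_on.simps\<close>)
    note e = comp[OF Y2d[OF q, of "(0, v)"], unfolded pv[OF q] p[symmetric]] and d = comp[OF Pd(2)[OF q, of "(0, v)"], unfolded pa]
    note c = cd[OF q, THEN conjunct1] cd[OF q, THEN conjunct2, THEN conjunct1] cd[OF q, THEN conjunct2, THEN conjunct2]
    note D = quadratic_deriv[OF e[of 1] e[of 2] d[of 1] d[of 2] cr[OF c(1)] cr[OF c(2)] cr[OF c(3)]]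
    have oX: "open ((\<lambda>t. (t, r)) -` V)" by (rule open_vimage[OF V(1)]) (intro continuous_intros)
    \<comment> \<open>The metric at the fixed point \<open>r\<close> does not see \<open>X\<close>.
      On the other side the derivative of \<open>y\<close> is \<open>p\<close>, so the two products
      of \<open>p\<close> with itself cancel.\<close>
    have "((\<lambda>t. heavenly_form \<Theta> r v) has_real_derivative 0) (at X)" by (rule DERIV_const)
    then have "((\<lambda>t. dd Y (0, v) (t, r) $ 1 * dd P (0, v) (t, r) $ 2 - dd Y (0, v) (t, r) $ 2 * dd P (0, v) (t, r) $ 1
      - c21 (t, r) / 2 * (dd Y (0, v) (t, r) $ 1)\<^sup>2 - c22 (t, r) * (dd Y (0, v) (t, r) $ 1 * dd Y (0, v) (t, r) $ 2) + c12 (t, r) / 2 * (dd Y (0, v) (t, r) $ 2)\<^sup>2)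
       has_real_derivative 0) (at X)"
      by (rule has_field_derivative_transform_within_open[OF _ oX]) (use q form[of "(_, r)" v] Xr in auto)
    from DERIV_unique[OF D this] show ?thesis
      unfolding Xr[symmetric] y[symmetric] p[symmetric] by (simp add: algebra_simps power2_eq_square)
  qed
  show ?thesis by (rule that[of c21 c22 c12], erule cd, rule main, simp_all add: P_def)
qed

end

text \<open>Transfers the evolution equation to \<open>Lambda_system \<Lambda>\<close>, which agrees
  with the constructed \<open>F\<close> on an open set only; all derivatives involved are
  local.\<close>

lemma phi_equation_cong:
  assumes D: "open D" "q \<in> D" and eq: "\<And>r. r \<in> D \<Longrightarrow> F r = G r" and F: "phi_equation F q"
  shows "phi_equation G q"
proof -
  have p: "pd (\<lambda>s. F s $ A) v r = pd (\<lambda>s. G s $ A) v r" if "r \<in> D" for r A v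
    by (rule pd_cong_open[OF D(1) that]) (simp add: eq)
  have ph: "phi F A B r = phi G A B r" if "r \<in> D" for A B r unfolding phi_def p[OF that] ..
  have "total_deriv F (phi F A B) q = total_deriv G (phi G A B) q" for A B
  proof -
    have "pd (phi F A B) v q = pd (phi G A B) v q" for v by (rule pd_cong_open[OF D]) (rule ph)
    then show ?thesis unfolding total_deriv_def eq[OF D(2)] by simp
  qed
  then show ?thesis using F unfolding phi_equation_def p[OF D(2)] ph[OF D(2)] Omega_sq_def by simp
qed

text \<open>The Poincare lemma in the variables \<open>P\<close>: \<open>F\<^sub>2 dP\<^sub>1 - F\<^sub>1 dP\<^sub>2\<close> is closed because \<open>F\<^sub>P\<close> is trace-free.\<close>

lemma (in jet_system) potential:
  fixes P\<^sub>0 :: "real^2" and D\<^sub>0 :: "jet set"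
  defines "S \<equiv> \<lambda>t q :: jet. (fst q, fst (snd q), P\<^sub>0 + t *\<^sub>R (snd (snd q) - P\<^sub>0))"
  defines "I \<equiv> \<lambda>q :: jet. integral {0..1} (\<lambda>t. (F (S t q) $ 1 * (snd (snd q) - P\<^sub>0) $ 2 - F (S t q) $ 2 * (snd (snd q) - P\<^sub>0) $ 1) / 2)"
  assumes D0: "open D\<^sub>0" and seg: "\<And>t q. q \<in> D\<^sub>0 \<Longrightarrow> \<bar>t\<bar> < 2 \<Longrightarrow> S t q \<in> D" and q: "q \<in> D\<^sub>0"
  shows "I differentiable at q" "dd I (dP 1) q = - F q $ 2 / 2" "dd I (dP 2) q = F q $ 1 / 2"
proof -
  define T where "T = {-2<..<2::real}"
  have T: "open T" "{0..1} \<subseteq> T" unfolding T_def by auto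
  have TD: "open (T \<times> D\<^sub>0)" using T D0 by (intro open_Times)
  define S' where "S' z = S (fst z) (snd z)" for z
  define w where "w z = snd (snd (snd z)) - P\<^sub>0" for z :: "real \<times> jet"
  define K where "K z = (F (S' z) $ 1 * w z $ 2 - F (S' z) $ 2 * w z $ 1) / 2" for z
  have S': "S' z = (fst (snd z), fst (snd (snd z)), P\<^sub>0 + fst z *\<^sub>R w z)" for z unfolding S'_def S_def w_def by simp
  note i = Ck_on_fst[OF TD] Ck_on_snd[OF TD] Ck_on_id[OF TD]
  have wC: "Ck_on 2 w (T \<times> D\<^sub>0)" unfolding w_def by (intro Ck_on_diff[OF TD] Ck_on_const[OF TD] i)
  have S'C: "Ck_on 2 S' (T \<times> D\<^sub>0)" unfolding S'
    by (intro Ck_on_Pair[OF TD] Ck_on_add[OF TD] Ck_on_const[OF TD] Ck_on_scaleR[OF TD] wC i)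
  have S'D: "S' z \<in> D" if "z \<in> T \<times> D\<^sub>0" for z using seg that unfolding S'_def T_def by auto
  have FC: "Ck_on 2 (\<lambda>z. F (S' z)) (T \<times> D\<^sub>0)" by (rule Ck_on_compose[OF TD D F2 S'C]) (use S'D in auto)
  have KC: "Ck_on (Suc 1) K (T \<times> D\<^sub>0)"
  proof -
    have "Ck_on 2 (\<lambda>z. (1/2) * (F (S' z) $ 1 * w z $ 2 - F (S' z) $ 2 * w z $ 1)) (T \<times> D\<^sub>0)"
      by (intro Ck_on_cmult[OF TD] Ck_on_diff[OF TD] Ck_on_mult[OF TD] Ck_on_vec_nth[OF TD] wC FC)
    then show ?thesis unfolding K_def by (simp add: numeral_2_eq_2 del: Ck_on.simps)
  qed
  have Ieq: "I = (\<lambda>q. integral {0..1} (\<lambda>t. K (t, q)))" unfolding I_def K_def S'_def w_def by simp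
  note I' = Ck_on_integral(2)[OF T D0 KC refl q, folded Ieq]
  show "I differentiable at q" by (rule differentiableI[OF I'])
  have dI: "dd I v q = integral {0..1} (\<lambda>t. dd K (0, v) (t, q))" for v by (rule dd_eqI[OF I'])
  have dK: "dd K (0, dP A) (t, q) = ((t * dd F (dP A) (S t q) $ 1) * (snd (snd q) - P\<^sub>0) $ 2 + F (S t q) $ 1 * axis A 1 $ 2
      - ((t * dd F (dP A) (S t q) $ 2) * (snd (snd q) - P\<^sub>0) $ 1 + F (S t q) $ 2 * axis A 1 $ 1)) / 2"
    and dF: "((\<lambda>t. F (S t q) $ i) has_real_derivative dd F (0, 0, snd (snd q) - P\<^sub>0) (S t q) $ i) (at t)"
    if t: "t \<in> {0..1}" for t A i
  proof -
    have z: "(t, q) \<in> T \<times> D\<^sub>0" using t T(2) q by auto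
    have Fd: "F differentiable at (S' (t, q))" by (rule F_diff[OF S'D[OF z]])
    have wd: "(w has_derivative (\<lambda>h. snd (snd (snd h)))) (at (t, q))" unfolding w_def by (auto intro!: derivative_eq_intros)
    have "(S' has_derivative (\<lambda>h. (fst (snd h), fst (snd (snd h)), 0 + (fst (t, q) *\<^sub>R snd (snd (snd h)) + fst h *\<^sub>R w (t, q))))) (at (t, q))"
      unfolding S'[abs_def]
      by (intro has_derivative_Pair has_derivative_fst has_derivative_snd has_derivative_ident has_derivative_add has_derivative_const has_derivative_scaleR wd)
    from has_derivative_compose[OF this has_derivative_dd[OF Fd]]
    have Fz: "((\<lambda>z. F (S' z)) has_derivative (\<lambda>h. dd F (fst (snd h), fst (snd (snd h)), t *\<^sub>R snd (snd (snd h)) + fst h *\<^sub>R w (t, q)) (S' (t, q)))) (at (t, q))" by simp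
    note Fi = bounded_linear.has_derivative[OF bounded_linear_vec_nth Fz]
    note wi = bounded_linear.has_derivative[OF bounded_linear_vec_nth wd]
    note Kd = bounded_linear.has_derivative[OF bounded_linear_divide has_derivative_diff[OF has_derivative_mult[OF Fi[of 1] wi[of 2]] has_derivative_mult[OF Fi[of 2] wi[of 1]]], of 2]
    have sc: "dd F (0, 0, t *\<^sub>R axis A 1) (S' (t, q)) = t *\<^sub>R dd F (dP A) (S' (t, q))"
      using linear_scale[OF dd_linear[OF Fd], of t "dP A"] unfolding dP_def by simp
    have w0: "w (t, q) = snd (snd q) - P\<^sub>0" "S' (t, q) = S t q" unfolding w_def S'_def by simp_all
    show "dd K (0, dP A) (t, q) = ((t * dd F (dP A) (S t q) $ 1) * (snd (snd q) - P\<^sub>0) $ 2 + F (S t q) $ 1 * axis A 1 $ 2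
      - ((t * dd F (dP A) (S t q) $ 2) * (snd (snd q) - P\<^sub>0) $ 1 + F (S t q) $ 2 * axis A 1 $ 1)) / 2"
      unfolding K_def[abs_def] dd_eqI[OF Kd] w0[symmetric] using sc by (simp add: dP_def)
    have "((\<lambda>s. (s, q)) has_derivative (\<lambda>h. (h, 0))) (at t)" by (auto intro!: derivative_eq_intros)
    from has_derivative_compose[OF this Fi[of i]]
    have "((\<lambda>s. F (S s q) $ i) has_derivative (\<lambda>h. dd F (0, 0, h *\<^sub>R (snd (snd q) - P\<^sub>0)) (S t q) $ i)) (at t)"
      unfolding w0 by (simp add: S'_def)
    moreover have "dd F (0, 0, h *\<^sub>R (snd (snd q) - P\<^sub>0)) (S t q) $ i = dd F (0, 0, snd (snd q) - P\<^sub>0) (S t q) $ i * h" for h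
      using linear_scale[OF dd_linear[OF Fd], of h "(0, 0, snd (snd q) - P\<^sub>0)"] unfolding w0 by simp
    ultimately show "((\<lambda>t. F (S t q) $ i) has_real_derivative dd F (0, 0, snd (snd q) - P\<^sub>0) (S t q) $ i) (at t)"
      unfolding has_field_derivative_def by simp
  qed
  \<comment> \<open>The integrand is the derivative of \<open>t * F (S t q) $ i\<close>, whose
    values at 1 and 0 are \<open>F q $ i\<close> and 0.\<close>
  have ftc: "integral {0..1} (\<lambda>t. F (S t q) $ i + t * dd F (0, 0, snd (snd q) - P\<^sub>0) (S t q) $ i) = F q $ i" for i
  proof (rule integral_unique)
    have "((\<lambda>t. F (S t q) $ i + t * dd F (0, 0, snd (snd q) - P\<^sub>0) (S t q) $ i) has_integral (1 * F (S 1 q) $ i - 0 * F (S 0 q) $ i)) {0..1}"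
    proof (rule fundamental_theorem_of_calculus)
      fix t :: real assume t: "t \<in> {0..1}"
      have "((\<lambda>t. t * F (S t q) $ i) has_real_derivative 1 * F (S t q) $ i + dd F (0, 0, snd (snd q) - P\<^sub>0) (S t q) $ i * t) (at t)"
        by (rule DERIV_mult[OF DERIV_ident dF[OF t]])
      then show "((\<lambda>t. t * F (S t q) $ i) has_vector_derivative F (S t q) $ i + t * dd F (0, 0, snd (snd q) - P\<^sub>0) (S t q) $ i) (at t within {0..1})"
        unfolding has_real_derivative_iff_has_vector_derivative by (simp add: has_vector_derivative_at_within mult.commute)
    qed simp
    then show "((\<lambda>t. F (S t q) $ i + t * dd F (0, 0, snd (snd q) - P\<^sub>0) (S t q) $ i) has_integral F q $ i) {0..1}"
      by (simp add: S_def)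
  qed
  have ex: "dd F (0, 0, snd (snd q) - P\<^sub>0) (S t q) $ i = (snd (snd q) - P\<^sub>0) $ 1 * dd F (dP 1) (S t q) $ i + (snd (snd q) - P\<^sub>0) $ 2 * dd F (dP 2) (S t q) $ i"
    and tr: "dd F (dP 1) (S t q) $ 1 = - dd F (dP 2) (S t q) $ 2" if t: "t \<in> {0..1}" for t i
  proof -
    have SD: "S t q \<in> D" by (rule seg[OF q]) (use t in auto)
    show "dd F (0, 0, snd (snd q) - P\<^sub>0) (S t q) $ i = (snd (snd q) - P\<^sub>0) $ 1 * dd F (dP 1) (S t q) $ i + (snd (snd q) - P\<^sub>0) $ 2 * dd F (dP 2) (S t q) $ i"
      unfolding dd_jet_expand[OF F_diff[OF SD]] by simp
    show "dd F (dP 1) (S t q) $ 1 = - dd F (dP 2) (S t q) $ 2" by (rule trace2[OF SD])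
  qed
  have ax: "(axis 1 1 :: real^2) $ 1 = 1" "(axis 1 1 :: real^2) $ 2 = 0" "(axis 2 1 :: real^2) $ 1 = 0" "(axis 2 1 :: real^2) $ 2 = 1"
    by (simp_all add: axis_def)
  \<comment> \<open>Trace-freeness replaces \<open>dd F (dP 1) $ 1\<close> by
    \<open>- dd F (dP 2) $ 2\<close>, which completes the radial derivative of \<open>F $ 2\<close>
    and allows \<open>ftc\<close>.\<close>
  have "dd I (dP 1) q = integral {0..1} (\<lambda>t. (- 1/2) * (F (S t q) $ 2 + t * dd F (0, 0, snd (snd q) - P\<^sub>0) (S t q) $ 2))"
    unfolding dI by (rule integral_cong) (simp add: dK ex tr ax field_simps)
  then show "dd I (dP 1) q = - F q $ 2 / 2" unfolding integral_mult_right ftc by simp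
  have "dd I (dP 2) q = integral {0..1} (\<lambda>t. (1/2) * (F (S t q) $ 1 + t * dd F (0, 0, snd (snd q) - P\<^sub>0) (S t q) $ 1))"
    unfolding dI by (rule integral_cong) (simp add: dK ex tr ax field_simps)
  then show "dd I (dP 2) q = F q $ 1 / 2" unfolding integral_mult_right ftc by simp
qed

section \<open>Existence of the system and of \<open>\<Lambda>\<close>\<close>

context heavenly_at
begin

text \<open>The map from \<open>(X, p)\<close> to the jet \<open>(X, Y, Y')\<close> of the twistor
  line of \<open>p\<close> is a local diffeomorphism, so \<open>Y''\<close> becomes a function
  \<open>F\<close> of the jet. The prescribed 2-jet at \<open>X\<^sub>0\<close> gives both the base
  point and the initial values of \<open>F\<close>.\<close>

lemma jet_system_exists:
  obtains F D where "jet_system F D" "Ck_on 5 F D" "data_of_point X\<^sub>0 p\<^sub>0 \<in> D" "\<And>q. q \<in> D \<Longrightarrow> phi_equation F q"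
    "\<And>Y P. (X\<^sub>0, Y, P) \<in> D \<Longrightarrow> point_of_data Y P \<in> U \<and> F (X\<^sub>0, Y, P) = vector [- 2 * fx (point_of_data Y P), - 2 * fy (point_of_data Y P)]"
proof -
  obtain V Y where lp: "lax_pair V Y" and z0: "(X\<^sub>0, p\<^sub>0) \<in> V" and Y7: "Ck_on 7 Y V" and det: "\<And>q. q \<in> V \<Longrightarrow> detM Y q = 1"
    and Y0: "\<And>q. q \<in> V \<Longrightarrow> fst q = X\<^sub>0 \<Longrightarrow> Y q = vector [snd q $ 1, snd q $ 2]"
    and P0: "\<And>q. q \<in> V \<Longrightarrow> fst q = X\<^sub>0 \<Longrightarrow> dd Y (1, 0) q = vector [- snd q $ 4, snd q $ 3]"
    and A0: "\<And>q. q \<in> V \<Longrightarrow> fst q = X\<^sub>0 \<Longrightarrow> dd (dd Y (1, 0)) (1, 0) q = vector [- 2 * fx (snd q), - 2 * fy (snd q)]"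
    by (rule lax_pair_exists) (rule that)
  have V: "open V" "V \<subseteq> UU" using lp unfolding lax_pair_def by auto
  have Y3: "Ck_on (Suc (Suc (Suc 0))) Y V" by (rule Ck_on_mono[OF Y7 _ V(1)]) simp
  obtain c21 c22 c12 where cd: "\<And>q. q \<in> V \<Longrightarrow> c21 differentiable at q \<and> c22 differentiable at q \<and> c12 differentiable at q"
    and id: "\<And>q v y p a. q \<in> V \<Longrightarrow> y = dd Y (0, v) q \<Longrightarrow> p = dd (dd Y (1, 0)) (0, v) q \<Longrightarrow> a = dd (dd (dd Y (1, 0)) (1, 0)) (0, v) q \<Longrightarrow>
       y$1 * a$2 - y$2 * a$1 = dd c21 (1, 0) q / 2 * (y$1)\<^sup>2 + dd c22 (1, 0) q * (y$1 * y$2) - dd c12 (1, 0) q / 2 * (y$2)\<^sup>2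
         + c21 q * y$1 * p$1 + c22 q * (p$1 * y$2 + y$1 * p$2) - c12 q * y$2 * p$2"
    by (rule lax_pair_identity[OF lp Y3 det]) (assumption, rule that)
  define P where "P = dd Y (1, 0)"
  define A where "A = dd P (1, 0)"
  have P6: "Ck_on 6 P V" unfolding P_def by (rule Ck_on_dd[OF V(1)]) (use Y7 in \<open>simp add: eval_nat_numeral del: Ck_on.simps\<close>)
  have A5: "Ck_on 5 A V" unfolding A_def by (rule Ck_on_dd[OF V(1)]) (use P6 in \<open>simp add: eval_nat_numeral del: Ck_on.simps\<close>)
  have Yd: "Y differentiable at q" and Pd: "P differentiable at q" if "q \<in> V" for q
    using Ck_on_Suc_differentiable[OF Y3 V(1) that] Ck_on_Suc_differentiable[of 0 P, OF Ck_on_mono[OF P6 _ V(1)] V(1) that] by auto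
  define \<Psi> where "\<Psi> q = (fst q, Y q, P q)" for q
  have \<Psi>6: "Ck_on 6 \<Psi> V" unfolding \<Psi>_def
    by (intro Ck_on_Pair[OF V(1)] Ck_on_fst[OF V(1)] Ck_on_id[OF V(1)] P6 Ck_on_mono[OF Y7 _ V(1)]) simp
  have "(\<Psi> has_derivative (\<lambda>v. (fst v, dd Y v q, dd P v q))) (at q)" if "q \<in> V" for q
    unfolding \<Psi>_def[abs_def] by (intro has_derivative_Pair has_derivative_fst has_derivative_ident has_derivative_dd Yd Pd that)
  note \<Psi>d = differentiableI[OF this] and \<Psi>_dd = dd_eqI[OF this]
  define \<Psi>' where "\<Psi>' q = point_of_jet (\<Psi> q)" for q
  have \<Psi>'6: "Ck_on (Suc 5) \<Psi>' V" unfolding \<Psi>'_def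
    using Ck_on_bounded_linear_comp[OF bounded_linear_point_of_jet V(1) \<Psi>6] by (simp add: eval_nat_numeral del: Ck_on.simps)
  have \<Psi>'_dd: "dd \<Psi>' v q = point_of_jet (fst v, dd Y v q, dd P v q)" if "q \<in> V" for v q
    unfolding \<Psi>'_def[abs_def] dd_bounded_linear[OF bounded_linear_point_of_jet \<Psi>d[OF that]] \<Psi>_dd[OF that] ..
  have pj0: "point_of_jet 0 = 0" by (rule linear_0[OF bounded_linear.linear[OF bounded_linear_point_of_jet]])
  have cl: "bounded_linear (\<lambda>q :: real \<times> (real^4). vector [r * snd q $ i, snd q $ j] :: real^2)" for i j and r :: real
    by (auto simp: linear_conv_bounded_linear[symmetric] vec_eq_iff forall_2 algebra_simps intro!: linearI)
  note cld = bounded_linear_imp_has_derivative[OF cl]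
  have inj: "v = 0" if z: "dd \<Psi>' v (X\<^sub>0, p\<^sub>0) = 0" for v
  proof -
    have "(fst v, dd Y v (X\<^sub>0, p\<^sub>0), dd P v (X\<^sub>0, p\<^sub>0)) = (0 :: jet)"
      using z unfolding \<Psi>'_dd[OF z0] by (intro inj_point_of_jet) (simp add: pj0)
    then have v: "v = (0, snd v)" and z': "dd Y v (X\<^sub>0, p\<^sub>0) = 0" "dd P v (X\<^sub>0, p\<^sub>0) = 0" by (auto simp: zero_prod_def prod_eq_iff)
    have "dd Y (0, snd v) (X\<^sub>0, p\<^sub>0) = dd (\<lambda>q. vector [1 * snd q $ 1, snd q $ 2]) (0, snd v) (X\<^sub>0, p\<^sub>0)"
      by (rule dd_eq_on_slice[OF V(1) z0 Yd[OF z0] differentiableI[OF cld]]) (simp add: Y0)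
    moreover have "dd P (0, snd v) (X\<^sub>0, p\<^sub>0) = dd (\<lambda>q. vector [(- 1) * snd q $ 4, snd q $ 3]) (0, snd v) (X\<^sub>0, p\<^sub>0)"
      by (rule dd_eq_on_slice[OF V(1) z0 Pd[OF z0] differentiableI[OF cld]]) (simp add: P_def P0)
    ultimately have "snd v = 0" using z' unfolding v[symmetric] dd_eqI[OF cld] by (simp add: vec_eq_iff forall_2 forall_4)
    then show "v = 0" using v by (simp add: prod_eq_iff)
  qed
  obtain U1 V1 g where U1: "open U1" "U1 \<subseteq> V" "(X\<^sub>0, p\<^sub>0) \<in> U1" "open V1" "\<Psi>' (X\<^sub>0, p\<^sub>0) \<in> V1" "\<Psi>' ` U1 = V1" "g ` V1 = U1"
    "\<And>x. x \<in> U1 \<Longrightarrow> g (\<Psi>' x) = x" "\<And>y. y \<in> V1 \<Longrightarrow> \<Psi>' (g y) = y" "Ck_on (Suc 5) g V1" "\<And>x. x \<in> U1 \<Longrightarrow> bij (\<lambda>v. dd \<Psi>' v x)"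
    by (rule Ck_inverse_function_theorem[OF V(1) z0 \<Psi>'6 inj], assumption, rule that)
  define D where "D = point_of_jet -` V1"
  have oD: "open D" unfolding D_def
    by (rule open_vimage[OF U1(4)]) (rule linear_continuous_on[OF bounded_linear_point_of_jet])
  \<comment> \<open>The inverse \<open>g\<close> is of class 6 and \<open>A = Y''\<close> of class
    5, which is the class demanded of the system.\<close>
  define F where "F r = A (g (point_of_jet r))" for r
  have F5: "Ck_on 5 F D"
  proof -
    have g5: "Ck_on 5 g V1" by (rule Ck_on_mono[OF U1(10) _ U1(4)]) simp
    have "Ck_on 5 (\<lambda>r. g (point_of_jet r)) D"
      by (rule Ck_on_compose[OF oD U1(4) g5 Ck_on_bounded_linear[OF bounded_linear_point_of_jet oD]]) (auto simp: D_def)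
    then show ?thesis unfolding F_def
      by (rule Ck_on_compose[OF oD V(1) A5]) (use U1(2,7) in \<open>auto simp: D_def\<close>)
  qed
  have \<Psi>D: "\<Psi> z \<in> D" "F (\<Psi> z) = A z" if "z \<in> U1" for z
    using U1(6,8) that unfolding D_def F_def \<Psi>'_def by auto
  have Dcases: "\<exists>z\<in>U1. \<Psi> z = r" if "r \<in> D" for r
  proof
    show "g (point_of_jet r) \<in> U1" using that U1(7) unfolding D_def by auto
    show "\<Psi> (g (point_of_jet r)) = r" by (rule inj_point_of_jet) (use U1(9) that in \<open>simp add: \<Psi>'_def D_def\<close>)
  qed
  have F2: "Ck_on 2 F D" by (rule Ck_on_mono[OF F5 _ oD]) simp
  have Fd: "F differentiable at r" if "r \<in> D" for r
    using Ck_on_Suc_differentiable[of 1 F D r] F2 oD that by (simp add: numeral_2_eq_2 del: Ck_on.simps)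
  have field: "dd \<Psi> (1, 0) z = jet_field F (\<Psi> z)" if "z \<in> U1" for z
    using \<Psi>_dd[of z "(1, 0)"] \<Psi>D(2)[OF that] U1(2) that unfolding jet_field_def A_def P_def by (auto simp: \<Psi>_def P_def)
  have coeffs: "dd F (dP 1) (\<Psi> z) $ 2 = c21 z" "dd F (dP 2) (\<Psi> z) $ 2 = c22 z" "dd F (dP 1) (\<Psi> z) $ 1 = - c22 z" "dd F (dP 2) (\<Psi> z) $ 1 = c12 z"
    "dd c21 (1, 0) z = 2 * dd F (dY 1) (\<Psi> z) $ 2" "dd c12 (1, 0) z = 2 * dd F (dY 2) (\<Psi> z) $ 1"
    "dd c22 (1, 0) z = dd F (dY 2) (\<Psi> z) $ 2 - dd F (dY 1) (\<Psi> z) $ 1" if z: "z \<in> U1" for z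
  proof -
    have zV: "z \<in> V" using z U1(2) by auto
    \<comment> \<open>Because the jet map is a local diffeomorphism, the variations \<open>y\<close>
      and \<open>p\<close> take all values independently; this is what permits comparison of
      coefficients.\<close>
    have ex: "\<exists>v. dd Y (0, v) z = y \<and> dd P (0, v) z = p" for y p
    proof -
      obtain v where "dd \<Psi>' v z = point_of_jet (0, y, p)" using bij_is_surj[OF U1(11)[OF z]] by (metis surjD)
      then have "(fst v, dd Y v z, dd P v z) = (0, y, p)" unfolding \<Psi>'_dd[OF zV] by (rule inj_point_of_jet)
      then show ?thesis by (metis Pair_inject prod.collapse)
    qed
    have chain: "dd A (0, v) z = dd F (0, dd Y (0, v) z, dd P (0, v) z) (\<Psi> z)" for v
    proof -
      have "dd A (0, v) z = dd (\<lambda>z. F (\<Psi> z)) (0, v) z" by (rule dd_cong_open[OF U1(1) z]) (simp add: \<Psi>D)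
      then show ?thesis using dd_compose[OF Fd[OF \<Psi>D(1)[OF z]] \<Psi>d[OF zV], of "(0, v)"] unfolding \<Psi>_dd[OF zV] by simp
    qed
    have "y1 * (dd F (dY 1) (\<Psi> z) $ 2 * y1 + dd F (dY 2) (\<Psi> z) $ 2 * y2 + dd F (dP 1) (\<Psi> z) $ 2 * p1 + dd F (dP 2) (\<Psi> z) $ 2 * p2)
       - y2 * (dd F (dY 1) (\<Psi> z) $ 1 * y1 + dd F (dY 2) (\<Psi> z) $ 1 * y2 + dd F (dP 1) (\<Psi> z) $ 1 * p1 + dd F (dP 2) (\<Psi> z) $ 1 * p2)
      = dd c21 (1, 0) z / 2 * y1\<^sup>2 + dd c22 (1, 0) z * (y1 * y2) - dd c12 (1, 0) z / 2 * y2\<^sup>2 + c21 z * y1 * p1 + c22 z * (p1 * y2 + y1 * p2) - c12 z * y2 * p2"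
      for y1 y2 p1 p2
    proof -
      obtain v where v: "dd Y (0, v) z = vector [y1, y2]" "dd P (0, v) z = vector [p1, p2]" using ex by blast
      note i = id[OF zV v(1)[symmetric] v(2)[symmetric, unfolded P_def] refl[of "dd (dd (dd Y (1, 0)) (1, 0)) (0, v) z"]]
      have "dd (dd (dd Y (1, 0)) (1, 0)) (0, v) z = dd F (0, vector [y1, y2], vector [p1, p2]) (\<Psi> z)"
        using chain[of v] unfolding v unfolding A_def P_def .
      from i[unfolded this dd_jet_expand[OF Fd[OF \<Psi>D(1)[OF z]]]] show ?thesis by (simp add: algebra_simps)
    qed
    note C = coefficient_comparison[OF this]
    show "dd F (dP 1) (\<Psi> z) $ 2 = c21 z" "dd F (dP 2) (\<Psi> z) $ 2 = c22 z" "dd F (dP 1) (\<Psi> z) $ 1 = - c22 z" "dd F (dP 2) (\<Psi> z) $ 1 = c12 z"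
    "dd c21 (1, 0) z = 2 * dd F (dY 1) (\<Psi> z) $ 2" "dd c12 (1, 0) z = 2 * dd F (dY 2) (\<Psi> z) $ 1"
    "dd c22 (1, 0) z = dd F (dY 2) (\<Psi> z) $ 2 - dd F (dY 1) (\<Psi> z) $ 1" by (rule C)+
  qed
  interpret jet_system F D
  proof
    show "dd F (dP 1) q $ 1 + dd F (dP 2) q $ 2 = 0" if "q \<in> D" for q using Dcases[OF that] coeffs by auto
  qed (rule oD F2)+
  have phieq: "phi_equation F q" if q: "q \<in> D" for q
  proof -
    obtain z where z: "z \<in> U1" "\<Psi> z = q" using Dcases[OF q] by auto
    have zV: "z \<in> V" using z U1(2) by auto
    \<comment> \<open>The derivative along \<open>jet_field\<close> is the
      \<open>X\<close>-derivative at a fixed point of the four-manifold.\<close>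
    have dc: "dd (\<lambda>r. dd F v r $ i) (jet_field F q) q = dd c (1, 0) z" if c: "\<And>z. z \<in> U1 \<Longrightarrow> dd F v (\<Psi> z) $ i = c z" for v i c
    proof -
      have "dd c (1, 0) z = dd (\<lambda>z. dd F v (\<Psi> z) $ i) (1, 0) z" by (rule dd_cong_open[OF U1(1) z(1)]) (simp add: c)
      also have "\<dots> = dd (\<lambda>r. dd F v r $ i) (dd \<Psi> (1, 0) z) (\<Psi> z)"
        by (rule dd_compose[OF dF_diff[OF \<Psi>D(1)[OF z(1)]] \<Psi>d[OF zV]])
      finally show ?thesis unfolding field[OF z(1)] z(2) by simp
    qed
    have d: "dd (\<lambda>r. dd F (dP 1) r $ 2) (jet_field F q) q = dd c21 (1, 0) z" "dd (\<lambda>r. dd F (dP 2) r $ 1) (jet_field F q) q = dd c12 (1, 0) z"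
      "dd (\<lambda>r. dd F (dP 2) r $ 2) (jet_field F q) q = dd c22 (1, 0) z"
      by (rule dc, erule coeffs)+
    show ?thesis unfolding phi_equation_iff[OF q] d using coeffs(5-7)[OF z(1)] unfolding z(2) by blast
  qed
  have init: "point_of_data Y' P' \<in> U \<and> F (X\<^sub>0, Y', P') = vector [- 2 * fx (point_of_data Y' P'), - 2 * fy (point_of_data Y' P')]"
    if r: "(X\<^sub>0, Y', P') \<in> D" for Y' P'
  proof -
    obtain z where z: "z \<in> U1" "\<Psi> z = (X\<^sub>0, Y', P')" using Dcases[OF r] by auto
    have zV: "z \<in> V" using z U1(2) by auto
    have X: "fst z = X\<^sub>0" and YP: "Y' = Y z" "P' = P z" using z(2) unfolding \<Psi>_def by auto
    have "point_of_data Y' P' = snd z" unfolding YP P_def Y0[OF zV X] P0[OF zV X] point_of_data_def by (simp add: vec_eq_iff forall_4)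
    then show ?thesis using zV V(2) \<Psi>D(2)[OF z(1)] A0[OF zV X] unfolding z(2) A_def P_def by auto
  qed
  have "\<Psi> (X\<^sub>0, p\<^sub>0) = data_of_point X\<^sub>0 p\<^sub>0" unfolding \<Psi>_def P_def using Y0[OF z0] P0[OF z0] by (simp add: data_of_point_def)
  then have "data_of_point X\<^sub>0 p\<^sub>0 \<in> D" using \<Psi>D(1)[OF U1(3)] by simp
  then show ?thesis using that[OF jet_system_axioms F5 _ phieq init] by blast
qed

text \<open>The system determines \<open>\<Lambda>\<close> only up to a function of
  \<open>(X, Y)\<close>. This function is chosen so that \<open>\<Lambda>\<close> equals
  \<open>- \<Theta>\<close> at the reference value \<open>P0\<close>; on the slice the
  \<open>P\<close>-derivatives of the two agree, so equality spreads to all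
  \<open>P\<close>.\<close>

lemma Lambda_solution_exists:
  obtains D \<Lambda> where "data_of_point X\<^sub>0 p\<^sub>0 \<in> D" "Lambda_solution \<Theta> U X\<^sub>0 D \<Lambda>"
proof -
  obtain F D' where js: "jet_system F D'" and F5: "Ck_on 5 F D'" and d0: "data_of_point X\<^sub>0 p\<^sub>0 \<in> D'"
    and ph: "\<And>q. q \<in> D' \<Longrightarrow> phi_equation F q"
    and init: "\<And>Y P. (X\<^sub>0, Y, P) \<in> D' \<Longrightarrow> point_of_data Y P \<in> U \<and> F (X\<^sub>0, Y, P) = vector [- 2 * fx (point_of_data Y P), - 2 * fy (point_of_data Y P)]"
    by (rule jet_system_exists) (rule that)
  interpret jet_system F D' by (rule js)
  obtain Y0 P0 where YP0: "data_of_point X\<^sub>0 p\<^sub>0 = (X\<^sub>0, Y0, P0)" unfolding data_of_point_def by blast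
  obtain a where a: "a > 0" "ball X\<^sub>0 a \<times> ball (Y0, P0) a \<subseteq> D'" using ball_times_subset[OF D] d0 unfolding YP0 by metis
  have "(Y0, P0) \<in> ball (Y0, P0) a" using a by simp
  then obtain b where b: "b > 0" "ball Y0 b \<times> ball P0 b \<subseteq> ball (Y0, P0) a" using ball_times_subset[OF open_ball] by metis
  \<comment> \<open>The radius \<open>b/2\<close> keeps \<open>P0 + t *\<^sub>R (P - P0)\<close>
    within \<open>b\<close> of \<open>P0\<close> for all \<open>t\<close> below 2 in absolute value,
    as \<open>potential\<close> asks.\<close>
  define D where "D = ball X\<^sub>0 a \<times> (ball Y0 b \<times> ball P0 (b/2))"
  have oD: "open D" unfolding D_def by (intro open_Times open_ball)
  have sub: "ball X\<^sub>0 a \<times> (ball Y0 b \<times> ball P0 b) \<subseteq> D'" using a b by (auto simp: subset_iff)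
  have seg: "(fst q, fst (snd q), P0 + t *\<^sub>R (snd (snd q) - P0)) \<in> D'" if q: "q \<in> D" and t: "\<bar>t\<bar> < 2" for t q
  proof -
    have "norm (t *\<^sub>R (snd (snd q) - P0)) \<le> 2 * norm (snd (snd q) - P0)" using t by (simp add: mult_right_mono)
    also have "\<dots> < b" using q unfolding D_def by (auto simp: dist_norm norm_minus_commute)
    finally show ?thesis using q by (intro subsetD[OF sub]) (auto simp: D_def dist_norm)
  qed
  have DD: "D \<subseteq> D'" using seg[of _ 1] by auto
  define I where "I q = integral {0..1} (\<lambda>t. (F (fst q, fst (snd q), P0 + t *\<^sub>R (snd (snd q) - P0)) $ 1 * (snd (snd q) - P0) $ 2
     - F (fst q, fst (snd q), P0 + t *\<^sub>R (snd (snd q) - P0)) $ 2 * (snd (snd q) - P0) $ 1) / 2)" for q :: jet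
  note I = potential[OF oD seg, folded I_def]
  define base where "base q = point_of_data (fst (snd q)) P0" for q :: jet
  \<comment> \<open>\<open>I\<close> vanishes at \<open>P = P0\<close>; the first summand is the
    free function of \<open>(X, Y)\<close>, taken constant in \<open>X\<close>.\<close>
  define \<Lambda> where "\<Lambda> q = - \<Theta> (base q) + I q" for q
  have baseU: "base q \<in> U" if "q \<in> D" for q
    using init[of "fst (snd q)" P0] seg[of "(X\<^sub>0, snd q)" 0] that a unfolding base_def D_def by auto
  have bd: "(\<lambda>q. \<Theta> (base q)) differentiable at q" if q: "q \<in> D" for q
  proof -
    have "bounded_linear (\<lambda>q :: jet. point_of_data (fst (snd q)) 0)"
      unfolding point_of_data_def linear_conv_bounded_linear[symmetric] by (auto intro!: linearI simp: vec_eq_iff forall_4)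
    from has_derivative_add[OF bounded_linear_imp_has_derivative[OF this] has_derivative_const[of "point_of_data 0 P0"]]
    have "((\<lambda>q :: jet. point_of_data (fst (snd q)) 0 + point_of_data 0 P0) has_derivative (\<lambda>v. point_of_data (fst (snd v)) 0 + 0)) (at q)" .
    moreover have "point_of_data (fst (snd q)) 0 + point_of_data 0 P0 = base q" for q :: jet
      unfolding base_def point_of_data_def by (simp add: vec_eq_iff forall_4)
    ultimately have "(base has_derivative (\<lambda>v. point_of_data (fst (snd v)) 0 + 0)) (at q)" by (simp add: fun_eq_iff)
    from has_derivative_compose[OF this has_derivative_dd[OF diffs(1)[OF baseU[OF q]]]] show ?thesis by (rule differentiableI)
  qed
  have \<Lambda>d: "\<Lambda> differentiable at q" and \<Lambda>_dd: "dd \<Lambda> (dP 1) q = - F q $ 2 / 2" "dd \<Lambda> (dP 2) q = F q $ 1 / 2" if q: "q \<in> D" for q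
  proof -
    have bm: "(\<lambda>q. - \<Theta> (base q)) differentiable at q" by (rule differentiable_minus[OF bd[OF q]])
    have b0: "dd (\<lambda>q. - \<Theta> (base q)) (dP A) q = 0" for A
      by (rule dd_const_on_line[OF bm]) (simp add: base_def dP_def)
    have Id: "I differentiable at q" "dd I (dP 1) q = - F q $ 2 / 2" "dd I (dP 2) q = F q $ 1 / 2"
      by (rule I, assumption, assumption, rule q)+
    show "\<Lambda> differentiable at q" unfolding \<Lambda>_def[abs_def] by (rule differentiable_add[OF bm Id(1)])
    show "dd \<Lambda> (dP 1) q = - F q $ 2 / 2" "dd \<Lambda> (dP 2) q = F q $ 1 / 2"
      unfolding \<Lambda>_def[abs_def] dd_add[OF bm Id(1)] b0 Id(2,3) by simp_all
  qed
  have sys: "Lambda_system \<Lambda> q = F q" if "q \<in> D" for q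
    unfolding Lambda_system_def pd_eq_dd[OF \<Lambda>d[OF that]] \<Lambda>_dd[OF that] by (simp add: vec_eq_iff forall_2)
  have init': "\<Lambda> (X\<^sub>0, Y, P) = - \<Theta> (point_of_data Y P)" if r: "(X\<^sub>0, Y, P) \<in> D" for Y P
  proof -
    define w where "w = P - P0"
    define q where "q t = (X\<^sub>0, Y, P0) + t *\<^sub>R ((0, 0, w) :: jet)" for t :: real
    have q: "q t = (X\<^sub>0, Y, P0 + t *\<^sub>R w)" for t unfolding q_def by simp
    have qD: "q t \<in> D" if t: "t \<in> {0..1}" for t
    proof -
      have "norm (t *\<^sub>R w) \<le> 1 * norm w" unfolding norm_scaleR by (rule mult_right_mono) (use t in auto)
      also have "\<dots> < b/2" using r unfolding D_def w_def by (auto simp: dist_norm norm_minus_commute)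
      finally show ?thesis using r unfolding q D_def by (auto simp: dist_norm)
    qed
    \<comment> \<open>The defect in the initial condition along the segment from \<open>P0\<close>
      to \<open>P\<close>; its derivative vanishes as \<open>F\<close> on the slice is the gradient
      expression in \<open>\<Theta>\<close>.\<close>
    define f where "f t = \<Lambda> (q t) + \<Theta> (point_of_data Y (P0 + t *\<^sub>R w))" for t
    have "f 1 = f 0"
    proof (rule zero_deriv_unit_interval)
      fix t :: real assume t: "t \<in> {0..1}"
      note D1 = qD[OF t]
      define z where "z = point_of_data Y (P0 + t *\<^sub>R w)"
      have Fz: "z \<in> U" "F (q t) = vector [- 2 * fx z, - 2 * fy z]"
        using init[of Y "P0 + t *\<^sub>R w"] D1 DD unfolding q z_def by auto
      have pe: "point_of_data Y (P0 + s *\<^sub>R w) = point_of_data Y P0 + s *\<^sub>R (w $ 2 *\<^sub>R axis 3 1 + (- w $ 1) *\<^sub>R axis 4 1)" for s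
        unfolding point_of_data_def by (simp add: vec_eq_iff forall_4 axis_def)
      note \<Theta>d = diffs(1)[OF Fz(1)]
      have "\<Theta> differentiable at (point_of_data Y P0 + t *\<^sub>R (w $ 2 *\<^sub>R axis 3 1 + (- w $ 1) *\<^sub>R axis 4 1))"
        using \<Theta>d unfolding z_def pe .
      from has_vector_derivative_line[OF this]
      have "((\<lambda>t. \<Theta> (point_of_data Y (P0 + t *\<^sub>R w))) has_vector_derivative dd \<Theta> (w $ 2 *\<^sub>R axis 3 1 + (- w $ 1) *\<^sub>R axis 4 1) z) (at t)"
        unfolding z_def pe .
      then have 1: "((\<lambda>t. \<Theta> (point_of_data Y (P0 + t *\<^sub>R w))) has_vector_derivative w $ 2 * fx z - w $ 1 * fy z) (at t)"
        unfolding linear_add[OF dd_linear[OF \<Theta>d]] linear_scale[OF dd_linear[OF \<Theta>d]] fx_def fy_def by simp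
      have "((\<lambda>t. \<Lambda> (q t)) has_vector_derivative dd \<Lambda> (0, 0, w) (q t)) (at t)"
        unfolding q_def by (rule has_vector_derivative_line) (use \<Lambda>d[OF D1] in \<open>simp add: q_def\<close>)
      also have "dd \<Lambda> (0, 0, w) (q t) = w $ 1 * fy z - w $ 2 * fx z"
        unfolding dd_jet_expand[OF \<Lambda>d[OF D1]] \<Lambda>_dd[OF D1] Fz(2) by simp
      finally have "(f has_vector_derivative (w $ 1 * fy z - w $ 2 * fx z) + (w $ 2 * fx z - w $ 1 * fy z)) (at t)"
        unfolding f_def[abs_def] by (rule has_vector_derivative_add[OF _ 1])
      then show "(f has_vector_derivative 0) (at t)" by simp
    qed
    moreover have "f 0 = 0" unfolding f_def q \<Lambda>_def I_def base_def by simp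
    ultimately show ?thesis unfolding f_def q w_def by simp
  qed
  have "Lambda_solution \<Theta> U X\<^sub>0 D \<Lambda>" unfolding Lambda_solution_def
  proof (intro conjI ballI allI impI)
    show "open D" by (rule oD)
    show "\<Lambda> differentiable_on D" using \<Lambda>d by (auto intro!: differentiable_at_imp_differentiable_on)
    show "Ck_on 5 (Lambda_system \<Lambda>) D" by (rule Ck_on_cong[OF oD _ Ck_on_subset[OF F5 DD]]) (simp add: sys)
    show "phi_equation (Lambda_system \<Lambda>) q" if "q \<in> D" for q
      by (rule phi_equation_cong[OF oD that _ ph]) (use sys DD that in auto)
    fix Y P assume r: "(X\<^sub>0, Y, P) \<in> D"
    show "point_of_data Y P \<in> U" using init r DD by blast
    show "\<Lambda> (X\<^sub>0, Y, P) = - \<Theta> (point_of_data Y P)" by (rule init'[OF r])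
  qed
  moreover have "data_of_point X\<^sub>0 p\<^sub>0 \<in> D" unfolding YP0 D_def using a b by simp
  ultimately show ?thesis using that by blast
qed

end

text \<open>Existence is local, near each point of \<open>U\<close>, while the second part concerns
  every pair \<open>D\<close>, \<open>\<Lambda>\<close> that solves the initial value problem. The
  claims about the system thus do not depend on how a solution was obtained.\<close>

theorem theorem5p1:
  fixes \<Theta> :: "real^4 \<Rightarrow> real" and U :: "(real^4) set" and X\<^sub>0 :: real
  assumes "open U" and "smooth_on \<Theta> U" and "\<forall>p\<in>U. second_heavenly \<Theta> p"
  shows "(\<forall>p\<in>U. \<exists>D \<Lambda>. data_of_point X\<^sub>0 p \<in> D \<and> Lambda_solution \<Theta> U X\<^sub>0 D \<Lambda>) \<and>
    (\<forall>D \<Lambda>. Lambda_solution \<Theta> U X\<^sub>0 D \<Lambda> \<longrightarrow>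
       (\<forall>q\<in>D. Omega_sq (Lambda_system \<Lambda>) q = 0) \<and>
       wilczynski_vanish (Lambda_system \<Lambda>) D \<and>
       (\<forall>p\<in>U. data_of_point X\<^sub>0 p \<in> D \<longrightarrow>
          corresponds_near (heavenly_metric \<Theta>) U (Lambda_system \<Lambda>) D p (data_of_point X\<^sub>0 p)))"
proof (intro conjI ballI allI impI)
  fix p assume p: "p \<in> U"
  interpret heavenly_at \<Theta> U X\<^sub>0 p by unfold_locales (use assms p in auto)
  show "\<exists>D \<Lambda>. data_of_point X\<^sub>0 p \<in> D \<and> Lambda_solution \<Theta> U X\<^sub>0 D \<Lambda>" by (rule Lambda_solution_exists) blast
next
  fix D \<Lambda> assume sol: "Lambda_solution \<Theta> U X\<^sub>0 D \<Lambda>"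
  interpret jet_system "Lambda_system \<Lambda>" D by (rule Lambda_solution_jet_system[OF sol])
  show "Omega_sq (Lambda_system \<Lambda>) q = 0" if "q \<in> D" for q by (rule Omega_sq_zero[OF that])
  show "wilczynski_vanish (Lambda_system \<Lambda>) D"
    unfolding wilczynski_vanish_def using wilczynski sol unfolding Lambda_solution_def by blast
  fix p assume p: "p \<in> U" "data_of_point X\<^sub>0 p \<in> D"
  obtain cc I\<^sub>0 N\<^sub>0 where "solution_patch \<Theta> U X\<^sub>0 D \<Lambda> cc I\<^sub>0 N\<^sub>0 p"
    using Lambda_solution_patch[OF assms(1,2) sol p] by blast
  then show "corresponds_near (heavenly_metric \<Theta>) U (Lambda_system \<Lambda>) D p (data_of_point X\<^sub>0 p)"
    by (rule solution_patch.corresponds)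
qed

end
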